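(* Let $\mathcal{A}=\text{*-alg}(\mathcal{A}_0\cup\mathcal{F}_0)\subset C(\mathbb{T}^2_q)\subset B(\ell_2(\mathbb{N}))$ be the dense $*$-subalgebra of $C(\mathbb{T}^2_q)$ generated by $\mathcal{A}_0$ and $\mathcal{F}_0$ (as defined in the context). Set $\mathcal{H}:=\ell_2(\mathbb{N})\oplus\ell_2(\mathbb{N})$ and define a $*$-representation $\pi:\mathcal{A}\to B(\ell_2(\mathbb{N})\oplus\ell_2(\mathbb{N}))$ by $\pi(a):=a\oplus a$. Consider the self-adjoint operator $$D:=\begin{pmatrix}0&\partial_z\\ \partial_z^*&0\end{pmatrix}\quad\text{on}\quad \mathrm{dom}(D):=\mathrm{dom}(N)\oplus\mathrm{dom}(N).$$ Then $(\mathcal{A},\mathcal{H},D)$ is a $1^+$-summable regular even spectral triple for $C(\mathbb{T}^2_q)$ with grading operator $\gamma:=\mathrm{id}\oplus(-\mathrm{id})$. The Dirac operator $D$ has discrete spectrum $\mathrm{spec}(D)=\mathbb{Z}$, each eigenvalue $k\in\mathrm{spec}(D)$ has multiplicity $1$, and a complete set of eigenvectors $\{b_k:k\in\mathbb{Z}\}$ satisfying $Db_k=k\,b_k$ is given by $$b_k:=\tfrac{1}{\sqrt2}(e_{k-1}\oplus e_k),\quad b_{-k}:=\tfrac{1}{\sqrt2}(-e_{k-1}\oplus e_k),\quad k>0,\qquad b_0:=0\oplus e_0.$$ Its fundamental class is $F=\begin{pmatrix}0&S^*\\ S&0\end{pmatrix}$, it is non-trivial, and $\mathrm{ind}(D)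=1$.
   Context: $\mathbb{N}=\{0,1,2,\dots\}$. A densely defined closable operator is not distinguished from its closure; in particular a commutator of an unbounded operator with a bounded one is called bounded (an element of $B(\mathcal{H})$) if it is densely defined and extends to a bounded operator, and is then identified with that extension. Toeplitz algebra. Let $u\in C(\mathbb{S}^1)$, $u(\zeta)=\zeta$, and let $e_m:=\frac{1}{\sqrt{2\pi}}u^m$, $m\in\mathbb{Z}$, which is an orthonormal basis of $L_2(\mathbb{S}^1)$ (Lebesgue measure on $\mathbb{S}^1$, total mass $2\pi$). Identify $\ell_2(\mathbb{N})$ with $\overline{\mathrm{span}}\{u^n:n\in\mathbb{N}\}\subset L_2(\mathbb{S}^1)$, with orthonormal basis $\{e_n:n\in\mathbb{N}\}$, and let $P_+$ be the orthogonal projection of $L_2(\mathbb{S}^1)$ onto it. For $f\in C(\mathbb{S}^1)$ define $\hat T_f\in B(\ell_2(\mathbb{N}))$ by $\hat T_f(\phi):=P_+(f\phi)$. The Toeplitz algebra $\mathcal{T}$ is the C*-subalgebra of $B(\ell_2(\mathbb{N}))$ generated by $\{\hat T_f: f\in C(\mathbb{S}^1)\}$. It contains the compact operators $K(\ell_2(\mathbb{N}))$, and the symbol map $\sigma:\mathcal{T}\to C(\mathbb{S}^1)$ is the surjective *-homomorphism with kernel $K(\ell_2(\mathbb{N}))$ determined by $\sigma(\hat T_f)=f$. Noncommutative Toeplitz torus. Set $$C(\mathbb{S}^1\vee\mathbb{S}^1):=\{f\in C(\mathbb{S}^1): f(\mathrm{e}^{\mathrm{i}t})=f(-\mathrm{i}\,\mathrm{e}^{-\mathrm{i}t}),\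 f(\mathrm{e}^{-\mathrm{i}t})=f(\mathrm{i}\,\mathrm{e}^{\mathrm{i}t}),\ t\in[0,\tfrac{\pi}{2}]\},$$ $$C(\mathbb{T}^2_q):=\{a\in\mathcal{T}:\sigma(a)\in C(\mathbb{S}^1\vee\mathbb{S}^1)\},$$ which is a C*-subalgebra of $\mathcal{T}$ containing $K(\ell_2(\mathbb{N}))$. The generating sets. Let $C^\infty(\mathbb{S}^1\vee\mathbb{S}^1):=C(\mathbb{S}^1\vee\mathbb{S}^1)\cap C^\infty(\mathbb{S}^1)$, $\mathcal{A}_0:=\{\hat T_f: f\in C^\infty(\mathbb{S}^1\vee\mathbb{S}^1)\}\subset C(\mathbb{T}^2_q)$, and $\mathcal{F}_0:=\bigcup_{n\in\mathbb{N}}\mathrm{End}(\mathrm{span}\{e_0,\dots,e_n\})$, where each endomorphism is regarded as an element of $K(\ell_2(\mathbb{N}))\subset C(\mathbb{T}^2_q)$ by letting it act as $0$ on the orthogonal complement. The operators. $N(e_n):=n\,e_n$ and $\partial_z(e_n):=n\,e_{n-1}$ (so $\partial_z(e_0)=0$), both with domain $\mathrm{dom}(N)=\mathrm{dom}(\partial_z):=\{\sum_{n\in\mathbb{N}}\alpha_n e_n\in\ell_2(\mathbb{N}):\sum_{n\in\mathbb{N}}n^2|\alpha_n|^2<\infty\}$. The adjoint of $\partial_z$ is $\partial_z^*(e_n)=(n+1)e_{n+1}$ with $\mathrm{dom}(\partial_z^* )=\mathrm{dom}(N)$. $S$ is the unilateral shift on $\ell_2(\mathbb{N})$: $S(e_n)=e_{n+1}$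 for $n\in\mathbb{N}$, and $S^*(e_n)=e_{n-1}$ for $n\geq1$, $S^*(e_0)=0$. Spectral triples. Given a unital C*-algebra $A$, a spectral triple $(\mathcal{A},\mathcal{H},D)$ for $A$ consists of a dense *-subalgebra $\mathcal{A}\subset A$, a Hilbert space $\mathcal{H}$ with a faithful *-representation $\pi:\mathcal{A}\to B(\mathcal{H})$, and a self-adjoint operator $D$ on $\mathcal{H}$ (the Dirac operator) such that $[D,\pi(a)]\in B(\mathcal{H})$ for all $a\in\mathcal{A}$ and $(D+\mathrm{i})^{-1}\in K(\mathcal{H})$, the compact operators. It is - even, if there is a grading operator $\gamma\in B(\mathcal{H})$ with $\gamma^*=\gamma$, $\gamma^2=1$, $\gamma D=-D\gamma$ and $\gamma\pi(a)=\pi(a)\gamma$ for all $a\in\mathcal{A}$; - regular, if $\delta^k(\pi(a))\in B(\mathcal{H})$ and $\delta^k([D,\pi(a)])\in B(\mathcal{H})$ for all $a\in\mathcal{A}$ and $k\in\mathbb{N}$, where $\delta(x):=[|D|,x]$; - $1^+$-summable, if $(1+|D|)^{-(1+\epsilon)}$ is trace class for all $\epsilon>0$ but $(1+|D|)^{-1}$ is not trace class. Fundamental class and index. Let $D=F|D|$ be the polar decomposition of $D$. The grading $\gamma$ gives a decomposition $\mathcal{H}=\mathcal{H}_+\oplus\mathcal{H}_-$ with $\gamma=\begin{pmatrix}1&0\\ 0&-1\end{pmatrix}$ and $F=\begin{pmatrix}0&F_{+-}\\ F_{-+}&0\end{pmatrix}$, so that $F_{+-}:\mathcal{H}_-\to\mathcal{H}_+$.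 For an even, regular, $1^+$-summable spectral triple, $F_{+-}$ and $F_{-+}$ are Fredholm and one defines $\mathrm{ind}(D):=\mathrm{ind}(F_{+-})$ (Fredholm index, $\dim\ker-\dim\mathrm{coker}$). $F$ is called the fundamental class of $D$, and it is called non-trivial if $\mathrm{ind}(D)\neq0$. *)

theory Defs
  imports "HOL-Analysis.Analysis"
begin

section \<open>Complex Hilbert spaces\<close>

text \<open>
  Complex Hilbert spaces extend the real inner product spaces of the library, whose norm and
  topology they inherit. The complex inner product is antilinear in its first argument.
\<close>

class chilbert_space = real_inner + complete_space +
  fixes scaleC :: "complex \<Rightarrow> 'a \<Rightarrow> 'a"  (infixr \<open>*\<^sub>C\<close> 75)
    and cinner :: "'a \<Rightarrow> 'a \<Rightarrow> complex"
  assumes scaleC_add_right: "a *\<^sub>C (x + y) = a *\<^sub>C x + a *\<^sub>C y"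
    and scaleC_add_left: "(a + b) *\<^sub>C x = a *\<^sub>C x + b *\<^sub>C x"
    and scaleC_scaleC: "a *\<^sub>C (b *\<^sub>C x) = (a * b) *\<^sub>C x"
    and scaleR_scaleC: "r *\<^sub>R x = complex_of_real r *\<^sub>C x"
    and cinner_commute: "cinner x y = cnj (cinner y x)"
    and cinner_add_left: "cinner (x + y) z = cinner x z + cinner y z"
    and cinner_scaleC_left: "cinner (a *\<^sub>C x) y = cnj a * cinner x y"
    and inner_eq_Re_cinner: "inner x y = Re (cinner x y)"

global_interpretation cvec: vector_space "scaleC :: complex \<Rightarrow> 'a \<Rightarrow> 'a::chilbert_space"
proof
  fix a b :: complex and x y :: 'a
  show "a *\<^sub>C (x + y) = a *\<^sub>C x + a *\<^sub>C y" by (rule scaleC_add_right)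
  show "(a + b) *\<^sub>C x = a *\<^sub>C x + b *\<^sub>C x" by (rule scaleC_add_left)
  show "a *\<^sub>C (b *\<^sub>C x) = (a * b) *\<^sub>C x" by (rule scaleC_scaleC)
  show "1 *\<^sub>C x = x" using scaleR_scaleC[of 1 x] by simp
qed

instantiation prod :: (chilbert_space, chilbert_space) chilbert_space
begin

definition scaleC_prod :: "complex \<Rightarrow> 'a \<times> 'b \<Rightarrow> 'a \<times> 'b" where
  "scaleC_prod a x = (a *\<^sub>C fst x, a *\<^sub>C snd x)"

definition cinner_prod :: "'a \<times> 'b \<Rightarrow> 'a \<times> 'b \<Rightarrow> complex" where
  "cinner_prod x y = cinner (fst x) (fst y) + cinner (snd x) (snd y)"

instance
proof
  fix a b :: complex and r :: real and x y z :: "'a \<times> 'b"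
  show "a *\<^sub>C (x + y) = a *\<^sub>C x + a *\<^sub>C y"
    by (simp add: scaleC_prod_def scaleC_add_right)
  show "(a + b) *\<^sub>C x = a *\<^sub>C x + b *\<^sub>C x"
    by (simp add: scaleC_prod_def scaleC_add_left)
  show "a *\<^sub>C (b *\<^sub>C x) = (a * b) *\<^sub>C x"
    by (simp add: scaleC_prod_def scaleC_scaleC)
  show "r *\<^sub>R x = complex_of_real r *\<^sub>C x"
    by (simp add: scaleC_prod_def scaleR_prod_def scaleR_scaleC)
  show "cinner x y = cnj (cinner y x)"
    by (simp add: cinner_prod_def cinner_commute[of "fst x"] cinner_commute[of "snd x"])
  show "cinner (x + y) z = cinner x z + cinner y z"
    by (simp add: cinner_prod_def cinner_add_left)
  show "cinner (a *\<^sub>C x) y = cnj a * cinner x y"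
    by (simp add: cinner_prod_def scaleC_prod_def cinner_scaleC_left algebra_simps)
  show "inner x y = Re (cinner x y)"
    by (simp add: cinner_prod_def inner_prod_def inner_eq_Re_cinner)
qed

end

definition orthonormal_basis :: "'a::chilbert_space set \<Rightarrow> bool" where
  "orthonormal_basis B \<longleftrightarrow>
     (\<forall>x\<in>B. \<forall>y\<in>B. cinner x y = (if x = y then 1 else 0)) \<and> closure (cvec.span B) = UNIV"


section \<open>Bounded operators\<close>

text \<open>
  The library's bounded linear functions are only real linear, hence the following carrier;
  their norm and topology are those of the operator norm.
\<close>

definition bops :: "('a::chilbert_space \<Rightarrow>\<^sub>L 'b::chilbert_space) set" where
  "bops = {T. \<forall>c x. blinfun_apply T (c *\<^sub>C x) = c *\<^sub>C blinfun_apply T x}"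

definition adj :: "('a::chilbert_space \<Rightarrow>\<^sub>L 'b::chilbert_space) \<Rightarrow> ('b \<Rightarrow>\<^sub>L 'a)" where
  "adj T = (THE T'. \<forall>x y. cinner (blinfun_apply T x) y = cinner x (blinfun_apply T' y))"

definition scaleC_op ::
    "complex \<Rightarrow> ('a::chilbert_space \<Rightarrow>\<^sub>L 'b::chilbert_space) \<Rightarrow> ('a \<Rightarrow>\<^sub>L 'b)" where
  "scaleC_op c T = Blinfun (\<lambda>x. c *\<^sub>C blinfun_apply T x)"

definition compact_ops :: "('a::chilbert_space \<Rightarrow>\<^sub>L 'b::chilbert_space) set" where
  "compact_ops = {T \<in> bops. compact (closure (blinfun_apply T ` cball 0 1))}"

definition dsum_op ::
    "('a::chilbert_space \<Rightarrow>\<^sub>L 'a) \<Rightarrow> ('b::chilbert_space \<Rightarrow>\<^sub>L 'b) \<Rightarrow> (('a \<times> 'b) \<Rightarrow>\<^sub>L ('a \<times> 'b))" where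
  "dsum_op S T = Blinfun (\<lambda>(x, y). (blinfun_apply S x, blinfun_apply T y))"

definition offdiag_op ::
    "('b::chilbert_space \<Rightarrow>\<^sub>L 'a::chilbert_space) \<Rightarrow> ('a \<Rightarrow>\<^sub>L 'b) \<Rightarrow> (('a \<times> 'b) \<Rightarrow>\<^sub>L ('a \<times> 'b))" where
  "offdiag_op S T = Blinfun (\<lambda>(x, y). (blinfun_apply S y, blinfun_apply T x))"

definition star_subalgebra :: "('a::chilbert_space \<Rightarrow>\<^sub>L 'a) set \<Rightarrow> bool" where
  "star_subalgebra A \<longleftrightarrow> A \<subseteq> bops \<and> 0 \<in> A \<and>
     (\<forall>S\<in>A. \<forall>T\<in>A. S + T \<in> A \<and> S o\<^sub>L T \<in> A) \<and>
     (\<forall>c. \<forall>T\<in>A. scaleC_op c T \<in> A) \<and> (\<forall>T\<in>A. adj T \<in> A)"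

definition cstar_subalgebra :: "('a::chilbert_space \<Rightarrow>\<^sub>L 'a) set \<Rightarrow> bool" where
  "cstar_subalgebra A \<longleftrightarrow> star_subalgebra A \<and> closed A"

definition star_alg :: "('a::chilbert_space \<Rightarrow>\<^sub>L 'a) set \<Rightarrow> ('a \<Rightarrow>\<^sub>L 'a) set" where
  "star_alg X = \<Inter>{A. star_subalgebra A \<and> X \<subseteq> A}"

definition cstar_alg :: "('a::chilbert_space \<Rightarrow>\<^sub>L 'a) set \<Rightarrow> ('a \<Rightarrow>\<^sub>L 'a) set" where
  "cstar_alg X = \<Inter>{A. cstar_subalgebra A \<and> X \<subseteq> A}"

text \<open>Unital C*-algebras are taken in a concrete representation on some Hilbert space; the unit
  need not be the identity operator of that space.\<close>

definition unital_cstar_algebra :: "('a::chilbert_space \<Rightarrow>\<^sub>L 'a) set \<Rightarrow> bool" where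
  "unital_cstar_algebra A \<longleftrightarrow> cstar_subalgebra A \<and> (\<exists>e\<in>A. \<forall>a\<in>A. e o\<^sub>L a = a \<and> a o\<^sub>L e = a)"

definition faithful_star_rep ::
    "('a::chilbert_space \<Rightarrow>\<^sub>L 'a) set \<Rightarrow> (('a \<Rightarrow>\<^sub>L 'a) \<Rightarrow> ('h::chilbert_space \<Rightarrow>\<^sub>L 'h)) \<Rightarrow> bool" where
  "faithful_star_rep A \<pi> \<longleftrightarrow> \<pi> ` A \<subseteq> bops \<and> inj_on \<pi> A \<and>
     (\<forall>S\<in>A. \<forall>T\<in>A. \<pi> (S + T) = \<pi> S + \<pi> T \<and> \<pi> (S o\<^sub>L T) = \<pi> S o\<^sub>L \<pi> T) \<and>
     (\<forall>c. \<forall>T\<in>A. \<pi> (scaleC_op c T) = scaleC_op c (\<pi> T)) \<and> (\<forall>T\<in>A. \<pi> (adj T) = adj (\<pi> T))"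


section \<open>Unbounded operators\<close>

text \<open>
  An operator \<open>G\<close> is given by its graph, \<open>(x, y) \<in> G\<close> meaning that \<open>x\<close> is in the domain and
  \<open>G x = y\<close>. The product of operators is relational composition in the opposite order: the operator
  \<open>G H\<close> (first \<open>H\<close>, then \<open>G\<close>, on its natural domain) is \<open>H O G\<close>.
\<close>

definition op_graph :: "('a::chilbert_space \<Rightarrow>\<^sub>L 'b::chilbert_space) \<Rightarrow> ('a \<times> 'b) set" where
  "op_graph T = {(x, blinfun_apply T x) | x. True}"

definition is_operator :: "('a::chilbert_space \<times> 'b::chilbert_space) set \<Rightarrow> bool" where
  "is_operator G \<longleftrightarrow> cvec.subspace G \<and> single_valued G"

definition densely_defined :: "('a::chilbert_space \<times> 'b::chilbert_space) set \<Rightarrow> bool" where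
  "densely_defined G \<longleftrightarrow> closure (Domain G) = UNIV"

definition op_adjoint :: "('a::chilbert_space \<times> 'b::chilbert_space) set \<Rightarrow> ('b \<times> 'a) set" where
  "op_adjoint G = {(y, z). \<forall>(x, w)\<in>G. cinner w y = cinner x z}"

definition self_adjoint :: "('a::chilbert_space \<times> 'a) set \<Rightarrow> bool" where
  "self_adjoint G \<longleftrightarrow> is_operator G \<and> densely_defined G \<and> op_adjoint G = G"

definition positive_op :: "('a::chilbert_space \<times> 'a) set \<Rightarrow> bool" where
  "positive_op G \<longleftrightarrow> self_adjoint G \<and> (\<forall>(x, y)\<in>G. 0 \<le> Re (cinner x y))"

definition op_uminus :: "('a::chilbert_space \<times> 'b::chilbert_space) set \<Rightarrow> ('a \<times> 'b) set" where
  "op_uminus G = {(x, - y) | x y. (x, y) \<in> G}"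

definition op_shift :: "('a::chilbert_space \<times> 'a) set \<Rightarrow> complex \<Rightarrow> ('a \<times> 'a) set" where
  "op_shift G c = {(x, y + c *\<^sub>C x) | x y. (x, y) \<in> G}"

text \<open>\<open>[G, T] = G T - T G\<close> on its natural domain\<close>

definition commutator :: "('a::chilbert_space \<times> 'a) set \<Rightarrow> ('a \<Rightarrow>\<^sub>L 'a) \<Rightarrow> ('a \<times> 'a) set" where
  "commutator G T =
     {(x, y - blinfun_apply T z) | x y z. (blinfun_apply T x, y) \<in> G \<and> (x, z) \<in> G}"

definition bounded_extension ::
    "('a::chilbert_space \<times> 'b::chilbert_space) set \<Rightarrow> ('a \<Rightarrow>\<^sub>L 'b) \<Rightarrow> bool" where
  "bounded_extension G B \<longleftrightarrow> densely_defined G \<and> B \<in> bops \<and> G \<subseteq> op_graph B"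

definition op_spectrum :: "('a::chilbert_space \<times> 'a) set \<Rightarrow> complex set" where
  "op_spectrum G = {l. \<not> (\<exists>R\<in>bops. op_graph R = converse (op_shift G (- l)))}"

definition eigenspace :: "('a::chilbert_space \<times> 'a) set \<Rightarrow> complex \<Rightarrow> 'a set" where
  "eigenspace G l = {x. (x, l *\<^sub>C x) \<in> G}"

definition finite_dimensional :: "'a::chilbert_space set \<Rightarrow> bool" where
  "finite_dimensional V \<longleftrightarrow> (\<exists>B. finite B \<and> V \<subseteq> cvec.span B)"

definition discrete_spectrum :: "('a::chilbert_space \<times> 'a) set \<Rightarrow> bool" where
  "discrete_spectrum G \<longleftrightarrow> (\<forall>l\<in>op_spectrum G. l isolated_in op_spectrum G \<and>
     eigenspace G l \<noteq> {0} \<and> finite_dimensional (eigenspace G l))"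

definition op_kernel :: "('a::chilbert_space \<times> 'b::chilbert_space) set \<Rightarrow> 'a set" where
  "op_kernel G = {x. (x, 0) \<in> G}"

definition op_abs :: "('a::chilbert_space \<times> 'b::chilbert_space) set \<Rightarrow> ('a \<times> 'a) set" where
  "op_abs G = (THE A. positive_op A \<and> A O A = G O op_adjoint G)"

text \<open>The polar decomposition \<open>G = F |G|\<close>, with \<open>F\<close> a partial isometry having the kernel of \<open>G\<close>\<close>

definition polar_part :: "('a::chilbert_space \<times> 'b::chilbert_space) set \<Rightarrow> ('a \<Rightarrow>\<^sub>L 'b) \<Rightarrow> bool" where
  "polar_part G F \<longleftrightarrow> F \<in> bops \<and> G = op_abs G O op_graph F \<and>
     op_kernel (op_graph F) = op_kernel G \<and>
     (\<forall>x. (\<forall>y\<in>op_kernel (op_graph F). cinner y x = 0) \<longrightarrow> norm (blinfun_apply F x) = norm x)"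

text \<open>
  The bounded operator \<open>f(A)\<close>, for a self-adjoint operator \<open>A\<close> whose eigenvectors span a dense
  subspace (such as one with compact resolvent) and \<open>f\<close> bounded on the spectrum of \<open>A\<close>: it is
  determined by \<open>f(A) x = f(l) x\<close> whenever \<open>A x = l x\<close>.
\<close>

definition fun_calculus ::
    "('a::chilbert_space \<times> 'a) set \<Rightarrow> (real \<Rightarrow> real) \<Rightarrow> ('a \<Rightarrow>\<^sub>L 'a)" where
  "fun_calculus A f =
     (THE T. T \<in> bops \<and> (\<forall>l x. (x, l *\<^sub>R x) \<in> A \<longrightarrow> blinfun_apply T x = f l *\<^sub>R x))"

definition trace_class :: "('a::chilbert_space \<Rightarrow>\<^sub>L 'a) \<Rightarrow> bool" where
  "trace_class T \<longleftrightarrow> T \<in> bops \<and> (\<exists>B. orthonormal_basis B \<and>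
     (\<lambda>x. cinner x (THE y. (x, y) \<in> op_abs (op_graph T))) summable_on B)"


section \<open>Fredholm operators between subspaces\<close>

text \<open>\<open>quotient_basis V W B\<close>: the map \<open>V \<rightarrow> V/W\<close> is injective on \<open>B\<close> and sends it to a basis of
  \<open>V/W\<close>.\<close>

definition quotient_basis ::
    "'a::chilbert_space set \<Rightarrow> 'a set \<Rightarrow> 'a set \<Rightarrow> bool" where
  "quotient_basis V W B \<longleftrightarrow> B \<subseteq> V \<and> cvec.independent B \<and> cvec.span B \<inter> W = {0} \<and>
     V = {w + x | w x. w \<in> W \<and> x \<in> cvec.span B}"

definition finite_codim :: "'a::chilbert_space set \<Rightarrow> 'a set \<Rightarrow> bool" where
  "finite_codim V W \<longleftrightarrow> (\<exists>B. finite B \<and> quotient_basis V W B)"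

definition codim :: "'a::chilbert_space set \<Rightarrow> 'a set \<Rightarrow> nat" where
  "codim V W = (THE n. \<exists>B. finite B \<and> quotient_basis V W B \<and> n = card B)"

text \<open>The following two notions concern the restriction \<open>V \<rightarrow> W\<close> of \<open>T\<close>.\<close>

definition fredholm_on ::
    "'a::chilbert_space set \<Rightarrow> 'b::chilbert_space set \<Rightarrow> ('a \<Rightarrow>\<^sub>L 'b) \<Rightarrow> bool" where
  "fredholm_on V W T \<longleftrightarrow> blinfun_apply T ` V \<subseteq> W \<and>
     finite_dimensional {x \<in> V. blinfun_apply T x = 0} \<and>
     closed (blinfun_apply T ` V) \<and> finite_codim W (blinfun_apply T ` V)"

definition fredholm_index_on ::
    "'a::chilbert_space set \<Rightarrow> 'b::chilbert_space set \<Rightarrow> ('a \<Rightarrow>\<^sub>L 'b) \<Rightarrow> int" where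
  "fredholm_index_on V W T =
     int (cvec.dim {x \<in> V. blinfun_apply T x = 0}) - int (codim W (blinfun_apply T ` V))"


section \<open>Spectral triples\<close>

definition spectral_triple ::
    "('a::chilbert_space \<Rightarrow>\<^sub>L 'a) set \<Rightarrow> ('a \<Rightarrow>\<^sub>L 'a) set \<Rightarrow>
     (('a \<Rightarrow>\<^sub>L 'a) \<Rightarrow> ('h::chilbert_space \<Rightarrow>\<^sub>L 'h)) \<Rightarrow> ('h \<times> 'h) set \<Rightarrow> bool" where
  "spectral_triple A \<A> \<pi> D \<longleftrightarrow> unital_cstar_algebra A \<and>
     star_subalgebra \<A> \<and> \<A> \<subseteq> A \<and> A \<subseteq> closure \<A> \<and>
     faithful_star_rep \<A> \<pi> \<and> self_adjoint D \<and>
     (\<forall>a\<in>\<A>. \<exists>B. bounded_extension (commutator D (\<pi> a)) B) \<and>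
     (\<exists>R\<in>compact_ops. op_graph R = converse (op_shift D \<i>))"

definition even_grading ::
    "('a::chilbert_space \<Rightarrow>\<^sub>L 'a) set \<Rightarrow> (('a \<Rightarrow>\<^sub>L 'a) \<Rightarrow> ('h::chilbert_space \<Rightarrow>\<^sub>L 'h)) \<Rightarrow>
     ('h \<times> 'h) set \<Rightarrow> ('h \<Rightarrow>\<^sub>L 'h) \<Rightarrow> bool" where
  "even_grading \<A> \<pi> D \<gamma> \<longleftrightarrow> \<gamma> \<in> bops \<and> adj \<gamma> = \<gamma> \<and> \<gamma> o\<^sub>L \<gamma> = id_blinfun \<and>
     D O op_graph \<gamma> = op_uminus (op_graph \<gamma> O D) \<and> (\<forall>a\<in>\<A>. \<gamma> o\<^sub>L \<pi> a = \<pi> a o\<^sub>L \<gamma>)"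

text \<open>\<open>delta_bounded A k x\<close>: the iterated commutator of order \<open>k\<close> of \<open>x\<close> with \<open>A\<close> is bounded, where
  at each stage a bounded commutator is replaced by its (unique) bounded extension.\<close>

primrec delta_bounded ::
    "('h::chilbert_space \<times> 'h) set \<Rightarrow> nat \<Rightarrow> ('h \<Rightarrow>\<^sub>L 'h) \<Rightarrow> bool" where
  "delta_bounded A 0 x \<longleftrightarrow> x \<in> bops"
| "delta_bounded A (Suc k) x \<longleftrightarrow>
     (\<exists>y. bounded_extension (commutator A x) y \<and> delta_bounded A k y)"

definition regular_triple ::
    "('a::chilbert_space \<Rightarrow>\<^sub>L 'a) set \<Rightarrow> (('a \<Rightarrow>\<^sub>L 'a) \<Rightarrow> ('h::chilbert_space \<Rightarrow>\<^sub>L 'h)) \<Rightarrow>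
     ('h \<times> 'h) set \<Rightarrow> bool" where
  "regular_triple \<A> \<pi> D \<longleftrightarrow> (\<forall>a\<in>\<A>. \<forall>k. delta_bounded (op_abs D) k (\<pi> a) \<and>
     (\<exists>B. bounded_extension (commutator D (\<pi> a)) B \<and> delta_bounded (op_abs D) k B))"

definition one_plus_summable :: "('h::chilbert_space \<times> 'h) set \<Rightarrow> bool" where
  "one_plus_summable D \<longleftrightarrow>
     (\<forall>\<epsilon>>0. trace_class (fun_calculus (op_abs D) (\<lambda>l. (1 + l) powr (- (1 + \<epsilon>))))) \<and>
     \<not> trace_class (fun_calculus (op_abs D) (\<lambda>l. inverse (1 + l)))"

definition fundamental_class :: "('h::chilbert_space \<times> 'h) set \<Rightarrow> ('h \<Rightarrow>\<^sub>L 'h)" where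
  "fundamental_class D = (THE F. polar_part D F)"

definition pos_part :: "('h::chilbert_space \<Rightarrow>\<^sub>L 'h) \<Rightarrow> 'h set" where
  "pos_part \<gamma> = {x. blinfun_apply \<gamma> x = x}"

definition neg_part :: "('h::chilbert_space \<Rightarrow>\<^sub>L 'h) \<Rightarrow> 'h set" where
  "neg_part \<gamma> = {x. blinfun_apply \<gamma> x = - x}"

text \<open>Since \<open>F\<close> is odd, its block \<open>F\<^sub>+\<^sub>-\<close> is its restriction to a map from the negative to the
  positive part; likewise for \<open>F\<^sub>-\<^sub>+\<close>.\<close>

definition fredholm_fundamental_class ::
    "('h::chilbert_space \<Rightarrow>\<^sub>L 'h) \<Rightarrow> ('h \<times> 'h) set \<Rightarrow> bool" where
  "fredholm_fundamental_class \<gamma> D \<longleftrightarrow>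
     fredholm_on (neg_part \<gamma>) (pos_part \<gamma>) (fundamental_class D) \<and>
     fredholm_on (pos_part \<gamma>) (neg_part \<gamma>) (fundamental_class D)"

definition dirac_index :: "('h::chilbert_space \<Rightarrow>\<^sub>L 'h) \<Rightarrow> ('h \<times> 'h) set \<Rightarrow> int" where
  "dirac_index \<gamma> D = fredholm_index_on (neg_part \<gamma>) (pos_part \<gamma>) (fundamental_class D)"

definition nontrivial_fundamental_class ::
    "('h::chilbert_space \<Rightarrow>\<^sub>L 'h) \<Rightarrow> ('h \<times> 'h) set \<Rightarrow> bool" where
  "nontrivial_fundamental_class \<gamma> D \<longleftrightarrow> dirac_index \<gamma> D \<noteq> 0"


section \<open>The Hilbert space of square summable sequences\<close>

typedef ell2 = "{x :: nat \<Rightarrow> complex. summable (\<lambda>n. (cmod (x n))\<^sup>2)}"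
  morphisms entry Abs_ell2
  by (rule exI[of _ "\<lambda>_. 0"]) simp

setup_lifting type_definition_ell2

lemma summable_norm2_add:
  fixes x y :: "nat \<Rightarrow> complex"
  assumes "summable (\<lambda>n. (cmod (x n))\<^sup>2)" "summable (\<lambda>n. (cmod (y n))\<^sup>2)"
  shows "summable (\<lambda>n. (cmod (x n + y n))\<^sup>2)"
proof (rule summable_comparison_test')
  show "summable (\<lambda>n. 2 * (cmod (x n))\<^sup>2 + 2 * (cmod (y n))\<^sup>2)"
    using assms by (intro summable_add summable_mult)
  fix n
  have "(cmod (x n + y n))\<^sup>2 \<le> (cmod (x n) + cmod (y n))\<^sup>2"
    by (intro power_mono norm_triangle_ineq) simp
  also have "\<dots> \<le> 2 * (cmod (x n))\<^sup>2 + 2 * (cmod (y n))\<^sup>2"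
    using sum_squares_bound[of "cmod (x n)" "cmod (y n)"] by (simp add: power2_sum)
  finally show "norm ((cmod (x n + y n))\<^sup>2) \<le> 2 * (cmod (x n))\<^sup>2 + 2 * (cmod (y n))\<^sup>2"
    by simp
qed

lemma summable_cnj_mult:
  fixes x y :: "nat \<Rightarrow> complex"
  assumes "summable (\<lambda>n. (cmod (x n))\<^sup>2)" "summable (\<lambda>n. (cmod (y n))\<^sup>2)"
  shows "summable (\<lambda>n. cnj (x n) * y n)"
proof (rule summable_comparison_test')
  show "summable (\<lambda>n. (cmod (x n))\<^sup>2 + (cmod (y n))\<^sup>2)"
    using assms by (intro summable_add)
  fix n
  have "2 * (cmod (x n) * cmod (y n)) \<le> (cmod (x n))\<^sup>2 + (cmod (y n))\<^sup>2"
    using sum_squares_bound[of "cmod (x n)" "cmod (y n)"] by simp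
  moreover have "0 \<le> cmod (x n) * cmod (y n)"
    by simp
  ultimately have "cmod (x n) * cmod (y n) \<le> (cmod (x n))\<^sup>2 + (cmod (y n))\<^sup>2"
    by linarith
  then show "norm (cnj (x n) * y n) \<le> (cmod (x n))\<^sup>2 + (cmod (y n))\<^sup>2"
    by (simp add: norm_mult)
qed

instantiation ell2 :: real_vector
begin

lift_definition zero_ell2 :: ell2 is "\<lambda>_. 0" by simp

lift_definition plus_ell2 :: "ell2 \<Rightarrow> ell2 \<Rightarrow> ell2" is "\<lambda>x y n. x n + y n"
  by (rule summable_norm2_add)

lift_definition uminus_ell2 :: "ell2 \<Rightarrow> ell2" is "\<lambda>x n. - x n" by simp

lift_definition minus_ell2 :: "ell2 \<Rightarrow> ell2 \<Rightarrow> ell2" is "\<lambda>x y n. x n - y n"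
  subgoal for x y using summable_norm2_add[of x "\<lambda>n. - y n"] by simp
  done

lift_definition scaleR_ell2 :: "real \<Rightarrow> ell2 \<Rightarrow> ell2" is "\<lambda>r x n. r *\<^sub>R x n"
  by (simp add: power_mult_distrib summable_mult)

instance
  by standard (transfer; simp add: fun_eq_iff algebra_simps)+

end

lemma entry_simps [simp]:
  "entry 0 n = 0" "entry (x + y) n = entry x n + entry y n" "entry (- x) n = - entry x n"
  "entry (x - y) n = entry x n - entry y n" "entry (r *\<^sub>R x) n = r *\<^sub>R entry x n"
  by (transfer; simp)+

lemma summable_entry: "summable (\<lambda>n. (cmod (entry x n))\<^sup>2)"
  using entry[of x] by simp

lemma summable_entry_mult: "summable (\<lambda>n. cnj (entry x n) * entry y n)"
  by (intro summable_cnj_mult summable_entry)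

lemma ell2_eqI: "(\<And>n. entry x n = entry y n) \<Longrightarrow> x = y"
  by (metis entry_inject ext)

instantiation ell2 :: real_inner
begin

definition inner_ell2 :: "ell2 \<Rightarrow> ell2 \<Rightarrow> real" where
  "inner_ell2 x y = Re (\<Sum>n. cnj (entry x n) * entry y n)"

definition norm_ell2 :: "ell2 \<Rightarrow> real" where "norm_ell2 x = sqrt (inner x x)"

definition dist_ell2 :: "ell2 \<Rightarrow> ell2 \<Rightarrow> real" where "dist_ell2 x y = norm (x - y)"

definition sgn_ell2 :: "ell2 \<Rightarrow> ell2" where "sgn_ell2 x = x /\<^sub>R norm x"

definition uniformity_ell2 :: "(ell2 \<times> ell2) filter" where
  "uniformity_ell2 = (INF e\<in>{0<..}. principal {(x, y). dist x y < e})"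

definition open_ell2 :: "ell2 set \<Rightarrow> bool" where
  "open_ell2 U \<longleftrightarrow> (\<forall>x\<in>U. \<forall>\<^sub>F (x', y) in uniformity. x' = x \<longrightarrow> y \<in> U)"

lemma inner_ell2_self: "inner x x = (\<Sum>n. (cmod (entry x n))\<^sup>2)" for x :: ell2
proof -
  have "inner x x = (\<Sum>n. Re (cnj (entry x n) * entry x n))"
    unfolding inner_ell2_def by (rule Re_suminf[OF summable_entry_mult])
  also have "(\<lambda>n. Re (cnj (entry x n) * entry x n)) = (\<lambda>n. (cmod (entry x n))\<^sup>2)"
    by (simp add: cmod_power2 flip: power2_eq_square)
  finally show ?thesis .
qed

instance
proof
  fix x y z :: ell2 and r :: real
  show "dist x y = norm (x - y)" by (rule dist_ell2_def)
  show "sgn x = x /\<^sub>R norm x" by (rule sgn_ell2_def)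
  show "uniformity = (INF e\<in>{0<..}. principal {(x, y :: ell2). dist x y < e})"
    by (rule uniformity_ell2_def)
  fix U :: "ell2 set"
  show "open U \<longleftrightarrow> (\<forall>x\<in>U. \<forall>\<^sub>F (x', y) in uniformity. x' = x \<longrightarrow> y \<in> U)"
    by (rule open_ell2_def)
  show "inner x y = inner y x"
    unfolding inner_ell2_def Re_suminf[OF summable_entry_mult] by (simp add: algebra_simps)
  show "inner (x + y) z = inner x z + inner y z"
    unfolding inner_ell2_def
    using suminf_add[OF summable_entry_mult[of x z] summable_entry_mult[of y z]]
    by (simp add: algebra_simps flip: plus_complex.sel)
  show "inner (r *\<^sub>R x) y = r * inner x y"
    unfolding inner_ell2_def
    using suminf_mult[OF summable_entry_mult[of x y], of "complex_of_real r"]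
    by (simp add: scaleR_conv_of_real mult.assoc)
  show "0 \<le> inner x x"
    unfolding inner_ell2_self by (rule suminf_nonneg[OF summable_entry]) simp
  show "inner x x = 0 \<longleftrightarrow> x = 0"
  proof
    assume "inner x x = 0"
    then have "(cmod (entry x n))\<^sup>2 = 0" for n
      unfolding inner_ell2_self using suminf_eq_zero_iff[OF summable_entry[of x]] by simp
    then show "x = 0" by (intro ell2_eqI) simp
  qed (simp add: inner_ell2_self)
  show "norm x = sqrt (inner x x)" by (rule norm_ell2_def)
qed

end

lemma norm_ell2_power2: "(norm x)\<^sup>2 = (\<Sum>n. (cmod (entry x n))\<^sup>2)" for x :: ell2
  unfolding power2_norm_eq_inner inner_ell2_self ..

lemma sum_entry_le_norm: "(\<Sum>n<N. (cmod (entry x n))\<^sup>2) \<le> (norm x)\<^sup>2"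
  unfolding norm_ell2_power2 by (rule sum_le_suminf[OF summable_entry]) auto

lemma norm_entry_le: "cmod (entry x n) \<le> norm x"
proof -
  have "(cmod (entry x n))\<^sup>2 \<le> (\<Sum>i<Suc n. (cmod (entry x i))\<^sup>2)"
    by (simp add: sum_nonneg)
  also note sum_entry_le_norm
  finally show ?thesis by (rule power2_le_imp_le) simp
qed

instance ell2 :: complete_space
proof
  fix X :: "nat \<Rightarrow> ell2"
  assume X: "Cauchy X"
  have "Cauchy (\<lambda>m. entry (X m) n)" for n
  proof (rule metric_CauchyI)
    fix e :: real assume "0 < e"
    then obtain M where M: "\<And>i j. M \<le> i \<Longrightarrow> M \<le> j \<Longrightarrow> dist (X i) (X j) < e"
      using X unfolding Cauchy_def by meson
    have "dist (entry (X i) n) (entry (X j) n) < e" if "M \<le> i" "M \<le> j" for i j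
      using norm_entry_le[of "X i - X j" n] M[OF that] by (simp add: dist_norm)
    then show "\<exists>M. \<forall>i\<ge>M. \<forall>j\<ge>M. dist (entry (X i) n) (entry (X j) n) < e" by blast
  qed
  then have "\<forall>n. \<exists>l. (\<lambda>m. entry (X m) n) \<longlonglongrightarrow> l"
    by (simp add: Cauchy_convergent_iff convergent_def)
  then obtain a where a: "\<And>n. (\<lambda>m. entry (X m) n) \<longlonglongrightarrow> a n" by metis
  have key: "\<exists>M. \<forall>m\<ge>M. \<forall>N. (\<Sum>i<N. (cmod (entry (X m) i - a i))\<^sup>2) \<le> e\<^sup>2" if e: "0 < e" for e :: real
  proof -
    obtain M where M: "\<And>i j. M \<le> i \<Longrightarrow> M \<le> j \<Longrightarrow> dist (X i) (X j) < e"
      using X e unfolding Cauchy_def by meson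
    have "(\<Sum>i<N. (cmod (entry (X m) i - a i))\<^sup>2) \<le> e\<^sup>2" if "M \<le> m" for m N
    proof (rule tendsto_upperbound)
      show "(\<lambda>j. \<Sum>i<N. (cmod (entry (X m) i - entry (X j) i))\<^sup>2)
          \<longlonglongrightarrow> (\<Sum>i<N. (cmod (entry (X m) i - a i))\<^sup>2)"
        by (intro tendsto_intros a)
      have "(\<Sum>i<N. (cmod (entry (X m) i - entry (X j) i))\<^sup>2) \<le> e\<^sup>2" if "M \<le> j" for j
      proof -
        have "(\<Sum>i<N. (cmod (entry (X m) i - entry (X j) i))\<^sup>2) \<le> (norm (X m - X j))\<^sup>2"
          using sum_entry_le_norm[where x = "X m - X j" and N = N] by simp
        also have "\<dots> \<le> e\<^sup>2"
          using M[OF \<open>M \<le> m\<close> that] by (intro power_mono) (simp_all add: dist_norm)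
        finally show ?thesis .
      qed
      then show "\<forall>\<^sub>F j in sequentially. (\<Sum>i<N. (cmod (entry (X m) i - entry (X j) i))\<^sup>2) \<le> e\<^sup>2"
        by (auto simp: eventually_sequentially)
    qed simp
    then show ?thesis by blast
  qed
  obtain M where M: "\<And>N. (\<Sum>i<N. (cmod (entry (X M) i - a i))\<^sup>2) \<le> 1"
    using key[of 1] by auto
  have "summable (\<lambda>i. (cmod (entry (X M) i - a i))\<^sup>2)"
    using M by (intro bounded_imp_summable[where B = 1]) (simp_all only: lessThan_Suc_atMost[symmetric] zero_le_power2)
  then have "summable (\<lambda>i. (cmod (a i))\<^sup>2)"
    using summable_norm2_add[OF summable_entry[of "X M"], of "\<lambda>i. - (entry (X M) i - a i)"]
    by (simp add: norm_minus_commute)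
  then have L: "entry (Abs_ell2 a) = a"
    by (simp add: Abs_ell2_inverse)
  have "X \<longlonglongrightarrow> Abs_ell2 a"
  proof (rule metric_LIMSEQ_I)
    fix r :: real assume r: "0 < r"
    then obtain K where K: "\<And>m N. K \<le> m \<Longrightarrow> (\<Sum>i<N. (cmod (entry (X m) i - a i))\<^sup>2) \<le> (r / 2)\<^sup>2"
      using key[of "r / 2"] by auto
    have "dist (X m) (Abs_ell2 a) < r" if "K \<le> m" for m
    proof -
      have "(norm (X m - Abs_ell2 a))\<^sup>2 \<le> (r / 2)\<^sup>2"
        unfolding norm_ell2_power2
        by (rule suminf_le_const[OF summable_entry]) (use K[OF that] in \<open>simp add: L\<close>)
      then have "norm (X m - Abs_ell2 a) \<le> r / 2"
        by (rule power2_le_imp_le) (use r in simp)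
      then show ?thesis using r by (simp add: dist_norm)
    qed
    then show "\<exists>K. \<forall>m\<ge>K. dist (X m) (Abs_ell2 a) < r" by blast
  qed
  then show "convergent X" by (auto simp: convergent_def)
qed

instantiation ell2 :: chilbert_space
begin

lift_definition scaleC_ell2 :: "complex \<Rightarrow> ell2 \<Rightarrow> ell2" is "\<lambda>a x n. a * x n"
  by (simp add: norm_mult power_mult_distrib summable_mult)

definition cinner_ell2 :: "ell2 \<Rightarrow> ell2 \<Rightarrow> complex" where
  "cinner_ell2 x y = (\<Sum>n. cnj (entry x n) * entry y n)"

lemma entry_scaleC [simp]: "entry (a *\<^sub>C x) n = a * entry x n"
  by transfer simp

instance
proof
  fix a b :: complex and r :: real and x y z :: ell2
  show "a *\<^sub>C (x + y) = a *\<^sub>C x + a *\<^sub>C y"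
    by (rule ell2_eqI) (simp add: algebra_simps)
  show "(a + b) *\<^sub>C x = a *\<^sub>C x + b *\<^sub>C x"
    by (rule ell2_eqI) (simp add: algebra_simps)
  show "a *\<^sub>C (b *\<^sub>C x) = (a * b) *\<^sub>C x"
    by (rule ell2_eqI) simp
  show "r *\<^sub>R x = complex_of_real r *\<^sub>C x"
    by (rule ell2_eqI) (simp add: scaleR_conv_of_real)
  show "cinner x y = cnj (cinner y x)"
    unfolding cinner_ell2_def
    using bounded_linear.suminf[OF bounded_linear_cnj summable_entry_mult[of y x]]
    by (simp add: mult.commute)
  show "cinner (x + y) z = cinner x z + cinner y z"
    unfolding cinner_ell2_def
    using suminf_add[OF summable_entry_mult[of x z] summable_entry_mult[of y z]]
    by (simp add: algebra_simps)
  show "cinner (a *\<^sub>C x) y = cnj a * cinner x y"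
    unfolding cinner_ell2_def
    using suminf_mult[OF summable_entry_mult[of x y], of "cnj a"]
    by (simp add: mult.assoc)
  show "inner x y = Re (cinner x y)"
    by (simp add: cinner_ell2_def inner_ell2_def)
qed

end

definition ebasis :: "nat \<Rightarrow> ell2" where
  "ebasis n = Abs_ell2 (\<lambda>m. if m = n then 1 else 0)"

definition unilateral_shift :: "ell2 \<Rightarrow>\<^sub>L ell2" where
  "unilateral_shift = Blinfun (\<lambda>x. Abs_ell2 (case_nat 0 (entry x)))"


section \<open>The Toeplitz algebra\<close>

text \<open>Lebesgue measure on the unit circle, of total mass \<open>2\<pi>\<close>\<close>

definition circle_measure :: "complex measure" where
  "circle_measure =
     distr (restrict_space lborel {0..<2 * pi}) (restrict_space borel (sphere 0 1)) cis"

definition L2_circle :: "(complex \<Rightarrow> complex) set" where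
  "L2_circle = {\<phi> \<in> borel_measurable circle_measure.
     integrable circle_measure (\<lambda>z. (cmod (\<phi> z))\<^sup>2)}"

definition circle_inner :: "(complex \<Rightarrow> complex) \<Rightarrow> (complex \<Rightarrow> complex) \<Rightarrow> complex" where
  "circle_inner \<phi> \<psi> = (LINT z|circle_measure. cnj (\<phi> z) * \<psi> z)"

definition circle_basis :: "int \<Rightarrow> complex \<Rightarrow> complex" where
  "circle_basis m z = z powi m / complex_of_real (sqrt (2 * pi))"

text \<open>The embedding of square summable sequences into the square integrable functions on the circle,
  sending the standard basis to the functions \<open>circle_basis n\<close>, \<open>n \<ge> 0\<close> (the value, given by a
  series that converges in the mean, is unique almost everywhere); and, conversely, the orthogonal
  projection onto its range, given by the Fourier coefficients.\<close>

definition hardy_embed :: "ell2 \<Rightarrow> complex \<Rightarrow> complex" where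
  "hardy_embed x = (SOME \<phi>. \<phi> \<in> L2_circle \<and>
     (\<lambda>n. LINT z|circle_measure. (cmod (\<phi> z - (\<Sum>k<n. entry x k * circle_basis (int k) z)))\<^sup>2)
       \<longlonglongrightarrow> 0)"

definition hardy_proj :: "(complex \<Rightarrow> complex) \<Rightarrow> ell2" where
  "hardy_proj \<phi> = Abs_ell2 (\<lambda>n. circle_inner (circle_basis (int n)) \<phi>)"

definition toeplitz :: "(complex \<Rightarrow> complex) \<Rightarrow> (ell2 \<Rightarrow>\<^sub>L ell2)" where
  "toeplitz f = Blinfun (\<lambda>x. hardy_proj (\<lambda>z. f z * hardy_embed x z))"

text \<open>Functions on the circle are represented by functions on the complex plane, of which only the
  values on the circle matter.\<close>

definition C_circle :: "(complex \<Rightarrow> complex) set" where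
  "C_circle = {f. continuous_on (sphere 0 1) f}"

definition C_inf_circle :: "(complex \<Rightarrow> complex) set" where
  "C_inf_circle = {f. \<forall>k t. ((\<lambda>g t. vector_derivative g (at t)) ^^ k) (\<lambda>t. f (cis t))
     differentiable (at t)}"

definition toeplitz_algebra :: "(ell2 \<Rightarrow>\<^sub>L ell2) set" where
  "toeplitz_algebra = cstar_alg (toeplitz ` C_circle)"

definition is_symbol_map :: "((ell2 \<Rightarrow>\<^sub>L ell2) \<Rightarrow> complex \<Rightarrow> complex) \<Rightarrow> bool" where
  "is_symbol_map s \<longleftrightarrow>
     (\<forall>a\<in>toeplitz_algebra. s a \<in> C_circle) \<and>
     (\<forall>a\<in>toeplitz_algebra. \<forall>b\<in>toeplitz_algebra. \<forall>c. \<forall>z\<in>sphere 0 1.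
        s (a + b) z = s a z + s b z \<and> s (a o\<^sub>L b) z = s a z * s b z \<and>
        s (scaleC_op c a) z = c * s a z \<and> s (adj a) z = cnj (s a z)) \<and>
     (\<forall>f\<in>C_circle. \<exists>a\<in>toeplitz_algebra. \<forall>z\<in>sphere 0 1. s a z = f z) \<and>
     {a \<in> toeplitz_algebra. \<forall>z\<in>sphere 0 1. s a z = 0} = compact_ops \<and>
     (\<forall>f\<in>C_circle. \<forall>z\<in>sphere 0 1. s (toeplitz f) z = f z)"

text \<open>The values of the symbol map on the circle are uniquely determined.\<close>

definition symbol_map :: "(ell2 \<Rightarrow>\<^sub>L ell2) \<Rightarrow> complex \<Rightarrow> complex" where
  "symbol_map = (SOME s. is_symbol_map s)"


section \<open>The noncommutative Toeplitz torus\<close>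

definition C_wedge :: "(complex \<Rightarrow> complex) set" where
  "C_wedge = {f \<in> C_circle. \<forall>t\<in>{0..pi / 2}.
     f (exp (\<i> * t)) = f (- \<i> * exp (- \<i> * t)) \<and> f (exp (- \<i> * t)) = f (\<i> * exp (\<i> * t))}"

definition toeplitz_torus :: "(ell2 \<Rightarrow>\<^sub>L ell2) set" where
  "toeplitz_torus = {a \<in> toeplitz_algebra. symbol_map a \<in> C_wedge}"

definition smooth_toeplitz_ops :: "(ell2 \<Rightarrow>\<^sub>L ell2) set" where
  "smooth_toeplitz_ops = toeplitz ` (C_wedge \<inter> C_inf_circle)"

text \<open>\<open>End (span {e\<^sub>0, \<dots>, e\<^sub>n})\<close> for all \<open>n\<close>, acting as zero on the orthogonal complement\<close>

definition finite_matrix_ops :: "(ell2 \<Rightarrow>\<^sub>L ell2) set" where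
  "finite_matrix_ops = (\<Union>n. {T \<in> bops.
     range (blinfun_apply T) \<subseteq> cvec.span (ebasis ` {..n}) \<and>
     (\<forall>x. (\<forall>y\<in>cvec.span (ebasis ` {..n}). cinner y x = 0) \<longrightarrow> blinfun_apply T x = 0)})"

definition torus_smooth_algebra :: "(ell2 \<Rightarrow>\<^sub>L ell2) set" where
  "torus_smooth_algebra = star_alg (smooth_toeplitz_ops \<union> finite_matrix_ops)"

definition dom_N :: "ell2 set" where
  "dom_N = {x. summable (\<lambda>n. (real n)\<^sup>2 * (cmod (entry x n))\<^sup>2)}"

text \<open>For \<open>n = 0\<close> the scalar vanishes, so the truncated predecessor is harmless.\<close>

definition del_z :: "(ell2 \<times> ell2) set" where
  "del_z = {(x, y). x \<in> dom_N \<and> (\<lambda>n. entry x n *\<^sub>C of_nat n *\<^sub>C ebasis (n - 1)) sums y}"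

definition torus_dirac :: "((ell2 \<times> ell2) \<times> (ell2 \<times> ell2)) set" where
  "torus_dirac = {((x, y), (u, v)). x \<in> dom_N \<and> y \<in> dom_N \<and>
     (y, u) \<in> del_z \<and> (x, v) \<in> op_adjoint del_z}"

definition torus_rep :: "(ell2 \<Rightarrow>\<^sub>L ell2) \<Rightarrow> ((ell2 \<times> ell2) \<Rightarrow>\<^sub>L (ell2 \<times> ell2))" where
  "torus_rep a = dsum_op a a"

definition torus_grading :: "(ell2 \<times> ell2) \<Rightarrow>\<^sub>L (ell2 \<times> ell2)" where
  "torus_grading = dsum_op id_blinfun (- id_blinfun)"

definition torus_eigvec :: "int \<Rightarrow> ell2 \<times> ell2" where
  "torus_eigvec k =
     (if k > 0 then (1 / sqrt 2) *\<^sub>C (ebasis (nat (k - 1)), ebasis (nat k))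
      else if k < 0 then (1 / sqrt 2) *\<^sub>C (- ebasis (nat (- k - 1)), ebasis (nat (- k)))
      else (0, ebasis 0))"

end

theory Submission
  imports Defs
begin

text \<open>
  The Dirac operator becomes transparent in its eigenvectors. Since
  \<open>\<partial>\<^sub>z e\<^sub>k = k e\<^sub>k\<^sub>-\<^sub>1\<close> and \<open>\<partial>\<^sub>z\<^sup>* e\<^sub>k\<^sub>-\<^sub>1 = k e\<^sub>k\<close>, it interchanges \<open>k\<close> times the two
  vectors \<open>e\<^sub>k\<^sub>-\<^sub>1 \<oplus> 0\<close> and \<open>0 \<oplus> e\<^sub>k\<close>; their sum and difference give the eigenvalues \<open>k\<close>
  and \<open>- k\<close>, and \<open>0 \<oplus> e\<^sub>0\<close> is left over as the kernel. These vectors form an orthonormal basis, and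
  \<open>D\<close> is exactly the diagonal operator with the eigenvalues \<open>k \<in> \<int>\<close> on its maximal domain
  (\<open>torus_dirac_diag\<close>). What concerns \<open>D\<close> alone is then a statement about sequences of numbers: it is
  self-adjoint because the eigenvalues are real, its spectrum is \<open>\<int>\<close>, the resolvent is compact
  because \<open>1 / (k + \<i>)\<close> tends to \<open>0\<close>, \<open>|D|\<close> is diagonal with eigenvalues \<open>|k|\<close> by uniqueness of
  positive square roots (\<open>op_abs_diag_op\<close>), and summability is the behaviour of
  \<open>\<Sum>k (1 + |k|)\<^sup>-\<^sup>s\<close> for \<open>s > 1\<close> and for \<open>s = 1\<close> (\<open>trace_class_bdiag\<close>, \<open>trace_class_bdiagD\<close>).
  The phase \<open>F\<close> is diagonal with eigenvalues \<open>sgn k\<close>, and in block form consists of the shift and its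
  adjoint (\<open>polar_part_torus_phase\<close>). The block \<open>S\<^sup>*\<close> from the negative to the positive part is
  onto with kernel spanned by \<open>e\<^sub>0\<close>, so the index is \<open>1\<close>.

  That \<open>C(\<T>\<^sup>2\<^sub>q)\<close> is a unital C*-algebra, with the smooth algebra dense in it, requires the structure of the
  Toeplitz algebra. A Toeplitz operator is bounded by the supremum of its symbol, and its matrix entries
  are the Fourier coefficients of the symbol (\<open>toeplitz_norm\<close>, \<open>toeplitz_entry\<close>). The products
  \<open>T\<^sub>f T\<^sub>g\<close> and \<open>T\<^sub>f\<^sub>g\<close> differ by a compact operator, and at every point \<open>\<zeta>\<close> of the circle there is a
  sequence of unit vectors on which \<open>T\<^sub>f\<close> is asymptotically the number \<open>f \<zeta>\<close> and compact operators
  vanish (\<open>toeplitz_mult_and_eigvec\<close>). Hence the supremum of \<open>|f|\<close> is at most the norm of \<open>T\<^sub>f + K\<close> for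
  every compact \<open>K\<close> (\<open>symbol_le_norm\<close>), so the sums \<open>T\<^sub>f + K\<close> form a norm closed algebra, which is the
  Toeplitz algebra, with symbol \<open>f\<close> (\<open>toeplitz_algebra_eq\<close>); the symbols that respect
  the identifications on the circle give \<open>C(\<T>\<^sup>2\<^sub>q)\<close> in the same form (\<open>toeplitz_torus_eq\<close>).
  For the density, compact operators are limits of finite matrices, and symbols have to be approximated
  by smooth symbols with the same identifications. Trigonometric polynomials do not suffice: by analyticity such a polynomial would
  satisfy both identifications on the whole circle, and hence take equal values at \<open>z\<close> and
  \<open>- z\<close>. The approximations are instead multiplied by functions that are flat at the corners
  \<open>1, \<i>, -1, -\<i>\<close> (\<open>smooth_wedge_dense\<close>).

  Regularity comes from one observation: the commutator with \<open>N\<close> multiplies the matrix entry \<open>(m, n)\<close> by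
  \<open>m - n\<close>, which differentiates the symbol of a Toeplitz operator and keeps finite matrices finite. The algebra
  generated by all smooth Toeplitz operators and the finite matrices is thus mapped into itself
  (\<open>number_commutator_smooth\<close>). For a Toeplitz operator \<open>a\<close> the blocks of
  \<open>[D, a \<oplus> a]\<close> are \<open>[N, a]\<close> up to shifts, finite matrices are immediate, and the Leibniz rule
  covers products (\<open>dirac_commutator_smooth\<close>), while \<open>|D| = (N + 1) \<oplus> N\<close>, so the iterated commutators with \<open>|D|\<close> are again
  block operators over that algebra (\<open>smooth_blocks_abs_commutator\<close>) and in particular bounded.\<close>

notation blinfun_apply (infixl \<open>\<cdot>\<close> 100)

section \<open>Complex Hilbert spaces and their bounded operators\<close>

lemma cinner_add_right: "cinner x (y + z) = cinner x y + cinner x z"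
  by (metis cinner_add_left cinner_commute complex_cnj_add)

lemma cinner_scaleC_right: "cinner x (a *\<^sub>C y) = a * cinner x y"
  by (metis cinner_commute cinner_scaleC_left complex_cnj_cnj complex_cnj_mult)

lemma cinner_scaleR_left: "cinner (r *\<^sub>R x) y = r * cinner x y"
  by (simp add: scaleR_scaleC cinner_scaleC_left)

lemma cinner_scaleR_right: "cinner x (r *\<^sub>R y) = r * cinner x y"
  by (simp add: scaleR_scaleC cinner_scaleC_right)

lemma cinner_minus_left: "cinner (- x) y = - cinner x y"
  using cinner_scaleR_left[of "-1" x y] by simp

lemma cinner_minus_right: "cinner x (- y) = - cinner x y"
  using cinner_scaleR_right[of x "-1" y] by simp

lemma cinner_diff_left: "cinner (x - y) z = cinner x z - cinner y z"
  using cinner_add_left[of x "- y" z] by (simp add: cinner_minus_left)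

lemma cinner_diff_right: "cinner x (y - z) = cinner x y - cinner x z"
  using cinner_add_right[of x y "- z"] by (simp add: cinner_minus_right)

lemma cinner_zero_left [simp]: "cinner 0 y = 0"
  using cinner_scaleR_left[of 0] by simp

lemma cinner_zero_right [simp]: "cinner x 0 = 0"
  using cinner_scaleR_right[of _ 0] by simp

lemma cinner_sum_left: "cinner (sum f A) y = (\<Sum>i\<in>A. cinner (f i) y)"
  by (induction A rule: infinite_finite_induct) (auto simp: cinner_add_left)

lemma cinner_sum_right: "cinner x (sum f A) = (\<Sum>i\<in>A. cinner x (f i))"
  by (induction A rule: infinite_finite_induct) (auto simp: cinner_add_right)

lemmas cinner_simps = cinner_add_left cinner_add_right cinner_diff_left cinner_diff_right
  cinner_minus_left cinner_minus_right cinner_scaleC_left cinner_scaleC_right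
  cinner_scaleR_left cinner_scaleR_right

lemma cinner_self: "cinner x x = complex_of_real ((norm x)\<^sup>2)"
proof -
  have "Im (cinner x x) = 0"
    using cinner_commute[of x x] by (metis cnj.simps(2) neg_equal_zero)
  moreover have "Re (cinner x x) = (norm x)\<^sup>2"
    by (simp add: power2_norm_eq_inner inner_eq_Re_cinner)
  ultimately show ?thesis by (simp add: complex_eq_iff)
qed

lemma norm_scaleC: "norm (a *\<^sub>C x) = cmod a * norm x" for x :: "'a::chilbert_space"
proof -
  have "complex_of_real ((norm (a *\<^sub>C x))\<^sup>2) = (a * cnj a) * cinner x x"
    unfolding cinner_self[symmetric] by (simp add: cinner_simps)
  also have "\<dots> = complex_of_real ((cmod a * norm x)\<^sup>2)"
    unfolding cinner_self complex_norm_square[symmetric] by (simp add: power_mult_distrib)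
  finally have "complex_of_real ((norm (a *\<^sub>C x))\<^sup>2) = complex_of_real ((cmod a * norm x)\<^sup>2)" .
  then have "(norm (a *\<^sub>C x))\<^sup>2 = (cmod a * norm x)\<^sup>2"
    using of_real_eq_iff by blast
  then show ?thesis by (simp add: power2_eq_iff_nonneg)
qed

lemmas scaleC_minus_left = cvec.scale_minus_left
lemmas scaleC_minus_right = cvec.scale_minus_right
lemmas scaleC_diff_left = cvec.scale_left_diff_distrib
lemmas scaleC_diff_right = cvec.scale_right_diff_distrib

lemma scaleC_scaleR_commute: "a *\<^sub>C (r *\<^sub>R x) = r *\<^sub>R (a *\<^sub>C x)" for x :: "'a::chilbert_space"
  by (simp add: scaleR_scaleC scaleC_scaleC mult.commute)

text \<open>Multiplying \<open>x\<close> by a complex number of modulus one makes the inner product real, which reduces the claim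
  to the real inner product space.\<close>

lemma cinner_Cauchy_Schwarz: "cmod (cinner x y) \<le> norm x * norm y"
proof (cases "cinner x y = 0")
  case False
  define u where "u = cinner x y / cmod (cinner x y)"
  have u: "cmod u = 1" using False by (simp add: u_def norm_divide)
  have "cnj u * cinner x y = (cinner x y * cnj (cinner x y)) / cmod (cinner x y)"
    by (simp add: u_def)
  also have "\<dots> = complex_of_real (cmod (cinner x y))"
    using False by (simp add: power2_eq_square flip: complex_norm_square)
  finally have "cmod (cinner x y) = Re (cnj u * cinner x y)"
    by simp
  also have "\<dots> = inner (u *\<^sub>C x) y" by (simp add: inner_eq_Re_cinner cinner_simps)
  also have "\<dots> \<le> norm (u *\<^sub>C x) * norm y" by (rule norm_cauchy_schwarz)
  finally show ?thesis by (simp add: norm_scaleC u)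
qed simp

lemma bounded_linear_cinner_right: "bounded_linear (cinner x)"
  by (rule bounded_linear_intro[where K = "norm x"])
    (simp_all add: cinner_simps scaleR_conv_of_real cinner_Cauchy_Schwarz mult.commute[of "norm _" "norm x"])

lemma bounded_linear_cinner_left: "bounded_linear (\<lambda>x. cinner x y)"
  by (rule bounded_linear_intro[where K = "norm y"])
    (auto simp: cinner_simps scaleR_conv_of_real cinner_Cauchy_Schwarz)

lemma bounded_linear_scaleC: "bounded_linear (\<lambda>x::'a::chilbert_space. a *\<^sub>C x)"
  by (rule bounded_linear_intro[where K = "cmod a"])
    (auto simp: scaleC_add_right scaleC_scaleR_commute norm_scaleC)

lemma cinner_eq_zero_iff [simp]: "cinner x x = 0 \<longleftrightarrow> x = 0"
  by (simp add: cinner_self)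

lemma bopsD: "T \<in> bops \<Longrightarrow> T \<cdot> (c *\<^sub>C x) = c *\<^sub>C T \<cdot> x"
  by (simp add: bops_def)

lemma norm_blinfun_le: "0 \<le> B \<Longrightarrow> (\<And>x. norm (T \<cdot> x) \<le> B * norm x) \<Longrightarrow> norm T \<le> B"
  by (rule norm_blinfun_bound) auto

lemma apply_scaleC_op [simp]: "scaleC_op c T \<cdot> x = c *\<^sub>C T \<cdot> x"
proof -
  have "bounded_linear (\<lambda>x. c *\<^sub>C T \<cdot> x)"
    by (intro bounded_linear_compose[OF bounded_linear_scaleC] blinfun.bounded_linear_right)
  then show ?thesis by (simp add: scaleC_op_def bounded_linear_Blinfun_apply)
qed

lemma bops_zero [simp]: "0 \<in> bops" and bops_id [simp]: "id_blinfun \<in> bops"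
  by (auto simp: bops_def)

lemma bops_add: "S \<in> bops \<Longrightarrow> T \<in> bops \<Longrightarrow> S + T \<in> bops"
  by (auto simp: bops_def blinfun.add_left scaleC_add_right)

lemma bops_minus: "S \<in> bops \<Longrightarrow> - S \<in> bops"
  by (auto simp: bops_def blinfun.minus_left scaleC_minus_right)

lemma bops_diff: "S \<in> bops \<Longrightarrow> T \<in> bops \<Longrightarrow> S - T \<in> bops"
  by (auto simp: bops_def blinfun.diff_left scaleC_diff_right)

lemma bops_compose: "S \<in> bops \<Longrightarrow> T \<in> bops \<Longrightarrow> S o\<^sub>L T \<in> bops"
  by (auto simp: bops_def)

lemma bops_scaleC: "S \<in> bops \<Longrightarrow> scaleC_op c S \<in> bops"
  by (auto simp: bops_def scaleC_scaleC mult.commute)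

lemma bops_sum: "(\<And>i. i \<in> A \<Longrightarrow> f i \<in> bops) \<Longrightarrow> sum f A \<in> bops"
  by (induction A rule: infinite_finite_induct) (auto intro: bops_add)

lemma uminus_eq_scaleC_op: "- T = scaleC_op (- 1) T"
  by (rule blinfun_eqI) (simp add: blinfun.minus_left scaleC_minus_left)

lemma tendsto_blinfun_apply:
  assumes "(F \<longlongrightarrow> T) G" shows "((\<lambda>n. F n \<cdot> x) \<longlongrightarrow> T \<cdot> x) G"
  using bounded_linear.tendsto[OF blinfun.bounded_linear_left assms] .

lemma closed_bops: "closed bops"
  unfolding closed_sequential_limits
proof (intro allI impI, elim conjE)
  fix F :: "nat \<Rightarrow> 'a::chilbert_space \<Rightarrow>\<^sub>L 'b::chilbert_space" and T
  assume F: "\<forall>n. F n \<in> bops" "F \<longlonglongrightarrow> T"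
  show "T \<in> bops" unfolding bops_def
  proof (intro CollectI allI)
    fix c x
    have "(\<lambda>n. F n \<cdot> (c *\<^sub>C x)) \<longlonglongrightarrow> c *\<^sub>C T \<cdot> x"
      using F(1) bounded_linear.tendsto[OF bounded_linear_scaleC tendsto_blinfun_apply[OF F(2)]]
      by (simp add: bopsD)
    with tendsto_blinfun_apply[OF F(2)]
    show "T \<cdot> (c *\<^sub>C x) = c *\<^sub>C T \<cdot> x"
      using LIMSEQ_unique by blast
  qed
qed

lemma cinner_eqI: "(\<And>z. cinner z x = cinner z y) \<Longrightarrow> x = y"
  by (metis cinner_diff_right cinner_eq_zero_iff eq_iff_diff_eq_0)

text \<open>Adjoints are determined by their defining identity, so any operator that satisfies it is the
  adjoint.\<close>

lemma adj_eqI: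
  assumes "\<And>x y. cinner (T \<cdot> x) y = cinner x (T' \<cdot> y)"
  shows "adj T = T'"
  unfolding adj_def
proof (rule the_equality)
  fix S assume S: "\<forall>x y. cinner (T \<cdot> x) y = cinner x (S \<cdot> y)"
  show "S = T'" by (rule blinfun_eqI, rule cinner_eqI) (metis S assms)
qed (use assms in simp)

subsection \<open>Compact operators\<close>

text \<open>In a complete space, compact closure is total boundedness. Finite nets are easier to combine than
  closures in the permanence properties below.\<close>

lemma compact_ops_iff:
  "T \<in> compact_ops \<longleftrightarrow> T \<in> bops \<and>
     (\<forall>e>0. \<exists>k. finite k \<and> blinfun_apply T ` cball 0 1 \<subseteq> (\<Union>x\<in>k. ball x e))"
proof -
  let ?S = "blinfun_apply T ` cball 0 1"
  have "compact (closure ?S) \<longleftrightarrow> (\<forall>e>0. \<exists>k. finite k \<and> closure ?S \<subseteq> (\<Union>x\<in>k. ball x e))"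
    by (simp add: compact_eq_totally_bounded complete_eq_closed)
  also have "\<dots> \<longleftrightarrow> (\<forall>e>0. \<exists>k. finite k \<and> ?S \<subseteq> (\<Union>x\<in>k. ball x e))" (is "?L \<longleftrightarrow> ?R")
  proof
    assume ?L then show ?R using closure_subset[of ?S] by (meson order_trans)
  next
    assume R: ?R
    show ?L
    proof (intro allI impI)
      fix e :: real assume "e > 0"
      then obtain k where k: "finite k" "?S \<subseteq> (\<Union>x\<in>k. ball x (e/2))"
        using R half_gt_zero by blast
      have "closure ?S \<subseteq> (\<Union>x\<in>k. ball x e)"
      proof
        fix y assume "y \<in> closure ?S"
        then obtain z where z: "z \<in> ?S" "dist z y < e/2"
          using \<open>e > 0\<close> by (meson closure_approachable half_gt_zero)
        then obtain x where "x \<in> k" "dist x z < e/2" using k(2) by auto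
        then have "dist x y < e" using z(2) by (metis dist_triangle_half_l dist_commute)
        then show "y \<in> (\<Union>x\<in>k. ball x e)" using \<open>x \<in> k\<close> by auto
      qed
      then show "\<exists>k. finite k \<and> closure ?S \<subseteq> (\<Union>x\<in>k. ball x e)" using k(1) by blast
    qed
  qed
  finally show ?thesis by (auto simp: compact_ops_def)
qed

lemma compact_ops_bops: "T \<in> compact_ops \<Longrightarrow> T \<in> bops"
  by (simp add: compact_ops_def)

lemma closed_compact_ops: "closed compact_ops"
  unfolding closed_sequential_limits
proof (intro allI impI, elim conjE)
  fix F :: "nat \<Rightarrow> 'a::chilbert_space \<Rightarrow>\<^sub>L 'b::chilbert_space" and T
  assume F: "\<forall>n. F n \<in> compact_ops" "F \<longlonglongrightarrow> T"
  have "T \<in> bops"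
    using F closed_bops compact_ops_bops unfolding closed_sequential_limits by blast
  moreover have "\<exists>k. finite k \<and> blinfun_apply T ` cball 0 1 \<subseteq> (\<Union>x\<in>k. ball x e)" if e: "e > 0" for e
  proof -
    obtain n where n: "norm (F n - T) < e/2"
      using F(2) e unfolding LIMSEQ_iff by (meson half_gt_zero order_refl)
    obtain k where k: "finite k" "blinfun_apply (F n) ` cball 0 1 \<subseteq> (\<Union>x\<in>k. ball x (e/2))"
      using F(1) e unfolding compact_ops_iff by (meson half_gt_zero)
    have "T \<cdot> x \<in> (\<Union>x\<in>k. ball x e)" if "x \<in> cball 0 1" for x
    proof -
      have "dist (F n \<cdot> x) (T \<cdot> x) \<le> norm (F n - T) * norm x"
        by (metis dist_norm blinfun.diff_left norm_blinfun)
      also have "\<dots> \<le> norm (F n - T) * 1" using that by (intro mult_left_mono) auto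
      finally have *: "dist (F n \<cdot> x) (T \<cdot> x) < e/2" using n by simp
      have "F n \<cdot> x \<in> (\<Union>x\<in>k. ball x (e/2))" using k(2) that by blast
      then obtain y where y: "y \<in> k" "dist y (F n \<cdot> x) < e/2"
        by (auto simp: mem_ball)
      have "dist y (T \<cdot> x) < e"
        using * y(2) by (metis dist_triangle_half_l dist_commute)
      then show ?thesis using y(1) by auto
    qed
    then show ?thesis using k(1) by blast
  qed
  ultimately show "T \<in> compact_ops" by (simp add: compact_ops_iff)
qed

lemma compact_ops_add:
  assumes "S \<in> compact_ops" "T \<in> compact_ops" shows "S + T \<in> compact_ops"
  unfolding compact_ops_iff
proof (intro conjI allI impI)
  show "S + T \<in> bops" using assms by (intro bops_add compact_ops_bops)
  fix e :: real assume "e > 0"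
  then obtain k l where k: "finite k" "blinfun_apply S ` cball 0 1 \<subseteq> (\<Union>x\<in>k. ball x (e/2))"
    and l: "finite l" "blinfun_apply T ` cball 0 1 \<subseteq> (\<Union>x\<in>l. ball x (e/2))"
    using assms unfolding compact_ops_iff by (meson half_gt_zero)
  have "(S + T) \<cdot> x \<in> (\<Union>z\<in>(\<lambda>(u, v). u + v) ` (k \<times> l). ball z e)" if "x \<in> cball 0 1" for x
  proof -
    have "S \<cdot> x \<in> (\<Union>x\<in>k. ball x (e/2))" "T \<cdot> x \<in> (\<Union>x\<in>l. ball x (e/2))"
      using k(2) l(2) that by blast+
    then obtain u v where uv: "u \<in> k" "dist u (S \<cdot> x) < e/2"
        "v \<in> l" "dist v (T \<cdot> x) < e/2"
      by (auto simp: mem_ball)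
    have "dist (u + v) ((S + T) \<cdot> x)
        \<le> dist u (S \<cdot> x) + dist v (T \<cdot> x)"
      unfolding blinfun.add_left by (rule dist_triangle_add)
    then have "dist (u + v) ((S + T) \<cdot> x) < e" using uv by linarith
    then have "(S + T) \<cdot> x \<in> ball (u + v) e" by simp
    then show ?thesis using uv(1,3) by (intro UN_I[of "u + v"]) (auto intro: image_eqI[of _ _ "(u, v)"])
  qed
  then show "\<exists>k. finite k \<and> blinfun_apply (S + T) ` cball 0 1 \<subseteq> (\<Union>x\<in>k. ball x e)"
    using k(1) l(1) by (intro exI[of _ "(\<lambda>(u, v). u + v) ` (k \<times> l)"]) blast
qed

lemma compact_closure_subset:
  fixes C :: "'a::t2_space set"
  assumes "compact C" "A \<subseteq> C" shows "compact (closure A)"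
proof -
  have "closure A \<subseteq> C" using assms by (simp add: closure_minimal compact_imp_closed)
  then have "C \<inter> closure A = closure A" by blast
  then show ?thesis using compact_Int_closed[OF assms(1) closed_closure[of A]] by simp
qed

lemma compact_ops_compose_left:
  assumes "S \<in> bops" "T \<in> compact_ops" shows "S o\<^sub>L T \<in> compact_ops"
  unfolding compact_ops_def
proof (intro CollectI conjI)
  show "S o\<^sub>L T \<in> bops" using assms by (simp add: bops_compose compact_ops_bops)
  have co: "compact (blinfun_apply S ` closure (blinfun_apply T ` cball 0 1))"
    using assms(2) by (intro compact_continuous_image linear_continuous_on blinfun.bounded_linear_right)
      (simp add: compact_ops_def)
  have "blinfun_apply (S o\<^sub>L T) ` cball 0 1 \<subseteq> blinfun_apply S ` closure (blinfun_apply T ` cball 0 1)"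
    using closure_subset[of "blinfun_apply T ` cball 0 1"] by auto
  then show "compact (closure (blinfun_apply (S o\<^sub>L T) ` cball 0 1))"
    by (rule compact_closure_subset[OF co])
qed

lemma compact_ops_compose_right:
  assumes "S \<in> compact_ops" "T \<in> bops" shows "S o\<^sub>L T \<in> compact_ops"
  unfolding compact_ops_iff
proof (intro conjI allI impI)
  show "S o\<^sub>L T \<in> bops" using assms by (simp add: bops_compose compact_ops_bops)
  fix e :: real assume "e > 0"
  define c where "c = norm T + 1"
  have c: "c > 0" unfolding c_def by (simp add: add_nonneg_pos)
  then obtain k where k: "finite k" "blinfun_apply S ` cball 0 1 \<subseteq> (\<Union>x\<in>k. ball x (e/c))"
    using assms(1) \<open>e > 0\<close> unfolding compact_ops_iff by (meson divide_pos_pos)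
  have "(S o\<^sub>L T) \<cdot> x \<in> (\<Union>z\<in>(\<lambda>u. c *\<^sub>R u) ` k. ball z e)" if "x \<in> cball 0 1" for x
  proof -
    have "norm (T \<cdot> x) \<le> c"
    proof -
      have "norm (T \<cdot> x) \<le> norm T * norm x" by (rule norm_blinfun)
      also have "\<dots> \<le> norm T * 1" using that by (intro mult_left_mono) auto
      finally show ?thesis by (simp add: c_def)
    qed
    then have "T \<cdot> x /\<^sub>R c \<in> cball 0 1" using c by (simp add: field_simps)
    then have "S \<cdot> (T \<cdot> x /\<^sub>R c) \<in> (\<Union>x\<in>k. ball x (e/c))"
      using k(2) by blast
    then obtain u where u: "u \<in> k" "dist u (S \<cdot> (T \<cdot> x /\<^sub>R c)) < e/c"
      by (auto simp: mem_ball)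
    have "(S o\<^sub>L T) \<cdot> x = c *\<^sub>R S \<cdot> (T \<cdot> x /\<^sub>R c)"
      using c by (simp add: blinfun.scaleR_right)
    then have "dist (c *\<^sub>R u) ((S o\<^sub>L T) \<cdot> x) = c * dist u (S \<cdot> (T \<cdot> x /\<^sub>R c))"
      using c by (simp add: dist_norm flip: scaleR_diff_right)
    also have "\<dots> < e" using u(2) c by (simp add: pos_less_divide_eq mult.commute)
    finally have "(S o\<^sub>L T) \<cdot> x \<in> ball (c *\<^sub>R u) e" by simp
    then show ?thesis using u(1) by blast
  qed
  then show "\<exists>k. finite k \<and> blinfun_apply (S o\<^sub>L T) ` cball 0 1 \<subseteq> (\<Union>x\<in>k. ball x e)"
    using k(1) by (intro exI[of _ "(\<lambda>u. c *\<^sub>R u) ` k"]) blast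
qed

lemma scaleC_op_conv_compose: "scaleC_op c T = scaleC_op c id_blinfun o\<^sub>L T"
  by (rule blinfun_eqI) simp

lemma compact_ops_scaleC: "T \<in> compact_ops \<Longrightarrow> scaleC_op c T \<in> compact_ops"
  by (subst scaleC_op_conv_compose) (auto intro!: compact_ops_compose_left bops_scaleC)

lemma compact_ops_minus: "T \<in> compact_ops \<Longrightarrow> - T \<in> compact_ops"
  by (simp add: uminus_eq_scaleC_op compact_ops_scaleC)

lemma compact_ops_diff: "S \<in> compact_ops \<Longrightarrow> T \<in> compact_ops \<Longrightarrow> S - T \<in> compact_ops"
  using compact_ops_add[of S "- T"] compact_ops_minus[of T] by simp

text \<open>A rank one operator maps the unit ball into the image of a disc of the complex plane.\<close>

lemma rank_one_compact:
  assumes T: "T \<in> bops" and eq: "\<And>x. T \<cdot> x = \<phi> x *\<^sub>C v"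
    and le: "\<And>x. cmod (\<phi> x) \<le> C * norm x"
  shows "T \<in> compact_ops"
  unfolding compact_ops_def
proof (intro CollectI conjI T)
  have C: "cmod (\<phi> x) \<le> \<bar>C\<bar>" if "x \<in> cball 0 1" for x
  proof -
    have "C * norm x \<le> \<bar>C\<bar> * 1" by (rule mult_mono) (use that in auto)
    then show ?thesis using le[of x] by simp
  qed
  have cont: "continuous_on UNIV (\<lambda>c. c *\<^sub>C v)"
    by (intro linear_continuous_on bounded_linear_intro[where K = "norm v"])
      (auto simp: scaleC_add_left scaleR_scaleC scaleC_scaleC norm_scaleC scaleR_conv_of_real)
  have co: "compact ((\<lambda>c. c *\<^sub>C v) ` cball 0 \<bar>C\<bar>)"
    by (intro compact_continuous_image continuous_on_subset[OF cont]) auto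
  have "blinfun_apply T ` cball 0 1 \<subseteq> (\<lambda>c. c *\<^sub>C v) ` cball 0 \<bar>C\<bar>"
  proof
    fix y assume "y \<in> blinfun_apply T ` cball 0 1"
    then obtain x where x: "x \<in> cball 0 1" "y = \<phi> x *\<^sub>C v" using eq by auto
    moreover have "\<phi> x \<in> cball 0 \<bar>C\<bar>" using C[OF x(1)] by simp
    ultimately show "y \<in> (\<lambda>c. c *\<^sub>C v) ` cball 0 \<bar>C\<bar>" by blast
  qed
  then show "compact (closure (blinfun_apply T ` cball 0 1))"
    by (rule compact_closure_subset[OF co])
qed

lemma compact_ops_zero [simp]: "0 \<in> compact_ops"
  by (auto simp: compact_ops_def image_constant_conv)

lemma compact_ops_sum: "(\<And>i. i \<in> A \<Longrightarrow> f i \<in> compact_ops) \<Longrightarrow> sum f A \<in> compact_ops"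
  by (induction A rule: infinite_finite_induct) (simp_all add: compact_ops_add)

section \<open>Orthonormal bases\<close>

lemma cnj_mult_self: "cnj z * z = complex_of_real ((cmod z)\<^sup>2)"
  by (metis complex_norm_square mult.commute)

lemma norm_sum_orthogonal:
  fixes B :: "'a::chilbert_space set"
  assumes on: "\<And>x y. x \<in> F \<Longrightarrow> y \<in> F \<Longrightarrow> cinner x y = (if x = y then 1 else 0)" and F: "finite F"
  shows "(norm (\<Sum>x\<in>F. c x *\<^sub>C x))\<^sup>2 = (\<Sum>x\<in>F. (cmod (c x))\<^sup>2)"
proof -
  have "complex_of_real ((norm (\<Sum>x\<in>F. c x *\<^sub>C x))\<^sup>2) = (\<Sum>x\<in>F. cnj (c x) * (\<Sum>y\<in>F. c y * cinner x y))"
    unfolding cinner_self[symmetric] cinner_sum_left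
    by (simp add: cinner_sum_right cinner_simps sum_distrib_left mult.left_commute)
  also have "\<dots> = (\<Sum>x\<in>F. cnj (c x) * (\<Sum>y\<in>F. if x = y then c y else 0))"
    by (intro sum.cong refl arg_cong2[of _ _ _ _ "(*)"]) (auto simp: on)
  also have "\<dots> = (\<Sum>x\<in>F. complex_of_real ((cmod (c x))\<^sup>2))"
    using F by (intro sum.cong refl) (simp only: sum.delta' if_True cnj_mult_self)
  finally show ?thesis by (simp only: of_real_eq_iff flip: of_real_sum)
qed

text \<open>Riesz and Fischer: the finite partial sums form a Cauchy net by the Pythagorean theorem.\<close>

lemma Riesz_Fischer:
  fixes B :: "'a::chilbert_space set"
  assumes on: "\<And>x y. x \<in> B \<Longrightarrow> y \<in> B \<Longrightarrow> cinner x y = (if x = y then 1 else 0)"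
    and sq: "(\<lambda>x. (cmod (c x))\<^sup>2) summable_on B"
  obtains z where "((\<lambda>x. c x *\<^sub>C x) has_sum z) B" "\<And>x. x \<in> B \<Longrightarrow> cinner x z = c x"
proof -
  let ?q = "\<lambda>x. (cmod (c x))\<^sup>2" and ?v = "\<lambda>x. c x *\<^sub>C x"
  have "\<exists>G. finite G \<and> G \<subseteq> B \<and> (\<forall>F. finite F \<and> G \<subseteq> F \<and> F \<subseteq> B \<longrightarrow> norm (sum ?v F - sum ?v G) < e)"
    if e: "e > 0" for e
  proof -
    obtain S where S: "(?q has_sum S) B" using sq by (auto simp: summable_on_def)
    obtain G where G: "finite G" "G \<subseteq> B"
      "\<And>F. finite F \<and> G \<subseteq> F \<and> F \<subseteq> B \<Longrightarrow> dist (sum ?q F) S < e\<^sup>2 / 2"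
      using S e unfolding has_sum_def tendsto_iff eventually_finite_subsets_at_top
      by (metis half_gt_zero zero_less_power)
    have "norm (sum ?v F - sum ?v G) < e" if F: "finite F" "G \<subseteq> F" "F \<subseteq> B" for F
    proof -
      have "sum ?v F - sum ?v G = sum ?v (F - G)" using F G by (simp add: sum_diff)
      then have "(norm (sum ?v F - sum ?v G))\<^sup>2 = sum ?q (F - G)"
        using F on by (simp only:) (intro norm_sum_orthogonal, auto simp: subset_eq)
      also have "\<dots> = sum ?q F - sum ?q G" using F G by (simp add: sum_diff)
      also have "\<dots> < e\<^sup>2"
      proof -
        have "\<bar>sum ?q F - S\<bar> < e\<^sup>2 / 2" "\<bar>sum ?q G - S\<bar> < e\<^sup>2 / 2"
          using G(3)[of F] G(3)[of G] F G(1,2) by (simp_all add: dist_real_def)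
        then show ?thesis unfolding abs_less_iff by linarith
      qed
      finally show ?thesis using e by (simp add: power2_less_imp_less)
    qed
    then show ?thesis using G by blast
  qed
  then have "\<forall>n. \<exists>G. finite G \<and> G \<subseteq> B \<and>
      (\<forall>F. finite F \<and> G \<subseteq> F \<and> F \<subseteq> B \<longrightarrow> norm (sum ?v F - sum ?v G) < inverse (real (Suc n)))"
    by simp
  then obtain G where G: "\<And>n. finite (G n)" "\<And>n. G n \<subseteq> B"
    "\<And>n F. finite F \<Longrightarrow> G n \<subseteq> F \<Longrightarrow> F \<subseteq> B \<Longrightarrow> norm (sum ?v F - sum ?v (G n)) < inverse (real (Suc n))"
    by metis
  have "Cauchy (\<lambda>n. sum ?v (G n))"
  proof (rule metric_CauchyI)
    fix e :: real assume "e > 0"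
    then obtain N where N: "inverse (real (Suc N)) < e / 2" using reals_Archimedean half_gt_zero by blast
    have *: "norm (sum ?v (G m \<union> G n) - sum ?v (G m)) < e / 2" if "m \<ge> N" for m n
    proof -
      have "norm (sum ?v (G m \<union> G n) - sum ?v (G m)) < inverse (real (Suc m))"
        using G by (intro G(3)) auto
      also have "\<dots> \<le> inverse (real (Suc N))" using that by (simp add: field_simps)
      finally show ?thesis using N by simp
    qed
    have "dist (sum ?v (G m)) (sum ?v (G n)) < e" if "m \<ge> N" "n \<ge> N" for m n
    proof (rule dist_triangle_half_l)
      show "dist (sum ?v (G m)) (sum ?v (G m \<union> G n)) < e / 2"
        using *[OF that(1), of n] by (simp only: dist_norm norm_minus_commute)
      show "dist (sum ?v (G n)) (sum ?v (G m \<union> G n)) < e / 2"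
        using *[OF that(2), of m] by (simp only: dist_norm norm_minus_commute Un_commute)
    qed
    then show "\<exists>M. \<forall>m\<ge>M. \<forall>n\<ge>M. dist (sum ?v (G m)) (sum ?v (G n)) < e" by blast
  qed
  then obtain z where z: "(\<lambda>n. sum ?v (G n)) \<longlonglongrightarrow> z"
    using Cauchy_convergent_iff convergent_def by blast
  have hs: "(?v has_sum z) B"
    unfolding has_sum_def tendsto_iff eventually_finite_subsets_at_top
  proof (intro allI impI)
    fix e :: real assume e: "e > 0"
    obtain N where N: "inverse (real (Suc N)) < e / 2" using e reals_Archimedean half_gt_zero by blast
    obtain n where n: "n \<ge> N" "dist (sum ?v (G n)) z < e / 2"
      using z e unfolding lim_sequentially by (metis half_gt_zero nle_le)
    have "dist (sum ?v F) z < e" if F: "finite F" "G n \<subseteq> F" "F \<subseteq> B" for F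
    proof -
      have "norm (sum ?v F - sum ?v (G n)) < inverse (real (Suc n))" using F by (rule G(3))
      also have "\<dots> \<le> inverse (real (Suc N))" using n by (simp add: field_simps)
      finally have "dist (sum ?v F) (sum ?v (G n)) < e / 2" using N by (simp only: dist_norm)
      moreover have "dist z (sum ?v (G n)) < e / 2" using n(2) by (simp only: dist_commute)
      ultimately show ?thesis by (rule dist_triangle_half_l)
    qed
    then show "\<exists>X. finite X \<and> X \<subseteq> B \<and> (\<forall>Y. finite Y \<and> X \<subseteq> Y \<and> Y \<subseteq> B \<longrightarrow> dist (sum ?v Y) z < e)"
      using G(1,2)[of n] by blast
  qed
  have "cinner x z = c x" if x: "x \<in> B" for x
  proof -
    have "((\<lambda>y. cinner x (?v y)) has_sum cinner x z) B"
      by (rule has_sum_bounded_linear[OF bounded_linear_cinner_right hs])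
    moreover have "((\<lambda>y. cinner x (?v y)) has_sum c x) B \<longleftrightarrow> ((\<lambda>y. cinner x (?v y)) has_sum c x) {x}"
      using x by (intro has_sum_cong_neutral) (auto simp: cinner_simps on)
    moreover have "((\<lambda>y. cinner x (?v y)) has_sum c x) {x}"
      using x by (intro has_sum_finiteI) (auto simp: cinner_simps on)
    ultimately show ?thesis using has_sum_unique by blast
  qed
  then show thesis using hs that by blast
qed

lemma orthonormal_basis_coord_eqI:
  assumes B: "orthonormal_basis B" and eq: "\<And>e. e \<in> B \<Longrightarrow> cinner e x = cinner e y"
  shows "x = y"
proof -
  have "cvec.span B \<subseteq> {z. cinner z (x - y) = 0}"
    using eq by (intro cvec.span_minimal) (auto simp: cvec.subspace_def cinner_simps)
  moreover have "closed {z. cinner z (x - y) = 0}"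
    by (intro closed_Collect_eq linear_continuous_on bounded_linear_cinner_left continuous_on_const)
  ultimately have "closure (cvec.span B) \<subseteq> {z. cinner z (x - y) = 0}" by (rule closure_minimal)
  then have "cinner (x - y) (x - y) = 0" using B unfolding orthonormal_basis_def by blast
  then show ?thesis by simp
qed

lemma Bessel_finite:
  assumes on: "\<And>x y. x \<in> F \<Longrightarrow> y \<in> F \<Longrightarrow> cinner x y = (if x = y then 1 else 0)" and F: "finite F"
  shows "(\<Sum>e\<in>F. (cmod (cinner e x))\<^sup>2) \<le> (norm x)\<^sup>2"
proof -
  define p where "p = (\<Sum>e\<in>F. cinner e x *\<^sub>C e)"
  have np: "(norm p)\<^sup>2 = (\<Sum>e\<in>F. (cmod (cinner e x))\<^sup>2)"
    unfolding p_def by (rule norm_sum_orthogonal[OF on F])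
  have "cinner p x = (\<Sum>e\<in>F. cnj (cinner e x) * cinner e x)"
    by (simp add: p_def cinner_sum_left cinner_simps)
  also have "\<dots> = (\<Sum>e\<in>F. complex_of_real ((cmod (cinner e x))\<^sup>2))"
    by (simp only: cnj_mult_self)
  also have "\<dots> = complex_of_real ((norm p)\<^sup>2)" by (simp add: np)
  finally have "cinner p x = complex_of_real ((norm p)\<^sup>2)" .
  then have "(norm p)\<^sup>2 \<le> norm p * norm x"
    using cinner_Cauchy_Schwarz[of p x] by (simp only: norm_of_real abs_power2)
  then have "norm p \<le> norm x"
    by (cases "norm p = 0") (auto simp: power2_eq_square mult_le_cancel_left)
  then show ?thesis unfolding np[symmetric] by (simp add: power_mono)
qed

lemma orthonormal_basis_expansion:
  assumes B: "orthonormal_basis B"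
  shows "((\<lambda>e. cinner e x *\<^sub>C e) has_sum x) B"
proof -
  have on: "\<And>x y. x \<in> B \<Longrightarrow> y \<in> B \<Longrightarrow> cinner x y = (if x = y then 1 else 0)"
    using B by (auto simp: orthonormal_basis_def)
  have "(\<lambda>e. (cmod (cinner e x))\<^sup>2) summable_on B"
    by (rule nonneg_bdd_above_summable_on)
      (auto intro!: bdd_aboveI[of _ "(norm x)\<^sup>2"] Bessel_finite simp: on subset_eq)
  then obtain z where z: "((\<lambda>e. cinner e x *\<^sub>C e) has_sum z) B" "\<And>e. e \<in> B \<Longrightarrow> cinner e z = cinner e x"
    using Riesz_Fischer[OF on, of B "\<lambda>e. cinner e x"] by blast
  then show ?thesis using orthonormal_basis_coord_eqI[OF B z(2)] by simp
qed

lemma orthonormal_basis_Parseval: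
  assumes B: "orthonormal_basis B"
  shows "((\<lambda>e. cinner x e * cinner e y) has_sum cinner x y) B"
  using has_sum_bounded_linear[OF bounded_linear_cinner_right orthonormal_basis_expansion[OF B, of y], of x]
  by (simp add: cinner_simps mult.commute)

lemma orthonormal_basis_norm:
  assumes B: "orthonormal_basis B"
  shows "((\<lambda>e. (cmod (cinner e x))\<^sup>2) has_sum (norm x)\<^sup>2) B"
proof -
  have "cinner x e * cinner e x = complex_of_real ((cmod (cinner e x))\<^sup>2)" for e
    by (subst cinner_commute) (rule cnj_mult_self)
  then show ?thesis
    using has_sum_Re[OF orthonormal_basis_Parseval[OF B, of x x]] by (simp add: cinner_self)
qed

locale onb =
  fixes b :: "'i \<Rightarrow> 'h::chilbert_space"
  assumes orthonormal: "cinner (b i) (b j) = (if i = j then 1 else 0)"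
    and dense: "closure (cvec.span (range b)) = UNIV"
begin

lemma inj: "inj b"
proof (rule injI)
  fix i j assume "b i = b j"
  then have "cinner (b i) (b j) = 1" using orthonormal[of i i] by simp
  then show "i = j" using orthonormal[of i j] by (metis zero_neq_one)
qed

lemma orthonormal_basis_range: "orthonormal_basis (range b)"
  using dense inj by (auto simp: orthonormal_basis_def orthonormal inj_eq)

lemma coord_eqI: "(\<And>i. cinner (b i) x = cinner (b i) y) \<Longrightarrow> x = y"
  using orthonormal_basis_coord_eqI[OF orthonormal_basis_range] by blast

lemma expansion: "((\<lambda>i. cinner (b i) x *\<^sub>C b i) has_sum x) UNIV"
  using orthonormal_basis_expansion[OF orthonormal_basis_range, of x]
  by (simp add: has_sum_reindex[OF inj] o_def)

lemma Parseval: "((\<lambda>i. cinner x (b i) * cinner (b i) y) has_sum cinner x y) UNIV"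
  using orthonormal_basis_Parseval[OF orthonormal_basis_range, of x y]
  by (simp add: has_sum_reindex[OF inj] o_def)

lemma norm_has_sum: "((\<lambda>i. (cmod (cinner (b i) x))\<^sup>2) has_sum (norm x)\<^sup>2) UNIV"
  using orthonormal_basis_norm[OF orthonormal_basis_range, of x]
  by (simp add: has_sum_reindex[OF inj] o_def)

lemma ex_coord:
  assumes "(\<lambda>i. (cmod (c i))\<^sup>2) summable_on UNIV"
  shows "\<exists>z. \<forall>i. cinner (b i) z = c i"
proof -
  have "(\<lambda>x. (cmod (c (inv b x)))\<^sup>2) summable_on range b"
    using assms by (subst summable_on_reindex[OF inj]) (simp add: o_def inv_f_f[OF inj])
  then obtain z where "\<And>x. x \<in> range b \<Longrightarrow> cinner x z = c (inv b x)"
    using Riesz_Fischer[of "range b" "\<lambda>x. c (inv b x)"] orthonormal_basis_range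
    unfolding orthonormal_basis_def by metis
  then show ?thesis by (metis inv_f_f[OF inj] rangeI)
qed

lemma bops_eqI:
  assumes "S \<in> bops" "T \<in> bops" and eq: "\<And>i. S \<cdot> b i = T \<cdot> b i"
  shows "S = T"
proof (rule blinfun_eqI)
  fix x
  have "((\<lambda>i. cinner (b i) x *\<^sub>C R \<cdot> b i) has_sum R \<cdot> x) UNIV"
    if "R \<in> bops" for R
    using has_sum_bounded_linear[OF blinfun.bounded_linear_right expansion[of x], of R] that
    by (simp add: bopsD)
  from this[OF assms(1)] this[OF assms(2)] show "S \<cdot> x = T \<cdot> x"
    using has_sum_unique by (simp add: eq, blast)
qed

lemma bops_eqI_matrix:
  assumes "S \<in> bops" "T \<in> bops"
    and eq: "\<And>i j. cinner (b i) (S \<cdot> b j) = cinner (b i) (T \<cdot> b j)"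
  shows "S = T"
  using assms by (intro bops_eqI coord_eqI)

lemma matrix_has_sum:
  assumes "T \<in> bops"
  shows "((\<lambda>j. cinner y (T \<cdot> b j) * cinner (b j) x) has_sum cinner y (T \<cdot> x)) UNIV"
proof -
  have "bounded_linear (\<lambda>x. cinner y (T \<cdot> x))"
    by (rule bounded_linear_compose[OF bounded_linear_cinner_right blinfun.bounded_linear_right])
  from has_sum_bounded_linear[OF this expansion[of x]] show ?thesis
    using assms by (simp add: bopsD cinner_simps mult.commute)
qed

text \<open>Bounded operators are built from prospective coordinates: by Riesz and Fischer, coordinate functionals
  that are uniformly square summable belong to a bounded operator.\<close>

lemma ex_op:
  assumes lin: "\<And>x y i. f i (x + y) = f i x + f i y" "\<And>a x i. f i (a *\<^sub>C x) = a * f i x"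
    and bd: "0 \<le> C" "\<And>x F. finite F \<Longrightarrow> (\<Sum>i\<in>F. (cmod (f i x))\<^sup>2) \<le> (C * norm x)\<^sup>2"
  shows "\<exists>T\<in>bops. norm T \<le> C \<and> (\<forall>x i. cinner (b i) (T \<cdot> x) = f i x)"
proof -
  have sq: "(\<lambda>i. (cmod (f i x))\<^sup>2) summable_on UNIV" for x
    by (rule nonneg_bdd_above_summable_on) (auto intro!: bdd_aboveI[of _ "(C * norm x)\<^sup>2"] bd(2))
  obtain g where g: "\<And>x i. cinner (b i) (g x) = f i x" using ex_coord[OF sq] by metis
  have ng: "norm (g x) \<le> C * norm x" for x
  proof (rule power2_le_imp_le)
    have hs: "((\<lambda>i. (cmod (f i x))\<^sup>2) has_sum (norm (g x))\<^sup>2) UNIV"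
      using norm_has_sum[of "g x"] by (simp add: g)
    show "(norm (g x))\<^sup>2 \<le> (C * norm x)\<^sup>2"
      by (rule has_sum_le_finite_sums[OF hs]) (auto intro: bd(2))
  qed (use bd(1) in simp)
  have add: "g (x + y) = g x + g y" for x y
    by (rule coord_eqI) (simp add: g lin cinner_simps)
  have sc: "g (a *\<^sub>C x) = a *\<^sub>C g x" for a x
    by (rule coord_eqI) (simp add: g lin cinner_simps)
  have "bounded_linear g"
    by (rule bounded_linear_intro[where K = C]) (auto simp: add sc scaleR_scaleC ng mult.commute)
  then have G: "blinfun_apply (Blinfun g) = g" by (rule bounded_linear_Blinfun_apply)
  show ?thesis
    by (rule bexI[of _ "Blinfun g"]) (auto simp: bops_def G sc g intro!: norm_blinfun_le bd(1) ng)
qed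

text \<open>The adjoint applied to \<open>y\<close> must have the coordinates \<open>\<langle>T b\<^sub>i, y\<rangle>\<close>, so it remains to see that
  these are square summable.\<close>

lemma adj_works:
  fixes T :: "'h \<Rightarrow>\<^sub>L 'h"
  assumes T: "T \<in> bops"
  shows "cinner (T \<cdot> x) y = cinner x (adj T \<cdot> y)" "adj T \<in> bops"
proof -
  have "\<exists>S\<in>bops. norm S \<le> norm T \<and> (\<forall>y i. cinner (b i) (S \<cdot> y) = cinner (T \<cdot> b i) y)"
  proof (rule ex_op)
    fix y and F :: "'i set" assume F: "finite F"
    let ?c = "\<lambda>i. cinner (T \<cdot> b i) y"
    \<comment> \<open>testing \<open>T\<close> on this vector bounds its own norm: \<open>|x|\<^sup>2 = \<langle>T x, y\<rangle> \<le> |T| |x| |y|\<close>\<close>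
    define x where "x = (\<Sum>i\<in>F. ?c i *\<^sub>C b i)"
    have nx: "(norm x)\<^sup>2 = (\<Sum>i\<in>F. (cmod (?c i))\<^sup>2)"
    proof -
      have "x = (\<Sum>e\<in>b ` F. cinner (T \<cdot> e) y *\<^sub>C e)"
        unfolding x_def by (subst sum.reindex) (auto intro: inj_on_subset[OF inj])
      also have "(norm \<dots>)\<^sup>2 = (\<Sum>e\<in>b ` F. (cmod (cinner (T \<cdot> e) y))\<^sup>2)"
        using F by (intro norm_sum_orthogonal) (auto simp: orthonormal inj_eq[OF inj])
      also have "\<dots> = (\<Sum>i\<in>F. (cmod (?c i))\<^sup>2)"
        by (subst sum.reindex) (auto intro: inj_on_subset[OF inj])
      finally show ?thesis .
    qed
    have "cinner (T \<cdot> x) y = (\<Sum>i\<in>F. cnj (?c i) * ?c i)"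
      using T by (simp add: x_def blinfun.sum_right bopsD cinner_sum_left cinner_simps)
    also have "\<dots> = complex_of_real ((norm x)\<^sup>2)"
      unfolding nx of_real_sum by (simp only: cnj_mult_self)
    finally have "(norm x)\<^sup>2 = cmod (cinner (T \<cdot> x) y)"
      by (simp only: norm_of_real abs_power2)
    also have "\<dots> \<le> norm (T \<cdot> x) * norm y" by (rule cinner_Cauchy_Schwarz)
    also have "\<dots> \<le> norm T * norm x * norm y" by (intro mult_right_mono norm_blinfun) simp
    finally have "norm x \<le> norm T * norm y"
      by (cases "norm x = 0") (auto simp: power2_eq_square algebra_simps mult_le_cancel_left)
    then show "(\<Sum>i\<in>F. (cmod (?c i))\<^sup>2) \<le> (norm T * norm y)\<^sup>2"
      unfolding nx[symmetric] by (simp add: power_mono)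
  qed (auto simp: cinner_simps)
  then obtain S where S: "S \<in> bops" "\<And>y i. cinner (b i) (S \<cdot> y) = cinner (T \<cdot> b i) y"
    by blast
  have "cinner (T \<cdot> x) y = cinner x (S \<cdot> y)" for x y
  proof -
    have "((\<lambda>j. cinner y (T \<cdot> b j) * cinner (b j) x) has_sum cinner y (T \<cdot> x)) UNIV"
      by (rule matrix_has_sum[OF T])
    then have "((\<lambda>j. cnj (cinner y (T \<cdot> b j) * cinner (b j) x))
        has_sum cnj (cinner y (T \<cdot> x))) UNIV"
      by (simp only: has_sum_cnj_iff)
    also have "(\<lambda>j. cnj (cinner y (T \<cdot> b j) * cinner (b j) x)) =
        (\<lambda>j. cinner x (b j) * cinner (b j) (S \<cdot> y))"
      by (simp add: S(2) mult.commute flip: cinner_commute)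
    finally show ?thesis using Parseval[of x "S \<cdot> y"] has_sum_unique
      by (metis cinner_commute)
  qed
  moreover from this have "adj T = S" by (rule adj_eqI)
  ultimately show "cinner (T \<cdot> x) y = cinner x (adj T \<cdot> y)" "adj T \<in> bops"
    using S(1) by auto
qed

lemma adj_coord: "T \<in> bops \<Longrightarrow>
    cinner (b i) (adj T \<cdot> b j) = cnj (cinner (b j) (T \<cdot> b i))"
  using adj_works(1)[of T "b i" "b j"] cinner_commute[of "T \<cdot> b i" "b j"] by simp

lemma adj_adj: "T \<in> bops \<Longrightarrow> adj (adj T) = T" for T :: "'h \<Rightarrow>\<^sub>L 'h"
proof (rule adj_eqI)
  fix x y assume T: "T \<in> bops"
  have "cinner (adj T \<cdot> x) y = cnj (cinner y (adj T \<cdot> x))"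
    by (rule cinner_commute)
  also have "\<dots> = cnj (cinner (T \<cdot> y) x)" by (simp only: adj_works(1)[OF T])
  also have "\<dots> = cinner x (T \<cdot> y)" by (rule cinner_commute[symmetric])
  finally show "cinner (adj T \<cdot> x) y = cinner x (T \<cdot> y)" .
qed

lemma adj_compose: "S \<in> bops \<Longrightarrow> T \<in> bops \<Longrightarrow> adj (S o\<^sub>L T) = adj T o\<^sub>L adj S" for S T :: "'h \<Rightarrow>\<^sub>L 'h"
  by (rule adj_eqI) (simp add: adj_works(1))

lemma adj_add: "S \<in> bops \<Longrightarrow> T \<in> bops \<Longrightarrow> adj (S + T) = adj S + adj T" for S T :: "'h \<Rightarrow>\<^sub>L 'h"
  by (rule adj_eqI) (simp add: adj_works(1) blinfun.add_left cinner_simps)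

lemma norm_adj:
  fixes T :: "'h \<Rightarrow>\<^sub>L 'h"
  assumes "T \<in> bops" shows "norm (adj T) \<le> norm T"
proof (rule norm_blinfun_le)
  fix y
  let ?z = "adj T \<cdot> y"
  have "complex_of_real ((norm ?z)\<^sup>2) = cinner (T \<cdot> ?z) y"
    by (simp only: adj_works(1)[OF assms] cinner_self)
  then have "(norm ?z)\<^sup>2 = cmod (cinner (T \<cdot> ?z) y)"
    by (metis norm_of_real abs_power2)
  also have "\<dots> \<le> norm (T \<cdot> ?z) * norm y" by (rule cinner_Cauchy_Schwarz)
  also have "\<dots> \<le> norm T * norm ?z * norm y" by (intro mult_right_mono norm_blinfun) simp
  finally show "norm ?z \<le> norm T * norm y"
    by (cases "norm ?z = 0") (auto simp: power2_eq_square algebra_simps mult_le_cancel_left)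
qed simp

lemma adj_diff: "S \<in> bops \<Longrightarrow> T \<in> bops \<Longrightarrow> adj (S - T) = adj S - adj T" for S T :: "'h \<Rightarrow>\<^sub>L 'h"
  by (rule adj_eqI) (simp add: adj_works(1) blinfun.diff_left cinner_simps)

lemma dist_adj: "S \<in> bops \<Longrightarrow> T \<in> bops \<Longrightarrow> dist (adj S) (adj T) \<le> dist S T" for S T :: "'h \<Rightarrow>\<^sub>L 'h"
  by (simp add: dist_norm norm_adj bops_diff flip: adj_diff)
end

section \<open>Diagonal operators\<close>

context onb
begin

text \<open>Asking that \<open>y\<close> exists imposes the maximal domain without naming it.\<close>

definition diag_op :: "('i \<Rightarrow> complex) \<Rightarrow> ('h \<times> 'h) set" where
  "diag_op \<mu> = {(x, y). \<forall>i. cinner (b i) y = \<mu> i * cinner (b i) x}"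

definition bdiag :: "('i \<Rightarrow> complex) \<Rightarrow> ('h \<Rightarrow>\<^sub>L 'h)" where
  "bdiag m = (SOME T. T \<in> bops \<and> (\<forall>x i. cinner (b i) (T \<cdot> x) = m i * cinner (b i) x))"

lemma diag_opI: "(\<And>i. cinner (b i) y = \<mu> i * cinner (b i) x) \<Longrightarrow> (x, y) \<in> diag_op \<mu>"
  by (simp add: diag_op_def)

lemma diag_opD: "(x, y) \<in> diag_op \<mu> \<Longrightarrow> cinner (b i) y = \<mu> i * cinner (b i) x"
  by (simp add: diag_op_def)

lemma basis_diag_op: "(b i, \<mu> i *\<^sub>C b i) \<in> diag_op \<mu>"
  by (simp add: diag_op_def cinner_simps orthonormal)

lemma bdiag_ex:
  assumes "\<And>i. cmod (m i) \<le> C"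
  shows "\<exists>T\<in>bops. norm T \<le> C \<and> (\<forall>x i. cinner (b i) (T \<cdot> x) = m i * cinner (b i) x)"
proof (rule ex_op)
  show C: "0 \<le> C" using assms norm_ge_zero order_trans by blast
  fix x and F :: "'i set" assume F: "finite F"
  have "(\<Sum>i\<in>F. (cmod (m i * cinner (b i) x))\<^sup>2) \<le> (\<Sum>i\<in>F. C\<^sup>2 * (cmod (cinner (b i) x))\<^sup>2)"
    using assms by (intro sum_mono) (simp add: norm_mult power_mult_distrib mult_right_mono power_mono)
  also have "\<dots> = C\<^sup>2 * (\<Sum>i\<in>F. (cmod (cinner (b i) x))\<^sup>2)" by (simp add: sum_distrib_left)
  also have "\<dots> \<le> C\<^sup>2 * (norm x)\<^sup>2"
    by (intro mult_left_mono finite_sum_le_has_sum[OF norm_has_sum F]) auto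
  finally show "(\<Sum>i\<in>F. (cmod (m i * cinner (b i) x))\<^sup>2) \<le> (C * norm x)\<^sup>2"
    by (simp add: power_mult_distrib)
qed (auto simp: cinner_simps algebra_simps)

lemma
  assumes "\<And>i. cmod (m i) \<le> C"
  shows bdiag_bops: "bdiag m \<in> bops"
    and bdiag_coord: "cinner (b i) (bdiag m \<cdot> x) = m i * cinner (b i) x"
proof -
  have "bdiag m \<in> bops \<and> (\<forall>x i. cinner (b i) (bdiag m \<cdot> x) = m i * cinner (b i) x)"
    unfolding bdiag_def by (rule someI_ex) (use bdiag_ex[of m C] assms in blast)
  then show "bdiag m \<in> bops" "cinner (b i) (bdiag m \<cdot> x) = m i * cinner (b i) x"
    by auto
qed

lemma op_graph_eq_diag_op:
  assumes "\<And>x i. cinner (b i) (T \<cdot> x) = m i * cinner (b i) x"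
  shows "op_graph T = diag_op m"
  unfolding op_graph_def diag_op_def
  by (auto simp: assms intro!: coord_eqI)

lemma bdiag_graph: "(\<And>i. cmod (m i) \<le> C) \<Longrightarrow> op_graph (bdiag m) = diag_op m"
  by (rule op_graph_eq_diag_op) (rule bdiag_coord)

lemma bdiag_basis: "(\<And>i. cmod (m i) \<le> C) \<Longrightarrow> bdiag m \<cdot> b i = m i *\<^sub>C b i"
  by (rule coord_eqI) (simp add: bdiag_coord[of m C] cinner_simps orthonormal)

lemma norm_bdiag_le:
  assumes "\<And>i. cmod (m i) \<le> C" shows "norm (bdiag m) \<le> C"
proof -
  obtain T where T: "T \<in> bops" "norm T \<le> C"
      "\<And>x i. cinner (b i) (T \<cdot> x) = m i * cinner (b i) x"
    using bdiag_ex[of m C] assms by blast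
  then have "T = bdiag m"
    by (intro bops_eqI coord_eqI) (simp_all add: bdiag_bops[of m C] bdiag_coord[of m C] assms)
  then show ?thesis using T(2) by simp
qed

lemma is_operator_diag_op: "is_operator (diag_op \<mu>)"
  unfolding is_operator_def single_valued_def cvec.subspace_def
  by (auto simp: diag_op_def cinner_simps zero_prod_def scaleC_prod_def algebra_simps intro!: coord_eqI)

lemma densely_defined_diag_op: "densely_defined (diag_op \<mu>)"
proof -
  have "cvec.subspace (Domain (diag_op \<mu>))"
    unfolding cvec.subspace_def
  proof (intro conjI ballI allI)
    show "0 \<in> Domain (diag_op \<mu>)" by (rule DomainI[of _ 0]) (simp add: diag_op_def)
    fix x y c assume "x \<in> Domain (diag_op \<mu>)" "y \<in> Domain (diag_op \<mu>)"
    then obtain u v where "(x, u) \<in> diag_op \<mu>" "(y, v) \<in> diag_op \<mu>" by auto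
    then have "(x + y, u + v) \<in> diag_op \<mu>" "(c *\<^sub>C x, c *\<^sub>C u) \<in> diag_op \<mu>"
      by (auto simp: diag_op_def cinner_simps algebra_simps)
    then show "x + y \<in> Domain (diag_op \<mu>)" "c *\<^sub>C x \<in> Domain (diag_op \<mu>)" by auto
  qed
  then have "cvec.span (range b) \<subseteq> Domain (diag_op \<mu>)"
    by (intro cvec.span_minimal) (use basis_diag_op in blast)
  then show ?thesis
    using dense closure_mono unfolding densely_defined_def by blast
qed

lemma op_adjoint_diag_op: "op_adjoint (diag_op \<mu>) = diag_op (\<lambda>i. cnj (\<mu> i))"
proof (intro equalityI subrelI)
  fix y z assume "(y, z) \<in> op_adjoint (diag_op \<mu>)"
  then have "cinner (\<mu> i *\<^sub>C b i) y = cinner (b i) z" for i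
    using basis_diag_op[of i \<mu>] unfolding op_adjoint_def by blast
  then show "(y, z) \<in> diag_op (\<lambda>i. cnj (\<mu> i))" by (simp add: diag_op_def cinner_simps)
next
  fix y z assume yz: "(y, z) \<in> diag_op (\<lambda>i. cnj (\<mu> i))"
  have "cinner w y = cinner x z" if xw: "(x, w) \<in> diag_op \<mu>" for x w
  proof -
    have "cinner w (b i) * cinner (b i) y = cinner x (b i) * cinner (b i) z" for i
      using diag_opD[OF xw, of i] diag_opD[OF yz, of i]
        cinner_commute[of w "b i"] cinner_commute[of x "b i"] by simp
    then show ?thesis using Parseval[of w y] Parseval[of x z] has_sum_unique by auto
  qed
  then show "(y, z) \<in> op_adjoint (diag_op \<mu>)" unfolding op_adjoint_def by auto
qed

lemma self_adjoint_diag_op: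
  "(\<And>i. cnj (\<mu> i) = \<mu> i) \<Longrightarrow> self_adjoint (diag_op \<mu>)"
  by (simp add: self_adjoint_def is_operator_diag_op densely_defined_diag_op op_adjoint_diag_op)

lemma diag_op_form_has_sum:
  assumes "(x, y) \<in> diag_op \<mu>"
  shows "((\<lambda>i. \<mu> i * complex_of_real ((cmod (cinner (b i) x))\<^sup>2)) has_sum cinner x y) UNIV"
proof -
  have "cinner x (b i) * cinner (b i) y = \<mu> i * complex_of_real ((cmod (cinner (b i) x))\<^sup>2)" for i
    unfolding diag_opD[OF assms] cnj_mult_self[symmetric] by (simp flip: cinner_commute)
  then show ?thesis using Parseval[of x y] by simp
qed

lemma positive_diag_op:
  assumes "\<And>i. 0 \<le> r i"
  shows "positive_op (diag_op (\<lambda>i. complex_of_real (r i)))"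
  unfolding positive_op_def
proof (intro conjI self_adjoint_diag_op, simp, intro ballI, clarify)
  fix x y assume "(x, y) \<in> diag_op (\<lambda>i. complex_of_real (r i))"
  from has_sum_Re[OF diag_op_form_has_sum[OF this]]
  show "0 \<le> Re (cinner x y)" by (rule has_sum_nonneg) (simp add: assms)
qed

lemma diag_op_shift: "op_shift (diag_op \<mu>) c = diag_op (\<lambda>i. \<mu> i + c)"
proof (intro equalityI subrelI)
  fix x y assume "(x, y) \<in> diag_op (\<lambda>i. \<mu> i + c)"
  then have "(x, y - c *\<^sub>C x) \<in> diag_op \<mu>"
    by (auto simp: diag_op_def cinner_simps algebra_simps)
  then show "(x, y) \<in> op_shift (diag_op \<mu>) c" unfolding op_shift_def by force
qed (auto simp: op_shift_def diag_op_def cinner_simps algebra_simps)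

lemma diag_op_converse:
  "(\<And>i. \<mu> i \<noteq> 0) \<Longrightarrow> converse (diag_op \<mu>) = diag_op (\<lambda>i. inverse (\<mu> i))"
  by (auto simp: diag_op_def field_simps)

subsection \<open>Absolute value\<close>

text \<open>Both products act as \<open>|\<mu>\<^sub>i|\<^sup>2\<close>, and the intermediate vectors \<open>\<mu>\<^sub>i x\<^sub>i\<close> and \<open>|\<mu>\<^sub>i| x\<^sub>i\<close>
  differ by phases. Multiplication by the phases is a bounded
  diagonal operator, which carries one intermediate vector to the other.\<close>

lemma diag_op_square:
  "diag_op (\<lambda>i. complex_of_real (cmod (\<mu> i))) O diag_op (\<lambda>i. complex_of_real (cmod (\<mu> i))) =
   diag_op \<mu> O op_adjoint (diag_op \<mu>)" (is "?A O ?A = _")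
proof -
  have sgn: "cmod (sgn z) \<le> 1" for z :: complex by (simp add: norm_sgn)
  have 1: "sgn z * complex_of_real (cmod z) = z" "cnj (sgn z) * z = complex_of_real (cmod z)"
    "cnj z * sgn z = complex_of_real (cmod z)" "complex_of_real (cmod z) * cnj (sgn z) = cnj z" for z
    by (cases "z = 0"; simp add: sgn_eq cnj_mult_self power2_eq_square;
        simp add: power2_eq_square mult.commute cnj_mult_self complex_norm_square[symmetric])+
  show ?thesis
    unfolding op_adjoint_diag_op
  proof (intro equalityI subrelI)
    fix x z assume "(x, z) \<in> ?A O ?A"
    then obtain y where y: "(x, y) \<in> ?A" "(y, z) \<in> ?A" by auto
    let ?y = "(bdiag (\<lambda>i. sgn (\<mu> i))) \<cdot> y"
    have c: "cinner (b i) ?y = sgn (\<mu> i) * cinner (b i) y" for i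
      by (rule bdiag_coord[where C = 1]) (rule sgn)
    have "(x, ?y) \<in> diag_op \<mu>"
      by (rule diag_opI) (simp only: c diag_opD[OF y(1)] 1 flip: mult.assoc)
    moreover have "(?y, z) \<in> diag_op (\<lambda>i. cnj (\<mu> i))"
      by (rule diag_opI) (simp only: c diag_opD[OF y(2)] 1 flip: mult.assoc)
    ultimately show "(x, z) \<in> diag_op \<mu> O diag_op (\<lambda>i. cnj (\<mu> i))" by blast
  next
    fix x z assume "(x, z) \<in> diag_op \<mu> O diag_op (\<lambda>i. cnj (\<mu> i))"
    then obtain y where y: "(x, y) \<in> diag_op \<mu>" "(y, z) \<in> diag_op (\<lambda>i. cnj (\<mu> i))" by auto
    let ?y = "(bdiag (\<lambda>i. cnj (sgn (\<mu> i)))) \<cdot> y"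
    have c: "cinner (b i) ?y = cnj (sgn (\<mu> i)) * cinner (b i) y" for i
      by (rule bdiag_coord[where C = 1]) (simp only: complex_mod_cnj sgn)
    have "(x, ?y) \<in> ?A"
      by (rule diag_opI) (simp only: c diag_opD[OF y(1)] 1 flip: mult.assoc)
    moreover have "(?y, z) \<in> ?A"
      by (rule diag_opI) (simp only: c diag_opD[OF y(2)] 1 flip: mult.assoc)
    ultimately show "(x, z) \<in> ?A O ?A" by blast
  qed
qed

text \<open>A positive square root \<open>A\<close> of \<open>G\<^sup>* G\<close> has the eigenvectors \<open>b\<^sub>i\<close>, because
  \<open>A + r\<close> is injective for \<open>r > 0\<close>. By symmetry \<open>A\<close> is then contained in the diagonal operator, and
  self-adjoint operators are maximal symmetric.\<close>

theorem op_abs_diag_op: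
  "op_abs (diag_op \<mu>) = diag_op (\<lambda>i. complex_of_real (cmod (\<mu> i)))" (is "_ = ?A")
  unfolding op_abs_def
proof (rule the_equality)
  show "positive_op ?A \<and> ?A O ?A = diag_op \<mu> O op_adjoint (diag_op \<mu>)"
    by (intro conjI positive_diag_op diag_op_square) simp
next
  fix A assume A: "positive_op A \<and> A O A = diag_op \<mu> O op_adjoint (diag_op \<mu>)"
  then have sa: "self_adjoint A" and pos: "\<And>x y. (x, y) \<in> A \<Longrightarrow> 0 \<le> Re (cinner x y)"
    and sq: "A O A = ?A O ?A"
    unfolding positive_op_def by (auto simp: diag_op_square)
  have sub: "cvec.subspace A" and adjA: "op_adjoint A = A"
    using sa by (auto simp: self_adjoint_def is_operator_def)
  have sc: "(c *\<^sub>C x, c *\<^sub>C y) \<in> A" if "(x, y) \<in> A" for c x y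
    using cvec.subspace_scale[OF sub that, of c] by (simp add: scaleC_prod_def)
  have df: "(x - x', y - y') \<in> A" if "(x, y) \<in> A" "(x', y') \<in> A" for x x' y y'
    using cvec.subspace_diff[OF sub that] by simp
  have sym: "cinner w y = cinner x z" if "(x, w) \<in> A" "(y, z) \<in> A" for x y w z
    using that adjA unfolding op_adjoint_def by blast
  have base: "(b i, complex_of_real (cmod (\<mu> i)) *\<^sub>C b i) \<in> A" for i
  proof -
    define r where "r = cmod (\<mu> i)"
    have "(b i, r *\<^sub>C b i) \<in> ?A" unfolding r_def by (rule basis_diag_op)
    moreover have "(r *\<^sub>C b i, r *\<^sub>C r *\<^sub>C b i) \<in> ?A"
      by (simp add: diag_op_def cinner_simps orthonormal r_def)
    ultimately have "(b i, r *\<^sub>C r *\<^sub>C b i) \<in> A O A" unfolding sq by blast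
    then obtain u where u: "(b i, u) \<in> A" "(u, r *\<^sub>C r *\<^sub>C b i) \<in> A" by auto
    have "u = r *\<^sub>C b i"
    proof (cases "r = 0")
      case True
      then have "cinner u u = cinner (b i) 0" using sym[OF u(1) u(2)] by simp
      then show ?thesis using True by simp
    next
      case False
      let ?w = "u - r *\<^sub>C b i"
      have "(?w, r *\<^sub>C r *\<^sub>C b i - r *\<^sub>C u) \<in> A" by (intro df u(2) sc u(1))
      then have "0 \<le> Re (cinner ?w (r *\<^sub>C r *\<^sub>C b i - r *\<^sub>C u))" by (rule pos)
      also have "r *\<^sub>C r *\<^sub>C b i - r *\<^sub>C u = (- complex_of_real r) *\<^sub>C ?w"
        by (simp add: scaleC_diff_right scaleC_minus_left)
      also have "Re (cinner ?w \<dots>) = - r * (norm ?w)\<^sup>2" by (simp only: cinner_scaleC_right cinner_self) simp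
      finally have "r * (norm ?w)\<^sup>2 \<le> 0" by simp
      moreover have "r > 0" using False by (simp add: r_def)
      ultimately show ?thesis by (simp add: mult_le_0_iff)
    qed
    then show ?thesis using u(1) by (simp add: r_def)
  qed
  have "A \<subseteq> ?A"
  proof (intro subrelI diag_opI)
    fix x y i assume "(x, y) \<in> A"
    from sym[OF base this] show "cinner (b i) y = complex_of_real (cmod (\<mu> i)) * cinner (b i) x"
      by (simp add: cinner_simps)
  qed
  moreover from this have "op_adjoint ?A \<subseteq> op_adjoint A" unfolding op_adjoint_def by blast
  then have "?A \<subseteq> A" by (simp add: adjA op_adjoint_diag_op)
  ultimately show "A = ?A" by blast
qed

subsection \<open>Spectrum and eigenspaces\<close>

lemma eigenspace_diag_op:
  "eigenspace (diag_op \<mu>) l = {x. \<forall>i. \<mu> i \<noteq> l \<longrightarrow> cinner (b i) x = 0}"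
  by (auto simp: eigenspace_def diag_op_def cinner_simps)

lemma resolvent_diag_op:
  assumes "0 < d" "\<And>i. d \<le> cmod (\<mu> i + c)"
  shows "bdiag (\<lambda>i. inverse (\<mu> i + c)) \<in> bops"
    "op_graph (bdiag (\<lambda>i. inverse (\<mu> i + c))) = converse (op_shift (diag_op \<mu>) c)"
proof -
  have bd: "cmod (inverse (\<mu> i + c)) \<le> inverse d" for i
    using assms by (simp add: norm_inverse le_imp_inverse_le)
  show "bdiag (\<lambda>i. inverse (\<mu> i + c)) \<in> bops" by (rule bdiag_bops[OF bd])
  have "\<mu> i + c \<noteq> 0" for i using assms by (metis norm_zero not_less)
  then show "op_graph (bdiag (\<lambda>i. inverse (\<mu> i + c))) = converse (op_shift (diag_op \<mu>) c)"
    by (simp add: bdiag_graph[OF bd] diag_op_shift diag_op_converse)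
qed

text \<open>An inverse of \<open>G - \<mu>\<^sub>i\<close> would map \<open>0\<close> to the eigenvector \<open>b\<^sub>i\<close>.\<close>

lemma eigenvalue_in_spectrum: "\<mu> i \<in> op_spectrum (diag_op \<mu>)"
proof (rule ccontr)
  assume "\<mu> i \<notin> op_spectrum (diag_op \<mu>)"
  then obtain R where R: "op_graph R = converse (op_shift (diag_op \<mu>) (- \<mu> i))"
    unfolding op_spectrum_def by auto
  have "(b i, 0) \<in> op_shift (diag_op \<mu>) (- \<mu> i)"
    unfolding diag_op_shift by (simp add: diag_op_def orthonormal)
  then have "(0, b i) \<in> op_graph R" unfolding R by simp
  then have "b i = 0" by (auto simp: op_graph_def)
  then show False using orthonormal[of i i] by simp
qed

subsection \<open>Compact and trace class diagonal operators\<close>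

lemma bdiag_single_compact:
  assumes "\<And>j. cmod (m j) \<le> C"
  shows "bdiag (\<lambda>j. if j = i then m j else 0) \<in> compact_ops"
proof (rule rank_one_compact)
  let ?m = "\<lambda>j. if j = i then m j else 0"
  have C: "0 \<le> C" using assms norm_ge_zero order_trans by blast
  have bd: "cmod (?m j) \<le> C" for j using assms C by simp
  show "bdiag ?m \<in> bops" by (rule bdiag_bops[OF bd])
  show "bdiag ?m \<cdot> x = (m i * cinner (b i) x) *\<^sub>C b i" for x
    by (rule coord_eqI) (simp add: bdiag_coord[OF bd] cinner_simps orthonormal)
  show "cmod (m i * cinner (b i) x) \<le> (cmod (m i) * norm (b i)) * norm x" for x
    using cinner_Cauchy_Schwarz[of "b i" x] by (simp add: norm_mult mult.assoc mult_left_mono)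
qed

text \<open>The truncation to the finitely many large entries is a finite sum of rank one operators, and the
  remainder has small norm.\<close>

lemma bdiag_compact:
  assumes bd: "\<And>j. cmod (m j) \<le> C" and fin: "\<And>e. e > 0 \<Longrightarrow> finite {i. e \<le> cmod (m i)}"
  shows "bdiag m \<in> compact_ops"
proof -
  have C: "0 \<le> C" using bd norm_ge_zero order_trans by blast
  have "\<exists>K\<in>compact_ops. dist K (bdiag m) < e" if e: "e > 0" for e
  proof -
    define F where "F = {i. e / 2 \<le> cmod (m i)}"
    have F: "finite F" unfolding F_def using e by (intro fin) simp
    define K where "K = (\<Sum>i\<in>F. bdiag (\<lambda>j. if j = i then m j else 0))"
    have K: "K \<in> compact_ops"
      unfolding K_def by (intro compact_ops_sum bdiag_single_compact[OF bd])
    have "K - bdiag m = bdiag (\<lambda>i. if i \<in> F then 0 else - m i)"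
    proof (rule bops_eqI)
      have bd2: "cmod (if i \<in> F then 0 else - m i) \<le> C" for i using bd C by simp
      show "bdiag (\<lambda>i. if i \<in> F then 0 else - m i) \<in> bops" by (rule bdiag_bops[OF bd2])
      show "K - bdiag m \<in> bops" by (intro bops_diff compact_ops_bops K bdiag_bops[OF bd])
      fix i
      have "K \<cdot> b i = (\<Sum>k\<in>F. if i = k then m i *\<^sub>C b i else 0)"
        unfolding K_def blinfun.sum_left
        using bd C by (intro sum.cong refl) (subst bdiag_basis[where C = C], auto)
      also have "\<dots> = (if i \<in> F then m i *\<^sub>C b i else 0)" using F by simp
      finally show "(K - bdiag m) \<cdot> b i = (bdiag (\<lambda>i. if i \<in> F then 0 else - m i)) \<cdot> b i"
        by (simp add: blinfun.diff_left bdiag_basis[OF bd] bdiag_basis[OF bd2] scaleC_minus_left)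
    qed
    moreover have "norm (bdiag (\<lambda>i. if i \<in> F then 0 else - m i)) \<le> e / 2"
      by (rule norm_bdiag_le) (use e in \<open>auto simp: F_def\<close>)
    ultimately have "dist K (bdiag m) < e" using e by (simp add: dist_norm)
    then show ?thesis using K by blast
  qed
  then show ?thesis using closed_approachable[OF closed_compact_ops] by blast
qed

lemma op_abs_bdiag_nonneg:
  assumes bd: "\<And>i. m i \<le> C" and nn: "\<And>i. 0 \<le> m i"
  shows "op_abs (op_graph (bdiag (\<lambda>i. complex_of_real (m i)))) = op_graph (bdiag (\<lambda>i. complex_of_real (m i)))"
proof -
  have "cmod (complex_of_real (m i)) \<le> C" for i using bd nn by simp
  from bdiag_graph[OF this] show ?thesis by (simp add: op_abs_diag_op nn)
qed

lemma the_op_graph: "(THE y. (x, y) \<in> op_graph T) = T \<cdot> x"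
  by (auto simp: op_graph_def)

lemma trace_class_bdiag:
  assumes bd: "\<And>i. m i \<le> C" and nn: "\<And>i. 0 \<le> m i" and sm: "m summable_on UNIV"
  shows "trace_class (bdiag (\<lambda>i. complex_of_real (m i)))"
  unfolding trace_class_def op_abs_bdiag_nonneg[OF bd nn] the_op_graph
proof (intro conjI exI)
  have bd': "cmod (complex_of_real (m i)) \<le> C" for i using bd nn by simp
  show "bdiag (\<lambda>i. complex_of_real (m i)) \<in> bops" by (rule bdiag_bops[OF bd'])
  show "orthonormal_basis (range b)" by (rule orthonormal_basis_range)
  have "(\<lambda>i. complex_of_real (m i)) summable_on UNIV"
    using summable_on_bounded_linear[OF bounded_linear_of_real sm] by simp
  then show "(\<lambda>x. cinner x ((bdiag (\<lambda>i. complex_of_real (m i))) \<cdot> x)) summable_on range b"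
    by (simp add: summable_on_reindex[OF inj] o_def bdiag_basis[OF bd'] cinner_simps orthonormal)
qed

text \<open>The trace of a positive diagonal operator does not depend on the orthonormal basis: by
  Parseval's identity, every other basis gives at least the sum over a finite set of eigenvalues.\<close>

lemma trace_class_bdiagD:
  assumes bd: "\<And>i. m i \<le> C" and nn: "\<And>i. 0 \<le> m i"
    and tr: "trace_class (bdiag (\<lambda>i. complex_of_real (m i)))"
  shows "m summable_on UNIV"
proof -
  let ?T = "bdiag (\<lambda>i. complex_of_real (m i))"
  have bd': "cmod (complex_of_real (m i)) \<le> C" for i using bd nn by simp
  obtain B where B: "orthonormal_basis B" and sm: "(\<lambda>x. cinner x (?T \<cdot> x)) summable_on B"
    using tr unfolding trace_class_def op_abs_bdiag_nonneg[OF bd nn] the_op_graph by blast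
  obtain s where s: "((\<lambda>x. Re (cinner x (?T \<cdot> x))) has_sum s) B"
    using summable_on_Re[OF sm] by (auto simp: summable_on_def)
  have form: "((\<lambda>i. m i * (cmod (cinner (b i) x))\<^sup>2) has_sum Re (cinner x (?T \<cdot> x))) UNIV" for x
  proof -
    have "(x, ?T \<cdot> x) \<in> diag_op (\<lambda>i. complex_of_real (m i))"
      by (rule diag_opI) (rule bdiag_coord[OF bd'])
    from has_sum_Re[OF diag_op_form_has_sum[OF this]] show ?thesis by simp
  qed
  have "sum m K \<le> s" if K: "finite K" for K
  proof -
    have "((\<lambda>x. (cmod (cinner (b i) x))\<^sup>2) has_sum 1) B" for i
    proof -
      have "norm (b i) = 1"
      proof -
        have "complex_of_real ((norm (b i))\<^sup>2) = complex_of_real (1\<^sup>2)"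
          unfolding cinner_self[symmetric] by (simp add: orthonormal)
        then show ?thesis using of_real_eq_iff power2_eq_imp_eq norm_ge_zero zero_le_one by blast
      qed
      moreover have "cmod (cinner (b i) x) = cmod (cinner x (b i))" for x
        by (subst cinner_commute) simp
      ultimately show ?thesis using orthonormal_basis_norm[OF B, of "b i"] by simp
    qed
    then have *: "((\<lambda>x. m i * (cmod (cinner (b i) x))\<^sup>2) has_sum m i * 1) B" for i
      by (rule has_sum_cmult_right)
    have "((\<lambda>x. \<Sum>i\<in>K. m i * (cmod (cinner (b i) x))\<^sup>2) has_sum (\<Sum>i\<in>K. m i)) B"
      using K
    proof (induction K)
      case (insert k K)
      then show ?case using has_sum_add[OF *[of k] insert.IH] by simp
    qed simp
    then show ?thesis using s
    proof (rule has_sum_mono)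
      fix x
      show "(\<Sum>i\<in>K. m i * (cmod (cinner (b i) x))\<^sup>2) \<le> Re (cinner x (?T \<cdot> x))"
        by (rule finite_sum_le_has_sum[OF form K]) (auto simp: nn)
    qed
  qed
  then show ?thesis
    by (intro nonneg_bdd_above_summable_on bdd_aboveI[of _ s]) (auto simp: nn)
qed

text \<open>An eigenvector for \<open>l\<close> has nonzero coordinates only where \<open>r i = l\<close>; conversely the values on the
  basis vectors determine the operator.\<close>

lemma fun_calculus_diag_op:
  assumes bd: "\<And>i. \<bar>f (r i)\<bar> \<le> C"
  shows "fun_calculus (diag_op (\<lambda>i. complex_of_real (r i))) f = bdiag (\<lambda>i. complex_of_real (f (r i)))"
  unfolding fun_calculus_def
proof (rule the_equality)
  let ?G = "diag_op (\<lambda>i. complex_of_real (r i))" and ?T = "bdiag (\<lambda>i. complex_of_real (f (r i)))"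
  have bd': "cmod (complex_of_real (f (r i))) \<le> C" for i using bd by simp
  have T: "?T \<in> bops" by (rule bdiag_bops[OF bd'])
  have "?T \<cdot> x = f l *\<^sub>R x" if x: "(x, l *\<^sub>R x) \<in> ?G" for l x
  proof (rule coord_eqI)
    fix i
    from diag_opD[OF x, of i] have "r i = l \<or> cinner (b i) x = 0" by (auto simp: cinner_simps)
    then show "cinner (b i) (?T \<cdot> x) = cinner (b i) (f l *\<^sub>R x)"
      by (auto simp: bdiag_coord[OF bd'] cinner_simps)
  qed
  with T show "?T \<in> bops \<and> (\<forall>l x. (x, l *\<^sub>R x) \<in> ?G \<longrightarrow> ?T \<cdot> x = f l *\<^sub>R x)" by blast
  fix S assume S: "S \<in> bops \<and> (\<forall>l x. (x, l *\<^sub>R x) \<in> ?G \<longrightarrow> S \<cdot> x = f l *\<^sub>R x)"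
  show "S = ?T"
  proof (rule bops_eqI)
    fix i
    have "(b i, r i *\<^sub>R b i) \<in> ?G"
      using basis_diag_op[of i "\<lambda>i. complex_of_real (r i)"] by (simp add: scaleR_scaleC)
    then have "S \<cdot> b i = f (r i) *\<^sub>R b i" using S by blast
    then show "S \<cdot> b i = ?T \<cdot> b i"
      by (simp add: bdiag_basis[OF bd'] scaleR_scaleC)
  qed (use S T in auto)
qed

subsection \<open>Commutators\<close>

text \<open>The matrix form of \<open>Y = [diag \<mu>, X]\<close>. It makes sense without any reference to the domain of the
  diagonal operator, and is inherited by sums and products and, for real \<open>\<mu>\<close>, by adjoints.\<close>

definition comm_rel :: "('i \<Rightarrow> complex) \<Rightarrow> ('h \<Rightarrow>\<^sub>L 'h) \<Rightarrow> ('h \<Rightarrow>\<^sub>L 'h) \<Rightarrow> bool" where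
  "comm_rel \<mu> X Y \<longleftrightarrow> X \<in> bops \<and> Y \<in> bops \<and>
     (\<forall>i j. cinner (b i) (Y \<cdot> b j) = (\<mu> i - \<mu> j) * cinner (b i) (X \<cdot> b j))"

text \<open>The matrix identity makes the bounded operator \<open>X\<close> preserve the maximal domain.\<close>

lemma comm_rel_bounded_extension:
  assumes "comm_rel \<mu> X Y"
  shows "bounded_extension (commutator (diag_op \<mu>) X) Y"
proof -
  have X: "X \<in> bops" and Y: "Y \<in> bops"
    and eq: "\<And>i j. cinner (b i) (Y \<cdot> b j) = (\<mu> i - \<mu> j) * cinner (b i) (X \<cdot> b j)"
    using assms by (auto simp: comm_rel_def)
  have key: "(X \<cdot> v, Y \<cdot> v + X \<cdot> z) \<in> diag_op \<mu>"
    if v: "(v, z) \<in> diag_op \<mu>" for v z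
  proof (rule diag_opI)
    fix i
    have "((\<lambda>j. cinner (b i) (Y \<cdot> b j) * cinner (b j) v +
        cinner (b i) (X \<cdot> b j) * cinner (b j) z)
      has_sum (cinner (b i) (Y \<cdot> v) + cinner (b i) (X \<cdot> z))) UNIV"
      by (intro has_sum_add matrix_has_sum X Y)
    moreover have "((\<lambda>j. \<mu> i * (cinner (b i) (X \<cdot> b j) * cinner (b j) v))
      has_sum (\<mu> i * cinner (b i) (X \<cdot> v))) UNIV"
      by (intro has_sum_cmult_right matrix_has_sum X)
    moreover have "(\<lambda>j. cinner (b i) (Y \<cdot> b j) * cinner (b j) v +
        cinner (b i) (X \<cdot> b j) * cinner (b j) z) =
      (\<lambda>j. \<mu> i * (cinner (b i) (X \<cdot> b j) * cinner (b j) v))"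
      by (simp add: fun_eq_iff eq diag_opD[OF v] algebra_simps)
    ultimately show "cinner (b i) (Y \<cdot> v + X \<cdot> z) = \<mu> i * cinner (b i) (X \<cdot> v)"
      using has_sum_unique by (auto simp: cinner_simps)
  qed
  have sv: "y = y'" if "(x, y) \<in> diag_op \<mu>" "(x, y') \<in> diag_op \<mu>" for x y y'
    using is_operator_diag_op that by (auto simp: is_operator_def single_valued_def)
  show ?thesis
    unfolding bounded_extension_def
  proof (intro conjI Y)
    have "Domain (diag_op \<mu>) \<subseteq> Domain (commutator (diag_op \<mu>) X)"
      unfolding commutator_def using key by blast
    then show "densely_defined (commutator (diag_op \<mu>) X)"
      using densely_defined_diag_op closure_mono unfolding densely_defined_def by blast
    show "commutator (diag_op \<mu>) X \<subseteq> op_graph Y"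
    proof (intro subrelI)
      fix v w assume "(v, w) \<in> commutator (diag_op \<mu>) X"
      then obtain y z where w: "w = y - X \<cdot> z" "(X \<cdot> v, y) \<in> diag_op \<mu>" "(v, z) \<in> diag_op \<mu>"
        unfolding commutator_def by auto
      then have "y = Y \<cdot> v + X \<cdot> z" using sv key by blast
      then show "(v, w) \<in> op_graph Y" using w by (auto simp: op_graph_def)
    qed
  qed
qed

lemma comm_rel_add: "comm_rel \<mu> X Y \<Longrightarrow> comm_rel \<mu> X' Y' \<Longrightarrow> comm_rel \<mu> (X + X') (Y + Y')"
  by (auto simp: comm_rel_def bops_add blinfun.add_left cinner_simps algebra_simps)

lemma comm_rel_scaleC: "comm_rel \<mu> X Y \<Longrightarrow> comm_rel \<mu> (scaleC_op c X) (scaleC_op c Y)"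
  by (auto simp: comm_rel_def bops_scaleC cinner_simps)

lemma comm_rel_adj:
  assumes "\<And>i. cnj (\<mu> i) = \<mu> i"
  shows "comm_rel \<mu> X Y \<Longrightarrow> comm_rel \<mu> (adj X) (- adj Y)"
  by (simp add: comm_rel_def adj_works(2) bops_minus adj_coord blinfun.minus_left cinner_minus_right
      assms left_diff_distrib)

text \<open>The Leibniz rule, by splitting \<open>\<mu>\<^sub>i - \<mu>\<^sub>j = (\<mu>\<^sub>i - \<mu>\<^sub>k) + (\<mu>\<^sub>k - \<mu>\<^sub>j)\<close> in the matrix product.\<close>

lemma comm_rel_compose:
  assumes "comm_rel \<mu> X Y" "comm_rel \<mu> X' Y'"
  shows "comm_rel \<mu> (X o\<^sub>L X') ((Y o\<^sub>L X') + (X o\<^sub>L Y'))"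
  unfolding comm_rel_def
proof (intro conjI allI)
  have X: "X \<in> bops" "Y \<in> bops" "X' \<in> bops" "Y' \<in> bops"
    and eq: "\<And>i j. cinner (b i) (Y \<cdot> b j) = (\<mu> i - \<mu> j) * cinner (b i) (X \<cdot> b j)"
      "\<And>i j. cinner (b i) (Y' \<cdot> b j) = (\<mu> i - \<mu> j) * cinner (b i) (X' \<cdot> b j)"
    using assms by (auto simp: comm_rel_def)
  show "X o\<^sub>L X' \<in> bops" "(Y o\<^sub>L X') + (X o\<^sub>L Y') \<in> bops"
    using X by (auto intro!: bops_compose bops_add)
  fix i j
  have "((\<lambda>k. cinner (b i) (Y \<cdot> b k) * cinner (b k) (X' \<cdot> b j) +
      cinner (b i) (X \<cdot> b k) * cinner (b k) (Y' \<cdot> b j))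
    has_sum cinner (b i) (((Y o\<^sub>L X') + (X o\<^sub>L Y')) \<cdot> b j)) UNIV"
    using X by (simp add: blinfun.add_left cinner_add_right has_sum_add matrix_has_sum)
  moreover have "((\<lambda>k. (\<mu> i - \<mu> j) * (cinner (b i) (X \<cdot> b k) * cinner (b k) (X' \<cdot> b j)))
    has_sum (\<mu> i - \<mu> j) * cinner (b i) ((X o\<^sub>L X') \<cdot> b j)) UNIV"
    using X by (simp add: has_sum_cmult_right matrix_has_sum)
  moreover have "(\<lambda>k. cinner (b i) (Y \<cdot> b k) * cinner (b k) (X' \<cdot> b j) +
      cinner (b i) (X \<cdot> b k) * cinner (b k) (Y' \<cdot> b j)) =
    (\<lambda>k. (\<mu> i - \<mu> j) * (cinner (b i) (X \<cdot> b k) * cinner (b k) (X' \<cdot> b j)))"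
    by (simp add: fun_eq_iff eq algebra_simps)
  ultimately show "cinner (b i) (((Y o\<^sub>L X') + (X o\<^sub>L Y')) \<cdot> b j) =
      (\<mu> i - \<mu> j) * cinner (b i) ((X o\<^sub>L X') \<cdot> b j)"
    using has_sum_unique by auto
qed

text \<open>Iterated commutators are controlled by exhibiting a set of bounded operators that taking commutators
  does not leave.\<close>

lemma delta_bounded_if_closed:
  assumes cl: "\<And>X. X \<in> \<X> \<Longrightarrow> \<exists>Y\<in>\<X>. comm_rel \<mu> X Y"
  shows "X \<in> \<X> \<Longrightarrow> delta_bounded (diag_op \<mu>) k X"
proof (induction k arbitrary: X)
  case 0
  then show ?case using cl by (auto simp: comm_rel_def)
next
  case (Suc k)
  then show ?case using cl comm_rel_bounded_extension by (metis delta_bounded.simps(2))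
qed

end

section \<open>Operators on square summable sequences\<close>

text \<open>An orthonormal family is complete as soon as only the zero vector is orthogonal to it: the
  Fourier series of any vector converges, and has the same coefficients as the vector.\<close>

lemma onbI:
  fixes b :: "'i \<Rightarrow> 'h::chilbert_space"
  assumes orth: "\<And>i j. cinner (b i) (b j) = (if i = j then 1 else 0)"
    and total: "\<And>x. (\<And>i. cinner (b i) x = 0) \<Longrightarrow> x = 0"
  shows "onb b"
proof
  show "cinner (b i) (b j) = (if i = j then 1 else 0)" for i j by (rule orth)
  have inj: "b i = b j \<Longrightarrow> i = j" for i j using orth[of i i] orth[of i j] by (auto split: if_splits)
  have on: "\<And>x y. x \<in> range b \<Longrightarrow> y \<in> range b \<Longrightarrow> cinner x y = (if x = y then 1 else 0)"
    using inj by (auto simp: orth)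
  have "x \<in> closure (cvec.span (range b))" for x
  proof -
    have "(\<lambda>e. (cmod (cinner e x))\<^sup>2) summable_on range b"
      by (rule nonneg_bdd_above_summable_on)
        (auto intro!: bdd_aboveI[of _ "(norm x)\<^sup>2"] Bessel_finite on simp: subset_iff)
    then obtain z where z: "((\<lambda>e. cinner e x *\<^sub>C e) has_sum z) (range b)"
        "\<And>e. e \<in> range b \<Longrightarrow> cinner e z = cinner e x"
      using Riesz_Fischer[OF on, of "range b" "\<lambda>e. cinner e x"] by blast
    have "z - x = 0" by (rule total) (simp add: cinner_simps z(2))
    moreover have "z \<in> closure (cvec.span (range b))"
    proof (rule Lim_in_closed_set)
      show "(sum (\<lambda>e. cinner e x *\<^sub>C e) \<longlongrightarrow> z) (finite_subsets_at_top (range b))"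
        using z(1) by (simp add: has_sum_def)
      have "sum (\<lambda>e. cinner e x *\<^sub>C e) F \<in> closure (cvec.span (range b))"
        if "finite F" "F \<subseteq> range b" for F
        using that by (intro subsetD[OF closure_subset] cvec.span_sum cvec.span_scale cvec.span_base) auto
      then show "eventually (\<lambda>F. sum (\<lambda>e. cinner e x *\<^sub>C e) F \<in> closure (cvec.span (range b)))
          (finite_subsets_at_top (range b))"
        by (auto simp: eventually_finite_subsets_at_top)
    qed auto
    ultimately show ?thesis by simp
  qed
  then show "closure (cvec.span (range b)) = UNIV" by blast
qed

lemma entry_ebasis: "entry (ebasis n) m = (if m = n then 1 else 0)"
proof -
  have "summable (\<lambda>m. (cmod (if m = n then 1 else 0))\<^sup>2)"
    by (rule summable_finite[of "{n}"]) auto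
  then show ?thesis by (simp add: ebasis_def Abs_ell2_inverse)
qed

lemma cinner_ebasis [simp]: "cinner (ebasis n) x = entry x n"
proof -
  have "(\<Sum>m. cnj (entry (ebasis n) m) * entry x m) = (\<Sum>m\<in>{n}. cnj (entry (ebasis n) m) * entry x m)"
    by (rule suminf_finite) (auto simp: entry_ebasis)
  then show ?thesis by (simp add: cinner_ell2_def entry_ebasis)
qed

interpretation std: onb ebasis
  by (rule onbI) (auto simp: entry_ebasis intro!: ell2_eqI)

lemma entry_sum: "entry (sum f A) n = (\<Sum>i\<in>A. entry (f i) n)"
  by (induction A rule: infinite_finite_induct) auto

abbreviation mat_entry :: "(ell2 \<Rightarrow>\<^sub>L ell2) \<Rightarrow> nat \<Rightarrow> nat \<Rightarrow> complex" where
  "mat_entry T m n \<equiv> entry (T \<cdot> ebasis n) m"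

lemma entry_adj: "T \<in> bops \<Longrightarrow> mat_entry (adj T) m n = cnj (mat_entry T n m)"
  using std.adj_coord[of T m n] by simp

lemma ell2_ops_eqI:
  assumes "S \<in> bops" "T \<in> bops"
    and "\<And>m n. mat_entry S m n = mat_entry T m n"
  shows "S = T"
  using assms by (intro std.bops_eqI_matrix) auto

lemma matrix_sums:
  assumes "T \<in> bops"
  shows "(\<lambda>n. mat_entry T m n * entry x n) sums entry (T \<cdot> x) m"
  using has_sum_imp_sums[OF std.matrix_has_sum[OF assms, of "ebasis m" x]] by simp

subsection \<open>The unilateral shift\<close>

lemma apply_unilateral_shift:
  "entry (unilateral_shift \<cdot> x) n = (case n of 0 \<Rightarrow> 0 | Suc m \<Rightarrow> entry x m)"
  and shift_bops: "unilateral_shift \<in> bops"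
proof -
  let ?f = "\<lambda>x. Abs_ell2 (case_nat 0 (entry x))"
  have sm: "summable (\<lambda>n. (cmod (case_nat 0 (entry x) n))\<^sup>2)" for x
    using summable_entry[of x] by (subst summable_Suc_iff[symmetric]) simp
  have en: "entry (?f x) = case_nat 0 (entry x)" for x
    using sm by (simp add: Abs_ell2_inverse)
  have nm: "norm (?f x) = norm x" for x
  proof -
    have "(norm (?f x))\<^sup>2 = (norm x)\<^sup>2"
      unfolding norm_ell2_power2 en using suminf_split_head[OF sm[of x]] by simp
    then show ?thesis by (simp add: power2_eq_iff_nonneg)
  qed
  have sc: "?f (c *\<^sub>C x) = c *\<^sub>C ?f x" for c x
    by (rule ell2_eqI) (simp add: en split: nat.split)
  have "bounded_linear ?f"
  proof (rule bounded_linear_intro[where K = 1])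
    show "?f (x + y) = ?f x + ?f y" for x y
      by (rule ell2_eqI) (simp add: en split: nat.split)
    show "?f (r *\<^sub>R x) = r *\<^sub>R ?f x" for r x
      by (simp add: scaleR_scaleC sc)
  qed (simp add: nm)
  then have ap: "blinfun_apply unilateral_shift = ?f"
    unfolding unilateral_shift_def by (rule bounded_linear_Blinfun_apply)
  show "entry (unilateral_shift \<cdot> x) n = (case n of 0 \<Rightarrow> 0 | Suc m \<Rightarrow> entry x m)"
    by (simp add: ap en)
  show "unilateral_shift \<in> bops" by (simp add: bops_def ap sc)
qed

lemma shift_ebasis: "unilateral_shift \<cdot> ebasis n = ebasis (Suc n)"
  by (rule ell2_eqI) (auto simp: apply_unilateral_shift entry_ebasis split: nat.split)

lemma shift_adj_bops: "adj unilateral_shift \<in> bops"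
  by (rule std.adj_works(2)[OF shift_bops])

lemma entry_shift_adj: "entry (adj unilateral_shift \<cdot> x) n = entry x (Suc n)"
  using std.adj_works(1)[OF shift_bops, of "ebasis n" x] by (simp add: shift_ebasis)

lemma shift_adj_shift: "adj unilateral_shift \<cdot> (unilateral_shift \<cdot> x) = x"
  by (rule ell2_eqI) (simp add: entry_shift_adj apply_unilateral_shift)

subsection \<open>Finite matrices and compact operators\<close>

definition munit :: "nat \<Rightarrow> nat \<Rightarrow> (ell2 \<Rightarrow>\<^sub>L ell2)" where
  "munit m n = Blinfun (\<lambda>x. entry x n *\<^sub>C ebasis m)"

lemma norm_ebasis [simp]: "norm (ebasis n) = 1"
proof -
  have "(norm (ebasis n))\<^sup>2 = 1"
    using cinner_self[of "ebasis n"] by (simp add: entry_ebasis del: of_real_power)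
  then show ?thesis using power2_eq_imp_eq[of "norm (ebasis n)" 1] by simp
qed

lemma apply_munit: "munit m n \<cdot> x = entry x n *\<^sub>C ebasis m"
  and munit_compact: "munit m n \<in> compact_ops"
proof -
  have "bounded_linear (\<lambda>x. entry x n *\<^sub>C ebasis m)"
    by (rule bounded_linear_intro[where K = 1])
      (simp_all add: scaleC_add_left scaleR_scaleC scaleC_scaleC norm_scaleC norm_entry_le scaleR_conv_of_real)
  then show ap: "munit m n \<cdot> x = entry x n *\<^sub>C ebasis m" for x
    by (simp add: munit_def bounded_linear_Blinfun_apply)
  show "munit m n \<in> compact_ops"
    by (rule rank_one_compact[OF _ ap, of 1])
      (auto simp: bops_def ap scaleC_scaleC norm_entry_le)
qed

lemma finite_matrix_ops_iff:
  "T \<in> finite_matrix_ops \<longleftrightarrow>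
     T \<in> bops \<and> (\<exists>N. \<forall>m n. m > N \<or> n > N \<longrightarrow> mat_entry T m n = 0)"
proof
  assume "T \<in> finite_matrix_ops"
  then obtain N where T: "T \<in> bops" and ran: "range (blinfun_apply T) \<subseteq> cvec.span (ebasis ` {..N})"
    and orth: "\<And>x. (\<And>y. y \<in> cvec.span (ebasis ` {..N}) \<Longrightarrow> cinner y x = 0) \<Longrightarrow> T \<cdot> x = 0"
    unfolding finite_matrix_ops_def by blast
  have sp: "cvec.span (ebasis ` {..N}) \<subseteq> {y. \<forall>m>N. entry y m = 0}"
    by (rule cvec.span_minimal) (auto simp: cvec.subspace_def entry_ebasis)
  have "mat_entry T m n = 0" if "m > N \<or> n > N" for m n
  proof (cases "m > N")
    case True
    then show ?thesis using ran sp by blast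
  next
    case False
    then have "n > N" using that by simp
    then have "T \<cdot> ebasis n = 0"
      using sp by (intro orth) (subst cinner_commute, auto)
    then show ?thesis by simp
  qed
  then show "T \<in> bops \<and> (\<exists>N. \<forall>m n. m > N \<or> n > N \<longrightarrow> mat_entry T m n = 0)"
    using T by blast
next
  assume "T \<in> bops \<and> (\<exists>N. \<forall>m n. m > N \<or> n > N \<longrightarrow> mat_entry T m n = 0)"
  then obtain N where T: "T \<in> bops"
    and N: "\<And>m n. m > N \<or> n > N \<Longrightarrow> mat_entry T m n = 0" by blast
  have ent: "entry (T \<cdot> x) m = (\<Sum>n\<le>N. mat_entry T m n * entry x n)" for x m
    by (rule sums_unique2[OF matrix_sums[OF T] sums_finite]) (auto simp: N)
  have big: "entry (T \<cdot> x) k = 0" if "k > N" for x k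
    unfolding ent[of x k] using that by (simp add: N)
  have "T \<cdot> x \<in> cvec.span (ebasis ` {..N})" for x
  proof -
    have "T \<cdot> x = (\<Sum>m\<le>N. entry (T \<cdot> x) m *\<^sub>C ebasis m)"
    proof (rule ell2_eqI)
      fix k
      have "(\<Sum>m\<le>N. entry (T \<cdot> x) m * entry (ebasis m) k) = (if k \<le> N then entry (T \<cdot> x) k else 0)"
        by (simp add: entry_ebasis if_distrib cong: if_cong)
      then show "entry (T \<cdot> x) k = entry (\<Sum>m\<le>N. entry (T \<cdot> x) m *\<^sub>C ebasis m) k"
        using big[of k x] by (auto simp: entry_sum)
    qed
    also have "\<dots> \<in> cvec.span (ebasis ` {..N})"
      by (intro cvec.span_sum cvec.span_scale cvec.span_base) auto
    finally show ?thesis .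
  qed
  moreover have "T \<cdot> x = 0" if x: "\<forall>y\<in>cvec.span (ebasis ` {..N}). cinner y x = 0" for x
  proof -
    have "entry x n = 0" if "n \<le> N" for n
      using x cvec.span_base[of "ebasis n" "ebasis ` {..N}"] that by fastforce
    then show ?thesis by (intro ell2_eqI) (simp add: ent[of x])
  qed
  ultimately show "T \<in> finite_matrix_ops" using T unfolding finite_matrix_ops_def by blast
qed

lemma finite_matrix_bops: "T \<in> finite_matrix_ops \<Longrightarrow> T \<in> bops"
  by (simp add: finite_matrix_ops_iff)

lemma finite_matrix_eq_sum_munit:
  assumes "T \<in> bops" "\<And>m n. m > N \<or> n > N \<Longrightarrow> mat_entry T m n = 0"
  shows "T = (\<Sum>m\<le>N. \<Sum>n\<le>N. scaleC_op (mat_entry T m n) (munit m n))"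
proof (rule ell2_ops_eqI)
  show "(\<Sum>m\<le>N. \<Sum>n\<le>N. scaleC_op (mat_entry T m n) (munit m n)) \<in> bops"
    by (intro bops_sum bops_scaleC compact_ops_bops munit_compact)
  fix k l
  have "mat_entry (\<Sum>m\<le>N. \<Sum>n\<le>N. scaleC_op (mat_entry T m n) (munit m n)) k l
     = (\<Sum>m\<le>N. \<Sum>n\<le>N. if n = l then if k = m then mat_entry T m n else 0 else 0)"
    unfolding blinfun.sum_left entry_sum
    by (intro sum.cong refl) (simp add: apply_munit entry_ebasis)
  also have "\<dots> = mat_entry T k l"
    using assms(2)[of k l] by (cases "l \<le> N") (auto simp: not_less)
  finally show "mat_entry T k l = mat_entry (\<Sum>m\<le>N. \<Sum>n\<le>N. scaleC_op (mat_entry T m n) (munit m n)) k l" ..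
qed (rule assms(1))

lemma ex_finite_matrix:
  assumes "\<And>m n. m > N \<or> n > N \<Longrightarrow> c m n = 0"
  shows "\<exists>T\<in>finite_matrix_ops. \<forall>m n. mat_entry T m n = c m n"
proof -
  define T where "T = (\<Sum>m\<le>N. \<Sum>n\<le>N. scaleC_op (c m n) (munit m n))"
  have "mat_entry T k l
     = (\<Sum>m\<le>N. \<Sum>n\<le>N. if n = l then if k = m then c m n else 0 else 0)" for k l
    unfolding T_def blinfun.sum_left entry_sum
    by (intro sum.cong refl) (simp add: apply_munit entry_ebasis)
  also have "\<dots> k l = c k l" for k l
    using assms[of k l] by (cases "l \<le> N") (auto simp: not_less)
  finally have ent: "mat_entry T k l = c k l" for k l .
  have "T \<in> bops"
    unfolding T_def by (intro bops_sum bops_scaleC compact_ops_bops munit_compact)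
  then have "T \<in> finite_matrix_ops" using assms unfolding finite_matrix_ops_iff ent by blast
  then show ?thesis using ent by blast
qed

lemma finite_matrix_compact: "finite_matrix_ops \<subseteq> compact_ops"
proof
  fix T assume "T \<in> finite_matrix_ops"
  then obtain N where T: "T \<in> bops" "\<And>m n. m > N \<or> n > N \<Longrightarrow> mat_entry T m n = 0"
    by (auto simp: finite_matrix_ops_iff)
  show "T \<in> compact_ops"
    by (subst finite_matrix_eq_sum_munit[where N = N, OF T], assumption)
      (intro compact_ops_sum compact_ops_scaleC munit_compact)
qed

text \<open>The projections onto the first \<open>N\<close> coordinates, through which compact operators are approximated by
  finite matrices.\<close>

definition trunc :: "nat \<Rightarrow> (ell2 \<Rightarrow>\<^sub>L ell2)" where
  "trunc N = std.bdiag (\<lambda>i. if i < N then 1 else 0)"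

lemma trunc_bops: "trunc N \<in> bops"
  unfolding trunc_def by (rule std.bdiag_bops[where C = 1]) auto

lemma entry_trunc: "entry (trunc N \<cdot> x) i = (if i < N then entry x i else 0)"
  using std.bdiag_coord[of "\<lambda>i. if i < N then 1 else 0" 1 i x] by (simp add: trunc_def)

lemma norm_trunc: "norm (trunc N \<cdot> x) \<le> norm x"
proof -
  have "norm (trunc N) \<le> 1" unfolding trunc_def by (rule std.norm_bdiag_le) simp
  then have "norm (trunc N) * norm x \<le> 1 * norm x" by (rule mult_right_mono) simp
  then show ?thesis using norm_blinfun[of "trunc N" x] by linarith
qed

lemma adj_trunc: "adj (trunc N) = trunc N"
  by (rule ell2_ops_eqI)
    (auto simp: trunc_bops std.adj_works(2) entry_adj entry_trunc entry_ebasis)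

lemma trunc_compact: "trunc N \<in> compact_ops"
  unfolding trunc_def
proof (rule std.bdiag_compact[where C = 1])
  fix e :: real assume "e > 0"
  then have "{i. e \<le> cmod (if i < N then 1 else 0)} \<subseteq> {..<N}" by (auto split: if_splits)
  then show "finite {i. e \<le> cmod (if i < N then 1 else 0)}" using finite_subset by blast
qed auto

lemma trunc_tendsto: "(\<lambda>N. trunc N \<cdot> x) \<longlonglongrightarrow> x"
proof -
  have "(\<lambda>N. \<Sum>n<N. entry x n *\<^sub>C ebasis n) \<longlonglongrightarrow> x"
    using has_sum_imp_sums[OF std.expansion[of x]] by (simp add: sums_def)
  moreover have "(\<Sum>n<N. entry x n *\<^sub>C ebasis n) = trunc N \<cdot> x" for N
    by (rule ell2_eqI) (simp add: entry_sum entry_trunc entry_ebasis if_distrib cong: if_cong)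
  ultimately show ?thesis by simp
qed

text \<open>The projections converge pointwise to the identity, hence uniformly on a finite net of the image of the
  unit ball.\<close>

lemma compact_trunc_approx:
  assumes K: "K \<in> compact_ops" and e: "e > 0"
  shows "\<exists>N. norm (K - (trunc N o\<^sub>L K)) \<le> e"
proof -
  obtain k where k: "finite k" "blinfun_apply K ` cball 0 1 \<subseteq> (\<Union>x\<in>k. ball x (e/3))"
    using K e unfolding compact_ops_iff by (meson divide_pos_pos zero_less_numeral)
  have "\<forall>\<^sub>F N in sequentially. \<forall>y\<in>k. dist (trunc N \<cdot> y) y < e/3"
    using k(1) e by (intro eventually_ball_finite ballI tendstoD trunc_tendsto) auto
  then obtain N where N: "\<And>y. y \<in> k \<Longrightarrow> dist (trunc N \<cdot> y) y < e/3"
    by (auto simp: eventually_sequentially)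
  let ?R = "K - (trunc N o\<^sub>L K)"
  have unit: "norm (?R \<cdot> x) \<le> e" if x: "norm x \<le> 1" for x
  proof -
    have "K \<cdot> x \<in> blinfun_apply K ` cball 0 1" using x by simp
    then have "K \<cdot> x \<in> (\<Union>x\<in>k. ball x (e/3))" using k(2) by blast
    then obtain y where y: "y \<in> k" "dist y (K \<cdot> x) < e/3" by (auto simp: mem_ball)
    have "?R \<cdot> x = (K \<cdot> x - y) + (y - trunc N \<cdot> y)
        + trunc N \<cdot> (y - K \<cdot> x)"
      by (simp add: blinfun.diff_left blinfun.diff_right)
    also have "norm \<dots> \<le> norm (K \<cdot> x - y) + norm (y - trunc N \<cdot> y)
        + norm (trunc N \<cdot> (y - K \<cdot> x))"
      by (intro norm_triangle_mono norm_triangle_ineq order_refl)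
    also have "\<dots> \<le> e/3 + e/3 + e/3"
      using y(2) N[OF y(1)] norm_trunc[of N "y - K \<cdot> x"]
      by (intro add_mono) (auto simp: dist_norm norm_minus_commute)
    finally show ?thesis by simp
  qed
  have "norm ?R \<le> e"
  proof (rule norm_blinfun_le)
    fix x show "norm (?R \<cdot> x) \<le> e * norm x"
    proof (cases "x = 0")
      case False
      then have "norm (?R \<cdot> (x /\<^sub>R norm x)) \<le> e" by (intro unit) simp
      then show ?thesis using False by (simp add: blinfun.scaleR_right field_simps)
    qed simp
  qed (use e in simp)
  then show ?thesis by blast
qed

text \<open>Truncating on the left is enough for a compact operator; truncating on the right is truncating
  the adjoint on the left, and the adjoint is compact after the first truncation.\<close>

theorem compact_ops_eq_closure_finite_matrix: "(compact_ops :: (ell2 \<Rightarrow>\<^sub>L ell2) set) = closure finite_matrix_ops"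
proof
  show "closure finite_matrix_ops \<subseteq> (compact_ops :: (ell2 \<Rightarrow>\<^sub>L ell2) set)"
    by (intro closure_minimal finite_matrix_compact closed_compact_ops)
  show "(compact_ops :: (ell2 \<Rightarrow>\<^sub>L ell2) set) \<subseteq> closure finite_matrix_ops"
  proof
    fix K :: "ell2 \<Rightarrow>\<^sub>L ell2" assume K: "K \<in> compact_ops"
    note Kb = compact_ops_bops[OF K]
    show "K \<in> closure finite_matrix_ops"
      unfolding closure_approachable
    proof (intro allI impI)
      fix e :: real assume e: "e > 0"
      obtain N where N: "norm (K - (trunc N o\<^sub>L K)) \<le> e/3"
        using compact_trunc_approx[OF K, of "e/3"] e by auto
      have "adj K o\<^sub>L trunc N \<in> compact_ops"
        by (intro compact_ops_compose_left trunc_compact std.adj_works(2) Kb)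
      then obtain M where M: "norm ((adj K o\<^sub>L trunc N) - (trunc M o\<^sub>L (adj K o\<^sub>L trunc N))) \<le> e/3"
        using compact_trunc_approx[of "adj K o\<^sub>L trunc N" "e/3"] e by auto
      have b: "adj K o\<^sub>L trunc N \<in> bops" "trunc M o\<^sub>L (adj K o\<^sub>L trunc N) \<in> bops"
        by (auto intro!: bops_compose trunc_bops std.adj_works(2) Kb)
      have "adj ((adj K o\<^sub>L trunc N) - (trunc M o\<^sub>L (adj K o\<^sub>L trunc N))) =
          (trunc N o\<^sub>L K) - ((trunc N o\<^sub>L K) o\<^sub>L trunc M)"
        using b by (simp add: std.adj_diff std.adj_compose std.adj_adj adj_trunc trunc_bops Kb std.adj_works(2))
      then have M': "norm ((trunc N o\<^sub>L K) - ((trunc N o\<^sub>L K) o\<^sub>L trunc M)) \<le> e/3"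
        using M std.norm_adj[OF bops_diff[OF b]] by simp
      let ?T = "(trunc N o\<^sub>L K) o\<^sub>L trunc M"
      have "?T \<in> finite_matrix_ops"
        unfolding finite_matrix_ops_iff
      proof (intro conjI exI allI impI)
        show "?T \<in> bops" by (intro bops_compose trunc_bops Kb)
        fix m n assume "m > max N M \<or> n > max N M"
        moreover have "trunc M \<cdot> ebasis n = (if n < M then ebasis n else 0)"
          by (rule ell2_eqI) (auto simp: entry_trunc entry_ebasis)
        ultimately show "mat_entry ?T m n = 0"
          by (auto simp: entry_trunc)
      qed
      moreover have "dist ?T K < e"
      proof -
        have "norm (K - ?T) \<le> norm (K - (trunc N o\<^sub>L K)) + norm ((trunc N o\<^sub>L K) - ?T)"
          by (metis diff_add_cancel add_diff_eq norm_triangle_ineq)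
        also have "\<dots> < e" using N M' e by simp
        finally show ?thesis by (simp add: dist_norm norm_minus_commute)
      qed
      ultimately show "\<exists>T\<in>finite_matrix_ops. dist T K < e" by blast
    qed
  qed
qed

lemma finite_matrix_adj: "T \<in> finite_matrix_ops \<Longrightarrow> adj T \<in> finite_matrix_ops"
proof -
  assume "T \<in> finite_matrix_ops"
  then obtain N where T: "T \<in> bops" "\<And>m n. m > N \<or> n > N \<Longrightarrow> mat_entry T m n = 0"
    by (auto simp: finite_matrix_ops_iff)
  then have "mat_entry (adj T) m n = 0" if "m > N \<or> n > N" for m n
    using that by (simp add: entry_adj disj_commute)
  then show "adj T \<in> finite_matrix_ops"
    using std.adj_works(2)[OF T(1)] unfolding finite_matrix_ops_iff by blast
qed

lemma compact_ops_adj: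
  fixes K :: "ell2 \<Rightarrow>\<^sub>L ell2"
  assumes K: "K \<in> compact_ops" shows "adj K \<in> compact_ops"
  unfolding compact_ops_eq_closure_finite_matrix closure_approachable
proof (intro allI impI)
  fix e :: real assume "e > 0"
  then obtain T where T: "T \<in> finite_matrix_ops" "dist T K < e"
    using K unfolding compact_ops_eq_closure_finite_matrix closure_approachable by blast
  have "dist (adj T) (adj K) \<le> dist T K"
    by (intro std.dist_adj finite_matrix_bops T compact_ops_bops K)
  then show "\<exists>T\<in>finite_matrix_ops. dist T (adj K) < e"
    using T finite_matrix_adj by (meson order.strict_trans1)
qed

section \<open>Square integrable functions on the circle\<close>

lemma cis_measurable:
  "cis \<in> measurable (restrict_space lborel {0..<2 * pi}) (restrict_space borel (sphere 0 1))"
proof (rule measurable_restrict_space2)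
  have "continuous_on UNIV cis" by (intro continuous_intros)
  then have "cis \<in> borel_measurable lborel" by (simp add: borel_measurable_continuous_onI)
  then show "cis \<in> borel_measurable (restrict_space lborel {0..<2 * pi})"
    by (rule measurable_restrict_space1)
qed auto

lemma space_circle_measure [simp]: "space circle_measure = sphere 0 1"
  by (simp add: circle_measure_def space_restrict_space)

lemma sets_circle_measure: "sets circle_measure = sets (restrict_space borel (sphere 0 1))"
  by (simp add: circle_measure_def)

lemma finite_circle_measure: "finite_measure circle_measure"
proof (rule finite_measureI)
  have "emeasure circle_measure (space circle_measure)
      = emeasure (restrict_space lborel {0..<2 * pi})
          (cis -` sphere 0 1 \<inter> space (restrict_space lborel {0..<2 * pi}))"
    unfolding circle_measure_def
    by (subst emeasure_distr[OF cis_measurable]) (auto simp: space_restrict_space sets_restrict_space)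
  also have "cis -` sphere 0 1 \<inter> space (restrict_space lborel {0..<2 * pi}) = {0..<2 * pi}"
    by (auto simp: space_restrict_space)
  finally show "emeasure circle_measure (space circle_measure) \<noteq> \<infinity>"
    by (simp add: emeasure_restrict_space)
qed

interpretation circle: finite_measure circle_measure
  by (rule finite_circle_measure)

lemma C_circle_measurable: "f \<in> C_circle \<Longrightarrow> f \<in> borel_measurable circle_measure"
  using borel_measurable_continuous_on_restrict[of "sphere 0 1" f]
  by (simp add: C_circle_def measurable_cong_sets[OF sets_circle_measure refl])

lemma C_circle_bounded:
  assumes "f \<in> C_circle"
  shows "\<exists>C. \<forall>z\<in>sphere 0 1. cmod (f z) \<le> C"
proof -
  have "compact (f ` sphere 0 1)"
    using assms by (intro compact_continuous_image) (auto simp: C_circle_def)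
  from compact_imp_bounded[OF this] obtain C where "\<forall>y\<in>f ` sphere 0 1. norm y \<le> C"
    unfolding bounded_iff by auto
  then show ?thesis by auto
qed

lemma C_circle_integrable:
  assumes "f \<in> C_circle" shows "integrable circle_measure f"
proof -
  obtain C where C: "\<And>z. z \<in> sphere 0 1 \<Longrightarrow> cmod (f z) \<le> C" using C_circle_bounded[OF assms] by metis
  show ?thesis
    by (rule circle.integrable_const_bound[where B = C]) (auto intro!: AE_I2 C C_circle_measurable assms)
qed

text \<open>Integrals of continuous functions are computed in the angle, where the fundamental theorem of calculus
  applies.\<close>

lemma integral_circle_eq:
  assumes "f \<in> C_circle"
  shows "(LINT z|circle_measure. f z) = integral {0..2 * pi} (\<lambda>t. f (cis t))"
proof -
  have f: "f \<in> borel_measurable (restrict_space borel (sphere 0 1))"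
    using C_circle_measurable[OF assms] by (simp add: measurable_cong_sets[OF sets_circle_measure refl])
  have int: "integrable (restrict_space lborel {0..<2 * pi}) (\<lambda>t. f (cis t))"
    using C_circle_integrable[OF assms] f unfolding circle_measure_def
    by (subst (asm) integrable_distr_eq[OF cis_measurable]) auto
  have "(LINT z|circle_measure. f z) = (LINT t|restrict_space lborel {0..<2 * pi}. f (cis t))"
    unfolding circle_measure_def by (rule integral_distr[OF cis_measurable f])
  also have "\<dots> = (LINT t:{0..<2 * pi}|lborel. f (cis t))"
    by (subst integral_restrict_space) (auto simp: set_lebesgue_integral_def)
  also have "\<dots> = integral {0..<2 * pi} (\<lambda>t. f (cis t))"
  proof (rule set_borel_integral_eq_integral)
    show "set_integrable lborel {0..<2 * pi} (\<lambda>t. f (cis t))"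
      using int by (subst (asm) integrable_restrict_space) (auto simp: set_integrable_def)
  qed
  also have "\<dots> = integral {0..2 * pi} (\<lambda>t. f (cis t))"
    by (rule integral_spike_set; rule negligible_subset[of "{2 * pi}"]) auto
  finally show ?thesis .
qed

lemma C_circle_intros:
  "(\<lambda>z. c) \<in> C_circle" "(\<lambda>z. z) \<in> C_circle" "cnj \<in> C_circle" "(\<lambda>z. z powi k) \<in> C_circle"
  "circle_basis k \<in> C_circle"
  "f \<in> C_circle \<Longrightarrow> g \<in> C_circle \<Longrightarrow> (\<lambda>z. f z + g z) \<in> C_circle"
  "f \<in> C_circle \<Longrightarrow> g \<in> C_circle \<Longrightarrow> (\<lambda>z. f z - g z) \<in> C_circle"
  "f \<in> C_circle \<Longrightarrow> g \<in> C_circle \<Longrightarrow> (\<lambda>z. f z * g z) \<in> C_circle"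
  "f \<in> C_circle \<Longrightarrow> (\<lambda>z. cnj (f z)) \<in> C_circle"
  "(\<And>i. i \<in> F \<Longrightarrow> h i \<in> C_circle) \<Longrightarrow> (\<lambda>z. \<Sum>i\<in>F. h i z) \<in> C_circle"
  by (auto simp: C_circle_def circle_basis_def[abs_def] intro!: continuous_intros)

lemma has_vector_derivative_cis:
  "((\<lambda>t. cis (c * t)) has_vector_derivative (\<i> * complex_of_real c * cis (c * t))) (at t within S)"
proof -
  have "((\<lambda>z. exp (\<i> * complex_of_real c * z)) has_field_derivative
      \<i> * complex_of_real c * exp (\<i> * complex_of_real c * complex_of_real t)) (at (complex_of_real t))"
    by (auto intro!: derivative_eq_intros)
  from has_vector_derivative_real_field[OF this, of S] show ?thesis
    by (simp add: cis_conv_exp mult.assoc)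
qed

text \<open>For \<open>k \<noteq> 0\<close> the function \<open>z\<^sup>k\<close> is the derivative of a periodic function.\<close>

lemma integral_powi: "(LINT z|circle_measure. z powi k) = (if k = 0 then 2 * pi else 0)"
proof (cases "k = 0")
  case True
  then show ?thesis by (subst integral_circle_eq) (auto intro: C_circle_intros simp: scaleR_conv_of_real)
next
  case False
  have "((\<lambda>t. cis (of_int k * t)) has_integral
      (cis (of_int k * (2 * pi)) / (\<i> * of_int k) - cis (of_int k * 0) / (\<i> * of_int k))) {0..2 * pi}"
  proof (rule fundamental_theorem_of_calculus)
    fix t
    from has_vector_derivative_mult_right[OF has_vector_derivative_cis[of "of_int k" t], of "inverse (\<i> * of_int k)"]
    show "((\<lambda>t. cis (of_int k * t) / (\<i> * of_int k)) has_vector_derivative cis (of_int k * t)) (at t within {0..2 * pi})"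
      using False by (simp add: field_simps)
  qed simp
  moreover have "cis (of_int k * (2 * pi)) = 1"
    using cis_multiple_2pi[of "of_int k"] by (simp add: mult.commute mult.left_commute)
  ultimately have "((\<lambda>t. cis (of_int k * t)) has_integral 0) {0..2 * pi}" by simp
  then have "integral {0..2 * pi} (\<lambda>t. cis t powi k) = 0"
    by (simp add: cis_power_int integral_unique)
  then show ?thesis using False by (simp add: integral_circle_eq C_circle_intros)
qed

lemma C_circle_L2: "f \<in> C_circle \<Longrightarrow> f \<in> L2_circle"
proof -
  assume f: "f \<in> C_circle"
  obtain C where C: "\<And>z. z \<in> sphere 0 1 \<Longrightarrow> cmod (f z) \<le> C" using C_circle_bounded[OF f] by metis
  have "integrable circle_measure (\<lambda>z. (cmod (f z))\<^sup>2)"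
    by (rule circle.integrable_const_bound[where B = "C\<^sup>2"])
      (use C_circle_measurable[OF f] in \<open>auto intro!: AE_I2 power_mono C\<close>)
  then show "f \<in> L2_circle" using C_circle_measurable[OF f] by (simp add: L2_circle_def)
qed

lemma L2_measurable: "\<phi> \<in> L2_circle \<Longrightarrow> \<phi> \<in> borel_measurable circle_measure"
  by (simp add: L2_circle_def)

lemma L2_square_integrable: "\<phi> \<in> L2_circle \<Longrightarrow> integrable circle_measure (\<lambda>z. (cmod (\<phi> z))\<^sup>2)"
  by (simp add: L2_circle_def)

lemma L2_diff: "\<phi> \<in> L2_circle \<Longrightarrow> \<psi> \<in> L2_circle \<Longrightarrow> (\<lambda>z. \<phi> z - \<psi> z) \<in> L2_circle"
proof -
  assume *: "\<phi> \<in> L2_circle" "\<psi> \<in> L2_circle"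
  have "integrable circle_measure (\<lambda>z. (cmod (\<phi> z - \<psi> z))\<^sup>2)"
  proof (rule Bochner_Integration.integrable_bound)
    show "integrable circle_measure (\<lambda>z. 2 * (cmod (\<phi> z))\<^sup>2 + 2 * (cmod (\<psi> z))\<^sup>2)"
      using * by (intro Bochner_Integration.integrable_add integrable_mult_right L2_square_integrable)
    have "norm ((cmod (\<phi> z - \<psi> z))\<^sup>2) \<le> norm (2 * (cmod (\<phi> z))\<^sup>2 + 2 * (cmod (\<psi> z))\<^sup>2)" for z
    proof -
      have "(cmod (\<phi> z - \<psi> z))\<^sup>2 \<le> (cmod (\<phi> z) + cmod (\<psi> z))\<^sup>2"
        by (intro power_mono norm_triangle_ineq4) simp
      also have "\<dots> \<le> 2 * (cmod (\<phi> z))\<^sup>2 + 2 * (cmod (\<psi> z))\<^sup>2"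
        using sum_squares_bound[of "cmod (\<phi> z)" "cmod (\<psi> z)"] by (simp add: power2_sum)
      finally show ?thesis by simp
    qed
    then show "AE z in circle_measure. norm ((cmod (\<phi> z - \<psi> z))\<^sup>2) \<le> norm (2 * (cmod (\<phi> z))\<^sup>2 + 2 * (cmod (\<psi> z))\<^sup>2)"
      by simp
  next
    have "(\<lambda>z. \<phi> z - \<psi> z) \<in> borel_measurable circle_measure"
      using * by (intro borel_measurable_diff L2_measurable)
    then show "(\<lambda>z. (cmod (\<phi> z - \<psi> z))\<^sup>2) \<in> borel_measurable circle_measure" by simp
  qed
  then show ?thesis using * by (auto simp: L2_circle_def)
qed

lemma
  assumes f: "f \<in> C_circle" and \<phi>: "\<phi> \<in> L2_circle"
    and C: "\<And>z. z \<in> sphere 0 1 \<Longrightarrow> cmod (f z) \<le> C"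
  shows L2_mult: "(\<lambda>z. f z * \<phi> z) \<in> L2_circle"
    and L2_mult_le: "(LINT z|circle_measure. (cmod (f z * \<phi> z))\<^sup>2) \<le> C\<^sup>2 * (LINT z|circle_measure. (cmod (\<phi> z))\<^sup>2)"
proof -
  have le: "(cmod (f z * \<phi> z))\<^sup>2 \<le> C\<^sup>2 * (cmod (\<phi> z))\<^sup>2" if "z \<in> sphere 0 1" for z
    using C[OF that] by (simp add: norm_mult power_mult_distrib mult_right_mono power_mono)
  have m: "(\<lambda>z. f z * \<phi> z) \<in> borel_measurable circle_measure"
    by (intro borel_measurable_times C_circle_measurable f L2_measurable \<phi>)
  have i: "integrable circle_measure (\<lambda>z. C\<^sup>2 * (cmod (\<phi> z))\<^sup>2)"
    by (intro integrable_mult_right L2_square_integrable \<phi>)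
  have i2: "integrable circle_measure (\<lambda>z. (cmod (f z * \<phi> z))\<^sup>2)"
    by (rule Bochner_Integration.integrable_bound[OF i]) (use m in \<open>auto intro!: AE_I2 simp: le\<close>)
  then show "(\<lambda>z. f z * \<phi> z) \<in> L2_circle" using m by (simp add: L2_circle_def)
  have "(LINT z|circle_measure. (cmod (f z * \<phi> z))\<^sup>2) \<le> (LINT z|circle_measure. C\<^sup>2 * (cmod (\<phi> z))\<^sup>2)"
    by (rule integral_mono[OF i2 i]) (simp add: le)
  then show "(LINT z|circle_measure. (cmod (f z * \<phi> z))\<^sup>2) \<le> C\<^sup>2 * (LINT z|circle_measure. (cmod (\<phi> z))\<^sup>2)"
    by simp
qed

lemma L2_inner_integrable:
  assumes "\<phi> \<in> L2_circle" "\<psi> \<in> L2_circle"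
  shows "integrable circle_measure (\<lambda>z. cnj (\<phi> z) * \<psi> z)"
proof (rule Bochner_Integration.integrable_bound)
  show "integrable circle_measure (\<lambda>z. (cmod (\<phi> z))\<^sup>2 + (cmod (\<psi> z))\<^sup>2)"
    using assms by (intro Bochner_Integration.integrable_add L2_square_integrable)
  have "norm (cnj (\<phi> z) * \<psi> z) \<le> norm ((cmod (\<phi> z))\<^sup>2 + (cmod (\<psi> z))\<^sup>2)" for z
  proof -
    have "2 * (cmod (\<phi> z) * cmod (\<psi> z)) \<le> (cmod (\<phi> z))\<^sup>2 + (cmod (\<psi> z))\<^sup>2"
      using sum_squares_bound[of "cmod (\<phi> z)" "cmod (\<psi> z)"] by simp
    moreover have "0 \<le> cmod (\<phi> z) * cmod (\<psi> z)" by simp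
    ultimately have "cmod (\<phi> z) * cmod (\<psi> z) \<le> (cmod (\<phi> z))\<^sup>2 + (cmod (\<psi> z))\<^sup>2" by linarith
    then show ?thesis by (simp add: norm_mult)
  qed
  then show "AE z in circle_measure. norm (cnj (\<phi> z) * \<psi> z) \<le> norm ((cmod (\<phi> z))\<^sup>2 + (cmod (\<psi> z))\<^sup>2)"
    by simp
  have "(\<lambda>z. cnj (\<phi> z)) \<in> borel_measurable circle_measure"
    using L2_measurable[OF assms(1)]
    by (rule measurable_compose[OF _ borel_measurable_continuous_onI]) (intro continuous_intros)
  then show "(\<lambda>z. cnj (\<phi> z) * \<psi> z) \<in> borel_measurable circle_measure"
    using L2_measurable[OF assms(2)] by (rule borel_measurable_times)
qed

lemma circle_inner_diff_right:
  "\<phi> \<in> L2_circle \<Longrightarrow> \<psi> \<in> L2_circle \<Longrightarrow> \<eta> \<in> L2_circle \<Longrightarrow>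
    circle_inner \<phi> (\<lambda>z. \<psi> z - \<eta> z) = circle_inner \<phi> \<psi> - circle_inner \<phi> \<eta>"
  unfolding circle_inner_def right_diff_distrib
  by (rule Bochner_Integration.integral_diff) (rule L2_inner_integrable; assumption)+

lemma circle_inner_cnj: "circle_inner \<phi> \<psi> = cnj (circle_inner \<psi> \<phi>)"
  unfolding circle_inner_def Bochner_Integration.integral_cnj[symmetric] by (simp add: mult.commute)

lemma circle_inner_sum_right:
  assumes "\<phi> \<in> L2_circle" "\<And>i. i \<in> F \<Longrightarrow> h i \<in> L2_circle"
  shows "circle_inner \<phi> (\<lambda>z. \<Sum>i\<in>F. c i * h i z) = (\<Sum>i\<in>F. c i * circle_inner \<phi> (h i))"
proof -
  have "circle_inner \<phi> (\<lambda>z. \<Sum>i\<in>F. c i * h i z) = (LINT z|circle_measure. (\<Sum>i\<in>F. c i * (cnj (\<phi> z) * h i z)))"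
    unfolding circle_inner_def by (simp add: sum_distrib_left mult.left_commute)
  also have "\<dots> = (\<Sum>i\<in>F. LINT z|circle_measure. c i * (cnj (\<phi> z) * h i z))"
    by (rule Bochner_Integration.integral_sum) (intro integrable_mult_right L2_inner_integrable assms)
  finally show ?thesis by (simp add: circle_inner_def)
qed

lemma circle_inner_self: "circle_inner \<phi> \<phi> = complex_of_real (LINT z|circle_measure. (cmod (\<phi> z))\<^sup>2)"
  unfolding circle_inner_def cnj_mult_self by (rule integral_complex_of_real)

definition fourier_coeff :: "(complex \<Rightarrow> complex) \<Rightarrow> int \<Rightarrow> complex" where
  "fourier_coeff f k = (LINT z|circle_measure. f z * z powi (- k)) / (2 * pi)"

lemma cnj_sphere: "cmod z = 1 \<Longrightarrow> cnj z = inverse z"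
  using cnj_mult_self[of z] inverse_unique[of z "cnj z"] by (simp add: mult.commute)

lemma circle_inner_basis:
  "circle_inner (circle_basis m) (\<lambda>z. f z * circle_basis n z) = fourier_coeff f (m - n)"
proof -
  have "circle_inner (circle_basis m) (\<lambda>z. f z * circle_basis n z)
      = (LINT z|circle_measure. f z * z powi (- (m - n)) / (2 * pi))"
    unfolding circle_inner_def
  proof (rule Bochner_Integration.integral_cong)
    fix z assume "z \<in> space circle_measure"
    then have z: "cmod z = 1" by simp
    then have "z \<noteq> 0" by auto
    let ?s = "complex_of_real (sqrt (2 * pi))"
    have 1: "?s * ?s = complex_of_real (2 * pi)"
      by (simp only: of_real_mult[symmetric] real_sqrt_mult_self) simp
    have 2: "z powi (- m) * z powi n = z powi (- (m - n))"
      using \<open>z \<noteq> 0\<close> by (simp flip: power_int_add)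
    have 3: "cnj (circle_basis m z) = z powi (- m) / ?s"
      by (simp add: circle_basis_def cnj_sphere[OF z] power_int_minus power_int_inverse)
    have "cnj (circle_basis m z) * (f z * circle_basis n z) = f z * (z powi (- m) * z powi n) / (?s * ?s)"
      unfolding 3 unfolding circle_basis_def by simp
    then show "cnj (circle_basis m z) * (f z * circle_basis n z) = f z * z powi (- (m - n)) / (2 * pi)"
      unfolding 1 2 by simp
  qed simp
  then show ?thesis by (simp add: fourier_coeff_def)
qed

lemma fourier_coeff_one: "fourier_coeff (\<lambda>_. 1) k = (if k = 0 then 1 else 0)"
  by (simp add: fourier_coeff_def integral_powi)

lemma circle_basis_orthonormal: "circle_inner (circle_basis m) (circle_basis n) = (if m = n then 1 else 0)"
  using circle_inner_basis[of m "\<lambda>_. 1" n] by (simp add: fourier_coeff_one)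

lemma integral_trig_sum:
  assumes F: "finite F"
  shows "(LINT z|circle_measure. (cmod (\<Sum>k\<in>F. c k * circle_basis k z))\<^sup>2) = (\<Sum>k\<in>F. (cmod (c k))\<^sup>2)"
proof -
  let ?h = "\<lambda>z. \<Sum>k\<in>F. c k * circle_basis k z"
  have h: "?h \<in> L2_circle" by (intro C_circle_L2 C_circle_intros)
  have "circle_inner ?h (circle_basis k) = (if k \<in> F then cnj (c k) else 0)" for k
  proof -
    have "circle_inner ?h (circle_basis k) = cnj (circle_inner (circle_basis k) ?h)" by (rule circle_inner_cnj)
    also have "circle_inner (circle_basis k) ?h = (\<Sum>j\<in>F. c j * circle_inner (circle_basis k) (circle_basis j))"
      by (intro circle_inner_sum_right C_circle_L2 C_circle_intros)
    also have "\<dots> = (if k \<in> F then c k else 0)"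
      using F by (simp add: circle_basis_orthonormal if_distrib cong: if_cong)
    finally show ?thesis by simp
  qed
  then have "(\<Sum>k\<in>F. c k * circle_inner ?h (circle_basis k)) = (\<Sum>k\<in>F. complex_of_real ((cmod (c k))\<^sup>2))"
    by (intro sum.cong refl) (simp only: if_True complex_norm_square)
  moreover have "circle_inner ?h ?h = (\<Sum>k\<in>F. c k * circle_inner ?h (circle_basis k))"
    by (intro circle_inner_sum_right h C_circle_L2 C_circle_intros)
  ultimately have "circle_inner ?h ?h = (\<Sum>k\<in>F. complex_of_real ((cmod (c k))\<^sup>2))"
    by simp
  then have "complex_of_real (LINT z|circle_measure. (cmod (?h z))\<^sup>2) = complex_of_real (\<Sum>k\<in>F. (cmod (c k))\<^sup>2)"
    unfolding circle_inner_self by simp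
  then show ?thesis by (simp only: of_real_eq_iff)
qed

lemma circle_Bessel:
  assumes g: "g \<in> L2_circle" and F: "finite F"
  shows "(\<Sum>m\<in>F. (cmod (circle_inner (circle_basis m) g))\<^sup>2) \<le> (LINT z|circle_measure. (cmod (g z))\<^sup>2)"
proof -
  let ?c = "\<lambda>m. circle_inner (circle_basis m) g"
  let ?h = "\<lambda>z. \<Sum>k\<in>F. ?c k * circle_basis k z"
  let ?s = "\<Sum>m\<in>F. (cmod (?c m))\<^sup>2"
  have h: "?h \<in> L2_circle" by (intro C_circle_L2 C_circle_intros)
  have d: "(\<lambda>z. g z - ?h z) \<in> L2_circle" by (rule L2_diff[OF g h])
  have gh: "circle_inner g ?h = complex_of_real ?s"
  proof -
    have "circle_inner g ?h = (\<Sum>m\<in>F. ?c m * circle_inner g (circle_basis m))"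
      by (intro circle_inner_sum_right g C_circle_L2 C_circle_intros)
    also have "\<dots> = (\<Sum>m\<in>F. complex_of_real ((cmod (?c m))\<^sup>2))"
      by (intro sum.cong refl) (subst (2) circle_inner_cnj, simp only: complex_norm_square)
    finally show ?thesis by simp
  qed
  have hh: "circle_inner ?h ?h = complex_of_real ?s"
    unfolding circle_inner_self integral_trig_sum[OF F] ..
  have hg: "circle_inner ?h g = complex_of_real ?s" by (subst circle_inner_cnj) (simp add: gh)
  have "complex_of_real (LINT z|circle_measure. (cmod (g z - ?h z))\<^sup>2) = circle_inner (\<lambda>z. g z - ?h z) (\<lambda>z. g z - ?h z)"
    by (rule circle_inner_self[symmetric])
  also have "\<dots> = circle_inner (\<lambda>z. g z - ?h z) g - circle_inner (\<lambda>z. g z - ?h z) ?h"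
    by (intro circle_inner_diff_right d g h)
  also have "circle_inner (\<lambda>z. g z - ?h z) g = cnj (circle_inner g g - circle_inner g ?h)"
    by (subst circle_inner_cnj) (simp only: circle_inner_diff_right[OF g g h])
  also have "circle_inner (\<lambda>z. g z - ?h z) ?h = cnj (circle_inner ?h g - circle_inner ?h ?h)"
    by (subst circle_inner_cnj) (simp only: circle_inner_diff_right[OF h g h])
  finally have "complex_of_real (LINT z|circle_measure. (cmod (g z - ?h z))\<^sup>2)
      = complex_of_real ((LINT z|circle_measure. (cmod (g z))\<^sup>2) - ?s)"
    by (simp only: gh hh hg circle_inner_self) simp
  then have "(LINT z|circle_measure. (cmod (g z))\<^sup>2) - ?s = (LINT z|circle_measure. (cmod (g z - ?h z))\<^sup>2)"
    by (simp only: of_real_eq_iff)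
  also have "\<dots> \<ge> 0" by simp
  finally show ?thesis by simp
qed

section \<open>The Hardy space embedding and Toeplitz operators\<close>

definition partial_sum :: "ell2 \<Rightarrow> nat \<Rightarrow> complex \<Rightarrow> complex" where
  "partial_sum x n z = (\<Sum>k<n. entry x k * circle_basis (int k) z)"

definition tail :: "ell2 \<Rightarrow> nat \<Rightarrow> real" where
  "tail x n = (\<Sum>k. (cmod (entry x (k + n)))\<^sup>2)"

lemma tail_tendsto: "tail x \<longlonglongrightarrow> 0"
  unfolding tail_def[abs_def] by (rule suminf_exist_split2[OF summable_entry])

lemma tail_nonneg: "0 \<le> tail x n"
  unfolding tail_def by (rule suminf_nonneg) (use summable_ignore_initial_segment[OF summable_entry] in auto)

lemma partial_sum_C_circle: "partial_sum x n \<in> C_circle"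
  unfolding partial_sum_def[abs_def] by (intro C_circle_intros)

lemma sum_int_image: "(\<Sum>k\<in>int ` A. f k) = (\<Sum>k\<in>A. f (int k))"
  by (subst sum.reindex) auto

lemma integral_partial_sum_sum:
  assumes "finite A"
  shows "(LINT z|circle_measure. (cmod (\<Sum>k\<in>A. c k * circle_basis (int k) z))\<^sup>2) = (\<Sum>k\<in>A. (cmod (c k))\<^sup>2)"
  using integral_trig_sum[of "int ` A" "\<lambda>k. c (nat k)"] assms by (simp add: sum_int_image)

lemma partial_sum_dist:
  assumes "m \<le> n"
  shows "(LINT z|circle_measure. (cmod (partial_sum x n z - partial_sum x m z))\<^sup>2) \<le> tail x m"
proof -
  have "partial_sum x n z - partial_sum x m z = (\<Sum>k\<in>{m..<n}. entry x k * circle_basis (int k) z)" for z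
    unfolding partial_sum_def using assms sum_diff_nat_ivl[of 0 m n "\<lambda>k. entry x k * circle_basis (int k) z"]
    by (simp add: atLeast0LessThan)
  then have "(LINT z|circle_measure. (cmod (partial_sum x n z - partial_sum x m z))\<^sup>2) = (\<Sum>k\<in>{m..<n}. (cmod (entry x k))\<^sup>2)"
    by (simp add: integral_partial_sum_sum)
  also have "\<dots> = (\<Sum>k<n - m. (cmod (entry x (k + m)))\<^sup>2)"
    using assms sum.shift_bounds_nat_ivl[of "\<lambda>k. (cmod (entry x k))\<^sup>2" 0 m "n - m"]
    by (simp add: atLeast0LessThan)
  also have "\<dots> \<le> tail x m"
    unfolding tail_def
    by (rule sum_le_suminf) (use summable_ignore_initial_segment[OF summable_entry] in auto)
  finally show ?thesis .
qed

lemma partial_sum_dist_sym: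
  "(LINT z|circle_measure. (cmod (partial_sum x n z - partial_sum x m z))\<^sup>2) \<le> tail x m + tail x n"
proof (cases "m \<le> n")
  case True
  then show ?thesis using partial_sum_dist[of m n x] tail_nonneg[of x n] by simp
next
  case False
  then show ?thesis using partial_sum_dist[of n m x] tail_nonneg[of x m] by (simp add: norm_minus_commute)
qed

lemma integral_partial_sum: "(LINT z|circle_measure. (cmod (partial_sum x n z))\<^sup>2) \<le> (norm x)\<^sup>2"
proof -
  have "(LINT z|circle_measure. (cmod (partial_sum x n z))\<^sup>2) = (\<Sum>k<n. (cmod (entry x k))\<^sup>2)"
    unfolding partial_sum_def by (rule integral_partial_sum_sum) simp
  then show ?thesis using sum_entry_le_norm[of x n] by simp
qed

text \<open>Bounds an integral of \<open>a\<close> by one of \<open>a\<^sup>2\<close>; the weight \<open>c\<close> is to be adapted to the size of the latter.\<close>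

lemma le_scaled_square:
  fixes a c :: real
  assumes "c > 0" shows "a \<le> c * a\<^sup>2 + 1 / c"
proof (cases "a \<le> 1 / c")
  case False
  moreover have "0 < 1 / c" using assms by simp
  ultimately have "0 \<le> a" by linarith
  have "1 \<le> c * a" using False assms by (simp add: field_simps)
  then have "a * 1 \<le> a * (c * a)" using \<open>0 \<le> a\<close> by (intro mult_left_mono)
  then have "a \<le> c * a\<^sup>2" by (simp add: power2_eq_square algebra_simps)
  then show ?thesis using assms by (simp add: add_increasing2)
qed (use assms in \<open>simp add: add_increasing\<close>)

text \<open>A subsequence of the partial sums with summable increments converges almost everywhere, and
  Fatou's lemma turns the pointwise limit into a limit in the mean.\<close>

lemma Riesz_Fischer_circle:
  "\<exists>\<phi>\<in>L2_circle. (\<lambda>n. LINT z|circle_measure. (cmod (\<phi> z - partial_sum x n z))\<^sup>2) \<longlonglongrightarrow> 0"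
proof -
  let ?M = circle_measure
  \<comment> \<open>the increments are then of order \<open>(1/2)\<^sup>j\<close> in \<open>L\<^sub>2\<close>, which is summable\<close>
  have "\<exists>N. tail x N < (1/4) ^ j" for j
    using tail_tendsto[of x] LIMSEQ_D[of "tail x" 0 "(1/4) ^ j"] tail_nonneg[of x] by fastforce
  then obtain N where N: "\<And>j. tail x (N j) < (1/4) ^ j" by metis
  define G where "G j z = partial_sum x (N (Suc j)) z - partial_sum x (N j) z" for j z
  have G_C: "G j \<in> C_circle" for j
    unfolding G_def[abs_def] by (intro C_circle_intros partial_sum_C_circle)
  have sqint: "integrable ?M (\<lambda>z. (cmod (f z))\<^sup>2)" if "f \<in> C_circle" for f
    using L2_square_integrable[OF C_circle_L2[OF that]] .
  have norm_int: "integrable ?M (\<lambda>z. cmod (G j z))" for j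
    using C_circle_integrable[OF G_C] by (rule Bochner_Integration.integrable_norm)
  define c where "c = 2 + measure ?M (space ?M)"
  have int_le: "(LINT z|?M. cmod (G j z)) \<le> c * (1/2) ^ j" for j
  proof -
    \<comment> \<open>the weight \<open>2\<^sup>j\<close> balances the bound \<open>2 (1/4)\<^sup>j\<close> of the integral of the square\<close>
    have "(LINT z|?M. cmod (G j z)) \<le> (LINT z|?M. 2 ^ j * (cmod (G j z))\<^sup>2 + 1 / 2 ^ j)"
      using norm_int by (rule integral_mono) (auto intro!: le_scaled_square sqint[OF G_C])
    also have "\<dots> = 2 ^ j * (LINT z|?M. (cmod (G j z))\<^sup>2) + measure ?M (space ?M) / 2 ^ j"
      using sqint[OF G_C] by (subst Bochner_Integration.integral_add) auto
    also have "(LINT z|?M. (cmod (G j z))\<^sup>2) \<le> 2 * (1/4) ^ j"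
    proof -
      have "tail x (N j) + tail x (N (Suc j)) \<le> 2 * (1/4) ^ j"
        using N[of j] N[of "Suc j"] zero_le_power[of "1/4::real" j] by (simp, linarith)
      then show ?thesis using partial_sum_dist_sym[of x "N (Suc j)" "N j"] by (simp add: G_def)
    qed
    finally have "(LINT z|?M. cmod (G j z)) \<le> 2 ^ j * (2 * (1/4) ^ j) + measure ?M (space ?M) / 2 ^ j"
      by (simp add: mult_left_mono)
    also have "(2::real) ^ j * (2 * (1/4) ^ j) = 2 * (1/2) ^ j"
      by (simp flip: power_mult_distrib)
    finally show ?thesis by (simp add: c_def field_simps power_one_over)
  qed
  have c: "c \<ge> 0" by (simp add: c_def)
  have "AE z in ?M. (\<Sum>j. ennreal (cmod (G j z))) \<noteq> \<infinity>"
  proof (rule nn_integral_noteq_infinite)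
    have meas: "(\<lambda>z. ennreal (cmod (G j z))) \<in> borel_measurable ?M" for j
      using C_circle_measurable[OF G_C[of j]] by simp
    then show "(\<lambda>z. \<Sum>j. ennreal (cmod (G j z))) \<in> borel_measurable ?M" by simp
    have "(\<integral>\<^sup>+z. (\<Sum>j. ennreal (cmod (G j z))) \<partial>?M) = (\<Sum>j. \<integral>\<^sup>+z. ennreal (cmod (G j z)) \<partial>?M)"
      by (rule nn_integral_suminf) (rule meas)
    also have "\<dots> = (\<Sum>j. ennreal (LINT z|?M. cmod (G j z)))"
      by (simp add: nn_integral_eq_integral[OF norm_int])
    also have "\<dots> \<le> (\<Sum>j. ennreal (c * (1/2) ^ j))"
      by (intro suminf_le ennreal_leI int_le) auto
    also have "\<dots> = ennreal (\<Sum>j. c * (1/2) ^ j)"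
      using c by (intro suminf_ennreal2) (auto intro!: summable_mult summable_geometric)
    finally show "(\<integral>\<^sup>+z. (\<Sum>j. ennreal (cmod (G j z))) \<partial>?M) \<noteq> \<infinity>"
      by (auto simp: top_unique)
  qed
  then have conv: "AE z in ?M. convergent (\<lambda>j. partial_sum x (N j) z)"
  proof eventually_elim
    case (elim z)
    then have "summable (\<lambda>j. cmod (G j z))"
      by (intro summable_suminf_not_top) auto
    then have "summable (\<lambda>j. G j z)" by (rule summable_norm_cancel)
    then have "convergent (\<lambda>n. \<Sum>j<n. G j z)" by (simp add: summable_iff_convergent)
    moreover have "(\<Sum>j<n. G j z) = partial_sum x (N n) z - partial_sum x (N 0) z" for n
      unfolding G_def by (rule sum_lessThan_telescope)
    ultimately have "convergent (\<lambda>n. partial_sum x (N n) z - partial_sum x (N 0) z)" by simp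
    then show "convergent (\<lambda>n. partial_sum x (N n) z)"
      using convergent_add_const_iff[of "- partial_sum x (N 0) z" "\<lambda>n. partial_sum x (N n) z"] by simp
  qed
  define \<phi> where "\<phi> z = lim (\<lambda>j. partial_sum x (N j) z)" for z
  have \<phi>m: "\<phi> \<in> borel_measurable ?M"
    unfolding \<phi>_def[abs_def] by (rule borel_measurable_lim_metric) (rule C_circle_measurable[OF partial_sum_C_circle])
  have nn: "(\<integral>\<^sup>+z. ennreal ((cmod (\<phi> z - partial_sum x n z))\<^sup>2) \<partial>?M) \<le> ennreal (tail x n)" for n
  proof -
    let ?u = "\<lambda>j z. ennreal ((cmod (partial_sum x (N j) z - partial_sum x n z))\<^sup>2)"
    have um: "?u j \<in> borel_measurable ?M" for j
      using C_circle_measurable[OF partial_sum_C_circle[of x "N j"]] C_circle_measurable[OF partial_sum_C_circle[of x n]] by simp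
    have "AE z in ?M. ennreal ((cmod (\<phi> z - partial_sum x n z))\<^sup>2) = liminf (\<lambda>j. ?u j z)"
      using conv
    proof eventually_elim
      case (elim z)
      then have "(\<lambda>j. partial_sum x (N j) z) \<longlonglongrightarrow> \<phi> z"
        unfolding \<phi>_def by (simp add: convergent_LIMSEQ_iff)
      then have "(\<lambda>j. ?u j z) \<longlonglongrightarrow> ennreal ((cmod (\<phi> z - partial_sum x n z))\<^sup>2)"
        by (intro tendsto_ennrealI tendsto_intros)
      then show ?case by (intro lim_imp_Liminf[symmetric]) auto
    qed
    then have "(\<integral>\<^sup>+z. ennreal ((cmod (\<phi> z - partial_sum x n z))\<^sup>2) \<partial>?M) = (\<integral>\<^sup>+z. liminf (\<lambda>j. ?u j z) \<partial>?M)"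
      by (rule nn_integral_cong_AE)
    also have "\<dots> \<le> liminf (\<lambda>j. \<integral>\<^sup>+z. ?u j z \<partial>?M)"
      by (rule nn_integral_liminf) (rule um)
    also have "\<dots> \<le> liminf (\<lambda>j. ennreal (tail x n + (1/4) ^ j))"
    proof (rule Liminf_mono, rule always_eventually, rule allI)
      fix j
      have "(\<lambda>z. partial_sum x (N j) z - partial_sum x n z) \<in> C_circle" by (intro C_circle_intros partial_sum_C_circle)
      then have "(\<integral>\<^sup>+z. ?u j z \<partial>?M) = ennreal (LINT z|?M. (cmod (partial_sum x (N j) z - partial_sum x n z))\<^sup>2)"
        by (intro nn_integral_eq_integral sqint) auto
      also have "\<dots> \<le> ennreal (tail x n + (1/4) ^ j)"
        using partial_sum_dist_sym[of x "N j" n] N[of j] by (intro ennreal_leI) linarith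
      finally show "(\<integral>\<^sup>+z. ?u j z \<partial>?M) \<le> ennreal (tail x n + (1/4) ^ j)" .
    qed
    also have "\<dots> = ennreal (tail x n + 0)"
      by (intro lim_imp_Liminf tendsto_ennrealI tendsto_add tendsto_const LIMSEQ_power_zero) auto
    finally show ?thesis by simp
  qed
  have dm: "(\<lambda>z. (cmod (\<phi> z - partial_sum x n z))\<^sup>2) \<in> borel_measurable ?M" for n
    using \<phi>m C_circle_measurable[OF partial_sum_C_circle[of x n]] by simp
  have di: "integrable ?M (\<lambda>z. (cmod (\<phi> z - partial_sum x n z))\<^sup>2)" for n
    using nn[of n] by (intro integrableI_nonneg dm) (auto intro: order.strict_trans1)
  have le: "(LINT z|?M. (cmod (\<phi> z - partial_sum x n z))\<^sup>2) \<le> tail x n" for n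
    using nn[of n] by (subst (asm) nn_integral_eq_integral[OF di]) (auto simp: ennreal_le_iff tail_nonneg)
  have "\<phi> \<in> L2_circle"
    using di[of 0] \<phi>m by (simp add: L2_circle_def partial_sum_def)
  moreover have "(\<lambda>n. LINT z|?M. (cmod (\<phi> z - partial_sum x n z))\<^sup>2) \<longlonglongrightarrow> 0"
    by (rule tendsto_sandwich[OF _ _ tendsto_const tail_tendsto[of x]]) (auto simp: le)
  ultimately show ?thesis by blast
qed

lemma hardy_embed_L2: "hardy_embed x \<in> L2_circle"
  and hardy_embed_tendsto:
    "(\<lambda>n. LINT z|circle_measure. (cmod (hardy_embed x z - partial_sum x n z))\<^sup>2) \<longlonglongrightarrow> 0"
proof -
  have "\<exists>\<phi>. \<phi> \<in> L2_circle \<and> (\<lambda>n. LINT z|circle_measure. (cmod (\<phi> z - partial_sum x n z))\<^sup>2) \<longlonglongrightarrow> 0"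
    using Riesz_Fischer_circle by blast
  from someI_ex[OF this] show "hardy_embed x \<in> L2_circle"
    "(\<lambda>n. LINT z|circle_measure. (cmod (hardy_embed x z - partial_sum x n z))\<^sup>2) \<longlonglongrightarrow> 0"
    unfolding hardy_embed_def partial_sum_def by auto
qed

text \<open>The coefficients of \<open>f \<phi>\<close>, for \<open>\<phi>\<close> the function of a sequence \<open>x\<close>, are obtained from the partial
  sums by Bessel's inequality: this gives the matrix of the Toeplitz operator and its norm bound, and
  makes the choice of \<open>\<phi>\<close> irrelevant.\<close>

lemma toeplitz_coeff_partial:
  assumes f: "f \<in> C_circle"
  shows "circle_inner (circle_basis (int m)) (\<lambda>z. f z * partial_sum x n z) =
    (\<Sum>k<n. entry x k * fourier_coeff f (int m - int k))"
proof -
  have "circle_inner (circle_basis (int m)) (\<lambda>z. f z * partial_sum x n z) =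
     circle_inner (circle_basis (int m)) (\<lambda>z. \<Sum>k<n. entry x k * (f z * circle_basis (int k) z))"
    unfolding partial_sum_def by (simp add: sum_distrib_left mult.left_commute)
  also have "\<dots> = (\<Sum>k<n. entry x k * circle_inner (circle_basis (int m)) (\<lambda>z. f z * circle_basis (int k) z))"
    by (intro circle_inner_sum_right C_circle_L2 C_circle_intros f)
  finally show ?thesis by (simp add: circle_inner_basis)
qed

lemma toeplitz_coeff_sums:
  assumes f: "f \<in> C_circle"
  shows "(\<lambda>k. entry x k * fourier_coeff f (int m - int k)) sums
    circle_inner (circle_basis (int m)) (\<lambda>z. f z * hardy_embed x z)"
proof -
  obtain C where C: "\<And>z. z \<in> sphere 0 1 \<Longrightarrow> cmod (f z) \<le> C" using C_circle_bounded[OF f] by metis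
  let ?\<phi> = "hardy_embed x"
  let ?a = "\<lambda>n. circle_inner (circle_basis (int m)) (\<lambda>z. f z * partial_sum x n z)"
  let ?l = "circle_inner (circle_basis (int m)) (\<lambda>z. f z * ?\<phi> z)"
  note L2 = L2_mult[OF f hardy_embed_L2 C] L2_mult[OF f C_circle_L2[OF partial_sum_C_circle] C]
    L2_diff[OF hardy_embed_L2 C_circle_L2[OF partial_sum_C_circle]]
  have le: "(cmod (?l - ?a n))\<^sup>2 \<le> C\<^sup>2 * (LINT z|circle_measure. (cmod (?\<phi> z - partial_sum x n z))\<^sup>2)" for n
  proof -
    have "?l - ?a n = circle_inner (circle_basis (int m)) (\<lambda>z. f z * (?\<phi> z - partial_sum x n z))"
      unfolding right_diff_distrib
      by (rule circle_inner_diff_right[symmetric]) (rule C_circle_L2[OF C_circle_intros(5)] L2 | assumption)+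
    then have "(cmod (?l - ?a n))\<^sup>2 = (\<Sum>m\<in>{int m}. (cmod (circle_inner (circle_basis m) (\<lambda>z. f z * (?\<phi> z - partial_sum x n z))))\<^sup>2)"
      by simp
    also have "\<dots> \<le> (LINT z|circle_measure. (cmod (f z * (?\<phi> z - partial_sum x n z)))\<^sup>2)"
      by (rule circle_Bessel[OF L2_mult[OF f L2(3) C]]) auto
    also have "\<dots> \<le> C\<^sup>2 * (LINT z|circle_measure. (cmod (?\<phi> z - partial_sum x n z))\<^sup>2)"
      by (rule L2_mult_le[OF f L2(3) C])
    finally show ?thesis .
  qed
  have "(\<lambda>n. (cmod (?l - ?a n))\<^sup>2) \<longlonglongrightarrow> 0"
    by (rule tendsto_sandwich[OF _ _ tendsto_const tendsto_mult_right_zero[OF hardy_embed_tendsto]])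
      (auto intro!: always_eventually le)
  then have "(\<lambda>n. sqrt ((cmod (?l - ?a n))\<^sup>2)) \<longlonglongrightarrow> sqrt 0" by (rule tendsto_real_sqrt)
  then have "(\<lambda>n. ?l - ?a n) \<longlonglongrightarrow> 0" by (simp add: tendsto_norm_zero_iff)
  from tendsto_diff[OF tendsto_const[of ?l] this] have "?a \<longlonglongrightarrow> ?l" by simp
  then show ?thesis by (simp add: sums_def toeplitz_coeff_partial[OF f])
qed

lemma toeplitz_coeff_bound:
  assumes f: "f \<in> C_circle" and C: "\<And>z. z \<in> sphere 0 1 \<Longrightarrow> cmod (f z) \<le> C" and F: "finite F"
  shows "(\<Sum>m\<in>F. (cmod (circle_inner (circle_basis (int m)) (\<lambda>z. f z * hardy_embed x z)))\<^sup>2) \<le> (C * norm x)\<^sup>2"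
proof (rule tendsto_upperbound)
  let ?a = "\<lambda>m n. circle_inner (circle_basis (int m)) (\<lambda>z. f z * partial_sum x n z)"
  show "(\<lambda>n. \<Sum>m\<in>F. (cmod (?a m n))\<^sup>2) \<longlonglongrightarrow>
      (\<Sum>m\<in>F. (cmod (circle_inner (circle_basis (int m)) (\<lambda>z. f z * hardy_embed x z)))\<^sup>2)"
    unfolding toeplitz_coeff_partial[OF f]
    using toeplitz_coeff_sums[OF f, of x] by (intro tendsto_intros) (simp add: sums_def)
  have "(\<Sum>m\<in>F. (cmod (?a m n))\<^sup>2) \<le> (C * norm x)\<^sup>2" for n
  proof -
    have "(\<Sum>m\<in>F. (cmod (?a m n))\<^sup>2) = (\<Sum>m\<in>int ` F. (cmod (circle_inner (circle_basis m) (\<lambda>z. f z * partial_sum x n z)))\<^sup>2)"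
      by (simp add: sum_int_image)
    also have "\<dots> \<le> (LINT z|circle_measure. (cmod (f z * partial_sum x n z))\<^sup>2)"
      using F by (intro circle_Bessel L2_mult[OF f C_circle_L2[OF partial_sum_C_circle] C]) auto
    also have "\<dots> \<le> C\<^sup>2 * (LINT z|circle_measure. (cmod (partial_sum x n z))\<^sup>2)"
      by (rule L2_mult_le[OF f C_circle_L2[OF partial_sum_C_circle] C])
    also have "\<dots> \<le> C\<^sup>2 * (norm x)\<^sup>2" by (intro mult_left_mono integral_partial_sum) simp
    finally show ?thesis by (simp add: power_mult_distrib)
  qed
  then show "\<forall>\<^sub>F n in sequentially. (\<Sum>m\<in>F. (cmod (?a m n))\<^sup>2) \<le> (C * norm x)\<^sup>2" by simp
qed simp

text \<open>The function of a sequence is determined only up to null sets, so linearity of the coordinates of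
  \<open>T\<^sub>f x\<close> in \<open>x\<close> is read off from the series for them; by Bessel's inequality they are square
  summable with the bound \<open>C |x|\<close>.\<close>

theorem
  assumes f: "f \<in> C_circle"
  shows toeplitz_bops: "toeplitz f \<in> bops"
    and toeplitz_norm: "(\<And>z. z \<in> sphere 0 1 \<Longrightarrow> cmod (f z) \<le> C) \<Longrightarrow> norm (toeplitz f) \<le> C"
    and toeplitz_entry: "mat_entry (toeplitz f) m n = fourier_coeff f (int m - int n)"
proof -
  let ?c = "\<lambda>m x. circle_inner (circle_basis (int m)) (\<lambda>z. f z * hardy_embed x z)"
  have ex: "toeplitz f \<in> bops \<and> norm (toeplitz f) \<le> C \<and>
      (\<forall>x m. entry (toeplitz f \<cdot> x) m = ?c m x)"
    if C: "\<And>z. z \<in> sphere 0 1 \<Longrightarrow> cmod (f z) \<le> C" for C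
  proof -
    have "C \<ge> 0" using C[of 1] norm_ge_zero[of "f 1"] by (simp, linarith)
    have "\<exists>T\<in>bops. norm T \<le> C \<and> (\<forall>x m. cinner (ebasis m) (T \<cdot> x) = ?c m x)"
    proof (rule std.ex_op[OF _ _ \<open>C \<ge> 0\<close>])
      fix x y m and a :: complex
      show "?c m (x + y) = ?c m x + ?c m y"
        using sums_add[OF toeplitz_coeff_sums[OF f, of x m] toeplitz_coeff_sums[OF f, of y m]]
        by (intro sums_unique2[OF toeplitz_coeff_sums[OF f]]) (simp add: distrib_right)
      show "?c m (a *\<^sub>C x) = a * ?c m x"
        using sums_mult[OF toeplitz_coeff_sums[OF f, of x m], of a]
        by (intro sums_unique2[OF toeplitz_coeff_sums[OF f]]) (simp add: mult.assoc)
    qed (rule toeplitz_coeff_bound[OF f C])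
    then obtain T where T: "T \<in> bops" "norm T \<le> C" "\<And>x m. entry (T \<cdot> x) m = ?c m x"
      by auto
    have "hardy_proj (\<lambda>z. f z * hardy_embed x z) = T \<cdot> x" for x
      unfolding hardy_proj_def T(3)[symmetric] by (rule entry_inverse)
    then have "toeplitz f = T" by (simp add: toeplitz_def blinfun_apply_inverse)
    then show ?thesis using T by simp
  qed
  then show "(\<And>z. z \<in> sphere 0 1 \<Longrightarrow> cmod (f z) \<le> C) \<Longrightarrow> norm (toeplitz f) \<le> C" by blast
  obtain C where "\<And>z. z \<in> sphere 0 1 \<Longrightarrow> cmod (f z) \<le> C" using C_circle_bounded[OF f] by metis
  from ex[OF this] have T: "toeplitz f \<in> bops" "\<And>x m. entry (toeplitz f \<cdot> x) m = ?c m x"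
    by auto
  from T(1) show "toeplitz f \<in> bops" .
  have "(\<lambda>k. entry (ebasis n) k * fourier_coeff f (int m - int k)) sums (\<Sum>k\<in>{n}. entry (ebasis n) k * fourier_coeff f (int m - int k))"
    by (rule sums_finite) (auto simp: entry_ebasis)
  from sums_unique2[OF toeplitz_coeff_sums[OF f] this]
  show "mat_entry (toeplitz f) m n = fourier_coeff f (int m - int n)"
    by (simp add: T(2) entry_ebasis)
qed

section \<open>The Toeplitz algebra\<close>

lemma fourier_coeff_cong: "(\<And>z. z \<in> sphere 0 1 \<Longrightarrow> f z = g z) \<Longrightarrow> fourier_coeff f k = fourier_coeff g k"
  unfolding fourier_coeff_def by (intro arg_cong2[of _ _ _ _ "(/)"] Bochner_Integration.integral_cong) auto

lemma toeplitz_cong: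
  assumes "f \<in> C_circle" "g \<in> C_circle" "\<And>z. z \<in> sphere 0 1 \<Longrightarrow> f z = g z"
  shows "toeplitz f = toeplitz g"
  using assms by (intro ell2_ops_eqI) (simp_all add: toeplitz_bops toeplitz_entry, intro fourier_coeff_cong, auto)

lemma fourier_coeff_add:
  assumes "f \<in> C_circle" "g \<in> C_circle" shows "fourier_coeff (\<lambda>z. f z + g z) k = fourier_coeff f k + fourier_coeff g k"
proof -
  have "(LINT z|circle_measure. f z * z powi (- k) + g z * z powi (- k))
      = (LINT z|circle_measure. f z * z powi (- k)) + (LINT z|circle_measure. g z * z powi (- k))"
    by (intro Bochner_Integration.integral_add C_circle_integrable C_circle_intros assms)
  then show ?thesis by (simp add: fourier_coeff_def distrib_right add_divide_distrib)
qed

lemma fourier_coeff_scale: "fourier_coeff (\<lambda>z. c * f z) k = c * fourier_coeff f k"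
  by (simp add: fourier_coeff_def mult.assoc)

lemma fourier_coeff_cnj: "fourier_coeff (\<lambda>z. cnj (f z)) k = cnj (fourier_coeff f (- k))"
proof -
  have "(LINT z|circle_measure. cnj (f z) * z powi (- k)) = (LINT z|circle_measure. cnj (f z * z powi k))"
    by (intro Bochner_Integration.integral_cong) (auto simp: cnj_sphere power_int_minus power_int_inverse)
  also have "\<dots> = cnj (LINT z|circle_measure. f z * z powi k)" by (rule Bochner_Integration.integral_cnj)
  finally show ?thesis by (simp add: fourier_coeff_def)
qed

lemma fourier_coeff_shift: "fourier_coeff (\<lambda>z. z * f z) k = fourier_coeff f (k - 1)"
proof -
  have "(LINT z|circle_measure. z * f z * z powi (- k)) = (LINT z|circle_measure. f z * z powi (- (k - 1)))"
  proof (intro Bochner_Integration.integral_cong refl)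
    fix z assume "z \<in> space circle_measure"
    then have "z \<noteq> 0" by auto
    then have "z powi (1 - k) = z * z powi (- k)"
      using power_int_add[of z 1 "- k"] by simp
    then show "z * f z * z powi (- k) = f z * z powi (- (k - 1))" by simp
  qed
  then show ?thesis by (simp add: fourier_coeff_def)
qed

lemma fourier_coeff_shift_cnj: "fourier_coeff (\<lambda>z. cnj z * f z) k = fourier_coeff f (k + 1)"
proof -
  have "fourier_coeff f (k + 1) = fourier_coeff (\<lambda>z. z * (cnj z * f z)) (k + 1)"
    by (rule fourier_coeff_cong) (simp add: mult.assoc[symmetric] cnj_mult_self mult.commute[of _ "cnj _"])
  then show ?thesis by (simp add: fourier_coeff_shift)
qed

lemma toeplitz_add: "f \<in> C_circle \<Longrightarrow> g \<in> C_circle \<Longrightarrow> toeplitz (\<lambda>z. f z + g z) = toeplitz f + toeplitz g"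
  by (intro ell2_ops_eqI bops_add toeplitz_bops C_circle_intros)
    (simp_all add: toeplitz_entry fourier_coeff_add blinfun.add_left C_circle_intros)

lemma toeplitz_scale: "f \<in> C_circle \<Longrightarrow> toeplitz (\<lambda>z. c * f z) = scaleC_op c (toeplitz f)"
  by (intro ell2_ops_eqI bops_scaleC toeplitz_bops C_circle_intros)
    (simp_all add: toeplitz_entry fourier_coeff_scale C_circle_intros)

lemma toeplitz_diff: "f \<in> C_circle \<Longrightarrow> g \<in> C_circle \<Longrightarrow> toeplitz (\<lambda>z. f z - g z) = toeplitz f - toeplitz g"
  using toeplitz_add[of f "\<lambda>z. - 1 * g z"] toeplitz_scale[of g "- 1"]
  by (simp add: C_circle_intros uminus_eq_scaleC_op[symmetric] C_circle_intros(8)[of "\<lambda>_. - 1" g, simplified])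

lemma toeplitz_cnj: "f \<in> C_circle \<Longrightarrow> toeplitz (\<lambda>z. cnj (f z)) = adj (toeplitz f)"
  by (intro ell2_ops_eqI std.adj_works(2) toeplitz_bops C_circle_intros)
    (simp_all add: toeplitz_entry fourier_coeff_cnj entry_adj toeplitz_bops C_circle_intros)

lemma toeplitz_one: "toeplitz (\<lambda>_. 1) = id_blinfun"
  by (intro ell2_ops_eqI toeplitz_bops C_circle_intros bops_id)
    (simp add: toeplitz_entry fourier_coeff_one entry_ebasis C_circle_intros)

lemma toeplitz_const: "toeplitz (\<lambda>_. c) = scaleC_op c id_blinfun"
  using toeplitz_scale[of "\<lambda>_. 1" c] by (simp add: toeplitz_one C_circle_intros)

lemma toeplitz_shift: "g \<in> C_circle \<Longrightarrow> toeplitz g o\<^sub>L unilateral_shift = toeplitz (\<lambda>z. z * g z)"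
  by (intro ell2_ops_eqI toeplitz_bops C_circle_intros bops_compose shift_bops)
    (simp_all add: toeplitz_entry fourier_coeff_shift shift_ebasis C_circle_intros algebra_simps)

lemma shift_toeplitz: "g \<in> C_circle \<Longrightarrow> adj unilateral_shift o\<^sub>L toeplitz g = toeplitz (\<lambda>z. cnj z * g z)"
  by (intro ell2_ops_eqI toeplitz_bops C_circle_intros bops_compose shift_adj_bops)
    (simp_all add: toeplitz_entry fourier_coeff_shift_cnj entry_shift_adj C_circle_intros algebra_simps)

lemma toeplitz_z: "toeplitz (\<lambda>z. z) = unilateral_shift"
  using toeplitz_shift[of "\<lambda>_. 1"] by (simp add: toeplitz_one C_circle_intros blinfun_eqI[of "id_blinfun o\<^sub>L unilateral_shift"])

lemma toeplitz_cnj_z: "toeplitz cnj = adj unilateral_shift"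
  using toeplitz_cnj[of "\<lambda>z. z"] by (simp add: toeplitz_z C_circle_intros)

lemma shift_range_projection: "(unilateral_shift o\<^sub>L adj unilateral_shift) + munit 0 0 = id_blinfun"
  by (intro blinfun_eqI ell2_eqI)
    (auto simp: blinfun.add_left apply_unilateral_shift entry_shift_adj apply_munit entry_ebasis split: nat.split)

text \<open>Writing \<open>g\<close> as \<open>cnj z (z g)\<close> gives \<open>T\<^sub>g = S\<^sup>* T\<^sub>z\<^sub>g\<close>, and \<open>S S\<^sup>*\<close> is the identity up to a
  projection of rank one.\<close>

lemma shift_toeplitz_compact:
  assumes g: "g \<in> C_circle"
  shows "(unilateral_shift o\<^sub>L toeplitz g) - toeplitz (\<lambda>z. z * g z) \<in> compact_ops"
proof -
  have zg: "(\<lambda>z. z * g z) \<in> C_circle" by (intro C_circle_intros g)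
  have "toeplitz g = toeplitz (\<lambda>z. cnj z * (z * g z))"
  proof (rule toeplitz_cong)
    show "(\<lambda>z. cnj z * (z * g z)) \<in> C_circle" by (intro C_circle_intros zg)
    show "g z = cnj z * (z * g z)" if "z \<in> sphere 0 1" for z
      using that by (simp add: mult.assoc[symmetric] cnj_mult_self)
  qed (rule g)
  also have "\<dots> = adj unilateral_shift o\<^sub>L toeplitz (\<lambda>z. z * g z)"
    by (rule shift_toeplitz[OF zg, symmetric])
  finally have eq: "toeplitz g = adj unilateral_shift o\<^sub>L toeplitz (\<lambda>z. z * g z)" .
  have "(unilateral_shift o\<^sub>L adj unilateral_shift) \<cdot> x + munit 0 0 \<cdot> x = x" for x
    using arg_cong[OF shift_range_projection, of "\<lambda>T. T \<cdot> x"] by (simp add: blinfun.add_left)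
  then have "(unilateral_shift o\<^sub>L toeplitz g) - toeplitz (\<lambda>z. z * g z) = - (munit 0 0 o\<^sub>L toeplitz (\<lambda>z. z * g z))"
    unfolding eq by (intro blinfun_eqI) (simp add: blinfun.diff_left blinfun.minus_left algebra_simps add_eq_0_iff)
  then show ?thesis
    by (simp add: compact_ops_minus compact_ops_compose_right munit_compact toeplitz_bops zg)
qed

subsection \<open>Approximate eigenvectors\<close>

text \<open>For \<open>\<zeta>\<close> on the circle, a Toeplitz operator acts on the unit vectors \<open>\<xi>\<^sub>n\<close> below asymptotically as
  the value of its symbol at \<open>\<zeta>\<close>, while compact operators annihilate them in the limit. They are truncations of the formal eigenvector
  \<open>\<Sum>k cnj \<zeta>\<^sup>k e\<^sub>k\<close> of the adjoint shift; the \<open>n + 1\<close> terms of modulus one account for the normalization.\<close>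

definition approx_eigvec :: "complex \<Rightarrow> nat \<Rightarrow> ell2" where
  "approx_eigvec \<zeta> n = complex_of_real (1 / sqrt (real (Suc n))) *\<^sub>C (\<Sum>k<Suc n. cnj \<zeta> ^ k *\<^sub>C ebasis k)"

lemma entry_approx_eigvec:
  "entry (approx_eigvec \<zeta> n) k = (if k \<le> n then cnj \<zeta> ^ k / complex_of_real (sqrt (real (Suc n))) else 0)"
proof -
  have "(\<Sum>i<Suc n. cnj \<zeta> ^ i * entry (ebasis i) k) = (\<Sum>i<Suc n. if i = k then cnj \<zeta> ^ i else 0)"
    by (intro sum.cong refl) (simp add: entry_ebasis)
  also have "\<dots> = (if k \<le> n then cnj \<zeta> ^ k else 0)" by (simp add: less_Suc_eq_le)
  finally show ?thesis by (simp add: approx_eigvec_def entry_sum del: sum.lessThan_Suc)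
qed

lemma norm_approx_eigvec:
  assumes "cmod \<zeta> = 1" shows "norm (approx_eigvec \<zeta> n) = 1"
proof -
  have "(norm (approx_eigvec \<zeta> n))\<^sup>2 = (\<Sum>k<Suc n. (cmod (entry (approx_eigvec \<zeta> n) k))\<^sup>2)"
    unfolding norm_ell2_power2 by (rule suminf_finite) (auto simp: entry_approx_eigvec)
  also have "\<dots> = (\<Sum>k<Suc n. 1 / real (Suc n))"
    using assms by (intro sum.cong refl)
      (simp add: entry_approx_eigvec less_Suc_eq_le norm_divide norm_power power_divide)
  also have "\<dots> = 1" by (simp add: field_simps)
  finally show ?thesis using power2_eq_imp_eq[of "norm (approx_eigvec \<zeta> n)" 1] by simp
qed

lemma inv_sqrt_tendsto: "(\<lambda>n. c / sqrt (real (Suc n))) \<longlonglongrightarrow> 0"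
proof -
  have "filterlim (\<lambda>n. sqrt (real (Suc n))) at_top sequentially"
    by (intro filterlim_compose[OF sqrt_at_top] filterlim_compose[OF filterlim_real_sequentially] filterlim_Suc)
  then show ?thesis by (intro tendsto_divide_0[OF tendsto_const] filterlim_at_top_imp_at_infinity)
qed

lemma compact_approx_eigvec:
  fixes K :: "ell2 \<Rightarrow>\<^sub>L ell2"
  assumes K: "K \<in> compact_ops" and \<zeta>: "cmod \<zeta> = 1"
  shows "(\<lambda>n. K \<cdot> approx_eigvec \<zeta> n) \<longlonglongrightarrow> 0"
proof (rule metric_LIMSEQ_I)
  fix e :: real assume e: "e > 0"
  obtain T where T: "T \<in> finite_matrix_ops" "dist T K < e / 2"
    using K e unfolding compact_ops_eq_closure_finite_matrix closure_approachable by (meson half_gt_zero)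
  then obtain N where N: "T \<in> bops" "\<And>m n. m > N \<or> n > N \<Longrightarrow> mat_entry T m n = 0"
    by (auto simp: finite_matrix_ops_iff)
  have mu: "(\<lambda>n. (scaleC_op c (munit i j)) \<cdot> approx_eigvec \<zeta> n) \<longlonglongrightarrow> 0" for c i j
  proof (rule Lim_null_comparison[OF _ inv_sqrt_tendsto])
    have *: "cmod (entry (approx_eigvec \<zeta> n) j) \<le> 1 / sqrt (real (Suc n))" for n
      using \<zeta> by (simp add: entry_approx_eigvec norm_divide norm_power)
    have "norm ((scaleC_op c (munit i j)) \<cdot> approx_eigvec \<zeta> n) \<le> cmod c / sqrt (real (Suc n))" for n
      using mult_left_mono[OF *[of n], of "cmod c"] by (simp add: apply_munit norm_scaleC norm_mult)
    then show "\<forall>\<^sub>F n in sequentially. norm ((scaleC_op c (munit i j)) \<cdot> approx_eigvec \<zeta> n) \<le> cmod c / sqrt (real (Suc n))"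
      by (intro always_eventually allI)
  qed
  have "(\<lambda>n. T \<cdot> approx_eigvec \<zeta> n) \<longlonglongrightarrow> (\<Sum>m\<le>N. \<Sum>n\<le>N. 0)"
    by (subst finite_matrix_eq_sum_munit[where N = N, OF N], assumption)
      (unfold blinfun.sum_left, intro tendsto_sum mu)
  then have "(\<lambda>n. T \<cdot> approx_eigvec \<zeta> n) \<longlonglongrightarrow> 0" by simp
  from LIMSEQ_D[OF this half_gt_zero[OF e]]
  obtain n0 where n0: "\<And>n. n \<ge> n0 \<Longrightarrow> norm (T \<cdot> approx_eigvec \<zeta> n) < e / 2"
    by auto
  have "dist (K \<cdot> approx_eigvec \<zeta> n) 0 < e" if "n \<ge> n0" for n
  proof -
    have "norm ((K - T) \<cdot> approx_eigvec \<zeta> n) \<le> norm (K - T) * norm (approx_eigvec \<zeta> n)"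
      by (rule norm_blinfun)
    also have "\<dots> < e / 2" using T(2) by (simp add: norm_approx_eigvec[OF \<zeta>] dist_norm norm_minus_commute)
    finally have "norm (K \<cdot> approx_eigvec \<zeta> n - T \<cdot> approx_eigvec \<zeta> n) < e / 2"
      by (simp add: blinfun.diff_left)
    with n0[OF that] norm_triangle_sub[of "K \<cdot> approx_eigvec \<zeta> n" "T \<cdot> approx_eigvec \<zeta> n"]
    show ?thesis by simp
  qed
  then show "\<exists>n0. \<forall>n\<ge>n0. dist (K \<cdot> approx_eigvec \<zeta> n) 0 < e" by blast
qed

lemma shift_approx_eigvec:
  assumes \<zeta>: "cmod \<zeta> = 1"
  shows "(\<lambda>n. unilateral_shift \<cdot> approx_eigvec \<zeta> n - \<zeta> *\<^sub>C approx_eigvec \<zeta> n) \<longlonglongrightarrow> 0"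
proof (rule Lim_null_comparison[OF _ inv_sqrt_tendsto[of 2]], rule always_eventually, rule allI)
  fix n
  let ?s = "complex_of_real (sqrt (real (Suc n)))"
  have zz: "\<zeta> * cnj \<zeta> = 1" using cnj_mult_self[of \<zeta>] \<zeta> by (simp add: mult.commute)
  have "unilateral_shift \<cdot> approx_eigvec \<zeta> n - \<zeta> *\<^sub>C approx_eigvec \<zeta> n =
      (- \<zeta> / ?s) *\<^sub>C ebasis 0 + (cnj \<zeta> ^ n / ?s) *\<^sub>C ebasis (Suc n)"
  proof (rule ell2_eqI)
    fix k
    show "entry (unilateral_shift \<cdot> approx_eigvec \<zeta> n - \<zeta> *\<^sub>C approx_eigvec \<zeta> n) k =
      entry ((- \<zeta> / ?s) *\<^sub>C ebasis 0 + (cnj \<zeta> ^ n / ?s) *\<^sub>C ebasis (Suc n)) k"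
    proof (cases k)
      case (Suc j)
      have "\<zeta> * cnj \<zeta> ^ Suc j = cnj \<zeta> ^ j" using zz by (simp flip: mult.assoc)
      then show ?thesis using Suc
        by (auto simp: apply_unilateral_shift entry_approx_eigvec entry_ebasis simp del: power_Suc)
    qed (simp add: apply_unilateral_shift entry_approx_eigvec entry_ebasis)
  qed
  also have "norm \<dots> \<le> norm ((- \<zeta> / ?s) *\<^sub>C ebasis 0) + norm ((cnj \<zeta> ^ n / ?s) *\<^sub>C ebasis (Suc n))"
    by (rule norm_triangle_ineq)
  also have "\<dots> = 2 / sqrt (real (Suc n))"
    using \<zeta> by (simp add: norm_scaleC norm_divide norm_power)
  finally show "norm (unilateral_shift \<cdot> approx_eigvec \<zeta> n - \<zeta> *\<^sub>C approx_eigvec \<zeta> n) \<le> 2 / sqrt (real (Suc n))" .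
qed

lemma shift_adj_approx_eigvec:
  assumes \<zeta>: "cmod \<zeta> = 1"
  shows "(\<lambda>n. adj unilateral_shift \<cdot> approx_eigvec \<zeta> n - cnj \<zeta> *\<^sub>C approx_eigvec \<zeta> n) \<longlonglongrightarrow> 0"
proof -
  let ?S = "unilateral_shift" and ?w = "approx_eigvec \<zeta>"
  have zz: "cnj \<zeta> * \<zeta> = 1" using cnj_mult_self[of \<zeta>] \<zeta> by simp
  have "adj ?S \<cdot> ?w n - cnj \<zeta> *\<^sub>C ?w n =
      (- cnj \<zeta>) *\<^sub>C adj ?S \<cdot> (?S \<cdot> ?w n - \<zeta> *\<^sub>C ?w n)" for n
    by (simp add: blinfun.diff_right shift_adj_shift bopsD[OF shift_adj_bops] scaleC_diff_right
        scaleC_minus_left scaleC_scaleC zz)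
  moreover have "(\<lambda>n. (- cnj \<zeta>) *\<^sub>C adj ?S \<cdot> (?S \<cdot> ?w n - \<zeta> *\<^sub>C ?w n)) \<longlonglongrightarrow>
      (- cnj \<zeta>) *\<^sub>C adj ?S \<cdot> 0"
    by (intro bounded_linear.tendsto[OF bounded_linear_scaleC] shift_approx_eigvec[OF \<zeta>]
        bounded_linear.tendsto[OF blinfun.bounded_linear_right])
  ultimately show ?thesis by simp
qed

subsection \<open>Symbols modulo compact operators\<close>

text \<open>The Stone--Weierstrass theorem as an induction principle: continuous functions on the circle are
  uniform limits of polynomials in \<open>z\<close> and its conjugate.\<close>

lemma C_circle_induct [consumes 1, case_names const ident cnj add mult limit]:
  assumes f: "f \<in> C_circle"
    and const: "\<And>c. P (\<lambda>_. c)" and ident: "P (\<lambda>z. z)" and cnj: "P cnj"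
    and add: "\<And>f g. f \<in> C_circle \<Longrightarrow> g \<in> C_circle \<Longrightarrow> P f \<Longrightarrow> P g \<Longrightarrow> P (\<lambda>z. f z + g z)"
    and mult: "\<And>f g. f \<in> C_circle \<Longrightarrow> g \<in> C_circle \<Longrightarrow> P f \<Longrightarrow> P g \<Longrightarrow> P (\<lambda>z. f z * g z)"
    and limit: "\<And>f. f \<in> C_circle \<Longrightarrow>
      (\<And>e. e > 0 \<Longrightarrow> \<exists>g\<in>C_circle. P g \<and> (\<forall>z\<in>sphere 0 1. cmod (f z - g z) < e)) \<Longrightarrow> P f"
  shows "P f"
proof (rule limit[OF f])
  fix e :: real assume "e > 0"
  let ?Q = "\<lambda>f. f \<in> C_circle \<and> P f"
  have Qc: "?Q (\<lambda>_. c)" for c using const C_circle_intros by auto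
  have Qm: "?Q (\<lambda>z. f z * g z)" if "?Q f" "?Q g" for f g using that mult C_circle_intros by auto
  have Qa: "?Q (\<lambda>z. f z + g z)" if "?Q f" "?Q g" for f g using that add C_circle_intros by auto
  have Qz: "?Q (\<lambda>z. z)" "?Q cnj" using ident cnj C_circle_intros by auto
  have poly: "?Q (\<lambda>z. complex_of_real (p z))" if "real_polynomial_function p" for p :: "complex \<Rightarrow> real"
    using that
  proof (induction p rule: real_polynomial_function.induct)
    case (linear h)
    interpret bounded_linear h by fact
    have hz: "h z = Re z * h 1 + Im z * h \<i>" for z
    proof -
      have "Re z *\<^sub>R 1 + Im z *\<^sub>R \<i> = z" by (simp add: complex_eq_iff)
      moreover have "h (Re z *\<^sub>R 1 + Im z *\<^sub>R \<i>) = Re z * h 1 + Im z * h \<i>"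
        by (simp only: add scaleR real_scaleR_def)
      ultimately show ?thesis by (simp only:)
    qed
    define a a' where "a = (h 1 - \<i> * h \<i>) / 2" and "a' = (h 1 + \<i> * h \<i>) / 2"
    have "complex_of_real (h z) = a * z + a' * cnj z" for z
      unfolding a_def a'_def by (subst hz) (simp add: complex_eq_iff field_simps)
    moreover have "?Q (\<lambda>z. a * z + a' * cnj z)"
      by (rule Qa[OF Qm[OF Qc Qz(1)] Qm[OF Qc Qz(2)]])
    ultimately show ?case by simp
  next
    case (const c)
    show ?case by (rule Qc)
  next
    case (add p q)
    show ?case using Qa[OF add.IH] by simp
  next
    case (mult p q)
    show ?case using Qm[OF mult.IH] by simp
  qed
  obtain g where g: "polynomial_function g" "\<And>z. z \<in> sphere 0 1 \<Longrightarrow> norm (f z - g z) < e"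
    using Stone_Weierstrass_polynomial_function[of "sphere 0 1" f e] f \<open>e > 0\<close>
    by (auto simp: C_circle_def)
  have "real_polynomial_function (\<lambda>z. Re (g z))" "real_polynomial_function (\<lambda>z. Im (g z))"
    using g(1) bounded_linear_Re bounded_linear_Im unfolding polynomial_function_def o_def by blast+
  then have "?Q (\<lambda>z. complex_of_real (Re (g z)) + \<i> * complex_of_real (Im (g z)))"
    by (intro Qa[OF poly Qm[OF Qc poly]])
  then have "?Q g" by (simp flip: complex_eq)
  then show "\<exists>g\<in>C_circle. P g \<and> (\<forall>z\<in>sphere 0 1. cmod (f z - g z) < e)" using g(2) by blast
qed

text \<open>Both claims hold for the generators \<open>z\<close> and \<open>cnj z\<close> of the continuous functions by direct
  computation. They are proved together because a product \<open>f f'\<close> is treated by replacing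
  \<open>T\<^sub>f\<^sub>f\<^sub>'\<close> by \<open>T\<^sub>f T\<^sub>f\<^sub>'\<close>: the error is compact by the first claim for \<open>f\<close>, and compact operators
  vanish asymptotically on the approximate eigenvectors. Uniform limits are harmless because the norm of a Toeplitz
  operator is at most the supremum of its symbol.\<close>

theorem toeplitz_mult_and_eigvec:
  assumes "f \<in> C_circle"
  shows "(\<forall>g\<in>C_circle. (toeplitz f o\<^sub>L toeplitz g) - toeplitz (\<lambda>z. f z * g z) \<in> compact_ops) \<and>
    (\<forall>\<zeta>. cmod \<zeta> = 1 \<longrightarrow> (\<lambda>n. toeplitz f \<cdot> approx_eigvec \<zeta> n - f \<zeta> *\<^sub>C approx_eigvec \<zeta> n) \<longlonglongrightarrow> 0)"
  using assms
proof (induction f rule: C_circle_induct)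
  case (const c)
  have "(scaleC_op c id_blinfun o\<^sub>L toeplitz g) = scaleC_op c (toeplitz g)" for g
    by (rule blinfun_eqI) simp
  then show ?case by (auto simp: toeplitz_const toeplitz_scale)
next
  case ident
  then show ?case by (simp add: toeplitz_z shift_toeplitz_compact shift_approx_eigvec)
next
  case cnj
  then show ?case by (simp add: toeplitz_cnj_z shift_toeplitz shift_adj_approx_eigvec)
next
  case (add f f')
  show ?case
  proof (intro conjI ballI allI impI)
    fix g assume g: "g \<in> C_circle"
    have "(toeplitz (\<lambda>z. f z + f' z) o\<^sub>L toeplitz g) - toeplitz (\<lambda>z. (f z + f' z) * g z) =
      ((toeplitz f o\<^sub>L toeplitz g) - toeplitz (\<lambda>z. f z * g z)) + ((toeplitz f' o\<^sub>L toeplitz g) - toeplitz (\<lambda>z. f' z * g z))"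
      using add.hyps g by (intro blinfun_eqI)
        (simp add: toeplitz_add distrib_right C_circle_intros blinfun.add_left blinfun.diff_left)
    then show "(toeplitz (\<lambda>z. f z + f' z) o\<^sub>L toeplitz g) - toeplitz (\<lambda>z. (f z + f' z) * g z) \<in> compact_ops"
      using add.IH g by (simp add: compact_ops_add)
  next
    fix \<zeta> :: complex assume \<zeta>: "cmod \<zeta> = 1"
    then show "(\<lambda>n. (toeplitz (\<lambda>z. f z + f' z)) \<cdot> approx_eigvec \<zeta> n - (f \<zeta> + f' \<zeta>) *\<^sub>C approx_eigvec \<zeta> n) \<longlonglongrightarrow> 0"
      using add.hyps tendsto_add[OF add.IH(1)[THEN conjunct2, rule_format, OF \<zeta>] add.IH(2)[THEN conjunct2, rule_format, OF \<zeta>]]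
      by (simp add: toeplitz_add blinfun.add_left scaleC_add_left algebra_simps)
  qed
next
  case (mult f f')
  have ff: "(\<lambda>z. f z * f' z) \<in> C_circle" using mult.hyps by (intro C_circle_intros)
  have com: "(toeplitz f o\<^sub>L toeplitz g) - toeplitz (\<lambda>z. f z * g z) \<in> compact_ops"
    "(toeplitz f' o\<^sub>L toeplitz g) - toeplitz (\<lambda>z. f' z * g z) \<in> compact_ops" if "g \<in> C_circle" for g
    using mult.IH that by auto
  show ?case
  proof (intro conjI ballI allI impI)
    fix g assume g: "g \<in> C_circle"
    have f'g: "(\<lambda>z. f' z * g z) \<in> C_circle" using mult.hyps g by (intro C_circle_intros)
    have "(toeplitz (\<lambda>z. f z * f' z) o\<^sub>L toeplitz g) - toeplitz (\<lambda>z. f z * f' z * g z) =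
      (- ((toeplitz f o\<^sub>L toeplitz f') - toeplitz (\<lambda>z. f z * f' z)) o\<^sub>L toeplitz g) +
      (toeplitz f o\<^sub>L ((toeplitz f' o\<^sub>L toeplitz g) - toeplitz (\<lambda>z. f' z * g z))) +
      ((toeplitz f o\<^sub>L toeplitz (\<lambda>z. f' z * g z)) - toeplitz (\<lambda>z. f z * (f' z * g z)))"
      by (intro blinfun_eqI)
        (simp add: blinfun.add_left blinfun.diff_left blinfun.diff_right blinfun.minus_left mult.assoc)
    then show "(toeplitz (\<lambda>z. f z * f' z) o\<^sub>L toeplitz g) - toeplitz (\<lambda>z. f z * f' z * g z) \<in> compact_ops"
      using com(1)[OF mult.hyps(2)] com(2)[OF g] com(1)[OF f'g] mult.hyps g
      by (simp add: compact_ops_add compact_ops_minus compact_ops_compose_left compact_ops_compose_right toeplitz_bops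
          del: minus_diff_eq)
  next
    fix \<zeta> :: complex assume \<zeta>: "cmod \<zeta> = 1"
    let ?w = "approx_eigvec \<zeta>"
    let ?K = "(toeplitz f o\<^sub>L toeplitz f') - toeplitz (\<lambda>z. f z * f' z)"
    have "(toeplitz (\<lambda>z. f z * f' z)) \<cdot> ?w n - (f \<zeta> * f' \<zeta>) *\<^sub>C ?w n =
      - ?K \<cdot> ?w n +
      toeplitz f \<cdot> (toeplitz f' \<cdot> ?w n - f' \<zeta> *\<^sub>C ?w n) +
      f' \<zeta> *\<^sub>C (toeplitz f \<cdot> ?w n - f \<zeta> *\<^sub>C ?w n)" for n
      using mult.hyps by (simp add: blinfun.diff_left blinfun.diff_right bopsD[OF toeplitz_bops] scaleC_diff_right
          scaleC_scaleC mult.commute)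
    moreover have "(\<lambda>n. - ?K \<cdot> ?w n +
      toeplitz f \<cdot> (toeplitz f' \<cdot> ?w n - f' \<zeta> *\<^sub>C ?w n) +
      f' \<zeta> *\<^sub>C (toeplitz f \<cdot> ?w n - f \<zeta> *\<^sub>C ?w n)) \<longlonglongrightarrow>
      - 0 + toeplitz f \<cdot> 0 + f' \<zeta> *\<^sub>C 0"
      using mult.IH \<zeta> mult.hyps
      by (intro tendsto_add tendsto_minus compact_approx_eigvec com \<zeta>
          bounded_linear.tendsto[OF bounded_linear_scaleC] bounded_linear.tendsto[OF blinfun.bounded_linear_right]) auto
    ultimately show "(\<lambda>n. (toeplitz (\<lambda>z. f z * f' z)) \<cdot> ?w n - (f \<zeta> * f' \<zeta>) *\<^sub>C ?w n) \<longlonglongrightarrow> 0"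
      by simp
  qed
next
  case (limit f)
  have near: "norm (toeplitz h - toeplitz h') \<le> e"
    if "h \<in> C_circle" "h' \<in> C_circle" "\<And>z. z \<in> sphere 0 1 \<Longrightarrow> cmod (h z - h' z) \<le> e" for h h' e
    using toeplitz_norm[of "\<lambda>z. h z - h' z" e] that by (simp add: toeplitz_diff C_circle_intros)
  show ?case
  proof (intro conjI ballI allI impI)
    fix g assume g: "g \<in> C_circle"
    obtain C where C: "\<And>z. z \<in> sphere 0 1 \<Longrightarrow> cmod (g z) \<le> C" using C_circle_bounded[OF g] by metis
    have "C \<ge> 0" using C[of 1] norm_ge_zero[of "g 1"] by (simp, linarith)
    let ?D = "\<lambda>f. (toeplitz f o\<^sub>L toeplitz g) - toeplitz (\<lambda>z. f z * g z)"
    have "\<exists>K\<in>compact_ops. dist K (?D f) < e" if e: "e > 0" for e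
    proof -
      \<comment> \<open>each of the two terms that change with the symbol contributes at most \<open>d C < e / 2\<close>\<close>
      define d where "d = e / (2 * (C + 1))"
      have d: "d > 0" using e \<open>C \<ge> 0\<close> by (simp add: d_def)
      obtain h where h: "h \<in> C_circle" "?D h \<in> compact_ops" "\<And>z. z \<in> sphere 0 1 \<Longrightarrow> cmod (f z - h z) < d"
        using limit(2)[OF d] g by blast
      have "norm (toeplitz g) \<le> C" by (rule toeplitz_norm[OF g C])
      have n1: "norm ((toeplitz f - toeplitz h) o\<^sub>L toeplitz g) \<le> d * C"
      proof -
        have "norm ((toeplitz f - toeplitz h) o\<^sub>L toeplitz g) \<le> norm (toeplitz f - toeplitz h) * norm (toeplitz g)"
          by (rule norm_blinfun_compose)
        also have "\<dots> \<le> d * C"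
          using h(3) d by (intro mult_mono near limit.hyps h(1) \<open>norm (toeplitz g) \<le> C\<close>) (auto intro: less_imp_le)
        finally show ?thesis .
      qed
      have n2: "norm (toeplitz (\<lambda>z. f z * g z) - toeplitz (\<lambda>z. h z * g z)) \<le> d * C"
      proof (rule near)
        fix z assume z: "z \<in> sphere (0::complex) 1"
        have "cmod (f z * g z - h z * g z) = cmod (f z - h z) * cmod (g z)"
          by (simp add: norm_mult flip: left_diff_distrib)
        also have "\<dots> \<le> d * C" using h(3)[OF z] C[OF z] d by (intro mult_mono) auto
        finally show "cmod (f z * g z - h z * g z) \<le> d * C" .
      qed (auto intro!: C_circle_intros limit.hyps g h)
      have "?D f - ?D h = ((toeplitz f - toeplitz h) o\<^sub>L toeplitz g) - (toeplitz (\<lambda>z. f z * g z) - toeplitz (\<lambda>z. h z * g z))"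
        by (intro blinfun_eqI) (simp add: blinfun.diff_left)
      then have "norm (?D f - ?D h) \<le> norm ((toeplitz f - toeplitz h) o\<^sub>L toeplitz g) +
          norm (toeplitz (\<lambda>z. f z * g z) - toeplitz (\<lambda>z. h z * g z))"
        by (simp only: norm_triangle_ineq4)
      also have "\<dots> \<le> d * C + d * C" by (intro add_mono n1 n2)
      also have "\<dots> < d * (2 * (C + 1))" using d by (simp add: algebra_simps)
      also have "\<dots> = e" using \<open>C \<ge> 0\<close> by (simp add: d_def)
      finally show ?thesis using h(2) by (intro bexI[of _ "?D h"]) (auto simp: dist_norm norm_minus_commute)
    qed
    then show "?D f \<in> compact_ops" using closed_approachable[OF closed_compact_ops] by blast
  next
    fix \<zeta> :: complex assume \<zeta>: "cmod \<zeta> = 1"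
    let ?w = "approx_eigvec \<zeta>"
    show "(\<lambda>n. toeplitz f \<cdot> ?w n - f \<zeta> *\<^sub>C ?w n) \<longlonglongrightarrow> 0"
    proof (rule metric_LIMSEQ_I)
      fix e :: real assume e: "e > 0"
      obtain h where h: "h \<in> C_circle" "(\<lambda>n. toeplitz h \<cdot> ?w n - h \<zeta> *\<^sub>C ?w n) \<longlonglongrightarrow> 0"
          "\<And>z. z \<in> sphere 0 1 \<Longrightarrow> cmod (f z - h z) < e / 3"
        using limit(2)[of "e / 3"] e \<zeta> by (metis divide_pos_pos zero_less_numeral)
      obtain n0 where n0: "\<And>n. n \<ge> n0 \<Longrightarrow> norm (toeplitz h \<cdot> ?w n - h \<zeta> *\<^sub>C ?w n) < e / 3"
        using h(2) e unfolding LIMSEQ_iff by (metis diff_zero divide_pos_pos zero_less_numeral)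
      have "dist (toeplitz f \<cdot> ?w n - f \<zeta> *\<^sub>C ?w n) 0 < e" if n: "n \<ge> n0" for n
      proof -
        have "norm ((toeplitz f - toeplitz h) \<cdot> ?w n) \<le> norm (toeplitz f - toeplitz h) * norm (?w n)"
          by (rule norm_blinfun)
        also have "\<dots> \<le> e / 3"
          using near[OF limit.hyps h(1), of "e / 3"] h(3) by (simp add: norm_approx_eigvec[OF \<zeta>] less_imp_le)
        finally have 1: "norm ((toeplitz f - toeplitz h) \<cdot> ?w n) \<le> e / 3" .
        have 2: "norm ((h \<zeta> - f \<zeta>) *\<^sub>C ?w n) < e / 3"
          using h(3)[of \<zeta>] \<zeta> by (simp add: norm_scaleC norm_approx_eigvec norm_minus_commute)
        have "toeplitz f \<cdot> ?w n - f \<zeta> *\<^sub>C ?w n =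
          (toeplitz f - toeplitz h) \<cdot> ?w n + (toeplitz h \<cdot> ?w n - h \<zeta> *\<^sub>C ?w n) + (h \<zeta> - f \<zeta>) *\<^sub>C ?w n"
          by (simp add: blinfun.diff_left scaleC_diff_left)
        also have "norm \<dots> \<le> norm ((toeplitz f - toeplitz h) \<cdot> ?w n) + norm (toeplitz h \<cdot> ?w n - h \<zeta> *\<^sub>C ?w n) + norm ((h \<zeta> - f \<zeta>) *\<^sub>C ?w n)"
          by (intro norm_triangle_mono norm_triangle_ineq order_refl)
        finally show ?thesis using 1 2 n0[OF n] by simp
      qed
      then show "\<exists>n0. \<forall>n\<ge>n0. dist (toeplitz f \<cdot> ?w n - f \<zeta> *\<^sub>C ?w n) 0 < e" by blast
    qed
  qed
qed

lemma toeplitz_mult_compact: "f \<in> C_circle \<Longrightarrow> g \<in> C_circle \<Longrightarrow>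
    (toeplitz f o\<^sub>L toeplitz g) - toeplitz (\<lambda>z. f z * g z) \<in> compact_ops"
  using toeplitz_mult_and_eigvec by blast

text \<open>On the approximate eigenvectors at \<open>z\<close> the operator \<open>T\<^sub>f + K\<close> is asymptotically multiplication by
  \<open>f z\<close>, so its norm cannot be smaller.\<close>

lemma symbol_le_norm:
  assumes f: "f \<in> C_circle" and K: "K \<in> compact_ops" and z: "z \<in> sphere 0 1"
  shows "cmod (f z) \<le> norm (toeplitz f + K)"
proof (rule tendsto_lowerbound)
  let ?w = "approx_eigvec z"
  have z: "cmod z = 1" using z by simp
  have "(\<lambda>n. (toeplitz f \<cdot> ?w n - f z *\<^sub>C ?w n) + K \<cdot> ?w n) \<longlonglongrightarrow> 0 + 0"
    using toeplitz_mult_and_eigvec[OF f] z by (intro tendsto_add compact_approx_eigvec K) auto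
  then have "(\<lambda>n. norm ((toeplitz f \<cdot> ?w n - f z *\<^sub>C ?w n) + K \<cdot> ?w n)) \<longlonglongrightarrow> 0"
    by (simp add: tendsto_norm_zero_iff)
  from tendsto_add[OF tendsto_const[of "norm (toeplitz f + K)"] this]
  show "(\<lambda>n. norm (toeplitz f + K) + norm ((toeplitz f \<cdot> ?w n - f z *\<^sub>C ?w n) + K \<cdot> ?w n)) \<longlonglongrightarrow> norm (toeplitz f + K)"
    by simp
  have "cmod (f z) \<le> norm (toeplitz f + K) + norm ((toeplitz f \<cdot> ?w n - f z *\<^sub>C ?w n) + K \<cdot> ?w n)" for n
  proof -
    have "cmod (f z) = norm (f z *\<^sub>C ?w n)" by (simp add: norm_scaleC norm_approx_eigvec[OF z])
    also have "f z *\<^sub>C ?w n = (toeplitz f + K) \<cdot> ?w n -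
       ((toeplitz f \<cdot> ?w n - f z *\<^sub>C ?w n) + K \<cdot> ?w n)"
      by (simp add: blinfun.add_left)
    also have "norm \<dots> \<le> norm ((toeplitz f + K) \<cdot> ?w n) +
       norm ((toeplitz f \<cdot> ?w n - f z *\<^sub>C ?w n) + K \<cdot> ?w n)"
      by (rule norm_triangle_ineq4)
    also have "norm ((toeplitz f + K) \<cdot> ?w n) \<le> norm (toeplitz f + K)"
      using norm_blinfun[of "toeplitz f + K" "?w n"] by (simp add: norm_approx_eigvec[OF z])
    finally show ?thesis by simp
  qed
  then show "\<forall>\<^sub>F n in sequentially. cmod (f z) \<le> norm (toeplitz f + K) + norm ((toeplitz f \<cdot> ?w n - f z *\<^sub>C ?w n) + K \<cdot> ?w n)"
    by simp
qed simp

subsection \<open>Toeplitz operators plus compact operators\<close>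

definition symbol_alg :: "(complex \<Rightarrow> complex) set \<Rightarrow> (ell2 \<Rightarrow>\<^sub>L ell2) set" where
  "symbol_alg \<C> = {toeplitz f + K | f K. f \<in> \<C> \<and> K \<in> compact_ops}"

lemma symbol_algI: "f \<in> \<C> \<Longrightarrow> K \<in> compact_ops \<Longrightarrow> a = toeplitz f + K \<Longrightarrow> a \<in> symbol_alg \<C>"
  unfolding symbol_alg_def by blast

lemma symbol_algE:
  assumes "a \<in> symbol_alg \<C>"
  obtains f K where "f \<in> \<C>" "K \<in> compact_ops" "a = toeplitz f + K"
  using assms unfolding symbol_alg_def by blast

text \<open>A set of symbols that is closed under the *-operations and uniform limits gives a C*-algebra.
  The estimate of the symbol by the norm makes the symbols of a convergent sequence uniformly Cauchy,
  so that the Toeplitz parts, and hence also the compact parts, converge separately.\<close>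

lemma cstar_subalgebra_symbol_alg:
  assumes sub: "\<C> \<subseteq> C_circle" and zero: "(\<lambda>_. 0) \<in> \<C>"
    and add: "\<And>f g. f \<in> \<C> \<Longrightarrow> g \<in> \<C> \<Longrightarrow> (\<lambda>z. f z + g z) \<in> \<C>"
    and mult: "\<And>f g. f \<in> \<C> \<Longrightarrow> g \<in> \<C> \<Longrightarrow> (\<lambda>z. f z * g z) \<in> \<C>"
    and scale: "\<And>c f. f \<in> \<C> \<Longrightarrow> (\<lambda>z. c * f z) \<in> \<C>"
    and cnj: "\<And>f. f \<in> \<C> \<Longrightarrow> (\<lambda>z. cnj (f z)) \<in> \<C>"
    and lim: "\<And>f. f \<in> C_circle \<Longrightarrow>
      (\<And>e. e > 0 \<Longrightarrow> \<exists>g\<in>\<C>. \<forall>z\<in>sphere 0 1. cmod (f z - g z) < e) \<Longrightarrow> f \<in> \<C>"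
  shows "cstar_subalgebra (symbol_alg \<C>)"
proof -
  have C: "f \<in> C_circle" if "f \<in> \<C>" for f using that sub by blast
  have "star_subalgebra (symbol_alg \<C>)"
    unfolding star_subalgebra_def
  proof (intro conjI ballI allI)
    show "symbol_alg \<C> \<subseteq> bops"
    proof
      fix a assume "a \<in> symbol_alg \<C>"
      then show "a \<in> bops" by (elim symbol_algE) (simp add: bops_add toeplitz_bops C compact_ops_bops)
    qed
    show "0 \<in> symbol_alg \<C>"
      using zero toeplitz_const[of 0] by (intro symbol_algI[of "\<lambda>_. 0" _ 0]) (auto intro!: blinfun_eqI)
  next
    fix S T assume "S \<in> symbol_alg \<C>" "T \<in> symbol_alg \<C>"
    then obtain f K g L where f: "f \<in> \<C>" "K \<in> compact_ops" "S = toeplitz f + K"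
      and g: "g \<in> \<C>" "L \<in> compact_ops" "T = toeplitz g + L" by (auto elim!: symbol_algE)
    note fg = C[OF f(1)] C[OF g(1)]
    show "S + T \<in> symbol_alg \<C>"
      by (rule symbol_algI[OF add[OF f(1) g(1)] compact_ops_add[OF f(2) g(2)]])
        (simp add: f g toeplitz_add fg)
    let ?K = "((toeplitz f o\<^sub>L toeplitz g) - toeplitz (\<lambda>z. f z * g z)) + (toeplitz f o\<^sub>L L) + (K o\<^sub>L T)"
    have Tb: "T \<in> bops" by (simp add: g bops_add toeplitz_bops fg compact_ops_bops)
    have "?K \<in> compact_ops"
      by (intro compact_ops_add toeplitz_mult_compact compact_ops_compose_left
          compact_ops_compose_right toeplitz_bops fg Tb f(2) g(2))
    then show "S o\<^sub>L T \<in> symbol_alg \<C>"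
      by (rule symbol_algI[OF mult[OF f(1) g(1)]])
        (auto intro!: blinfun_eqI simp: f g blinfun.add_left blinfun.add_right blinfun.diff_left)
  next
    fix c T assume "T \<in> symbol_alg \<C>"
    then obtain f K where f: "f \<in> \<C>" "K \<in> compact_ops" "T = toeplitz f + K" by (auto elim!: symbol_algE)
    show "scaleC_op c T \<in> symbol_alg \<C>"
      by (rule symbol_algI[OF scale[OF f(1), of c] compact_ops_scaleC[OF f(2), of c]])
        (auto intro!: blinfun_eqI simp: f toeplitz_scale C blinfun.add_left scaleC_add_right)
  next
    fix T assume "T \<in> symbol_alg \<C>"
    then obtain f K where f: "f \<in> \<C>" "K \<in> compact_ops" "T = toeplitz f + K" by (auto elim!: symbol_algE)
    show "adj T \<in> symbol_alg \<C>"
      by (rule symbol_algI[OF cnj[OF f(1)] compact_ops_adj[OF f(2)]])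
        (simp add: f toeplitz_cnj C std.adj_add toeplitz_bops compact_ops_bops)
  qed
  moreover have "closed (symbol_alg \<C>)"
    unfolding closed_sequential_limits
  proof (intro allI impI, elim conjE)
    fix F T assume F: "\<forall>n. F n \<in> symbol_alg \<C>" "F \<longlonglongrightarrow> T"
    have "\<forall>n. \<exists>f K. f \<in> \<C> \<and> K \<in> compact_ops \<and> F n = toeplitz f + K"
      using F(1) by (meson symbol_algE)
    then obtain f K where f: "\<And>n. f n \<in> \<C>" and K: "\<And>n. K n \<in> compact_ops"
      and FK: "\<And>n. F n = toeplitz (f n) + K n" by metis
    note fC = C[OF f]
    have near: "cmod (f m z - f n z) \<le> norm (F m - F n)" if "z \<in> sphere 0 1" for m n z
    proof -
      have "F m - F n = toeplitz (\<lambda>z. f m z - f n z) + (K m - K n)"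
        by (simp add: FK toeplitz_diff fC)
      then show ?thesis
        using symbol_le_norm[of "\<lambda>z. f m z - f n z" "K m - K n" z] that
        by (simp add: C_circle_intros fC compact_ops_diff K)
    qed
    have "Cauchy F" using F(2) by (rule LIMSEQ_imp_Cauchy)
    have "uniformly_Cauchy_on (sphere 0 1) f"
      unfolding uniformly_Cauchy_on_def
    proof (intro allI impI)
      fix e :: real assume "e > 0"
      then obtain M where M: "\<And>m n. m \<ge> M \<Longrightarrow> n \<ge> M \<Longrightarrow> dist (F m) (F n) < e"
        using \<open>Cauchy F\<close> unfolding Cauchy_def by blast
      have "dist (f m z) (f n z) < e" if "z \<in> sphere 0 1" "m \<ge> M" "n \<ge> M" for z m n
        using near[OF that(1), of m n] M[OF that(2,3)] by (simp add: dist_norm)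
      then show "\<exists>M. \<forall>z\<in>sphere 0 1. \<forall>m\<ge>M. \<forall>n\<ge>M. dist (f m z) (f n z) < e" by blast
    qed
    then obtain g where g: "uniform_limit (sphere 0 1) f g sequentially"
      using Cauchy_uniformly_convergent uniformly_convergent_on_def by blast
    have gC: "g \<in> C_circle"
      unfolding C_circle_def
      by (rule CollectI, rule uniform_limit_theorem[OF _ g]) (use fC in \<open>auto simp: C_circle_def\<close>)
    have unif: "\<exists>n0. \<forall>n\<ge>n0. \<forall>z\<in>sphere 0 1. cmod (f n z - g z) < e" if "e > 0" for e
      using uniform_limitD[OF g that] by (auto simp: eventually_sequentially dist_norm)
    have g\<C>: "g \<in> \<C>"
    proof (rule lim[OF gC])
      fix e :: real assume "e > 0"
      then obtain n0 where "\<forall>n\<ge>n0. \<forall>z\<in>sphere 0 1. cmod (f n z - g z) < e" using unif by blast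
      then show "\<exists>h\<in>\<C>. \<forall>z\<in>sphere 0 1. cmod (g z - h z) < e"
        using f[of n0] by (intro bexI[of _ "f n0"]) (auto simp: norm_minus_commute)
    qed
    have T: "(\<lambda>n. toeplitz (f n)) \<longlonglongrightarrow> toeplitz g"
    proof (rule metric_LIMSEQ_I)
      fix e :: real assume e: "e > 0"
      then obtain n0 where n0: "\<And>n z. n \<ge> n0 \<Longrightarrow> z \<in> sphere 0 1 \<Longrightarrow> cmod (f n z - g z) < e / 2"
        using unif[of "e / 2"] half_gt_zero by blast
      have "dist (toeplitz (f n)) (toeplitz g) < e" if "n \<ge> n0" for n
      proof -
        have "norm (toeplitz (\<lambda>z. f n z - g z)) \<le> e / 2"
          using n0[OF that] by (intro toeplitz_norm C_circle_intros fC gC) (auto intro: less_imp_le)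
        then show ?thesis using e by (simp add: toeplitz_diff fC gC dist_norm)
      qed
      then show "\<exists>n0. \<forall>n\<ge>n0. dist (toeplitz (f n)) (toeplitz g) < e" by blast
    qed
    have "(\<lambda>n. F n - toeplitz (f n)) \<longlonglongrightarrow> T - toeplitz g" by (intro tendsto_diff F T)
    then have "K \<longlonglongrightarrow> T - toeplitz g" by (simp add: FK)
    then have "T - toeplitz g \<in> compact_ops"
      using closed_compact_ops K unfolding closed_sequential_limits by blast
    then show "T \<in> symbol_alg \<C>" by (rule symbol_algI[OF g\<C>]) simp
  qed
  ultimately show ?thesis by (simp add: cstar_subalgebra_def)
qed

lemma cstar_subalgebra_symbol_alg_C_circle: "cstar_subalgebra (symbol_alg C_circle)"
  by (rule cstar_subalgebra_symbol_alg) (auto intro: C_circle_intros)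

lemma toeplitz_in_symbol_alg: "f \<in> \<C> \<Longrightarrow> toeplitz f \<in> symbol_alg \<C>"
  by (rule symbol_algI[of f _ 0]) auto

text \<open>The shift is the Toeplitz operator of \<open>z\<close>. The projection onto \<open>e\<^sub>0\<close> is \<open>1 - S S\<^sup>*\<close>, and moving it
  around by powers of \<open>S\<close> and \<open>S\<^sup>*\<close> gives all matrix units.\<close>

lemma compact_ops_subset_cstar:
  assumes A: "cstar_subalgebra A" and S: "toeplitz ` C_circle \<subseteq> A"
  shows "compact_ops \<subseteq> A"
proof -
  have A': "closed A" "0 \<in> A" "\<And>S T. S \<in> A \<Longrightarrow> T \<in> A \<Longrightarrow> S + T \<in> A" "\<And>S T. S \<in> A \<Longrightarrow> T \<in> A \<Longrightarrow> S o\<^sub>L T \<in> A"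
    "\<And>c T. T \<in> A \<Longrightarrow> scaleC_op c T \<in> A"
    using A by (auto simp: cstar_subalgebra_def star_subalgebra_def)
  have sh: "unilateral_shift \<in> A" "adj unilateral_shift \<in> A" "id_blinfun \<in> A"
    using S C_circle_intros(1)[of 1] C_circle_intros(2,3) toeplitz_z toeplitz_cnj_z toeplitz_one
    by (metis imageI subsetD)+
  have 00: "munit 0 0 \<in> A"
  proof -
    have "munit 0 0 = id_blinfun + scaleC_op (- 1) (unilateral_shift o\<^sub>L adj unilateral_shift)"
      using shift_range_projection by (simp flip: uminus_eq_scaleC_op) (metis add_diff_cancel_left')
    then show ?thesis using A' sh by simp
  qed
  have "munit m 0 \<in> A" for m
  proof (induction m)
    case (Suc m)
    have "munit (Suc m) 0 = unilateral_shift o\<^sub>L munit m 0"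
      by (rule blinfun_eqI) (simp add: apply_munit bopsD[OF shift_bops] shift_ebasis)
    then show ?case using A' sh Suc by simp
  qed (rule 00)
  then have mu: "munit m n \<in> A" for m n
  proof (induction n)
    case (Suc n)
    have "munit m (Suc n) = munit m n o\<^sub>L adj unilateral_shift"
      by (rule blinfun_eqI) (simp add: apply_munit entry_shift_adj)
    then show ?case using A' sh Suc by simp
  qed
  have sum: "sum h I \<in> A" if "\<And>i. i \<in> I \<Longrightarrow> h i \<in> A" for h and I :: "nat set"
    using that by (induction I rule: infinite_finite_induct) (auto intro: A')
  have "finite_matrix_ops \<subseteq> A"
  proof
    fix T assume "T \<in> finite_matrix_ops"
    then obtain N where T: "T \<in> bops" "\<And>m n. m > N \<or> n > N \<Longrightarrow> mat_entry T m n = 0"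
      by (auto simp: finite_matrix_ops_iff)
    show "T \<in> A"
      by (subst finite_matrix_eq_sum_munit[where N = N, OF T], assumption) (intro sum A' mu)
  qed
  then show ?thesis
    unfolding compact_ops_eq_closure_finite_matrix using A'(1) by (rule closure_minimal)
qed

theorem toeplitz_algebra_eq: "toeplitz_algebra = symbol_alg C_circle"
proof
  show "toeplitz_algebra \<subseteq> symbol_alg C_circle"
    unfolding toeplitz_algebra_def cstar_alg_def
    using cstar_subalgebra_symbol_alg_C_circle toeplitz_in_symbol_alg by blast
  show "symbol_alg C_circle \<subseteq> toeplitz_algebra"
    unfolding toeplitz_algebra_def cstar_alg_def
  proof (intro Inter_greatest subsetI)
    fix A T assume A: "A \<in> {A. cstar_subalgebra A \<and> toeplitz ` C_circle \<subseteq> A}" and T: "T \<in> symbol_alg C_circle"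
    then obtain f K where f: "f \<in> C_circle" "K \<in> compact_ops" "T = toeplitz f + K" by (auto elim!: symbol_algE)
    then have "toeplitz f \<in> A" "K \<in> A" using A compact_ops_subset_cstar[of A] by auto
    then show "T \<in> A" using A f by (auto simp: cstar_subalgebra_def star_subalgebra_def)
  qed
qed

lemma symbol_unique:
  assumes "f \<in> C_circle" "g \<in> C_circle" "K \<in> compact_ops" "L \<in> compact_ops"
    and eq: "toeplitz f + K = toeplitz g + L" and z: "z \<in> sphere 0 1"
  shows "f z = g z"
proof -
  have "toeplitz (\<lambda>z. f z - g z) + (K - L) = 0"
    using eq by (simp add: toeplitz_diff assms algebra_simps)
  then show ?thesis
    using symbol_le_norm[of "\<lambda>z. f z - g z" "K - L" z] assms
    by (simp add: C_circle_intros compact_ops_diff)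
qed

text \<open>The decomposition \<open>T\<^sub>f + K\<close> is unique on the circle, so any choice of \<open>f\<close> is a symbol map; this shows
  that the choice defining the symbol map is made from a nonempty set.\<close>

lemma is_symbol_map_symbol_map: "is_symbol_map symbol_map"
proof -
  define s where "s a = (SOME f. f \<in> C_circle \<and> (\<exists>K\<in>compact_ops. a = toeplitz f + K))" for a
  have s: "s a \<in> C_circle \<and> (\<exists>K\<in>compact_ops. a = toeplitz (s a) + K)" if "a \<in> toeplitz_algebra" for a
  proof -
    have "\<exists>f. f \<in> C_circle \<and> (\<exists>K\<in>compact_ops. a = toeplitz f + K)"
      using that unfolding toeplitz_algebra_eq by (meson symbol_algE)
    then show ?thesis unfolding s_def by (rule someI_ex)
  qed
  have sT: "s a z = f z" if "f \<in> C_circle" "K \<in> compact_ops" "a = toeplitz f + K" "z \<in> sphere 0 1" for a f K z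
  proof -
    have "a \<in> toeplitz_algebra" using that unfolding toeplitz_algebra_eq by (intro symbol_algI)
    then show ?thesis using s[of a] that symbol_unique by metis
  qed
  have "is_symbol_map s"
    unfolding is_symbol_map_def
  proof (intro conjI ballI allI)
    fix a assume a: "a \<in> toeplitz_algebra"
    then show "s a \<in> C_circle" using s by blast
    fix b c z assume b: "b \<in> toeplitz_algebra" and z: "z \<in> sphere (0::complex) 1"
    obtain K where K: "s a \<in> C_circle" "K \<in> compact_ops" "a = toeplitz (s a) + K" using s[OF a] by blast
    obtain L where L: "s b \<in> C_circle" "L \<in> compact_ops" "b = toeplitz (s b) + L" using s[OF b] by blast
    show "s (a + b) z = s a z + s b z"
    proof (rule sT[of "\<lambda>z. s a z + s b z" "K + L"])
      show "a + b = toeplitz (\<lambda>z. s a z + s b z) + (K + L)"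
        using K L by (simp add: toeplitz_add algebra_simps)
    qed (use K(1,2) L(1,2) z in \<open>auto intro!: C_circle_intros compact_ops_add\<close>)
    let ?K = "((toeplitz (s a) o\<^sub>L toeplitz (s b)) - toeplitz (\<lambda>z. s a z * s b z)) + (toeplitz (s a) o\<^sub>L L) + (K o\<^sub>L b)"
    have bb: "b \<in> bops" using L by (metis bops_add compact_ops_bops toeplitz_bops)
    show "s (a o\<^sub>L b) z = s a z * s b z"
    proof (rule sT[of "\<lambda>z. s a z * s b z" ?K])
      show "?K \<in> compact_ops"
        by (intro compact_ops_add toeplitz_mult_compact compact_ops_compose_left
          compact_ops_compose_right toeplitz_bops K(1,2) L(1,2) bb)
      have ap: "a \<cdot> x = (toeplitz (s a)) \<cdot> x + K \<cdot> x"
          "b \<cdot> x = (toeplitz (s b)) \<cdot> x + L \<cdot> x" for x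
        using K(3) L(3) by (metis blinfun.add_left)+
      show "a o\<^sub>L b = toeplitz (\<lambda>z. s a z * s b z) + ?K"
        by (rule blinfun_eqI) (simp add: ap(1) blinfun.add_left blinfun.diff_left, simp add: ap(2) blinfun.add_right)
    qed (use K(1,2) L(1,2) z in \<open>auto intro!: C_circle_intros\<close>)
    show "s (scaleC_op c a) z = c * s a z"
    proof (rule sT[of "\<lambda>z. c * s a z" "scaleC_op c K"])
      have "scaleC_op c (toeplitz (s a) + K) = toeplitz (\<lambda>z. c * s a z) + scaleC_op c K"
        by (rule blinfun_eqI) (simp add: toeplitz_scale K(1) blinfun.add_left scaleC_add_right)
      then show "scaleC_op c a = toeplitz (\<lambda>z. c * s a z) + scaleC_op c K" using K(3) by metis
    qed (use K(1,2) z in \<open>auto intro!: C_circle_intros compact_ops_scaleC\<close>)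
    show "s (adj a) z = cnj (s a z)"
    proof (rule sT[of "\<lambda>z. cnj (s a z)" "adj K"])
      have "adj (toeplitz (s a) + K) = toeplitz (\<lambda>z. cnj (s a z)) + adj K"
        using K(1,2) by (simp add: toeplitz_cnj std.adj_add toeplitz_bops compact_ops_bops)
      then show "adj a = toeplitz (\<lambda>z. cnj (s a z)) + adj K" using K(3) by metis
    qed (use K(1,2) z in \<open>auto intro!: C_circle_intros compact_ops_adj\<close>)
  next
    fix f assume f: "f \<in> C_circle"
    then have "toeplitz f \<in> toeplitz_algebra" by (simp add: toeplitz_algebra_eq toeplitz_in_symbol_alg)
    then show "\<exists>a\<in>toeplitz_algebra. \<forall>z\<in>sphere 0 1. s a z = f z"
      using sT[OF f compact_ops_zero] by (intro bexI[of _ "toeplitz f"]) auto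
    show "s (toeplitz f) z = f z" if "z \<in> sphere 0 1" for z
      using sT[OF f compact_ops_zero _ that] by simp
  next
    show "{a \<in> toeplitz_algebra. \<forall>z\<in>sphere 0 1. s a z = 0} = compact_ops"
    proof (intro equalityI subsetI)
      fix a assume a: "a \<in> {a \<in> toeplitz_algebra. \<forall>z\<in>sphere 0 1. s a z = 0}"
      then obtain K where K: "s a \<in> C_circle" "K \<in> compact_ops" "a = toeplitz (s a) + K" using s by blast
      have "toeplitz (s a) = toeplitz (\<lambda>_. 0)"
        using a K by (intro toeplitz_cong C_circle_intros) auto
      also have "\<dots> = 0" by (auto intro!: blinfun_eqI simp: toeplitz_const)
      finally show "a \<in> compact_ops" using K by simp
    next
      fix a :: "ell2 \<Rightarrow>\<^sub>L ell2" assume a: "a \<in> compact_ops"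
      have eq: "a = toeplitz (\<lambda>_. 0) + a" by (rule blinfun_eqI) (simp add: toeplitz_const blinfun.add_left)
      then have "a \<in> toeplitz_algebra"
        unfolding toeplitz_algebra_eq by (intro symbol_algI[of "\<lambda>_. 0" _ a] C_circle_intros a)
      then show "a \<in> {a \<in> toeplitz_algebra. \<forall>z\<in>sphere 0 1. s a z = 0}"
        using sT[OF C_circle_intros(1) a eq] by auto
    qed
  qed
  then show ?thesis unfolding symbol_map_def by (rule someI[of is_symbol_map])
qed

lemma symbol_map_eq:
  assumes f: "f \<in> C_circle" and K: "K \<in> compact_ops" and z: "z \<in> sphere 0 1"
  shows "symbol_map (toeplitz f + K) z = f z"
proof -
  note sm = is_symbol_map_symbol_map[unfolded is_symbol_map_def]
  have T: "toeplitz f \<in> toeplitz_algebra" by (simp add: toeplitz_algebra_eq toeplitz_in_symbol_alg f)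
  have K0: "K \<in> toeplitz_algebra" "symbol_map K z = 0" using sm K z by blast+
  have "symbol_map (toeplitz f + K) z = symbol_map (toeplitz f) z + symbol_map K z"
    using sm T K0 z by blast
  then show ?thesis using sm f z K0 by simp
qed

lemma C_wedge_cong:
  assumes f: "f \<in> C_wedge" and g: "g \<in> C_circle" and eq: "\<And>z. z \<in> sphere 0 1 \<Longrightarrow> g z = f z"
  shows "g \<in> C_wedge"
proof -
  have "exp (\<i> * complex_of_real t) \<in> sphere 0 1" "exp (- \<i> * complex_of_real t) \<in> sphere 0 1" for t
    by (simp_all add: norm_exp)
  moreover from this have "- \<i> * exp (- \<i> * complex_of_real t) \<in> sphere 0 1"
      "\<i> * exp (\<i> * complex_of_real t) \<in> sphere 0 1" for t
    by (simp_all add: norm_mult)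
  ultimately show ?thesis using f g by (simp add: C_wedge_def eq)
qed

theorem toeplitz_torus_eq: "toeplitz_torus = symbol_alg C_wedge"
proof (intro equalityI subsetI)
  fix a assume "a \<in> toeplitz_torus"
  then have a: "a \<in> toeplitz_algebra" "symbol_map a \<in> C_wedge" by (auto simp: toeplitz_torus_def)
  then obtain f K where f: "f \<in> C_circle" "K \<in> compact_ops" "a = toeplitz f + K"
    by (auto simp: toeplitz_algebra_eq elim!: symbol_algE)
  have "toeplitz f = toeplitz (symbol_map a)"
    using a(2) f by (intro toeplitz_cong) (auto simp: C_wedge_def symbol_map_eq)
  then show "a \<in> symbol_alg C_wedge" using f a by (intro symbol_algI[of "symbol_map a" _ K]) auto
next
  fix a assume "a \<in> symbol_alg C_wedge"
  then obtain f K where f: "f \<in> C_wedge" "K \<in> compact_ops" "a = toeplitz f + K"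
    by (auto elim!: symbol_algE)
  have fC: "f \<in> C_circle" using f(1) by (simp add: C_wedge_def)
  then have a: "a \<in> toeplitz_algebra" using f unfolding toeplitz_algebra_eq by (intro symbol_algI)
  then have "symbol_map a \<in> C_circle" using is_symbol_map_symbol_map by (simp add: is_symbol_map_def)
  then have "symbol_map a \<in> C_wedge" using f fC by (intro C_wedge_cong[OF f(1)]) (simp_all add: symbol_map_eq)
  with a show "a \<in> toeplitz_torus" by (simp add: toeplitz_torus_def)
qed

lemma C_wedge_intros:
  "(\<lambda>z. c) \<in> C_wedge"
  "f \<in> C_wedge \<Longrightarrow> g \<in> C_wedge \<Longrightarrow> (\<lambda>z. f z + g z) \<in> C_wedge"
  "f \<in> C_wedge \<Longrightarrow> g \<in> C_wedge \<Longrightarrow> (\<lambda>z. f z * g z) \<in> C_wedge"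
  "f \<in> C_wedge \<Longrightarrow> (\<lambda>z. cnj (f z)) \<in> C_wedge"
  by (simp_all add: C_wedge_def C_circle_intros)

lemma C_wedge_subset: "C_wedge \<subseteq> C_circle"
  by (auto simp: C_wedge_def)

lemma C_wedge_limit:
  assumes f: "f \<in> C_circle"
    and lim: "\<And>e. e > 0 \<Longrightarrow> \<exists>g\<in>C_wedge. \<forall>z\<in>sphere 0 1. cmod (f z - g z) < e"
  shows "f \<in> C_wedge"
proof -
  have eq: "f p = f q" if pq: "p \<in> sphere 0 1" "q \<in> sphere 0 1" "\<And>g. g \<in> C_wedge \<Longrightarrow> g p = g q" for p q
  proof (rule ccontr)
    assume "f p \<noteq> f q"
    then obtain g where g: "g \<in> C_wedge" "\<And>z. z \<in> sphere 0 1 \<Longrightarrow> cmod (f z - g z) < cmod (f p - f q) / 2"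
      using lim[of "cmod (f p - f q) / 2"] by auto
    have "f p - f q = (f p - g p) - (f q - g q)" using pq(3)[OF g(1)] by simp
    then have "cmod (f p - f q) \<le> cmod (f p - g p) + cmod (f q - g q)" by (metis norm_triangle_ineq4)
    then show False using g(2)[OF pq(1)] g(2)[OF pq(2)] by simp
  qed
  show ?thesis
    unfolding C_wedge_def
  proof (intro CollectI conjI ballI f)
    fix t assume t: "t \<in> {0..pi / 2}"
    show "f (exp (\<i> * complex_of_real t)) = f (- \<i> * exp (- \<i> * complex_of_real t))"
      using t by (intro eq) (auto simp: C_wedge_def norm_mult)
    show "f (exp (- \<i> * complex_of_real t)) = f (\<i> * exp (\<i> * complex_of_real t))"
      using t by (intro eq) (auto simp: C_wedge_def norm_mult)
  qed
qed

lemma cstar_subalgebra_toeplitz_torus: "cstar_subalgebra toeplitz_torus"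
  unfolding toeplitz_torus_eq
  by (rule cstar_subalgebra_symbol_alg)
    (simp_all add: C_wedge_intros C_wedge_limit C_wedge_subset)

lemma unital_toeplitz_torus: "unital_cstar_algebra toeplitz_torus"
  unfolding unital_cstar_algebra_def
proof (intro conjI bexI cstar_subalgebra_toeplitz_torus)
  show "id_blinfun \<in> toeplitz_torus"
    using toeplitz_in_symbol_alg[OF C_wedge_intros(1)[of 1]] by (simp add: toeplitz_torus_eq toeplitz_one)
  show "\<forall>a\<in>toeplitz_torus. id_blinfun o\<^sub>L a = a \<and> a o\<^sub>L id_blinfun = a"
    by (auto intro: blinfun_eqI)
qed

section \<open>Smooth functions on the circle\<close>

text \<open>Smoothness by coinduction: it suffices to exhibit a set of functions of the angle in which derivatives
  can be taken.\<close>

lemma C_inf_circleI: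
  assumes cl: "\<And>g. g \<in> \<S> \<Longrightarrow> \<exists>g'\<in>\<S>. \<forall>t. (g has_vector_derivative g' t) (at t)"
    and f: "(\<lambda>t. f (cis t)) \<in> \<S>"
  shows "f \<in> C_inf_circle"
proof -
  let ?D = "\<lambda>g t. vector_derivative g (at t)"
  have D: "?D g \<in> \<S>" if "g \<in> \<S>" for g
  proof -
    from cl[OF that] obtain g' where g': "g' \<in> \<S>" "\<And>t. (g has_vector_derivative g' t) (at t)" by blast
    then have "?D g = g'" by (auto intro: vector_derivative_at)
    then show ?thesis using g' by simp
  qed
  have "(?D ^^ k) (\<lambda>t. f (cis t)) \<in> \<S>" for k
    by (induction k) (simp_all add: f D)
  then show ?thesis
    unfolding C_inf_circle_def using cl by (auto simp: differentiable_def has_vector_derivative_def) metis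
qed

lemma C_inf_differentiable: "f \<in> C_inf_circle \<Longrightarrow> (\<lambda>t. f (cis t)) differentiable (at t)"
  unfolding C_inf_circle_def by (drule CollectD, drule spec[of _ 0]) simp

text \<open>Near a point of the circle, the angle is a continuous function.\<close>

lemma C_inf_C_circle: "C_inf_circle \<subseteq> C_circle"
proof
  fix f assume f: "f \<in> C_inf_circle"
  have F: "isCont (\<lambda>t. f (cis t)) t" for t
    by (rule differentiable_imp_continuous_within[OF C_inf_differentiable[OF f]])
  have "continuous (at z0 within sphere 0 1) f" if z0: "z0 \<in> sphere 0 1" for z0
  proof -
    have z0': "z0 \<noteq> 0" "cmod z0 = 1" using z0 by auto
    let ?a = "\<lambda>z. Arg z0 + Arg (z / z0)"
    have "isCont ?a z0"
      using z0' by (intro continuous_intros isCont_o2[OF _ continuous_at_Arg]) (auto simp: complex_nonpos_Reals_iff)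
    moreover have "isCont (\<lambda>t. f (cis t)) (?a z0)" by (rule F)
    ultimately have "isCont (\<lambda>z. f (cis (?a z))) z0" by (rule isCont_o2)
    then have "continuous (at z0 within sphere 0 1) (\<lambda>z. f (cis (?a z)))"
      by (rule continuous_at_imp_continuous_at_within)
    then show ?thesis
    proof (rule continuous_transform_within[OF _ zero_less_one z0])
      fix z :: complex assume "z \<in> sphere 0 1"
      then have "cmod z = 1" "z \<noteq> 0" by auto
      then have "cis (?a z) = z"
        using z0' by (simp add: cis_Arg sgn_eq norm_divide flip: cis_mult)
      then show "f (cis (?a z)) = f z" by simp
    qed
  qed
  then show "f \<in> C_circle" by (simp add: C_circle_def continuous_on_eq_continuous_within)
qed

text \<open>The derivative with respect to the angle. Periodicity makes it independent of the choice of the angle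
  \<open>Arg z\<close>.\<close>

definition circle_deriv :: "(complex \<Rightarrow> complex) \<Rightarrow> complex \<Rightarrow> complex" where
  "circle_deriv f z = vector_derivative (\<lambda>t. f (cis t)) (at (Arg z))"

lemma circle_deriv_cis:
  assumes f: "f \<in> C_inf_circle"
  shows "((\<lambda>t. f (cis t)) has_vector_derivative circle_deriv f (cis t)) (at t)"
proof -
  let ?F = "\<lambda>t. f (cis t)"
  have "cis (Arg (cis t)) = cis t" by (simp add: cis_Arg sgn_eq)
  then have "sin (Arg (cis t)) = sin t \<and> cos (Arg (cis t)) = cos t" by (simp add: complex_eq_iff)
  then obtain n :: int where n: "Arg (cis t) = t + 2 * pi * n"
    using sin_cos_eq_iff[of "Arg (cis t)" t] by blast
  let ?s = "2 * pi * real_of_int n"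
  have per: "cis (x + ?s) = cis x" for x
    by (simp add: cis_mult[symmetric] cis_multiple_2pi)
  have "(?F has_vector_derivative circle_deriv f (cis t)) (at (t + ?s))"
    unfolding circle_deriv_def n
    using C_inf_differentiable[OF f, of "t + ?s"] by (simp add: vector_derivative_works)
  moreover have "((\<lambda>x. x + ?s) has_vector_derivative 1) (at t)"
    by (auto intro!: derivative_eq_intros)
  ultimately have "(?F \<circ> (\<lambda>x. x + ?s) has_vector_derivative (1 *\<^sub>R circle_deriv f (cis t))) (at t)"
    by (intro vector_diff_chain_at)
  moreover have "?F \<circ> (\<lambda>x. x + ?s) = ?F" by (simp add: fun_eq_iff per)
  ultimately show ?thesis by simp
qed

lemma circle_deriv_C_inf:
  assumes f: "f \<in> C_inf_circle" shows "circle_deriv f \<in> C_inf_circle"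
proof -
  let ?D = "\<lambda>g t. vector_derivative g (at t)"
  have eq: "(\<lambda>t. circle_deriv f (cis t)) = ?D (\<lambda>t. f (cis t))"
    using vector_derivative_at[OF circle_deriv_cis[OF f]] by auto
  have "((?D ^^ Suc k) (\<lambda>t. f (cis t))) differentiable (at t)" for k t
    using f unfolding C_inf_circle_def by blast
  then show ?thesis
    unfolding C_inf_circle_def mem_Collect_eq eq by (simp add: funpow_Suc_right del: funpow.simps)
qed

text \<open>Integration by parts; the boundary terms cancel by periodicity.\<close>

lemma fourier_coeff_circle_deriv:
  assumes f: "f \<in> C_inf_circle"
  shows "fourier_coeff (circle_deriv f) k = \<i> * of_int k * fourier_coeff f k"
proof -
  have C: "f \<in> C_circle" "circle_deriv f \<in> C_circle"
    using C_inf_C_circle f circle_deriv_C_inf by auto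
  let ?e = "\<lambda>t. cis (of_int (- k) * t)"
  let ?p = "\<lambda>z. circle_deriv f z * z powi (- k)" and ?q = "\<lambda>z. f z * z powi (- k)"
  have pw: "cis t powi (- k) = ?e t" for t
    by (simp add: cis_power_int)
  have pq: "(\<lambda>z. ?p z - \<i> * of_int k * ?q z) \<in> C_circle" "?p \<in> C_circle" "?q \<in> C_circle"
    by (intro C_circle_intros C)+
  have "((\<lambda>t. ?p (cis t) - \<i> * of_int k * ?q (cis t)) has_integral
      (f (cis (2 * pi)) * ?e (2 * pi) - f (cis 0) * ?e 0)) {0..2 * pi}"
  proof (rule fundamental_theorem_of_calculus)
    fix t
    have "((\<lambda>t. f (cis t) * ?e t) has_vector_derivative
        (f (cis t) * (\<i> * complex_of_real (of_int (- k)) * ?e t) + circle_deriv f (cis t) * ?e t)) (at t within {0..2 * pi})"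
      by (intro has_vector_derivative_mult has_vector_derivative_cis has_vector_derivative_at_within[OF circle_deriv_cis[OF f]])
    then show "((\<lambda>t. f (cis t) * ?e t) has_vector_derivative (?p (cis t) - \<i> * of_int k * ?q (cis t))) (at t within {0..2 * pi})"
      unfolding pw by (simp add: algebra_simps)
  qed simp
  moreover have "?e (2 * pi) = 1"
    using cis_multiple_2pi[of "of_int (- k)"] by (simp add: mult.commute mult.left_commute)
  ultimately have "integral {0..2 * pi} (\<lambda>t. ?p (cis t) - \<i> * of_int k * ?q (cis t)) = 0"
    by (simp add: integral_unique)
  then have "0 = (LINT z|circle_measure. ?p z - \<i> * of_int k * ?q z)"
    using integral_circle_eq[OF pq(1)] by simp
  also have "\<dots> = (LINT z|circle_measure. ?p z) - (LINT z|circle_measure. \<i> * of_int k * ?q z)"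
    by (intro Bochner_Integration.integral_diff C_circle_integrable pq integrable_mult_right)
  finally show ?thesis by (simp add: fourier_coeff_def)
qed

subsection \<open>Flat functions\<close>

text \<open>The function \<open>exp (- 1 / x)\<close> for \<open>x > 0\<close>, divided by \<open>x\<^sup>n\<close> to have a family closed under
  derivatives\<close>

definition flat :: "nat \<Rightarrow> real \<Rightarrow> real" where
  "flat n x = (if x > 0 then exp (- 1 / x) / x ^ n else 0)"

lemma flat_tendsto_0: "(flat n \<longlongrightarrow> 0) (at 0)"
proof -
  have "((\<lambda>x. (inverse x) ^ n / exp (inverse x)) \<longlongrightarrow> 0) (at_right (0::real))"
    by (rule filterlim_compose[OF tendsto_power_div_exp_0 filterlim_inverse_at_top_right])
  moreover have "\<forall>\<^sub>F x in at_right 0. (inverse x) ^ n / exp (inverse x) = flat n x"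
    by (simp add: eventually_at_right_field flat_def exp_minus field_simps) (metis zero_less_one)
  ultimately have "(flat n \<longlongrightarrow> 0) (at_right 0)" using Lim_transform_eventually by blast
  moreover have "(flat n \<longlongrightarrow> 0) (at_left 0)"
    by (rule tendsto_eventually) (auto simp: eventually_at_filter flat_def)
  ultimately show ?thesis by (simp add: filterlim_split_at)
qed

lemma flat_deriv:
  "(flat n has_real_derivative (flat (n + 2) x - real n * flat (n + 1) x)) (at x)"
proof -
  consider "x > 0" | "x = 0" | "x < 0" by linarith
  then show ?thesis
  proof cases
    case 1
    have "((\<lambda>x. exp (- 1 / x) / x ^ n) has_real_derivative
        (exp (- 1 / x) * (1 / x\<^sup>2) * x ^ n - exp (- 1 / x) * (real n * x ^ (n - 1))) / (x ^ n * x ^ n)) (at x)"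
      using 1 by (auto intro!: derivative_eq_intros simp: power2_eq_square)
    moreover have "(exp (- 1 / x) * (1 / x\<^sup>2) * x ^ n - exp (- 1 / x) * (real n * x ^ (n - 1))) / (x ^ n * x ^ n)
        = flat (n + 2) x - real n * flat (n + 1) x"
      using 1 by (cases n) (simp_all add: flat_def field_simps power2_eq_square)
    ultimately have "((\<lambda>x. exp (- 1 / x) / x ^ n) has_real_derivative (flat (n + 2) x - real n * flat (n + 1) x)) (at x)"
      by simp
    then show ?thesis
      by (rule has_field_derivative_transform_within[OF _ 1]) (auto simp: flat_def dist_real_def)
  next
    case 2
    have eq: "(\<lambda>h. (flat n (0 + h) - flat n 0) / h) = flat (n + 1)"
      by (simp add: flat_def fun_eq_iff)
    have "((\<lambda>h. (flat n (0 + h) - flat n 0) / h) \<longlongrightarrow> 0) (at 0)"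
      unfolding eq by (rule flat_tendsto_0)
    then show ?thesis using 2 by (simp add: DERIV_def flat_def)
  next
    case 3
    have "((\<lambda>x. 0) has_real_derivative 0) (at x)" by simp
    then have "(flat n has_real_derivative 0) (at x)"
      by (rule has_field_derivative_transform_within[where d = "- x"]) (use 3 in \<open>auto simp: flat_def dist_real_def\<close>)
    then show ?thesis using 3 by (simp add: flat_def)
  qed
qed

lemma flat_0_bounds: "0 \<le> flat 0 x" "flat 0 x \<le> 1" "x > 0 \<Longrightarrow> flat 0 x > 0" "x \<le> 0 \<Longrightarrow> flat 0 x = 0"
  by (auto simp: flat_def)

lemma continuous_flat_0: "continuous_on UNIV (flat 0)"
  by (rule continuous_at_imp_continuous_on) (use flat_deriv[of 0] DERIV_isCont in blast)

text \<open>An algebra of functions closed under derivatives that contains trigonometric polynomials as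
  well as functions that vanish to infinite order where \<open>cos\<close> or \<open>sin\<close> vanish\<close>

inductive_set flat_trig :: "(real \<Rightarrow> complex) set" where
  const: "(\<lambda>_. c) \<in> flat_trig"
| cos: "(\<lambda>t. complex_of_real (cos t)) \<in> flat_trig"
| sin: "(\<lambda>t. complex_of_real (sin t)) \<in> flat_trig"
| flat_cos: "(\<lambda>t. complex_of_real (flat n (s * cos t))) \<in> flat_trig"
| flat_sin: "(\<lambda>t. complex_of_real (flat n (s * sin t))) \<in> flat_trig"
| add: "f \<in> flat_trig \<Longrightarrow> g \<in> flat_trig \<Longrightarrow> (\<lambda>t. f t + g t) \<in> flat_trig"
| mult: "f \<in> flat_trig \<Longrightarrow> g \<in> flat_trig \<Longrightarrow> (\<lambda>t. f t * g t) \<in> flat_trig"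

lemma has_vector_derivative_complex_of_real:
  "(f has_real_derivative D) (at t) \<Longrightarrow>
    ((\<lambda>t. complex_of_real (f t)) has_vector_derivative complex_of_real D) (at t)"
  by (rule has_vector_derivative_of_real) (simp add: has_real_derivative_iff_has_vector_derivative)

lemma flat_trig_deriv: "g \<in> flat_trig \<Longrightarrow> \<exists>g'\<in>flat_trig. \<forall>t. (g has_vector_derivative g' t) (at t)"
proof (induction g rule: flat_trig.induct)
  case (const c)
  show ?case by (rule bexI[OF _ flat_trig.const[of 0]]) simp
next
  case cos
  have "((\<lambda>t. complex_of_real (cos t)) has_vector_derivative (- 1 * complex_of_real (sin t))) (at t)" for t
    using has_vector_derivative_complex_of_real[OF DERIV_cos[of t]] by simp
  then show ?case by (intro bexI[OF _ flat_trig.mult[OF flat_trig.const[of "- 1"] flat_trig.sin]]) simp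
next
  case sin
  have "((\<lambda>t. complex_of_real (sin t)) has_vector_derivative (complex_of_real (cos t))) (at t)" for t
    using has_vector_derivative_complex_of_real[OF DERIV_sin[of t]] by simp
  then show ?case by (intro bexI[OF _ flat_trig.cos]) simp
next
  case (flat_cos n s)
  let ?f = "\<lambda>n t. complex_of_real (flat n (s * cos t))"
  let ?g = "\<lambda>t. (?f (n + 2) t + complex_of_real (- real n) * ?f (n + 1) t) * (complex_of_real (- s) * complex_of_real (sin t))"
  have "((\<lambda>t. flat n (s * cos t)) has_real_derivative
      (flat (n + 2) (s * cos t) - real n * flat (n + 1) (s * cos t)) * (s * - sin t)) (at t)" for t
    by (rule DERIV_chain2[OF flat_deriv]) (auto intro!: derivative_eq_intros)
  from has_vector_derivative_complex_of_real[OF this]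
  have "(?f n has_vector_derivative ?g t) (at t)" for t
    by (simp add: algebra_simps)
  then show ?case by (rule bexI[of _ ?g, OF allI]) (intro flat_trig.intros)
next
  case (flat_sin n s)
  let ?f = "\<lambda>n t. complex_of_real (flat n (s * sin t))"
  let ?g = "\<lambda>t. (?f (n + 2) t + complex_of_real (- real n) * ?f (n + 1) t) * (complex_of_real s * complex_of_real (cos t))"
  have "((\<lambda>t. flat n (s * sin t)) has_real_derivative
      (flat (n + 2) (s * sin t) - real n * flat (n + 1) (s * sin t)) * (s * cos t)) (at t)" for t
    by (rule DERIV_chain2[OF flat_deriv]) (auto intro!: derivative_eq_intros)
  from has_vector_derivative_complex_of_real[OF this]
  have "(?f n has_vector_derivative ?g t) (at t)" for t
    by (simp add: algebra_simps)
  then show ?case by (rule bexI[of _ ?g, OF allI]) (intro flat_trig.intros)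
next
  case (add f g)
  then obtain f' g' where "f' \<in> flat_trig" "g' \<in> flat_trig"
    "\<And>t. (f has_vector_derivative f' t) (at t)" "\<And>t. (g has_vector_derivative g' t) (at t)" by blast
  then show ?case
    by (intro bexI[OF _ flat_trig.add[of f' g']]) (auto intro: has_vector_derivative_add)
next
  case (mult f g)
  then obtain f' g' where "f' \<in> flat_trig" "g' \<in> flat_trig"
    "\<And>t. (f has_vector_derivative f' t) (at t)" "\<And>t. (g has_vector_derivative g' t) (at t)" by blast
  then show ?case using mult.hyps
    by (intro bexI[OF _ flat_trig.add[OF flat_trig.mult[of f g'] flat_trig.mult[of f' g]]])
      (auto intro: has_vector_derivative_mult)
qed

lemma flat_trig_C_inf: "(\<lambda>t. f (cis t)) \<in> flat_trig \<Longrightarrow> f \<in> C_inf_circle"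
  by (rule C_inf_circleI[OF flat_trig_deriv])

lemma real_polynomial_flat_trig:
  "real_polynomial_function p \<Longrightarrow> (\<lambda>t. complex_of_real (p (cis t))) \<in> flat_trig"
proof (induction p rule: real_polynomial_function.induct)
  case (linear h)
  interpret bounded_linear h by fact
  define a a' where "a = h 1" and "a' = h \<i>"
  have "h (cis t) = a * cos t + a' * sin t" for t
  proof -
    have "cos t *\<^sub>R 1 + sin t *\<^sub>R \<i> = cis t" by (simp add: complex_eq_iff)
    moreover have "h (cos t *\<^sub>R 1 + sin t *\<^sub>R \<i>) = cos t * h 1 + sin t * h \<i>"
      by (simp only: add scaleR real_scaleR_def)
    ultimately show ?thesis by (simp add: a_def a'_def mult.commute)
  qed
  moreover have "(\<lambda>t. complex_of_real a * complex_of_real (cos t) + complex_of_real a' * complex_of_real (sin t)) \<in> flat_trig"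
    by (rule flat_trig.add[OF flat_trig.mult[OF flat_trig.const flat_trig.cos] flat_trig.mult[OF flat_trig.const flat_trig.sin]])
  ultimately show ?case by simp
next
  case (const c)
  show ?case by (rule flat_trig.const)
next
  case (add p q)
  show ?case using flat_trig.add[OF add.IH] by simp
next
  case (mult p q)
  show ?case using flat_trig.mult[OF mult.IH] by simp
qed

lemma polynomial_flat_trig:
  fixes p :: "complex \<Rightarrow> complex"
  assumes "polynomial_function p" shows "(\<lambda>t. p (cis t)) \<in> flat_trig"
proof -
  have "real_polynomial_function (\<lambda>z. Re (p z))" "real_polynomial_function (\<lambda>z. Im (p z))"
    using assms bounded_linear_Re bounded_linear_Im unfolding polynomial_function_def o_def by blast+
  then have "(\<lambda>t. complex_of_real (Re (p (cis t))) + \<i> * complex_of_real (Im (p (cis t)))) \<in> flat_trig"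
    by (intro flat_trig.add[OF _ flat_trig.mult[OF flat_trig.const]] real_polynomial_flat_trig)
  then show ?thesis by (simp flip: complex_eq)
qed

lemma ident_C_inf: "(\<lambda>z. z) \<in> C_inf_circle" and cnj_C_inf: "cnj \<in> C_inf_circle"
  using polynomial_flat_trig[of "\<lambda>z. z"] polynomial_flat_trig[of cnj]
  by (auto intro!: flat_trig_C_inf polynomial_function_bounded_linear bounded_linear_cnj)

subsection \<open>Smooth functions on the wedge of two circles are dense\<close>

text \<open>The two identifications are the reflections \<open>z \<mapsto> - \<i> cnj z\<close>, exchanging the first and the third
  quadrant, and \<open>z \<mapsto> \<i> cnj z\<close>, exchanging the second and the fourth.\<close>

lemma C_wedge_iff:
  "f \<in> C_wedge \<longleftrightarrow> f \<in> C_circle \<and>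
    (\<forall>z\<in>sphere 0 1. (0 \<le> Re z \<and> 0 \<le> Im z \<longrightarrow> f z = f (- \<i> * cnj z)) \<and>
      (0 \<le> Re z \<and> Im z \<le> 0 \<longrightarrow> f z = f (\<i> * cnj z)))"
proof -
  have exp: "exp (\<i> * complex_of_real t) = cis t" "exp (- \<i> * complex_of_real t) = cis (- t)" for t
    by (simp_all add: cis_conv_exp)
  have ex: "\<exists>t\<in>{0..pi / 2}. z = cis t" if z: "cmod z = 1" "0 \<le> Re z" "0 \<le> Im z" for z
  proof
    have 1: "(Re z)\<^sup>2 + (Im z)\<^sup>2 = 1" using z(1) cmod_power2[of z] by simp
    then have "Re z \<le> 1" using z by (metis complex_Re_le_cmod)
    have "0 \<le> arccos (Re z)" "arccos (Re z) \<le> pi / 2"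
      using z \<open>Re z \<le> 1\<close> arccos_le_pi2[of "Re z"] arccos_lbound[of "Re z"] by simp_all
    then show "arccos (Re z) \<in> {0..pi / 2}" by simp
    have "sin (arccos (Re z)) = sqrt (1 - (Re z)\<^sup>2)" using z \<open>Re z \<le> 1\<close> by (intro sin_arccos) auto
    also have "1 - (Re z)\<^sup>2 = (Im z)\<^sup>2" using 1 by simp
    finally show "z = cis (arccos (Re z))"
      using z \<open>Re z \<le> 1\<close> by (simp add: complex_eq_iff cos_arccos)
  qed
  have sgn: "0 \<le> cos t" "0 \<le> sin t" if "t \<in> {0..pi / 2}" for t
    using that by (auto intro!: cos_ge_zero sin_ge_zero)
  have cj: "cnj (cis t) = cis (- t)" for t by (simp add: cis_cnj)
  show ?thesis
  proof
    assume f: "f \<in> C_wedge"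
    then have C: "f \<in> C_circle" and
      w: "\<And>t. t \<in> {0..pi / 2} \<Longrightarrow> f (cis t) = f (- \<i> * cis (- t)) \<and> f (cis (- t)) = f (\<i> * cis t)"
      unfolding C_wedge_def exp by auto
    have "f z = f (- \<i> * cnj z)" if "cmod z = 1" "0 \<le> Re z" "0 \<le> Im z" for z
      using ex[OF that] w cj by auto
    moreover have "f z = f (\<i> * cnj z)" if z: "cmod z = 1" "0 \<le> Re z" "Im z \<le> 0" for z
    proof -
      obtain t where t: "t \<in> {0..pi / 2}" "cnj z = cis t" using ex[of "cnj z"] z by auto
      then have "z = cis (- t)" by (metis cj complex_cnj_cnj)
      then show ?thesis using w[OF t(1)] t(2) by simp
    qed
    ultimately show "f \<in> C_circle \<and> (\<forall>z\<in>sphere 0 1. (0 \<le> Re z \<and> 0 \<le> Im z \<longrightarrow> f z = f (- \<i> * cnj z)) \<and>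
      (0 \<le> Re z \<and> Im z \<le> 0 \<longrightarrow> f z = f (\<i> * cnj z)))" using C by simp
  next
    assume f: "f \<in> C_circle \<and> (\<forall>z\<in>sphere 0 1. (0 \<le> Re z \<and> 0 \<le> Im z \<longrightarrow> f z = f (- \<i> * cnj z)) \<and>
      (0 \<le> Re z \<and> Im z \<le> 0 \<longrightarrow> f z = f (\<i> * cnj z)))"
    then have w: "\<And>z. cmod z = 1 \<Longrightarrow> 0 \<le> Re z \<Longrightarrow> 0 \<le> Im z \<Longrightarrow> f z = f (- \<i> * cnj z)"
      "\<And>z. cmod z = 1 \<Longrightarrow> 0 \<le> Re z \<Longrightarrow> Im z \<le> 0 \<Longrightarrow> f z = f (\<i> * cnj z)" by auto
    show "f \<in> C_wedge"
      unfolding C_wedge_def exp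
    proof (intro CollectI conjI ballI)
      fix t assume t: "t \<in> {0..pi / 2}"
      show "f (cis t) = f (- \<i> * cis (- t))" using w(1)[of "cis t"] sgn[OF t] by (simp add: cj)
      show "f (cis (- t)) = f (\<i> * cis t)" using w(2)[of "cis (- t)"] sgn[OF t] by (simp add: cj)
    qed (use f in simp)
  qed
qed

definition quadrant_bump :: "real \<Rightarrow> real \<Rightarrow> complex \<Rightarrow> complex" where
  "quadrant_bump s s' z = complex_of_real (flat 0 (s * Re z) * flat 0 (s' * Im z))"

text \<open>The given function is used on the first and the second quadrant, and carried over to the third and the
  fourth by the reflections; the bump functions make the pieces vanish to infinite order where they meet.\<close>

definition wedge_patch :: "(complex \<Rightarrow> complex) \<Rightarrow> complex \<Rightarrow> complex" where
  "wedge_patch p z = quadrant_bump 1 1 z * p z + quadrant_bump (- 1) (- 1) z * p (- \<i> * cnj z) +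
     (quadrant_bump (- 1) 1 z * p z + quadrant_bump 1 (- 1) z * p (\<i> * cnj z))"

lemma wedge_patch_flat_trig:
  assumes p: "polynomial_function p"
  shows "(\<lambda>t. wedge_patch p (cis t)) \<in> flat_trig"
proof -
  have lin: "polynomial_function (\<lambda>z. c * cnj z)" for c
    by (intro polynomial_function_bounded_linear bounded_linear_const_mult bounded_linear_cnj)
  have pc: "polynomial_function (\<lambda>z. p (c * cnj z))" for c
    using polynomial_function_compose[OF lin p] by (simp add: o_def)
  have q: "(\<lambda>t. quadrant_bump s s' (cis t)) \<in> flat_trig" for s s'
    using flat_trig.mult[OF flat_trig.flat_cos[of 0 s] flat_trig.flat_sin[of 0 s']] by (simp add: quadrant_bump_def)
  note qp = flat_trig.mult[OF q polynomial_flat_trig[OF p]] and qc = flat_trig.mult[OF q polynomial_flat_trig[OF pc]]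
  show ?thesis
    unfolding wedge_patch_def by (rule flat_trig.add[OF flat_trig.add[OF qp qc] flat_trig.add[OF qp qc]])
qed

lemma wedge_patch_smooth:
  assumes p: "polynomial_function p"
  shows "wedge_patch p \<in> C_wedge \<inter> C_inf_circle"
proof
  show inf: "wedge_patch p \<in> C_inf_circle"
    by (rule flat_trig_C_inf[OF wedge_patch_flat_trig[OF p]])
  show "wedge_patch p \<in> C_wedge"
    unfolding C_wedge_iff
  proof (intro conjI ballI impI)
    show "wedge_patch p \<in> C_circle" using inf C_inf_C_circle by blast
    fix z :: complex
    {
      assume "0 \<le> Re z \<and> 0 \<le> Im z"
      then have 0: "flat 0 (- Re z) = 0" "flat 0 (- Im z) = 0" by (simp_all add: flat_0_bounds)
      define w where "w = - \<i> * cnj z"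
      have w: "Re w = - Im z" "Im w = - Re z" "- (\<i> * cnj w) = z" by (simp_all add: w_def complex_eq_iff)
      have "wedge_patch p z = wedge_patch p w"
        by (simp add: wedge_patch_def quadrant_bump_def w 0)
      then show "wedge_patch p z = wedge_patch p (- \<i> * cnj z)" by (simp only: w_def)
    }
    assume "0 \<le> Re z \<and> Im z \<le> 0"
    then have 0: "flat 0 (- Re z) = 0" "flat 0 (Im z) = 0" by (simp_all add: flat_0_bounds)
    define w where "w = \<i> * cnj z"
    have w: "Re w = Im z" "Im w = Re z" "\<i> * cnj z = w" by (simp_all add: w_def complex_eq_iff)
    have "wedge_patch p z = wedge_patch p w"
      by (simp add: wedge_patch_def quadrant_bump_def w 0)
    then show "wedge_patch p z = wedge_patch p (\<i> * cnj z)" by (simp only: w_def)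
  qed
qed

text \<open>An element of the wedge algebra takes the same value at the four corners. After subtracting it,
  the function \<open>F\<close> vanishes wherever the bump function \<open>W\<close> does, so it is uniformly close to
  \<open>W Q\<close> with \<open>Q = F W / (W\<^sup>2 + d)\<close> for small \<open>d > 0\<close>.\<close>

lemma smooth_wedge_dense:
  assumes f: "f \<in> C_wedge" and e: "e > 0"
  shows "\<exists>g\<in>C_wedge \<inter> C_inf_circle. \<forall>z\<in>sphere 0 1. cmod (f z - g z) < e"
proof -
  have fC: "f \<in> C_circle" using f by (simp add: C_wedge_def)
  define c where "c = f 1"
  define F where "F z = f z - c" for z
  define W where "W z = (flat 0 (Re z) + flat 0 (- Re z)) * (flat 0 (Im z) + flat 0 (- Im z))" for z
  have w: "\<And>z. cmod z = 1 \<Longrightarrow> 0 \<le> Re z \<Longrightarrow> 0 \<le> Im z \<Longrightarrow> f z = f (- \<i> * cnj z)"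
      "\<And>z. cmod z = 1 \<Longrightarrow> 0 \<le> Re z \<Longrightarrow> Im z \<le> 0 \<Longrightarrow> f z = f (\<i> * cnj z)"
    using f unfolding C_wedge_iff by auto
  have FC: "F \<in> C_circle" unfolding F_def[abs_def] by (intro C_circle_intros fC)
  have contW: "continuous_on UNIV W"
    unfolding W_def[abs_def]
    by (intro continuous_intros continuous_on_compose2[OF continuous_flat_0]) auto
  have W_bounds: "0 \<le> W z" "W z \<le> 1" for z
  proof -
    have "0 \<le> flat 0 x + flat 0 (- x)" "flat 0 x + flat 0 (- x) \<le> 1" for x
      by (auto simp: flat_def)
    then show "0 \<le> W z" "W z \<le> 1" unfolding W_def by (auto intro!: mult_nonneg_nonneg mult_le_one)
  qed
  have F0: "F z = 0" if z: "cmod z = 1" "W z = 0" for z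
  proof -
    \<comment> \<open>\<open>W\<close> vanishes only at the four corners, which the reflections identify with each other\<close>
    have "Re z = 0 \<or> Im z = 0"
      using z(2) flat_0_bounds(3)[of "Re z"] flat_0_bounds(3)[of "- Re z"]
        flat_0_bounds(3)[of "Im z"] flat_0_bounds(3)[of "- Im z"]
        flat_0_bounds(1)[of "Re z"] flat_0_bounds(1)[of "- Re z"] flat_0_bounds(1)[of "Im z"] flat_0_bounds(1)[of "- Im z"]
      unfolding W_def mult_eq_0_iff by (smt (verit))
    moreover have "(Re z)\<^sup>2 + (Im z)\<^sup>2 = 1" using z(1) cmod_power2[of z] by simp
    ultimately have "z = 1 \<or> z = - 1 \<or> z = \<i> \<or> z = - \<i>"
      by (auto simp: complex_eq_iff power2_eq_1_iff)
    moreover have "f (- \<i>) = c" "f \<i> = c" "f (- 1) = c"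
      using w(1)[of 1] w(2)[of 1] w(1)[of \<i>] by (auto simp: c_def)
    ultimately show ?thesis by (auto simp: F_def c_def)
  qed
  obtain B where B: "\<And>z. z \<in> sphere 0 1 \<Longrightarrow> cmod (F z) \<le> B" using C_circle_bounded[OF FC] by metis
  have "B \<ge> 0" using B[of 1] norm_ge_zero[of "F 1"] by (simp, linarith)
  define L where "L = {z \<in> sphere 0 1. e / 3 \<le> cmod (F z)}"
  have "compact L"
  proof -
    have "continuous_on (sphere 0 1) (\<lambda>z. cmod (F z))"
      using FC unfolding C_circle_def by (auto intro: continuous_intros)
    then have "closed L" unfolding L_def
      by (intro continuous_on_closed_Collect_le[of "sphere 0 1"] continuous_on_const) auto
    then show ?thesis
      by (metis (no_types, lifting) L_def compact_sphere compact_Int_closed Int_absorb1 mem_Collect_eq subsetI)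
  qed
  obtain w0 where w0: "w0 > 0" "\<And>z. z \<in> L \<Longrightarrow> w0 \<le> W z"
  proof (cases "L = {}")
    case False
    then obtain z0 where z0: "z0 \<in> L" "\<And>z. z \<in> L \<Longrightarrow> W z0 \<le> W z"
      using continuous_attains_inf[OF \<open>compact L\<close> False continuous_on_subset[OF contW]] by auto
    have "F z0 \<noteq> 0" using z0(1) e by (auto simp: L_def)
    then have "W z0 \<noteq> 0" using F0[of z0] z0(1) by (auto simp: L_def)
    then show thesis using that[of "W z0"] z0(2) W_bounds(1)[of z0] by auto
  qed (use that[of 1] in auto)
  \<comment> \<open>chosen such that \<open>B d / w0\<^sup>2 \<le> e / 3\<close> where \<open>F\<close> is not small; the summand \<open>1\<close> allows \<open>B = 0\<close>\<close>
  define d where "d = e * w0\<^sup>2 / (3 * (B + 1))"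
  have d: "d > 0" using e w0 \<open>B \<ge> 0\<close> by (simp add: d_def)
  define Q where "Q z = F z * complex_of_real (W z / ((W z)\<^sup>2 + d))" for z
  have den: "(W z)\<^sup>2 + d > 0" for z using d by (simp add: add_nonneg_pos)
  have "continuous_on (sphere 0 1) Q"
    unfolding Q_def[abs_def]
    by (intro continuous_intros continuous_on_subset[OF contW]) (use FC den in \<open>auto simp: C_circle_def less_imp_neq[symmetric]\<close>)
  then obtain p where p: "polynomial_function p" "\<And>z. z \<in> sphere 0 1 \<Longrightarrow> norm (Q z - p z) < e / 3"
    using Stone_Weierstrass_polynomial_function[of "sphere 0 1" Q "e / 3"] e by auto
  have WQ: "cmod (F z - W z * Q z) \<le> e / 3" if z: "z \<in> sphere 0 1" for z
  proof -
    have "F z - W z * Q z = F z * complex_of_real (d / ((W z)\<^sup>2 + d))"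
    proof -
      define k where "k = complex_of_real (W z / ((W z)\<^sup>2 + d))"
      have "1 - W z * (W z / ((W z)\<^sup>2 + d)) = d / ((W z)\<^sup>2 + d)"
        using den[of z] by (simp add: field_simps power2_eq_square)
      then have "complex_of_real (d / ((W z)\<^sup>2 + d)) = 1 - W z * k"
        unfolding k_def by (metis of_real_1 of_real_diff of_real_mult)
      moreover have "F z - W z * Q z = F z * (1 - W z * k)"
        unfolding Q_def k_def[symmetric] by (simp add: algebra_simps)
      ultimately show ?thesis by (simp only:)
    qed
    then have eq: "cmod (F z - W z * Q z) = cmod (F z) * (d / ((W z)\<^sup>2 + d))"
      using d den[of z] by (simp add: norm_mult del: of_real_divide)
    show ?thesis
    proof (cases "z \<in> L")
      case True
      have "w0\<^sup>2 \<le> (W z)\<^sup>2 + d" using w0(1) w0(2)[OF True] d by (smt (verit) power_mono)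
      then have "cmod (F z) * (d / ((W z)\<^sup>2 + d)) \<le> B * (d / w0\<^sup>2)"
        using B[OF z] d w0 \<open>B \<ge> 0\<close> by (intro mult_mono frac_le) auto
      also have "B * (d / w0\<^sup>2) = (e / 3) * (B / (B + 1))" using w0 by (simp add: d_def)
      also have "\<dots> \<le> (e / 3) * 1" using e \<open>B \<ge> 0\<close> by (intro mult_left_mono) auto
      finally show ?thesis using eq by simp
    next
      case False
      then have "cmod (F z) \<le> e / 3" using z by (auto simp: L_def)
      moreover have "0 \<le> d / ((W z)\<^sup>2 + d)" "d / ((W z)\<^sup>2 + d) \<le> 1" using d den[of z] by (auto simp: field_simps)
      ultimately have "cmod (F z) * (d / ((W z)\<^sup>2 + d)) \<le> (e / 3) * 1" using e by (intro mult_mono) auto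
      then show ?thesis using eq by simp
    qed
  qed
  define g where "g z = c + wedge_patch p z" for z
  have upper: "cmod (f z - g z) < e" if z: "z \<in> sphere 0 1" "0 \<le> Im z" for z
  proof -
    have "wedge_patch p z = W z * p z"
      using z(2) by (simp add: wedge_patch_def quadrant_bump_def W_def flat_0_bounds algebra_simps)
    then have "f z - g z = (F z - W z * Q z) + W z * (Q z - p z)"
      by (simp add: F_def g_def algebra_simps)
    then have "cmod (f z - g z) \<le> cmod (F z - W z * Q z) + cmod (W z * (Q z - p z))"
      by (simp only: norm_triangle_ineq)
    moreover have "cmod (W z * (Q z - p z)) \<le> 1 * (e / 3)"
      unfolding norm_mult using W_bounds[of z] p(2)[OF z(1)] by (intro mult_mono) auto
    ultimately show ?thesis using WQ[OF z(1)] e by simp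
  qed
  have gw: "g \<in> C_wedge"
    unfolding g_def[abs_def] using wedge_patch_smooth[OF p(1)] by (intro C_wedge_intros) auto
  have gw': "\<And>z. cmod z = 1 \<Longrightarrow> 0 \<le> Re z \<Longrightarrow> 0 \<le> Im z \<Longrightarrow> g z = g (- \<i> * cnj z)"
      "\<And>z. cmod z = 1 \<Longrightarrow> 0 \<le> Re z \<Longrightarrow> Im z \<le> 0 \<Longrightarrow> g z = g (\<i> * cnj z)"
    using gw unfolding C_wedge_iff by auto
  have ginf: "g \<in> C_inf_circle"
    unfolding g_def[abs_def]
    by (rule flat_trig_C_inf) (rule flat_trig.add[OF flat_trig.const wedge_patch_flat_trig[OF p(1)]])
  have "cmod (f z - g z) < e" if z: "z \<in> sphere 0 1" for z
  proof -
    have z1: "cmod z = 1" using z by simp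
    consider "0 \<le> Im z" | "Im z < 0" "0 \<le> Re z" | "Im z < 0" "Re z < 0" by linarith
    then show ?thesis
    proof cases
      case 1
      then show ?thesis using upper z by blast
    next
      case 2
      then have "f z = f (\<i> * cnj z)" "g z = g (\<i> * cnj z)" using w(2) gw'(2) z1 by auto
      moreover have "cmod (f (\<i> * cnj z) - g (\<i> * cnj z)) < e" using z 2 by (intro upper) (auto simp: norm_mult)
      ultimately show ?thesis by simp
    next
      case 3
      let ?z = "- \<i> * cnj z"
      have "- \<i> * cnj ?z = z" by (simp flip: mult.assoc)
      moreover have "f ?z = f (- \<i> * cnj ?z)" "g ?z = g (- \<i> * cnj ?z)"
        using 3 z1 by (intro w(1) gw'(1); simp add: norm_mult)+
      moreover have "cmod (f ?z - g ?z) < e" using z 3 by (intro upper) (auto simp: norm_mult)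
      ultimately show ?thesis by simp
    qed
  qed
  then show ?thesis using gw ginf by blast
qed

section \<open>The smooth algebra is dense in the Toeplitz torus\<close>

lemma star_subalgebra_star_alg:
  assumes "star_subalgebra A" "X \<subseteq> A" shows "star_subalgebra (star_alg X)"
  using assms unfolding star_alg_def star_subalgebra_def by (intro conjI) blast+

lemma star_alg_subset: "star_subalgebra A \<Longrightarrow> X \<subseteq> A \<Longrightarrow> star_alg X \<subseteq> A"
  unfolding star_alg_def by blast

lemma star_alg_superset: "X \<subseteq> star_alg X"
  unfolding star_alg_def by blast

lemma generators_subset_torus: "smooth_toeplitz_ops \<union> finite_matrix_ops \<subseteq> toeplitz_torus"
proof -
  have "toeplitz f \<in> toeplitz_torus" if "f \<in> C_wedge" for f
    unfolding toeplitz_torus_eq using that by (rule toeplitz_in_symbol_alg)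
  moreover have "K \<in> toeplitz_torus" if "K \<in> finite_matrix_ops" for K
    unfolding toeplitz_torus_eq
  proof (rule symbol_algI[OF C_wedge_intros(1)[of 0]])
    show "K \<in> compact_ops" using that finite_matrix_compact by blast
    show "K = toeplitz (\<lambda>_. 0) + K" by (rule blinfun_eqI) (simp add: toeplitz_const blinfun.add_left)
  qed
  ultimately show ?thesis by (auto simp: smooth_toeplitz_ops_def)
qed

lemma star_subalgebra_toeplitz_torus: "star_subalgebra toeplitz_torus"
  using cstar_subalgebra_toeplitz_torus by (simp add: cstar_subalgebra_def)

lemma star_subalgebra_torus_smooth: "star_subalgebra torus_smooth_algebra"
  unfolding torus_smooth_algebra_def
  by (rule star_subalgebra_star_alg[OF star_subalgebra_toeplitz_torus generators_subset_torus])

lemma torus_smooth_subset: "torus_smooth_algebra \<subseteq> toeplitz_torus"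
  unfolding torus_smooth_algebra_def
  by (rule star_alg_subset[OF star_subalgebra_toeplitz_torus generators_subset_torus])

lemma torus_smooth_dense: "toeplitz_torus \<subseteq> closure torus_smooth_algebra"
proof
  fix a assume "a \<in> toeplitz_torus"
  then obtain f K where f: "f \<in> C_wedge" and K: "K \<in> compact_ops" and a: "a = toeplitz f + K"
    unfolding toeplitz_torus_eq by (rule symbol_algE)
  have fC: "f \<in> C_circle" using f by (simp add: C_wedge_def)
  show "a \<in> closure torus_smooth_algebra"
    unfolding closure_approachable
  proof (intro allI impI)
    fix e :: real assume e: "e > 0"
    obtain g where g: "g \<in> C_wedge \<inter> C_inf_circle" "\<And>z. z \<in> sphere 0 1 \<Longrightarrow> cmod (f z - g z) < e / 2"
      using smooth_wedge_dense[OF f, of "e / 2"] e by auto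
    have gC: "g \<in> C_circle" using g(1) by (simp add: C_wedge_def)
    obtain T where T: "T \<in> finite_matrix_ops" "dist T K < e / 2"
      using K e unfolding compact_ops_eq_closure_finite_matrix closure_approachable by (meson half_gt_zero)
    have "toeplitz g \<in> torus_smooth_algebra" "T \<in> torus_smooth_algebra"
      using g(1) T(1) star_alg_superset[of "smooth_toeplitz_ops \<union> finite_matrix_ops"]
      unfolding torus_smooth_algebra_def smooth_toeplitz_ops_def by blast+
    then have "toeplitz g + T \<in> torus_smooth_algebra"
      using star_subalgebra_torus_smooth by (simp add: star_subalgebra_def)
    moreover have "dist (toeplitz g + T) a < e"
    proof -
      have "norm (toeplitz (\<lambda>z. f z - g z)) \<le> e / 2"
        using g(2) by (intro toeplitz_norm C_circle_intros fC gC) (auto intro: less_imp_le)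
      then have "dist (toeplitz g) (toeplitz f) \<le> e / 2"
        by (simp add: toeplitz_diff fC gC dist_norm norm_minus_commute)
      then show ?thesis
        using T(2) dist_triangle_add[of "toeplitz g" T "toeplitz f" K] unfolding a by linarith
    qed
    ultimately show "\<exists>y\<in>torus_smooth_algebra. dist y a < e" by blast
  qed
qed

section \<open>Block operators\<close>

lemma fst_scaleC [simp]: "fst (c *\<^sub>C v) = c *\<^sub>C fst v" and snd_scaleC [simp]: "snd (c *\<^sub>C v) = c *\<^sub>C snd v"
  by (simp_all add: scaleC_prod_def)

lemma cinner_Pair: "cinner (x, y) v = cinner x (fst v) + cinner y (snd v)"
  by (simp add: cinner_prod_def)

lemma apply_dsum_op [simp]: "dsum_op S T \<cdot> v = (S \<cdot> fst v, T \<cdot> snd v)"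
proof -
  have "bounded_linear (\<lambda>v. (S \<cdot> fst v, T \<cdot> snd v))"
    by (intro bounded_linear_Pair bounded_linear_compose[OF blinfun.bounded_linear_right]
        bounded_linear_fst bounded_linear_snd)
  then show ?thesis unfolding dsum_op_def case_prod_beta by (simp add: bounded_linear_Blinfun_apply)
qed

lemma apply_offdiag_op [simp]:
  "offdiag_op S T \<cdot> v = (S \<cdot> snd v, T \<cdot> fst v)"
proof -
  have "bounded_linear (\<lambda>v. (S \<cdot> snd v, T \<cdot> fst v))"
    by (intro bounded_linear_Pair bounded_linear_compose[OF blinfun.bounded_linear_right]
        bounded_linear_fst bounded_linear_snd)
  then show ?thesis unfolding offdiag_op_def case_prod_beta by (simp add: bounded_linear_Blinfun_apply)
qed

lemma dsum_op_bops: "S \<in> bops \<Longrightarrow> T \<in> bops \<Longrightarrow> dsum_op S T \<in> bops"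
  by (auto simp: bops_def prod_eq_iff)

lemma offdiag_op_bops: "S \<in> bops \<Longrightarrow> T \<in> bops \<Longrightarrow> offdiag_op S T \<in> bops"
  by (auto simp: bops_def prod_eq_iff)

lemma apply_torus_rep [simp]: "torus_rep a \<cdot> v = (a \<cdot> fst v, a \<cdot> snd v)"
  by (simp add: torus_rep_def)

lemma torus_rep_bops: "a \<in> bops \<Longrightarrow> torus_rep a \<in> bops"
  by (simp add: torus_rep_def dsum_op_bops)

lemma torus_rep_algebra:
  "torus_rep (a + b) = torus_rep a + torus_rep b"
  "torus_rep (a o\<^sub>L b) = torus_rep a o\<^sub>L torus_rep b"
  "torus_rep (scaleC_op c a) = scaleC_op c (torus_rep a)"
  by (auto intro!: blinfun_eqI simp: blinfun.add_left prod_eq_iff)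

lemma torus_rep_adj: "a \<in> bops \<Longrightarrow> adj (torus_rep a) = torus_rep (adj a)"
  by (rule adj_eqI) (simp add: cinner_prod_def std.adj_works(1))

lemma offdiag_adj: "S \<in> bops \<Longrightarrow> T \<in> bops \<Longrightarrow> adj (offdiag_op S T) = offdiag_op (adj T) (adj S)"
  for S T :: "ell2 \<Rightarrow>\<^sub>L ell2"
  by (rule adj_eqI) (simp add: cinner_prod_def std.adj_works(1))

lemma faithful_torus_rep:
  assumes "A \<subseteq> bops" shows "faithful_star_rep A torus_rep"
  unfolding faithful_star_rep_def
proof (intro conjI ballI allI)
  show "torus_rep ` A \<subseteq> bops" using assms torus_rep_bops by blast
  show "inj_on torus_rep A"
  proof (rule inj_onI, rule blinfun_eqI)
    fix a b x assume "torus_rep a = torus_rep b"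
    then have "torus_rep a \<cdot> (x, x) = torus_rep b \<cdot> (x, x)" by simp
    then show "a \<cdot> x = b \<cdot> x" by simp
  qed
qed (use assms in \<open>auto simp: torus_rep_algebra torus_rep_adj\<close>)

section \<open>The Dirac operator is diagonal\<close>

abbreviation idx :: "int \<Rightarrow> nat" where "idx k \<equiv> nat \<bar>k\<bar>"

definition eigvec_norm :: "int \<Rightarrow> complex" where
  "eigvec_norm k = (if k = 0 then 1 else 1 / complex_of_real (sqrt 2))"

text \<open>The sign \<open>sgn 0 = 0\<close> removes the first component of \<open>b\<^sub>0\<close>, so the truncated subtraction does not
  matter.\<close>

lemma torus_eigvec_eq:
  "torus_eigvec k = eigvec_norm k *\<^sub>C (of_int (sgn k) *\<^sub>C ebasis (idx k - 1), ebasis (idx k))"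
proof -
  have "nat (k - 1) = idx k - 1" if "k > 0" using that by linarith
  moreover have "nat (- k - 1) = idx k - 1" if "k < 0" using that by linarith
  ultimately show ?thesis
    by (auto simp: torus_eigvec_def eigvec_norm_def scaleC_prod_def scaleC_minus_left sgn_if)
qed

lemma eigvec_norm_square: "eigvec_norm k * eigvec_norm k = (if k = 0 then 1 else 1 / 2)"
proof -
  have "complex_of_real (sqrt 2) * complex_of_real (sqrt 2) = 2"
    by (simp flip: of_real_mult)
  then show ?thesis by (simp add: eigvec_norm_def)
qed

lemma eigvec_norm_nz: "eigvec_norm k \<noteq> 0" and cnj_eigvec_norm: "cnj (eigvec_norm k) = eigvec_norm k"
  by (simp_all add: eigvec_norm_def)

lemma cinner_torus_eigvec:
  "cinner (torus_eigvec k) v =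
    eigvec_norm k * (of_int (sgn k) * entry (fst v) (idx k - 1) + entry (snd v) (idx k))"
  by (simp add: torus_eigvec_eq cinner_scaleC_left cinner_Pair cnj_eigvec_norm)

lemma idx_Suc: "k \<noteq> 0 \<Longrightarrow> \<exists>m. idx k = Suc m \<and> \<bar>k\<bar> = int (Suc m)"
  by (rule exI[of _ "idx k - 1"]) auto

text \<open>Completeness: the coordinates at \<open>k\<close> and \<open>- k\<close> are the sum and the difference of one entry from each
  component, so if all of them vanish, so do all entries.\<close>

interpretation eig: onb torus_eigvec
proof (rule onbI)
  fix k l :: int
  have "cinner (torus_eigvec k) (torus_eigvec l) = eigvec_norm k * eigvec_norm l *
     (of_int (sgn k * sgn l) * (if idx k - 1 = idx l - 1 then 1 else 0) + (if idx k = idx l then 1 else 0))"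
    unfolding cinner_torus_eigvec by (simp add: torus_eigvec_eq entry_ebasis algebra_simps)
  also have "\<dots> = (if k = l then 1 else 0)"
  proof (cases "k = 0 \<or> l = 0")
    case True
    then have "sgn k * sgn l = 0" "idx k = idx l \<longleftrightarrow> k = l" by auto
    then show ?thesis by (cases "k = l") (use True in \<open>auto simp: eigvec_norm_def\<close>)
  next
    case False
    obtain m n where mn: "idx k = Suc m" "\<bar>k\<bar> = int (Suc m)" "idx l = Suc n" "\<bar>l\<bar> = int (Suc n)"
      using idx_Suc[of k] idx_Suc[of l] False by auto
    have *: "idx k - 1 = idx l - 1 \<longleftrightarrow> \<bar>k\<bar> = \<bar>l\<bar>" "idx k = idx l \<longleftrightarrow> \<bar>k\<bar> = \<bar>l\<bar>"
      unfolding mn(1,3) unfolding mn(2,4) by simp_all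
    have "eigvec_norm k = eigvec_norm l" using False by (simp add: eigvec_norm_def)
    then have n: "eigvec_norm k * eigvec_norm l = 1 / 2" using False by (simp add: eigvec_norm_square)
    show ?thesis
      unfolding * n using False by (cases "\<bar>k\<bar> = \<bar>l\<bar>") (auto simp: abs_if sgn_if split: if_splits)
  qed
  finally show "cinner (torus_eigvec k) (torus_eigvec l) = (if k = l then 1 else 0)" .
next
  fix v assume v: "\<And>k. cinner (torus_eigvec k) v = 0"
  have eq: "of_int (sgn k) * entry (fst v) (idx k - 1) + entry (snd v) (idx k) = 0" for k
    using v[of k] by (simp add: cinner_torus_eigvec eigvec_norm_nz)
  have "entry (fst v) n = 0 \<and> entry (snd v) (Suc n) = 0" for n
    using eq[of "int (Suc n)"] eq[of "- int (Suc n)"] by (simp add: nat_add_distrib add_eq_0_iff) 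
  moreover have "entry (snd v) 0 = 0" using eq[of 0] by simp
  ultimately have "entry (fst v) n = 0" "entry (snd v) n = 0" for n by (cases n; simp)+
  then show "v = 0" by (simp add: prod_eq_iff ell2_eqI)
qed

text \<open>That the entries of \<open>\<partial>\<^sub>z x\<close>, or of its adjoint below, come from a square summable sequence already
  puts \<open>x\<close> into the domain. This is how the maximal domain of the diagonal operator is recognized as the given one.\<close>

lemma dom_N_I: "(\<And>n. entry y n = of_nat (Suc n) * entry x (Suc n)) \<Longrightarrow> x \<in> dom_N"
proof -
  assume y: "\<And>n. entry y n = of_nat (Suc n) * entry x (Suc n)"
  have "summable (\<lambda>n. (real (Suc n))\<^sup>2 * (cmod (entry x (Suc n)))\<^sup>2)"
    using summable_entry[of y] by (simp add: y norm_mult power_mult_distrib del: of_nat_Suc)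
  then show ?thesis unfolding dom_N_def mem_Collect_eq by (subst (asm) summable_Suc_iff)
qed

lemma dom_N_I': "(\<And>n. entry v (Suc n) = of_nat (Suc n) * entry x n) \<Longrightarrow> x \<in> dom_N"
proof -
  assume v: "\<And>n. entry v (Suc n) = of_nat (Suc n) * entry x n"
  have "summable (\<lambda>n. (cmod (entry v (Suc n)))\<^sup>2)" using summable_entry[of v] by (subst summable_Suc_iff)
  then show ?thesis unfolding dom_N_def mem_Collect_eq
  proof (rule summable_comparison_test'[where N = 0])
    fix n
    have "(real n)\<^sup>2 * (cmod (entry x n))\<^sup>2 \<le> (real (Suc n))\<^sup>2 * (cmod (entry x n))\<^sup>2"
      by (intro mult_right_mono power_mono) auto
    also have "\<dots> = (cmod (entry v (Suc n)))\<^sup>2"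
      by (simp add: v norm_mult power_mult_distrib del: of_nat_Suc)
    finally show "norm ((real n)\<^sup>2 * (cmod (entry x n))\<^sup>2) \<le> (cmod (entry v (Suc n)))\<^sup>2" by simp
  qed
qed

lemma dom_N_ex:
  assumes "x \<in> dom_N"
  shows "\<exists>y. \<forall>n. entry y n = of_nat (Suc n) * entry x (Suc n)"
    and "\<exists>v. entry v 0 = 0 \<and> (\<forall>n. entry v (Suc n) = of_nat (Suc n) * entry x n)"
proof -
  have sm: "summable (\<lambda>n. (real n)\<^sup>2 * (cmod (entry x n))\<^sup>2)" using assms by (simp add: dom_N_def)
  then have "summable (\<lambda>n. (real (Suc n))\<^sup>2 * (cmod (entry x (Suc n)))\<^sup>2)" by (subst summable_Suc_iff)
  then have "summable (\<lambda>n. (cmod (of_nat (Suc n) * entry x (Suc n)))\<^sup>2)"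
    by (simp add: norm_mult power_mult_distrib del: of_nat_Suc)
  then show "\<exists>y. \<forall>n. entry y n = of_nat (Suc n) * entry x (Suc n)"
    by (intro exI[of _ "Abs_ell2 (\<lambda>n. of_nat (Suc n) * entry x (Suc n))"]) (simp add: Abs_ell2_inverse)
  let ?v = "case_nat 0 (\<lambda>n. of_nat (Suc n) * entry x n)"
  have "summable (\<lambda>n. 2 * ((real n)\<^sup>2 * (cmod (entry x n))\<^sup>2) + 2 * (cmod (entry x n))\<^sup>2)"
    using sm by (intro summable_add summable_mult summable_entry)
  then have "summable (\<lambda>n. (cmod (?v (Suc n)))\<^sup>2)"
  proof (rule summable_comparison_test'[where N = 0])
    fix n
    have "(real (Suc n))\<^sup>2 \<le> 2 * (real n)\<^sup>2 + 2"
      using sum_squares_bound[of "real n" 1] by (simp add: power2_sum)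
    then have "(real (Suc n))\<^sup>2 * (cmod (entry x n))\<^sup>2 \<le> (2 * (real n)\<^sup>2 + 2) * (cmod (entry x n))\<^sup>2"
      by (intro mult_right_mono) auto
    then show "norm ((cmod (?v (Suc n)))\<^sup>2) \<le> 2 * ((real n)\<^sup>2 * (cmod (entry x n))\<^sup>2) + 2 * (cmod (entry x n))\<^sup>2"
      by (simp add: norm_mult power_mult_distrib distrib_right mult.assoc del: of_nat_Suc)
  qed
  then have "summable (\<lambda>n. (cmod (?v n))\<^sup>2)" by (subst (asm) summable_Suc_iff)
  then show "\<exists>v. entry v 0 = 0 \<and> (\<forall>n. entry v (Suc n) = of_nat (Suc n) * entry x n)"
    by (intro exI[of _ "Abs_ell2 ?v"]) (simp add: Abs_ell2_inverse del: of_nat_Suc)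
qed

lemma ebasis_dom_N: "ebasis n \<in> dom_N"
  unfolding dom_N_def mem_Collect_eq by (rule summable_finite[of "{n}"]) (auto simp: entry_ebasis)

lemma del_z_iff: "(x, y) \<in> del_z \<longleftrightarrow> x \<in> dom_N \<and> (\<forall>n. entry y n = of_nat (Suc n) * entry x (Suc n))"
proof -
  let ?s = "\<lambda>n. entry x n *\<^sub>C of_nat n *\<^sub>C ebasis (n - 1)"
  have sums: "?s sums y" if y: "\<And>n. entry y n = of_nat (Suc n) * entry x (Suc n)" for y
  proof -
    have "(\<lambda>n. entry y n *\<^sub>C ebasis n) sums y"
      using has_sum_imp_sums[OF std.expansion[of y]] by simp
    moreover have "(\<lambda>n. entry y n *\<^sub>C ebasis n) = (\<lambda>n. ?s (Suc n))"
      by (simp add: y scaleC_scaleC mult.commute del: of_nat_Suc)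
    ultimately have "(\<lambda>n. ?s (Suc n)) sums y" by simp
    then have "?s sums (y + ?s 0)" by (rule sums_Suc)
    then show ?thesis by simp
  qed
  show ?thesis
  proof
    assume "(x, y) \<in> del_z"
    then have x: "x \<in> dom_N" "?s sums y" by (auto simp: del_z_def)
    obtain y' where "\<forall>n. entry y' n = of_nat (Suc n) * entry x (Suc n)" using dom_N_ex(1)[OF x(1)] by blast
    then show "x \<in> dom_N \<and> (\<forall>n. entry y n = of_nat (Suc n) * entry x (Suc n))"
      using x sums[of y'] sums_unique2 by blast
  qed (use sums in \<open>auto simp: del_z_def\<close>)
qed

lemma adjoint_del_z_iff:
  "(x, v) \<in> op_adjoint del_z \<longleftrightarrow> entry v 0 = 0 \<and> (\<forall>n. entry v (Suc n) = of_nat (Suc n) * entry x n)"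
proof
  assume xv: "(x, v) \<in> op_adjoint del_z"
  have eq: "cinner w x = cinner p v" if "(p, w) \<in> del_z" for p w
    using xv that unfolding op_adjoint_def by blast
  have "(ebasis 0, 0) \<in> del_z" by (simp add: del_z_iff ebasis_dom_N entry_ebasis)
  moreover have "(ebasis (Suc n), of_nat (Suc n) *\<^sub>C ebasis n) \<in> del_z" for n
    by (auto simp: del_z_iff ebasis_dom_N entry_ebasis)
  ultimately show "entry v 0 = 0 \<and> (\<forall>n. entry v (Suc n) = of_nat (Suc n) * entry x n)"
    using eq[of "ebasis 0" 0] eq[of "ebasis (Suc n)" "of_nat (Suc n) *\<^sub>C ebasis n" for n]
    by (auto simp: cinner_scaleC_left simp del: of_nat_Suc)
next
  assume v: "entry v 0 = 0 \<and> (\<forall>n. entry v (Suc n) = of_nat (Suc n) * entry x n)"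
  have "cinner w x = cinner p v" if "(p, w) \<in> del_z" for p w
  proof -
    have w: "entry w n = of_nat (Suc n) * entry p (Suc n)" for n using that by (simp add: del_z_iff)
    have "cinner p v = (\<Sum>n. cnj (entry p (Suc n)) * entry v (Suc n))"
      unfolding cinner_ell2_def using suminf_split_head[OF summable_entry_mult[of p v]] v by simp
    also have "\<dots> = cinner w x"
      unfolding cinner_ell2_def by (simp add: v w mult.left_commute mult.assoc del: of_nat_Suc)
    finally show ?thesis by simp
  qed
  then show "(x, v) \<in> op_adjoint del_z" unfolding op_adjoint_def by auto
qed

lemma torus_dirac_iff: "((x, y), (u, v)) \<in> torus_dirac \<longleftrightarrow>
   (\<forall>n. entry u n = of_nat (Suc n) * entry y (Suc n)) \<and>
   entry v 0 = 0 \<and> (\<forall>n. entry v (Suc n) = of_nat (Suc n) * entry x n)"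
  unfolding torus_dirac_def using dom_N_I[of u y] dom_N_I'[of v x]
  by (auto simp: del_z_iff adjoint_del_z_iff)

text \<open>The eigenvalue equations for the coordinates at \<open>k\<close> and \<open>- k\<close> are the sum and the difference of the
  equations that define the two blocks of the Dirac operator.\<close>

theorem torus_dirac_diag: "torus_dirac = eig.diag_op of_int"
proof -
  have "((x, y), (u, v)) \<in> torus_dirac \<longleftrightarrow> ((x, y), (u, v)) \<in> eig.diag_op of_int" for x y u v
  proof -
    have "((x, y), (u, v)) \<in> eig.diag_op of_int \<longleftrightarrow>
      (\<forall>k::int. of_int (sgn k) * entry u (idx k - 1) + entry v (idx k) =
        of_int k * (of_int (sgn k) * entry x (idx k - 1) + entry y (idx k)))" (is "_ \<longleftrightarrow> (\<forall>k. ?P k)")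
    proof -
      have "cinner (torus_eigvec k) (u, v) = of_int k * cinner (torus_eigvec k) (x, y) \<longleftrightarrow> ?P k" for k
      proof -
        have "cinner (torus_eigvec k) (u, v) = of_int k * cinner (torus_eigvec k) (x, y) \<longleftrightarrow>
          eigvec_norm k * (of_int (sgn k) * entry u (idx k - 1) + entry v (idx k)) =
          eigvec_norm k * (of_int k * (of_int (sgn k) * entry x (idx k - 1) + entry y (idx k)))"
          unfolding cinner_torus_eigvec by (simp add: mult.left_commute)
        then show ?thesis by (simp only: mult_cancel_left eigvec_norm_nz) simp
      qed
      then show ?thesis by (simp add: eig.diag_op_def)
    qed
    also have "\<dots> \<longleftrightarrow> ?P 0 \<and> (\<forall>n. ?P (int (Suc n)) \<and> ?P (- int (Suc n)))"
    proof (intro iffI conjI allI)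
      fix k :: int assume a: "?P 0 \<and> (\<forall>n. ?P (int (Suc n)) \<and> ?P (- int (Suc n)))"
      consider "k = 0" | n where "k = int (Suc n)" | n where "k = - int (Suc n)"
        by (metis int_cases3 old.nat.exhaust of_nat_0_less_iff less_irrefl)
      then show "?P k" using a by cases metis+
    qed blast+
    also have "\<dots> \<longleftrightarrow> entry v 0 = 0 \<and> (\<forall>n. entry u n = of_nat (Suc n) * entry y (Suc n) \<and>
        entry v (Suc n) = of_nat (Suc n) * entry x n)"
    proof -
      have nn: "idx (int (Suc n)) = Suc n" "idx (- int (Suc n)) = Suc n" for n by linarith+
      have sg: "sgn (int (Suc n)) = 1" "sgn (- int (Suc n)) = - 1" for n by simp_all
      have alg: "(u' + v' = c * (x' + y') \<and> - u' + v' = - c * (- x' + y')) \<longleftrightarrow> u' = c * y' \<and> v' = c * x'"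
        for u' v' x' y' c :: complex
      proof (intro iffI conjI)
        assume a: "u' + v' = c * (x' + y') \<and> - u' + v' = - c * (- x' + y')"
        then have "(u' + v') + (- u' + v') = c * (x' + y') + (- c * (- x' + y'))" by (simp only:)
        then have "2 * v' = 2 * (c * x')" by (simp add: algebra_simps)
        then show v: "v' = c * x'" by simp
        have "u' + v' = c * y' + c * x'" using a by (simp only: distrib_left add.commute)
        then show "u' = c * y'" by (simp only: v add_right_cancel)
      qed (auto simp: algebra_simps)
      show ?thesis
        unfolding nn sg using alg[of "entry u n" "entry v (Suc n)" "of_nat (Suc n)" "entry x n" "entry y (Suc n)" for n]
        by (simp del: of_nat_Suc)
    qed
    finally show ?thesis unfolding torus_dirac_iff by blast
  qed
  then show ?thesis by auto
qed

lemma Domain_torus_dirac: "Domain torus_dirac = dom_N \<times> dom_N"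
proof (intro equalityI subsetI)
  fix p assume "p \<in> Domain torus_dirac"
  then show "p \<in> dom_N \<times> dom_N" by (auto simp: torus_dirac_def)
next
  fix p assume "p \<in> dom_N \<times> dom_N"
  then obtain x y where p: "p = (x, y)" "x \<in> dom_N" "y \<in> dom_N" by auto
  obtain u where u: "\<forall>n. entry u n = of_nat (Suc n) * entry y (Suc n)" using dom_N_ex(1)[OF p(3)] by blast
  obtain v where v: "entry v 0 = 0 \<and> (\<forall>n. entry v (Suc n) = of_nat (Suc n) * entry x n)" using dom_N_ex(2)[OF p(2)] by blast
  have "((x, y), (u, v)) \<in> torus_dirac" unfolding torus_dirac_iff using u v by blast
  then show "p \<in> Domain torus_dirac" using p(1) by blast
qed

lemma self_adjoint_torus_dirac: "self_adjoint torus_dirac"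
  unfolding torus_dirac_diag by (rule eig.self_adjoint_diag_op) simp

lemma op_abs_torus_dirac: "op_abs torus_dirac = eig.diag_op (\<lambda>k. complex_of_real \<bar>real_of_int k\<bar>)"
  unfolding torus_dirac_diag eig.op_abs_diag_op by simp

lemma torus_resolvent_compact: "\<exists>R\<in>compact_ops. op_graph R = converse (op_shift torus_dirac \<i>)"
proof -
  let ?m = "\<lambda>k::int. inverse (complex_of_int k + \<i>)"
  have ge: "1 \<le> cmod (complex_of_int k + \<i>)" "\<bar>real_of_int k\<bar> \<le> cmod (complex_of_int k + \<i>)" for k
    using abs_Im_le_cmod[of "complex_of_int k + \<i>"] abs_Re_le_cmod[of "complex_of_int k + \<i>"] by simp_all
  have bd: "cmod (?m k) \<le> 1" for k
    using ge(1)[of k] by (simp add: norm_inverse inverse_le_1_iff)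
  have "eig.bdiag ?m \<in> compact_ops"
  proof (rule eig.bdiag_compact[OF bd])
    fix e :: real assume e: "e > 0"
    have "\<bar>k\<bar> \<le> \<lceil>1 / e\<rceil>" if "e \<le> cmod (?m k)" for k
    proof -
      have "cmod (complex_of_int k + \<i>) \<le> 1 / e"
      proof -
        define c where "c = cmod (complex_of_int k + \<i>)"
        have "e \<le> inverse c" "c > 0" using that ge(1)[of k] by (simp_all only: norm_inverse c_def)
        then show ?thesis unfolding c_def[symmetric] using e by (simp add: field_simps)
      qed
      then have "\<bar>real_of_int k\<bar> \<le> 1 / e" using ge(2)[of k] by linarith
      then show ?thesis by linarith
    qed
    then have "{k. e \<le> cmod (?m k)} \<subseteq> {- \<lceil>1 / e\<rceil>..\<lceil>1 / e\<rceil>}" by (auto simp: abs_le_iff) (metis minus_le_iff)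
    then show "finite {k. e \<le> cmod (?m k)}" using finite_subset by blast
  qed
  then show ?thesis
    unfolding torus_dirac_diag using eig.resolvent_diag_op(2)[of 1 of_int \<i>, OF zero_less_one ge(1)] by blast
qed

section \<open>Spectrum\<close>

lemma spectrum_torus_dirac: "op_spectrum torus_dirac = \<int>"
proof (intro equalityI subsetI)
  fix l :: complex assume "l \<in> \<int>"
  then obtain k :: int where "l = of_int k" by (auto elim: Ints_cases)
  then show "l \<in> op_spectrum torus_dirac"
    unfolding torus_dirac_diag using eig.eigenvalue_in_spectrum[of of_int k] by simp
next
  fix l :: complex assume l: "l \<in> op_spectrum torus_dirac"
  show "l \<in> \<int>"
  proof (rule ccontr)
    assume "l \<notin> \<int>"
    then obtain d where d: "d > 0" "\<And>x. x \<in> \<int> \<Longrightarrow> d \<le> dist l x"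
      using separate_point_closed[of "\<int>" l] closed_Ints by blast
    have "d \<le> cmod (of_int k + - l)" for k
      using d(2)[of "of_int k"] by (simp add: dist_norm norm_minus_commute)
    from eig.resolvent_diag_op[of d of_int "- l", OF d(1) this] show False
      using l unfolding op_spectrum_def torus_dirac_diag by blast
  qed
qed

lemma eigenspace_torus_dirac: "eigenspace torus_dirac (of_int k) = cvec.span {torus_eigvec k}"
proof (intro equalityI subsetI)
  fix v assume "v \<in> eigenspace torus_dirac (of_int k)"
  then have v: "\<And>j. j \<noteq> k \<Longrightarrow> cinner (torus_eigvec j) v = 0"
    unfolding torus_dirac_diag eig.eigenspace_diag_op by auto
  have "v = cinner (torus_eigvec k) v *\<^sub>C torus_eigvec k"
    by (rule eig.coord_eqI) (auto simp: cinner_scaleC_right eig.orthonormal v)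
  then show "v \<in> cvec.span {torus_eigvec k}" by (metis cvec.span_base cvec.span_scale singletonI)
next
  fix v assume "v \<in> cvec.span {torus_eigvec k}"
  moreover have "cvec.span {torus_eigvec k} \<subseteq> eigenspace torus_dirac (of_int k)"
    unfolding torus_dirac_diag eig.eigenspace_diag_op
    by (rule cvec.span_minimal) (auto simp: eig.orthonormal cvec.subspace_def cinner_simps)
  ultimately show "v \<in> eigenspace torus_dirac (of_int k)" by blast
qed

lemma torus_eigvec_nz: "torus_eigvec k \<noteq> 0"
  using eig.orthonormal[of k k] by auto

lemma dim_span_single: "x \<noteq> 0 \<Longrightarrow> cvec.dim (cvec.span {x}) = 1"
  by (rule cvec.dim_unique[of "{x}"]) (auto simp: cvec.span_base)

lemma torus_eigvec_in_eigenspace: "torus_eigvec k \<in> eigenspace torus_dirac (of_int k)"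
  unfolding eigenspace_torus_dirac by (simp add: cvec.span_base)

lemma isolated_in_Ints: "(x::complex) \<in> \<int> \<Longrightarrow> x isolated_in \<int>"
proof -
  assume x: "x \<in> \<int>"
  have "x = y" if y: "y \<in> \<int>" "dist x y < 1" for y
  proof -
    obtain k l :: int where "x = of_int k" "y = of_int l" using x y(1) by (meson Ints_cases)
    then have "\<bar>real_of_int (k - l)\<bar> < 1" using y(2) by (simp add: dist_norm flip: of_int_diff)
    then have "k = l" by linarith
    then show ?thesis using \<open>x = of_int k\<close> \<open>y = of_int l\<close> by simp
  qed
  then show ?thesis using x by (auto simp: isolated_in_dist_Ex_iff intro!: exI[of _ 1])
qed

lemma discrete_spectrum_torus_dirac: "discrete_spectrum torus_dirac"
  unfolding discrete_spectrum_def spectrum_torus_dirac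
proof (intro ballI conjI)
  fix l :: complex assume l: "l \<in> \<int>"
  then obtain k :: int where k: "l = of_int k" by (auto elim: Ints_cases)
  show "l isolated_in \<int>" by (rule isolated_in_Ints[OF l])
  show "eigenspace torus_dirac l \<noteq> {0}"
    using torus_eigvec_in_eigenspace[of k] torus_eigvec_nz[of k] by (auto simp: k)
  show "finite_dimensional (eigenspace torus_dirac l)"
    unfolding k eigenspace_torus_dirac finite_dimensional_def by (intro exI[of _ "{torus_eigvec k}"]) simp
qed

section \<open>The fundamental class and its index\<close>

definition torus_phase :: "(ell2 \<times> ell2) \<Rightarrow>\<^sub>L (ell2 \<times> ell2)" where
  "torus_phase = offdiag_op (adj unilateral_shift) unilateral_shift"

lemma apply_torus_phase: "torus_phase \<cdot> v =
    (adj unilateral_shift \<cdot> snd v, unilateral_shift \<cdot> fst v)"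
  by (simp add: torus_phase_def)

lemma torus_phase_bops: "torus_phase \<in> bops"
  unfolding torus_phase_def by (intro offdiag_op_bops shift_adj_bops shift_bops)

text \<open>The phase exchanges the shapes of the two components, sending \<open>\<plusminus> e\<^sub>k\<^sub>-\<^sub>1 \<oplus> e\<^sub>k\<close> to
  \<open>e\<^sub>k\<^sub>-\<^sub>1 \<oplus> \<plusminus> e\<^sub>k\<close>, which is multiplication by the sign; and \<open>S\<^sup>* e\<^sub>0 = 0\<close>.\<close>

lemma torus_phase_coord:
  "cinner (torus_eigvec k) (torus_phase \<cdot> v) = of_int (sgn k) * cinner (torus_eigvec k) v"
proof (cases "k = 0")
  case True
  then show ?thesis by (simp add: cinner_torus_eigvec apply_unilateral_shift apply_torus_phase)
next
  case False
  then obtain m where m: "idx k = Suc m" using idx_Suc by blast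
  have "of_int (sgn k) * of_int (sgn k) = (1::complex)" using False by (auto simp: sgn_if)
  moreover have "c * (s * y + x) = s * (c * (s * x + y))" if "s * s = 1" for c s x y :: complex
  proof -
    have "s * (c * (s * x + y)) = c * ((s * s) * x + s * y)" by (simp add: algebra_simps)
    also have "\<dots> = c * (s * y + x)" unfolding that by (simp add: add.commute)
    finally show ?thesis by (rule sym)
  qed
  ultimately show ?thesis
    unfolding cinner_torus_eigvec m
    by (simp add: apply_unilateral_shift entry_shift_adj apply_torus_phase)
qed

lemma torus_phase_graph: "op_graph torus_phase = eig.diag_op (\<lambda>k. of_int (sgn k))"
  by (rule eig.op_graph_eq_diag_op) (rule torus_phase_coord)

lemma sgn_abs: "complex_of_int (sgn k) * complex_of_real \<bar>real_of_int k\<bar> = of_int k"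
  "complex_of_int (sgn k) * complex_of_int k = complex_of_real \<bar>real_of_int k\<bar>"
  by (auto simp: sgn_if)

lemma polar_part_torus_phase: "polar_part torus_dirac torus_phase"
  unfolding polar_part_def
proof (intro conjI allI impI torus_phase_bops)
  show "torus_dirac = op_abs torus_dirac O op_graph torus_phase"
    unfolding op_abs_torus_dirac torus_phase_graph
  proof (intro equalityI subrelI)
    fix x y assume xy: "(x, y) \<in> torus_dirac"
    then have y: "cinner (torus_eigvec k) y = of_int k * cinner (torus_eigvec k) x" for k
      unfolding torus_dirac_diag by (rule eig.diag_opD)
    let ?z = "torus_phase \<cdot> y"
    have "(x, ?z) \<in> eig.diag_op (\<lambda>k. complex_of_real \<bar>real_of_int k\<bar>)"
      by (rule eig.diag_opI) (simp only: torus_phase_coord y sgn_abs flip: mult.assoc)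
    moreover have "(?z, y) \<in> eig.diag_op (\<lambda>k. of_int (sgn k))"
      by (rule eig.diag_opI) (simp only: torus_phase_coord y sgn_abs flip: mult.assoc)
    ultimately show "(x, y) \<in> eig.diag_op (\<lambda>k. complex_of_real \<bar>real_of_int k\<bar>) O eig.diag_op (\<lambda>k. of_int (sgn k))"
      by blast
  next
    fix x y assume "(x, y) \<in> eig.diag_op (\<lambda>k. complex_of_real \<bar>real_of_int k\<bar>) O eig.diag_op (\<lambda>k. of_int (sgn k))"
    then obtain z where z: "(x, z) \<in> eig.diag_op (\<lambda>k. complex_of_real \<bar>real_of_int k\<bar>)" "(z, y) \<in> eig.diag_op (\<lambda>k. of_int (sgn k))"
      by blast
    show "(x, y) \<in> torus_dirac"
      unfolding torus_dirac_diag
      by (rule eig.diag_opI) (simp only: eig.diag_opD[OF z(1)] eig.diag_opD[OF z(2)] sgn_abs flip: mult.assoc)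
  qed
  have ker: "op_kernel (eig.diag_op \<mu>) = {x. \<forall>k. \<mu> k = 0 \<or> cinner (torus_eigvec k) x = 0}" for \<mu>
    by (auto simp: op_kernel_def eig.diag_op_def)
  show "op_kernel (op_graph torus_phase) = op_kernel torus_dirac"
    unfolding torus_phase_graph torus_dirac_diag ker by (simp add: sgn_eq_0_iff)
  fix x assume x: "\<forall>y\<in>op_kernel (op_graph torus_phase). cinner y x = 0"
  have "torus_eigvec 0 \<in> op_kernel (op_graph torus_phase)"
    unfolding torus_phase_graph ker by (auto simp: eig.orthonormal)
  then have "cinner (torus_eigvec 0) x = 0" using x by blast
  then have "(cmod (cinner (torus_eigvec k) (torus_phase \<cdot> x)))\<^sup>2 = (cmod (cinner (torus_eigvec k) x))\<^sup>2" for k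
    unfolding torus_phase_coord by (cases "k = 0") (auto simp: norm_mult sgn_if)
  then have "((\<lambda>k. (cmod (cinner (torus_eigvec k) x))\<^sup>2) has_sum (norm (torus_phase \<cdot> x))\<^sup>2) UNIV"
    using eig.norm_has_sum[of "torus_phase \<cdot> x"] by (simp only:)
  from has_sum_unique[OF this eig.norm_has_sum]
  have "(norm (torus_phase \<cdot> x))\<^sup>2 = (norm x)\<^sup>2" .
  then show "norm (torus_phase \<cdot> x) = norm x" by (simp add: power2_eq_iff_nonneg)
qed

text \<open>On \<open>b\<^sub>k\<close> with \<open>k \<noteq> 0\<close> the factorization forces \<open>|k| G b\<^sub>k = k b\<^sub>k\<close>; on \<open>b\<^sub>0\<close> the kernel condition
  forces \<open>G b\<^sub>0 = 0\<close>.\<close>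

lemma polar_part_torus_unique: "polar_part torus_dirac G \<Longrightarrow> G = torus_phase"
proof -
  assume G: "polar_part torus_dirac G"
  then have Gb: "G \<in> bops" and eq: "torus_dirac = op_abs torus_dirac O op_graph G"
    and ker: "op_kernel (op_graph G) = op_kernel torus_dirac"
    by (auto simp: polar_part_def)
  have phase: "torus_phase \<cdot> torus_eigvec k = of_int (sgn k) *\<^sub>C torus_eigvec k" for k
    by (rule eig.coord_eqI) (simp add: torus_phase_coord cinner_scaleC_right eig.orthonormal)
  show ?thesis
  proof (rule eig.bops_eqI[OF Gb torus_phase_bops])
    fix k
    show "G \<cdot> torus_eigvec k = torus_phase \<cdot> torus_eigvec k"
    proof (cases "k = 0")
      case True
      have "(torus_eigvec k, of_int k *\<^sub>C torus_eigvec k) \<in> torus_dirac"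
        unfolding torus_dirac_diag by (rule eig.basis_diag_op)
      then have "torus_eigvec k \<in> op_kernel torus_dirac" by (simp add: True op_kernel_def)
      then have "torus_eigvec k \<in> op_kernel (op_graph G)" by (simp only: ker)
      then show ?thesis unfolding phase by (auto simp: op_kernel_def op_graph_def True)
    next
      case False
      have "(torus_eigvec k, of_int k *\<^sub>C torus_eigvec k) \<in> torus_dirac"
        unfolding torus_dirac_diag by (rule eig.basis_diag_op)
      then obtain z where z: "(torus_eigvec k, z) \<in> op_abs torus_dirac" "G \<cdot> z = of_int k *\<^sub>C torus_eigvec k"
        by (subst (asm) eq) (auto simp: op_graph_def)
      define r where "r = complex_of_real \<bar>real_of_int k\<bar>"
      have r: "r \<noteq> 0" "of_int k = of_int (sgn k) * r" using False by (simp_all only: r_def sgn_abs) simp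
      have "z = r *\<^sub>C torus_eigvec k"
        using z(1) unfolding op_abs_torus_dirac r_def
        by (intro eig.coord_eqI) (auto simp: eig.diag_op_def cinner_scaleC_right eig.orthonormal)
      then have "r *\<^sub>C G \<cdot> torus_eigvec k = of_int k *\<^sub>C torus_eigvec k"
        using z(2) Gb by (simp add: bopsD)
      also have "\<dots> = r *\<^sub>C (of_int (sgn k) *\<^sub>C torus_eigvec k)"
        unfolding r(2) scaleC_scaleC by (simp only: mult.commute)
      finally show ?thesis unfolding phase by (rule cvec.scale_left_imp_eq[OF r(1)])
    qed
  qed
qed

lemma fundamental_class_torus: "fundamental_class torus_dirac = torus_phase"
  unfolding fundamental_class_def
  by (rule the_equality) (rule polar_part_torus_phase, rule polar_part_torus_unique)

lemma ell2_eq_minus_iff: "x = - x \<longleftrightarrow> x = (0::ell2)"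
  by (simp add: eq_neg_iff_add_eq_0 flip: scaleR_2)

lemma pos_part_torus: "pos_part torus_grading = {v. snd v = 0}"
  and neg_part_torus: "neg_part torus_grading = {v. fst v = 0}"
  using ell2_eq_minus_iff[THEN iffD1, OF sym]
  by (auto simp: pos_part_def neg_part_def torus_grading_def prod_eq_iff blinfun.minus_left ell2_eq_minus_iff)

lemma kernel_minus_to_plus: "{v \<in> {v. fst v = 0}. torus_phase \<cdot> v = 0} = cvec.span {(0, ebasis 0)}"
proof (intro equalityI subsetI)
  fix v assume "v \<in> {v \<in> {v. fst v = 0}. torus_phase \<cdot> v = 0}"
  then have v: "fst v = 0" "adj unilateral_shift \<cdot> snd v = 0" by (auto simp: prod_eq_iff apply_torus_phase)
  have "entry (snd v) (Suc n) = 0" for n using v(2) entry_shift_adj[of "snd v" n] by simp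
  then have "snd v = entry (snd v) 0 *\<^sub>C ebasis 0"
    by (intro ell2_eqI) (metis entry_ebasis entry_scaleC mult.right_neutral mult_zero_right not0_implies_Suc)
  then have "v = entry (snd v) 0 *\<^sub>C (0, ebasis 0)" using v(1) by (simp add: prod_eq_iff)
  then show "v \<in> cvec.span {(0, ebasis 0)}" by (metis cvec.span_base cvec.span_scale singletonI)
next
  fix v :: "ell2 \<times> ell2" assume "v \<in> cvec.span {(0, ebasis 0)}"
  moreover have "cvec.span {(0, ebasis 0)} \<subseteq> {v \<in> {v. fst v = 0}. torus_phase \<cdot> v = 0}"
  proof (rule cvec.span_minimal)
    have "adj unilateral_shift \<cdot> ebasis 0 = 0"
      by (rule ell2_eqI) (simp add: entry_shift_adj entry_ebasis)
    then show "{(0, ebasis 0)} \<subseteq> {v \<in> {v. fst v = 0}. torus_phase \<cdot> v = 0}"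
      by (simp add: prod_eq_iff apply_torus_phase)
    show "cvec.subspace {v \<in> {v. fst v = 0}. torus_phase \<cdot> v = 0}"
      using bopsD[OF shift_adj_bops] bopsD[OF shift_bops]
      by (auto simp: cvec.subspace_def prod_eq_iff blinfun.add_right apply_torus_phase)
  qed
  ultimately show "v \<in> {v \<in> {v. fst v = 0}. torus_phase \<cdot> v = 0}" by blast
qed

lemma image_minus_to_plus: "blinfun_apply torus_phase ` {v. fst v = 0} = {v. snd v = 0}"
proof (intro equalityI subsetI)
  fix v :: "ell2 \<times> ell2" assume "v \<in> {v. snd v = 0}"
  then have "v = torus_phase \<cdot> (0, unilateral_shift \<cdot> fst v)"
    by (simp add: prod_eq_iff shift_adj_shift apply_torus_phase)
  then show "v \<in> blinfun_apply torus_phase ` {v. fst v = 0}" by (rule image_eqI) simp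
qed (auto simp: apply_torus_phase)

lemma image_plus_to_minus: "blinfun_apply torus_phase ` {v. snd v = 0} = {v. fst v = 0 \<and> entry (snd v) 0 = 0}"
proof (intro equalityI subsetI)
  fix v :: "ell2 \<times> ell2" assume v: "v \<in> {v. fst v = 0 \<and> entry (snd v) 0 = 0}"
  have "snd v = unilateral_shift \<cdot> (adj unilateral_shift \<cdot> snd v)"
    using v by (intro ell2_eqI) (simp add: apply_unilateral_shift entry_shift_adj split: nat.split)
  then have "v = torus_phase \<cdot> (adj unilateral_shift \<cdot> snd v, 0)"
    using v by (simp add: prod_eq_iff apply_torus_phase)
  then show "v \<in> blinfun_apply torus_phase ` {v. snd v = 0}" by (rule image_eqI) simp
qed (auto simp: apply_unilateral_shift apply_torus_phase)

text \<open>The codimension is a definite description, so it has to be excluded that some nonempty set is a basis of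
  the zero quotient.\<close>

lemma quotient_basis_self: "cvec.subspace V \<Longrightarrow> quotient_basis V V B \<longleftrightarrow> B = {}"
proof
  assume V: "cvec.subspace V" and B: "quotient_basis V V B"
  show "B = {}"
  proof (rule ccontr)
    assume "B \<noteq> {}"
    then obtain x where x: "x \<in> B" by blast
    then have "x \<in> cvec.span B \<inter> V" using B cvec.span_base unfolding quotient_basis_def by blast
    then have "x = 0" using B unfolding quotient_basis_def by blast
    then show False using B x cvec.dependent_zero unfolding quotient_basis_def by blast
  qed
next
  assume V: "cvec.subspace V" and "B = {}"
  then show "quotient_basis V V B"
    using cvec.subspace_0[OF V] by (auto simp: quotient_basis_def cvec.independent_empty)
qed

lemma codim_self: "cvec.subspace V \<Longrightarrow> codim V V = 0"
  unfolding codim_def by (rule the_equality) (auto simp: quotient_basis_self)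

lemma subspace_snd_zero: "cvec.subspace {v :: ell2 \<times> ell2. snd v = 0}"
  by (auto simp: cvec.subspace_def)

lemma closed_plus: "closed {v :: ell2 \<times> ell2. snd v = 0}"
  by (intro closed_Collect_eq linear_continuous_on bounded_linear_snd continuous_on_const)

lemma fredholm_torus: "fredholm_fundamental_class torus_grading torus_dirac"
  unfolding fredholm_fundamental_class_def fundamental_class_torus pos_part_torus neg_part_torus fredholm_on_def
proof (intro conjI)
  show "finite_dimensional {v \<in> {v. fst v = 0}. torus_phase \<cdot> v = 0}"
    unfolding kernel_minus_to_plus finite_dimensional_def by (intro exI[of _ "{(0, ebasis 0)}"]) simp
  show "closed (blinfun_apply torus_phase ` {v. fst v = 0})"
    unfolding image_minus_to_plus by (rule closed_plus)
  show "finite_codim {v. snd v = 0} (blinfun_apply torus_phase ` {v. fst v = 0})"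
    unfolding image_minus_to_plus finite_codim_def
    by (rule exI[of _ "{}"]) (simp add: quotient_basis_self subspace_snd_zero)
  have "{v \<in> {v. snd v = 0}. torus_phase \<cdot> v = 0} \<subseteq> cvec.span {}"
  proof
    fix v assume "v \<in> {v \<in> {v. snd v = 0}. torus_phase \<cdot> v = 0}"
    then have v: "snd v = 0" "unilateral_shift \<cdot> fst v = 0" by (auto simp: prod_eq_iff apply_torus_phase)
    have "fst v = 0" using shift_adj_shift[of "fst v"] v(2) by simp
    with v(1) show "v \<in> cvec.span {}" by (simp add: prod_eq_iff)
  qed
  then show "finite_dimensional {v \<in> {v. snd v = 0}. torus_phase \<cdot> v = 0}"
    unfolding finite_dimensional_def by blast
  have "closed {v :: ell2 \<times> ell2. fst v = 0 \<and> cinner (ebasis 0) (snd v) = 0}"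
    by (intro closed_Collect_conj closed_Collect_eq linear_continuous_on bounded_linear_fst continuous_on_const
        bounded_linear_compose[OF bounded_linear_cinner_right bounded_linear_snd])
  then show "closed (blinfun_apply torus_phase ` {v. snd v = 0})"
    unfolding image_plus_to_minus by simp
  have "quotient_basis {v :: ell2 \<times> ell2. fst v = 0} {v. fst v = 0 \<and> entry (snd v) 0 = 0} {(0, ebasis 0)}"
    unfolding quotient_basis_def
  proof (intro conjI)
    have nz: "(0, ebasis 0) \<noteq> (0 :: ell2 \<times> ell2)"
      using entry_ebasis[of 0 0] by (auto simp: zero_prod_def)
    then show "cvec.independent {(0 :: ell2, ebasis 0)}" by simp
    have sp: "cvec.span {(0 :: ell2, ebasis 0)} = range (\<lambda>c. (0, c *\<^sub>C ebasis 0))"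
      by (auto simp: cvec.span_singleton scaleC_prod_def)
    show "cvec.span {(0, ebasis 0)} \<inter> {v. fst v = 0 \<and> entry (snd v) 0 = 0} = {0 :: ell2 \<times> ell2}"
      unfolding sp by (auto simp: entry_ebasis zero_prod_def image_iff)
    show "{v :: ell2 \<times> ell2. fst v = 0} = {w + x | w x. w \<in> {v. fst v = 0 \<and> entry (snd v) 0 = 0} \<and> x \<in> cvec.span {(0, ebasis 0)}}"
      unfolding sp
    proof (intro equalityI subsetI)
      fix v :: "ell2 \<times> ell2" assume v: "v \<in> {v. fst v = 0}"
      let ?x = "(0, entry (snd v) 0 *\<^sub>C ebasis 0)"
      have "v = (v - ?x) + ?x" by simp
      moreover have "v - ?x \<in> {v. fst v = 0 \<and> entry (snd v) 0 = 0}" using v by (simp add: entry_ebasis)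
      ultimately show "v \<in> {w + x | w x. w \<in> {v. fst v = 0 \<and> entry (snd v) 0 = 0} \<and> x \<in> range (\<lambda>c. (0, c *\<^sub>C ebasis 0))}"
        by blast
    qed auto
  qed simp
  then show "finite_codim {v. fst v = 0} (blinfun_apply torus_phase ` {v. snd v = 0})"
    unfolding image_plus_to_minus finite_codim_def by blast
qed (auto simp: image_minus_to_plus image_plus_to_minus)

lemma dirac_index_torus: "dirac_index torus_grading torus_dirac = 1"
proof -
  have nz: "(0, ebasis 0) \<noteq> (0 :: ell2 \<times> ell2)"
    using entry_ebasis[of 0 0] by (auto simp: zero_prod_def)
  show ?thesis
    unfolding dirac_index_def fundamental_class_torus pos_part_torus neg_part_torus fredholm_index_on_def
      kernel_minus_to_plus image_minus_to_plus
    using dim_span_single[OF nz] by (simp add: codim_self[OF subspace_snd_zero])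
qed

section \<open>Commutators and regularity\<close>

text \<open>Larger than the smooth algebra of the torus: the derivative of a symbol that respects the reflections
  changes its sign under them, and the blocks of commutators with \<open>D\<close> contain the shift.\<close>

definition smooth_ops :: "(ell2 \<Rightarrow>\<^sub>L ell2) set" where
  "smooth_ops = star_alg (toeplitz ` C_inf_circle \<union> finite_matrix_ops)"

lemma smooth_ops_generators_bops:
  "toeplitz ` C_inf_circle \<union> finite_matrix_ops \<subseteq> bops"
  using C_inf_C_circle toeplitz_bops finite_matrix_bops by blast

lemma star_subalgebra_bops: "star_subalgebra (bops :: (ell2 \<Rightarrow>\<^sub>L ell2) set)"
  by (auto simp: star_subalgebra_def bops_add bops_compose bops_scaleC std.adj_works(2))

lemma star_subalgebra_smooth_ops: "star_subalgebra smooth_ops"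
  unfolding smooth_ops_def by (rule star_subalgebra_star_alg[OF star_subalgebra_bops smooth_ops_generators_bops])

lemma smooth_ops_closed:
  "0 \<in> smooth_ops" "a \<in> smooth_ops \<Longrightarrow> a \<in> bops"
  "a \<in> smooth_ops \<Longrightarrow> b \<in> smooth_ops \<Longrightarrow> a + b \<in> smooth_ops"
  "a \<in> smooth_ops \<Longrightarrow> b \<in> smooth_ops \<Longrightarrow> a o\<^sub>L b \<in> smooth_ops"
  "a \<in> smooth_ops \<Longrightarrow> scaleC_op c a \<in> smooth_ops"
  "a \<in> smooth_ops \<Longrightarrow> adj a \<in> smooth_ops"
  using star_subalgebra_smooth_ops by (auto simp: star_subalgebra_def)

lemma smooth_ops_minus: "a \<in> smooth_ops \<Longrightarrow> - a \<in> smooth_ops"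
  unfolding uminus_eq_scaleC_op by (rule smooth_ops_closed)

lemma smooth_ops_diff: "a \<in> smooth_ops \<Longrightarrow> b \<in> smooth_ops \<Longrightarrow> a - b \<in> smooth_ops"
  using smooth_ops_closed(3)[of a "- b"] smooth_ops_minus[of b] by simp

lemma smooth_ops_generators:
  "f \<in> C_inf_circle \<Longrightarrow> toeplitz f \<in> smooth_ops" "K \<in> finite_matrix_ops \<Longrightarrow> K \<in> smooth_ops"
  using subsetD[OF star_alg_superset[of "toeplitz ` C_inf_circle \<union> finite_matrix_ops"]]
  unfolding smooth_ops_def by simp_all

lemma torus_smooth_subset_smooth_ops: "torus_smooth_algebra \<subseteq> smooth_ops"
  unfolding torus_smooth_algebra_def
  by (rule star_alg_subset[OF star_subalgebra_smooth_ops])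
    (auto simp: smooth_toeplitz_ops_def intro: smooth_ops_generators)

lemma smooth_ops_induct [consumes 1, case_names toeplitz finite zero add compose scale adj]:
  assumes a: "a \<in> smooth_ops"
    and gen: "\<And>f. f \<in> C_inf_circle \<Longrightarrow> P (toeplitz f)" "\<And>K. K \<in> finite_matrix_ops \<Longrightarrow> P K"
    and zero: "P 0"
    and add: "\<And>a b. a \<in> smooth_ops \<Longrightarrow> b \<in> smooth_ops \<Longrightarrow> P a \<Longrightarrow> P b \<Longrightarrow> P (a + b)"
    and compose: "\<And>a b. a \<in> smooth_ops \<Longrightarrow> b \<in> smooth_ops \<Longrightarrow> P a \<Longrightarrow> P b \<Longrightarrow> P (a o\<^sub>L b)"
    and scale: "\<And>c a. a \<in> smooth_ops \<Longrightarrow> P a \<Longrightarrow> P (scaleC_op c a)"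
    and adj: "\<And>a. a \<in> smooth_ops \<Longrightarrow> P a \<Longrightarrow> P (adj a)"
  shows "P a"
proof -
  have "star_subalgebra {a \<in> smooth_ops. P a}"
    unfolding star_subalgebra_def
    by (auto simp: smooth_ops_closed zero add compose scale adj)
  then have "smooth_ops \<subseteq> {a \<in> smooth_ops. P a}"
    by (subst smooth_ops_def, intro star_alg_subset) (auto simp: smooth_ops_generators gen)
  then show ?thesis using a by blast
qed

text \<open>The commutator with the number operator multiplies the matrix entries by \<open>m - n\<close>, which for a
  Toeplitz operator is the derivative of its symbol.\<close>

lemma number_commutator_iff:
  "std.comm_rel of_nat a b \<longleftrightarrow> a \<in> bops \<and> b \<in> bops \<and> (\<forall>m n. mat_entry b m n = (of_nat m - of_nat n) * mat_entry a m n)"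
  by (simp add: std.comm_rel_def)

lemma number_commutator_smooth:
  "a \<in> smooth_ops \<Longrightarrow> \<exists>b\<in>smooth_ops. std.comm_rel of_nat a b"
proof (induction a rule: smooth_ops_induct)
  case (toeplitz f)
  have C: "f \<in> C_circle" "circle_deriv f \<in> C_circle"
    using toeplitz C_inf_C_circle circle_deriv_C_inf by auto
  have "std.comm_rel of_nat (toeplitz f) (scaleC_op (- \<i>) (toeplitz (circle_deriv f)))"
    unfolding number_commutator_iff
    by (auto simp: toeplitz_bops C bops_scaleC toeplitz_entry fourier_coeff_circle_deriv toeplitz left_diff_distrib simp flip: mult.assoc)
  then show ?case
    by (intro bexI[of _ "scaleC_op (- \<i>) (toeplitz (circle_deriv f))"] smooth_ops_closed
        smooth_ops_generators circle_deriv_C_inf toeplitz)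
next
  case (finite K)
  then obtain N where N: "K \<in> bops" "\<And>m n. m > N \<or> n > N \<Longrightarrow> mat_entry K m n = 0"
    by (auto simp: finite_matrix_ops_iff)
  obtain L where L: "L \<in> finite_matrix_ops" "\<forall>m n. mat_entry L m n = (of_nat m - of_nat n) * mat_entry K m n"
    using ex_finite_matrix[of N "\<lambda>m n. (of_nat m - of_nat n) * mat_entry K m n"] N(2) by auto
  then have "std.comm_rel of_nat K L" using N(1) finite_matrix_bops by (simp add: number_commutator_iff)
  then show ?case using L(1) smooth_ops_generators by blast
next
  case zero
  show ?case by (rule bexI[of _ 0]) (auto simp: number_commutator_iff smooth_ops_closed)
next
  case (add a b)
  then show ?case using std.comm_rel_add smooth_ops_closed(3) by metis
next
  case (compose a b)
  then obtain a' b' where "a' \<in> smooth_ops" "std.comm_rel of_nat a a'" "b' \<in> smooth_ops" "std.comm_rel of_nat b b'"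
    by blast
  then show ?case
    using compose.hyps std.comm_rel_compose[of of_nat a a' b b']
    by (intro bexI[of _ "(a' o\<^sub>L b) + (a o\<^sub>L b')"]) (auto intro!: smooth_ops_closed)
next
  case (scale c a)
  then show ?case using std.comm_rel_scaleC smooth_ops_closed(5) by metis
next
  case (adj a)
  then obtain a' where "a' \<in> smooth_ops" "std.comm_rel of_nat a a'" by blast
  then show ?case
    using std.comm_rel_adj[of of_nat a a'] by (intro bexI[of _ "- adj a'"]) (auto intro!: smooth_ops_closed smooth_ops_minus)
qed

lemma offdiag_algebra:
  "offdiag_op S T + offdiag_op S' T' = offdiag_op (S + S') (T + T')"
  "scaleC_op c (offdiag_op S T) = offdiag_op (scaleC_op c S) (scaleC_op c T)"
  "- offdiag_op S T = offdiag_op (- S) (- T)"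
  "offdiag_op S T o\<^sub>L torus_rep a = offdiag_op (S o\<^sub>L a) (T o\<^sub>L a)"
  "torus_rep a o\<^sub>L offdiag_op S T = offdiag_op (a o\<^sub>L S) (a o\<^sub>L T)"
  for S T S' T' a :: "ell2 \<Rightarrow>\<^sub>L ell2"
  by (auto intro!: blinfun_eqI simp: blinfun.add_left blinfun.minus_left prod_eq_iff)

lemma torus_eigvec_components:
  "fst (torus_eigvec l) = (eigvec_norm l * of_int (sgn l)) *\<^sub>C ebasis (idx l - 1)"
  "snd (torus_eigvec l) = eigvec_norm l *\<^sub>C ebasis (idx l)"
  by (simp_all add: torus_eigvec_eq scaleC_scaleC)

lemma torus_rep_matrix:
  assumes "a \<in> bops"
  shows "cinner (torus_eigvec k) (torus_rep a \<cdot> torus_eigvec l) =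
    eigvec_norm k * eigvec_norm l *
      (of_int (sgn k) * of_int (sgn l) * mat_entry a (idx k - 1) (idx l - 1) + mat_entry a (idx k) (idx l))"
  by (simp add: cinner_torus_eigvec torus_eigvec_components bopsD[OF assms] algebra_simps)

lemma offdiag_matrix:
  assumes "S \<in> bops" "T \<in> bops"
  shows "cinner (torus_eigvec k) (offdiag_op S T \<cdot> torus_eigvec l) =
    eigvec_norm k * eigvec_norm l *
      (of_int (sgn k) * mat_entry S (idx k - 1) (idx l) + of_int (sgn l) * mat_entry T (idx k) (idx l - 1))"
  by (simp add: cinner_torus_eigvec torus_eigvec_components bopsD[OF assms(1)] bopsD[OF assms(2)] algebra_simps)

lemma sign_cases [case_names zero pos neg]:
  fixes k :: int
  obtains "k = 0" "sgn k = 0" "idx k = 0" "complex_of_int k = 0"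
  | m where "sgn k = 1" "idx k = Suc m" "complex_of_int k = of_nat (Suc m)"
  | m where "sgn k = - 1" "idx k = Suc m" "complex_of_int k = - of_nat (Suc m)"
proof -
  consider "k = 0" | "k > 0" | "k < 0" by linarith
  then show thesis
  proof cases
    case 1
    then show thesis by (intro that(1)) auto
  next
    case 2
    then obtain m where m: "k = int (Suc m)" by (metis gr0_implies_Suc zero_less_imp_eq_int)
    show thesis unfolding m by (intro that(2)[of m]) (simp_all add: m del: of_nat_Suc)
  next
    case 3
    then obtain m where m: "k = - int (Suc m)" by (metis gr0_implies_Suc zero_less_imp_eq_int neg_0_less_iff_less minus_minus)
    show thesis unfolding m by (intro that(3)[of m]) (simp_all add: m del: of_nat_Suc)
  qed
qed

text \<open>The blocks of the commutator with the Dirac operator are the commutators with \<open>\<partial>\<^sub>z\<close> and its adjoint,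
  whose matrices appear here. The truncated predecessor of \<open>0\<close> is always multiplied by \<open>0\<close>.\<close>

lemma dirac_commutatorI:
  assumes a: "a \<in> bops" and S: "S \<in> bops" "\<And>m n. mat_entry S m n = of_nat (Suc m) * mat_entry a (Suc m) n - of_nat n * mat_entry a m (n - 1)"
    and T: "T \<in> bops" "\<And>m n. mat_entry T m n = of_nat m * mat_entry a (m - 1) n - of_nat (Suc n) * mat_entry a m (Suc n)"
  shows "eig.comm_rel of_int (torus_rep a) (offdiag_op S T)"
  unfolding eig.comm_rel_def torus_rep_matrix[OF a] offdiag_matrix[OF S(1) T(1)]
proof (intro conjI allI torus_rep_bops a offdiag_op_bops S T)
  fix k l :: int
  have "of_int (sgn k) * mat_entry S (idx k - 1) (idx l) + of_int (sgn l) * mat_entry T (idx k) (idx l - 1) =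
    (of_int k - of_int l) * (of_int (sgn k) * of_int (sgn l) * mat_entry a (idx k - 1) (idx l - 1) + mat_entry a (idx k) (idx l))"
  proof (cases k rule: sign_cases; cases l rule: sign_cases)
  qed (simp_all only: S(2) T(2), simp_all add: algebra_simps)
  then show "eigvec_norm k * eigvec_norm l *
      (of_int (sgn k) * mat_entry S (idx k - 1) (idx l) + of_int (sgn l) * mat_entry T (idx k) (idx l - 1)) =
    (of_int k - of_int l) * (eigvec_norm k * eigvec_norm l *
      (of_int (sgn k) * of_int (sgn l) * mat_entry a (idx k - 1) (idx l - 1) + mat_entry a (idx k) (idx l)))"
    by simp
qed

text \<open>For a Toeplitz operator \<open>a\<close>, whose entries depend only on \<open>m - n\<close>, the blocks are \<open>S\<^sup>* [N, a]\<close> and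
  \<open>[N, a] S\<close>, with \<open>[N, a]\<close> again a smooth Toeplitz operator.\<close>

theorem dirac_commutator_smooth:
  "a \<in> smooth_ops \<Longrightarrow> \<exists>S\<in>smooth_ops. \<exists>T\<in>smooth_ops. eig.comm_rel of_int (torus_rep a) (offdiag_op S T)"
proof (induction a rule: smooth_ops_induct)
  case (toeplitz f)
  have C: "f \<in> C_circle" "circle_deriv f \<in> C_circle"
    using toeplitz C_inf_C_circle circle_deriv_C_inf by auto
  let ?d = "scaleC_op (- \<i>) (toeplitz (circle_deriv f))"
  have d: "?d \<in> smooth_ops"
    by (intro smooth_ops_closed smooth_ops_generators circle_deriv_C_inf toeplitz)
  have md: "mat_entry ?d m n = (of_nat m - of_nat n) * fourier_coeff f (int m - int n)" for m n
    by (simp add: toeplitz_entry C fourier_coeff_circle_deriv toeplitz left_diff_distrib flip: mult.assoc)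
  have sh: "unilateral_shift \<in> smooth_ops" "adj unilateral_shift \<in> smooth_ops"
    using smooth_ops_generators(1)[OF ident_C_inf] smooth_ops_generators(1)[OF cnj_C_inf]
    by (simp_all add: toeplitz_z toeplitz_cnj_z)
  have "eig.comm_rel of_int (torus_rep (toeplitz f)) (offdiag_op (adj unilateral_shift o\<^sub>L ?d) (?d o\<^sub>L unilateral_shift))"
  proof (rule dirac_commutatorI)
    show "toeplitz f \<in> bops" by (rule toeplitz_bops[OF C(1)])
    show "(adj unilateral_shift o\<^sub>L ?d) \<in> bops" "(?d o\<^sub>L unilateral_shift) \<in> bops"
      by (intro bops_compose smooth_ops_closed(2)[OF d] smooth_ops_closed(2)[OF sh(1)] smooth_ops_closed(2)[OF sh(2)])+
    fix m n
    have "mat_entry (adj unilateral_shift o\<^sub>L ?d) m n = (of_nat (Suc m) - of_nat n) * fourier_coeff f (int (Suc m) - int n)"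
      unfolding blinfun_apply_blinfun_compose entry_shift_adj by (rule md)
    then show "mat_entry (adj unilateral_shift o\<^sub>L ?d) m n =
        of_nat (Suc m) * mat_entry (toeplitz f) (Suc m) n - of_nat n * mat_entry (toeplitz f) m (n - 1)"
      by (cases n) (simp_all add: toeplitz_entry C algebra_simps)
    have "mat_entry (?d o\<^sub>L unilateral_shift) m n = (of_nat m - of_nat (Suc n)) * fourier_coeff f (int m - int (Suc n))"
      unfolding blinfun_apply_blinfun_compose shift_ebasis by (rule md)
    then show "mat_entry (?d o\<^sub>L unilateral_shift) m n =
        of_nat m * mat_entry (toeplitz f) (m - 1) n - of_nat (Suc n) * mat_entry (toeplitz f) m (Suc n)"
      by (cases m) (simp_all add: toeplitz_entry C algebra_simps)
  qed
  then show ?case using smooth_ops_closed(4)[OF sh(2) d] smooth_ops_closed(4)[OF d sh(1)] by blast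
next
  case (finite K)
  then obtain N where N: "K \<in> bops" "\<And>m n. m > N \<or> n > N \<Longrightarrow> mat_entry K m n = 0"
    by (auto simp: finite_matrix_ops_iff)
  obtain S where S: "S \<in> finite_matrix_ops" "\<forall>m n. mat_entry S m n = of_nat (Suc m) * mat_entry K (Suc m) n - of_nat n * mat_entry K m (n - 1)"
  proof -
    have "of_nat (Suc m) * mat_entry K (Suc m) n - of_nat n * mat_entry K m (n - 1) = 0" if "m > Suc N \<or> n > Suc N" for m n
    proof -
      have "Suc m > N \<or> n > N" "m > N \<or> n - 1 > N" using that by linarith+
      then show ?thesis by (simp only: N(2)) simp
    qed
    then show thesis using that ex_finite_matrix[of "Suc N" "\<lambda>m n. of_nat (Suc m) * mat_entry K (Suc m) n - of_nat n * mat_entry K m (n - 1)"]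
      by blast
  qed
  obtain T where T: "T \<in> finite_matrix_ops" "\<forall>m n. mat_entry T m n = of_nat m * mat_entry K (m - 1) n - of_nat (Suc n) * mat_entry K m (Suc n)"
  proof -
    have "of_nat m * mat_entry K (m - 1) n - of_nat (Suc n) * mat_entry K m (Suc n) = 0" if "m > Suc N \<or> n > Suc N" for m n
    proof -
      have "m - 1 > N \<or> n > N" "m > N \<or> Suc n > N" using that by linarith+
      then show ?thesis by (simp only: N(2)) simp
    qed
    then show thesis using that ex_finite_matrix[of "Suc N" "\<lambda>m n. of_nat m * mat_entry K (m - 1) n - of_nat (Suc n) * mat_entry K m (Suc n)"]
      by blast
  qed
  have "eig.comm_rel of_int (torus_rep K) (offdiag_op S T)"
    by (rule dirac_commutatorI[OF N(1) finite_matrix_bops[OF S(1)] _ finite_matrix_bops[OF T(1)]])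
      (use S(2) T(2) in blast)+
  then show ?case using S(1) T(1) smooth_ops_generators(2) by blast
next
  case zero
  have "eig.comm_rel of_int (torus_rep 0) (offdiag_op 0 0)"
    by (rule dirac_commutatorI) auto
  then show ?case using smooth_ops_closed(1) by blast
next
  case (add a b)
  then obtain S T S' T' where ST: "S \<in> smooth_ops" "T \<in> smooth_ops" "S' \<in> smooth_ops" "T' \<in> smooth_ops"
    and cr: "eig.comm_rel of_int (torus_rep a) (offdiag_op S T)" "eig.comm_rel of_int (torus_rep b) (offdiag_op S' T')"
    by blast
  have "eig.comm_rel of_int (torus_rep (a + b)) (offdiag_op (S + S') (T + T'))"
    using eig.comm_rel_add[OF cr] by (simp only: torus_rep_algebra offdiag_algebra)
  then show ?case using ST smooth_ops_closed(3) by blast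
next
  case (compose a b)
  then obtain S T S' T' where ST: "S \<in> smooth_ops" "T \<in> smooth_ops" "S' \<in> smooth_ops" "T' \<in> smooth_ops"
    and cr: "eig.comm_rel of_int (torus_rep a) (offdiag_op S T)" "eig.comm_rel of_int (torus_rep b) (offdiag_op S' T')"
    by blast
  have "eig.comm_rel of_int (torus_rep (a o\<^sub>L b)) (offdiag_op ((S o\<^sub>L b) + (a o\<^sub>L S')) ((T o\<^sub>L b) + (a o\<^sub>L T')))"
    using eig.comm_rel_compose[OF cr] by (simp only: torus_rep_algebra offdiag_algebra)
  moreover have "(S o\<^sub>L b) + (a o\<^sub>L S') \<in> smooth_ops" "(T o\<^sub>L b) + (a o\<^sub>L T') \<in> smooth_ops"
    using ST compose.hyps by (auto intro!: smooth_ops_closed)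
  ultimately show ?case by blast
next
  case (scale c a)
  then obtain S T where ST: "S \<in> smooth_ops" "T \<in> smooth_ops"
    and cr: "eig.comm_rel of_int (torus_rep a) (offdiag_op S T)" by blast
  have "eig.comm_rel of_int (torus_rep (scaleC_op c a)) (offdiag_op (scaleC_op c S) (scaleC_op c T))"
    using eig.comm_rel_scaleC[OF cr, of c] by (simp only: torus_rep_algebra offdiag_algebra)
  then show ?case using ST smooth_ops_closed(5) by blast
next
  case (adj a)
  then obtain S T where ST: "S \<in> smooth_ops" "T \<in> smooth_ops"
    and cr: "eig.comm_rel of_int (torus_rep a) (offdiag_op S T)" by blast
  have "eig.comm_rel of_int (adj (torus_rep a)) (- adj (offdiag_op S T))"
    by (rule eig.comm_rel_adj[OF _ cr]) simp
  then have "eig.comm_rel of_int (torus_rep (adj a)) (offdiag_op (- adj T) (- adj S))"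
    using ST adj.hyps smooth_ops_closed(2) by (simp only: torus_rep_adj offdiag_adj offdiag_algebra)
  then show ?case using ST smooth_ops_closed(6) smooth_ops_minus by blast
qed

text \<open>Contains the represented algebra as well as its commutators with \<open>D\<close>, and will be seen to be closed under
  commutators with \<open>|D|\<close>.\<close>

definition smooth_blocks :: "((ell2 \<times> ell2) \<Rightarrow>\<^sub>L (ell2 \<times> ell2)) set" where
  "smooth_blocks = torus_rep ` smooth_ops \<union> {offdiag_op S T | S T. S \<in> smooth_ops \<and> T \<in> smooth_ops}"

text \<open>The absolute value of the Dirac operator is \<open>(N + 1) \<oplus> N\<close>: its commutator acts on diagonal blocks
  as the commutator with \<open>N\<close>, and differs from it on off-diagonal blocks by a bounded term.\<close>

lemma smooth_blocks_abs_commutator: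
  assumes "X \<in> smooth_blocks"
  shows "\<exists>Y\<in>smooth_blocks. eig.comm_rel (\<lambda>k. complex_of_real \<bar>real_of_int k\<bar>) X Y"
proof -
  have ab: "complex_of_real \<bar>real_of_int k\<bar> = of_nat (idx k)" for k
    by (cases k rule: int_cases) simp_all
  consider a where "a \<in> smooth_ops" "X = torus_rep a"
    | S T where "S \<in> smooth_ops" "T \<in> smooth_ops" "X = offdiag_op S T"
    using assms by (auto simp: smooth_blocks_def)
  then show ?thesis
  proof cases
    case 1
    then obtain b where b: "b \<in> smooth_ops" "std.comm_rel of_nat a b" using number_commutator_smooth by blast
    then have ab': "a \<in> bops" "b \<in> bops" and mb: "\<And>m n. mat_entry b m n = (of_nat m - of_nat n) * mat_entry a m n"
      by (auto simp: number_commutator_iff)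
    have "eig.comm_rel (\<lambda>k. complex_of_real \<bar>real_of_int k\<bar>) (torus_rep a) (torus_rep b)"
      unfolding eig.comm_rel_def torus_rep_matrix[OF ab'(1)] torus_rep_matrix[OF ab'(2)] ab
    proof (intro conjI allI torus_rep_bops ab')
      fix k l :: int
      have "of_int (sgn k) * of_int (sgn l) * mat_entry b (idx k - 1) (idx l - 1) + mat_entry b (idx k) (idx l) =
        (of_nat (idx k) - of_nat (idx l)) * (of_int (sgn k) * of_int (sgn l) * mat_entry a (idx k - 1) (idx l - 1) + mat_entry a (idx k) (idx l))"
      proof (cases k rule: sign_cases; cases l rule: sign_cases)
      qed (simp_all only: mb, simp_all add: algebra_simps)
      then show "eigvec_norm k * eigvec_norm l * (of_int (sgn k) * of_int (sgn l) * mat_entry b (idx k - 1) (idx l - 1) + mat_entry b (idx k) (idx l)) =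
        (of_nat (idx k) - of_nat (idx l)) * (eigvec_norm k * eigvec_norm l * (of_int (sgn k) * of_int (sgn l) * mat_entry a (idx k - 1) (idx l - 1) + mat_entry a (idx k) (idx l)))"
        by simp
    qed
    then show ?thesis using 1 b(1) unfolding smooth_blocks_def by blast
  next
    case 2
    obtain S' where S': "S' \<in> smooth_ops" "std.comm_rel of_nat S S'" using number_commutator_smooth[OF 2(1)] by blast
    obtain T' where T': "T' \<in> smooth_ops" "std.comm_rel of_nat T T'" using number_commutator_smooth[OF 2(2)] by blast
    have ST: "S' + S \<in> smooth_ops" "T' - T \<in> smooth_ops"
      using 2 S'(1) T'(1) smooth_ops_closed(3) smooth_ops_diff by auto
    note bs = smooth_ops_closed(2)[OF ST(1)] smooth_ops_closed(2)[OF ST(2)]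
      smooth_ops_closed(2)[OF 2(1)] smooth_ops_closed(2)[OF 2(2)]
    have mS: "mat_entry (S' + S) m n = (of_nat m + 1 - of_nat n) * mat_entry S m n" for m n
      using S'(2) by (simp add: number_commutator_iff blinfun.add_left algebra_simps)
    have mT: "mat_entry (T' - T) m n = (of_nat m - 1 - of_nat n) * mat_entry T m n" for m n
      using T'(2) by (simp add: number_commutator_iff blinfun.diff_left algebra_simps)
    have "eig.comm_rel (\<lambda>k. complex_of_real \<bar>real_of_int k\<bar>) (offdiag_op S T) (offdiag_op (S' + S) (T' - T))"
      unfolding eig.comm_rel_def offdiag_matrix[OF bs(1,2)] offdiag_matrix[OF bs(3,4)] ab
    proof (intro conjI allI offdiag_op_bops bs)
      fix k l :: int
      have "of_int (sgn k) * mat_entry (S' + S) (idx k - 1) (idx l) + of_int (sgn l) * mat_entry (T' - T) (idx k) (idx l - 1) =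
        (of_nat (idx k) - of_nat (idx l)) * (of_int (sgn k) * mat_entry S (idx k - 1) (idx l) + of_int (sgn l) * mat_entry T (idx k) (idx l - 1))"
      proof (cases k rule: sign_cases; cases l rule: sign_cases)
      qed (simp_all only: mS mT, simp_all add: algebra_simps)
      then show "eigvec_norm k * eigvec_norm l * (of_int (sgn k) * mat_entry (S' + S) (idx k - 1) (idx l) + of_int (sgn l) * mat_entry (T' - T) (idx k) (idx l - 1)) =
        (of_nat (idx k) - of_nat (idx l)) * (eigvec_norm k * eigvec_norm l * (of_int (sgn k) * mat_entry S (idx k - 1) (idx l) + of_int (sgn l) * mat_entry T (idx k) (idx l - 1)))"
        by simp
    qed
    then show ?thesis using 2 ST unfolding smooth_blocks_def by blast
  qed
qed

lemma regular_torus: "regular_triple torus_smooth_algebra torus_rep torus_dirac"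
  unfolding regular_triple_def
proof (intro ballI allI conjI)
  fix a k assume "a \<in> torus_smooth_algebra"
  then have a: "a \<in> smooth_ops" using torus_smooth_subset_smooth_ops by blast
  note db = eig.delta_bounded_if_closed[OF smooth_blocks_abs_commutator, folded op_abs_torus_dirac]
  show "delta_bounded (op_abs torus_dirac) k (torus_rep a)"
    by (rule db) (use a in \<open>auto simp: smooth_blocks_def\<close>)
  obtain S T where ST: "S \<in> smooth_ops" "T \<in> smooth_ops" "eig.comm_rel of_int (torus_rep a) (offdiag_op S T)"
    using dirac_commutator_smooth[OF a] by blast
  have "bounded_extension (commutator torus_dirac (torus_rep a)) (offdiag_op S T)"
    unfolding torus_dirac_diag by (rule eig.comm_rel_bounded_extension[OF ST(3)])
  moreover have "delta_bounded (op_abs torus_dirac) k (offdiag_op S T)"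
    by (rule db) (use ST in \<open>auto simp: smooth_blocks_def\<close>)
  ultimately show "\<exists>B. bounded_extension (commutator torus_dirac (torus_rep a)) B \<and> delta_bounded (op_abs torus_dirac) k B"
    by blast
qed

lemma spectral_triple_torus: "spectral_triple toeplitz_torus torus_smooth_algebra torus_rep torus_dirac"
  unfolding spectral_triple_def
proof (intro conjI ballI)
  show "faithful_star_rep torus_smooth_algebra torus_rep"
    using star_subalgebra_torus_smooth by (intro faithful_torus_rep) (simp add: star_subalgebra_def)
  fix a assume "a \<in> torus_smooth_algebra"
  then show "\<exists>B. bounded_extension (commutator torus_dirac (torus_rep a)) B"
    using regular_torus by (simp add: regular_triple_def) blast
qed (rule unital_toeplitz_torus star_subalgebra_torus_smooth torus_smooth_subset torus_smooth_dense
    self_adjoint_torus_dirac torus_resolvent_compact)+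

lemma even_torus: "even_grading torus_smooth_algebra torus_rep torus_dirac torus_grading"
  unfolding even_grading_def
proof (intro conjI ballI)
  have g: "torus_grading \<cdot> v = (fst v, - snd v)" for v
    by (simp add: torus_grading_def blinfun.minus_left)
  show "torus_grading \<in> bops"
    by (auto simp: bops_def g prod_eq_iff scaleC_minus_right)
  show "adj torus_grading = torus_grading"
    by (rule adj_eqI) (simp add: g cinner_prod_def cinner_minus_left cinner_minus_right)
  show "torus_grading o\<^sub>L torus_grading = id_blinfun"
    by (rule blinfun_eqI) (simp add: g)
  show "torus_grading o\<^sub>L torus_rep a = torus_rep a o\<^sub>L torus_grading" for a
    by (rule blinfun_eqI) (simp add: g blinfun.minus_right)
  show "torus_dirac O op_graph torus_grading = op_uminus (op_graph torus_grading O torus_dirac)"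
  proof -
    have eq: "((x, - y), (- u, v)) \<in> torus_dirac \<longleftrightarrow> ((x, y), (u, v)) \<in> torus_dirac" for x y u v
      by (simp add: torus_dirac_iff)
    have "(p, q) \<in> torus_dirac O op_graph torus_grading \<longleftrightarrow> (p, q) \<in> op_uminus (op_graph torus_grading O torus_dirac)" for p q
    proof -
      obtain x y u v where p: "p = (x, y)" "q = (u, v)" by (metis surj_pair)
      have "(p, q) \<in> torus_dirac O op_graph torus_grading \<longleftrightarrow> ((x, y), (u, - v)) \<in> torus_dirac"
      proof
        assume "(p, q) \<in> torus_dirac O op_graph torus_grading"
        then obtain r where "(p, r) \<in> torus_dirac" "q = (fst r, - snd r)" by (auto simp: op_graph_def g)
        then show "((x, y), (u, - v)) \<in> torus_dirac" by (simp add: p)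
      next
        assume "((x, y), (u, - v)) \<in> torus_dirac"
        then show "(p, q) \<in> torus_dirac O op_graph torus_grading"
          by (intro relcompI[of p "(u, - v)"]) (simp_all add: p op_graph_def g)
      qed
      also have "\<dots> \<longleftrightarrow> ((x, - y), (- u, - v)) \<in> torus_dirac" by (rule eq[symmetric])
      also have "\<dots> \<longleftrightarrow> (p, q) \<in> op_uminus (op_graph torus_grading O torus_dirac)"
        by (auto simp: p op_uminus_def op_graph_def g relcomp_unfold) (metis add.inverse_inverse uminus_Pair)
      finally show ?thesis .
    qed
    then show ?thesis by (intro equalityI subrelI) blast+
  qed
qed

section \<open>Summability\<close>

text \<open>Every natural number other than \<open>0\<close> is the absolute value of exactly two integers.\<close>

lemma summable_on_int_iff:
  fixes f :: "nat \<Rightarrow> real"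
  assumes nn: "\<And>n. 0 \<le> f n"
  shows "(\<lambda>k::int. f (idx k)) summable_on UNIV \<longleftrightarrow> summable f"
proof
  assume "(\<lambda>k::int. f (idx k)) summable_on UNIV"
  then have "(\<lambda>k::int. f (idx k)) summable_on range int"
    by (rule summable_on_subset_banach) simp
  then have "f summable_on UNIV" by (simp add: summable_on_reindex o_def)
  then show "summable f" by (rule summable_on_imp_summable)
next
  assume f: "summable f"
  then have 1: "f summable_on UNIV" by (rule summable_nonneg_imp_summable_on) (rule nn)
  have "(\<lambda>k::int. f (idx k)) summable_on range int"
    using 1 by (subst summable_on_reindex) (auto simp: o_def)
  moreover have "(\<lambda>k::int. f (idx k)) summable_on range (\<lambda>n. - int (Suc n))"
  proof -
    have "summable (\<lambda>n. f (Suc n))" using f by (subst summable_Suc_iff)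
    then have "(\<lambda>n. f (Suc n)) summable_on UNIV" by (rule summable_nonneg_imp_summable_on) (rule nn)
    moreover have "inj (\<lambda>n. - int (Suc n))" by (rule injI) simp
    moreover have "idx (- int (Suc n)) = Suc n" for n by linarith
    ultimately show ?thesis by (subst summable_on_reindex) (simp_all only: o_def)
  qed
  moreover have "range int \<inter> range (\<lambda>n. - int (Suc n)) = {}" by auto
  ultimately have "(\<lambda>k::int. f (idx k)) summable_on (range int \<union> range (\<lambda>n. - int (Suc n)))"
    by (rule summable_on_Un_disjoint)
  moreover have "range int \<union> range (\<lambda>n. - int (Suc n)) = UNIV"
  proof -
    have "k \<in> range int \<union> range (\<lambda>n. - int (Suc n))" for k
      by (cases k rule: int_cases) auto
    then show ?thesis by blast
  qed
  ultimately show "(\<lambda>k::int. f (idx k)) summable_on UNIV" by simp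
qed

lemma one_plus_summable_torus: "one_plus_summable torus_dirac"
  unfolding one_plus_summable_def op_abs_torus_dirac
proof (intro conjI allI impI)
  have ab: "\<bar>real_of_int k\<bar> = real (idx k)" for k by simp
  {
    fix e :: real assume e: "e > 0"
    let ?f = "\<lambda>l. (1 + l) powr (- (1 + e))"
    have nn: "0 \<le> ?f \<bar>real_of_int k\<bar>" for k by simp
    have bd: "?f \<bar>real_of_int k\<bar> \<le> 1" for k
    proof -
      have "?f \<bar>real_of_int k\<bar> \<le> (1 + \<bar>real_of_int k\<bar>) powr 0" using e by (intro powr_mono) auto
      also have "(1 + \<bar>real_of_int k\<bar>) powr 0 = 1" by simp
      finally show ?thesis .
    qed
    have "summable (\<lambda>n. real n powr (- (1 + e)))" using e by (simp add: summable_real_powr_iff)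
    then have "summable (\<lambda>n. ?f (real n))" by (subst (asm) summable_Suc_iff[symmetric]) (simp add: add.commute)
    then have sm: "(\<lambda>k. ?f \<bar>real_of_int k\<bar>) summable_on UNIV"
      unfolding ab by (subst summable_on_int_iff) auto
    have "fun_calculus (eig.diag_op (\<lambda>k. complex_of_real \<bar>real_of_int k\<bar>)) ?f = eig.bdiag (\<lambda>k. complex_of_real (?f \<bar>real_of_int k\<bar>))"
      by (rule eig.fun_calculus_diag_op[where C = 1]) (use nn bd in simp)
    then show "trace_class (fun_calculus (eig.diag_op (\<lambda>k. complex_of_real \<bar>real_of_int k\<bar>)) ?f)"
      using eig.trace_class_bdiag[of "\<lambda>k. ?f \<bar>real_of_int k\<bar>", OF bd nn sm] by simp
  }
  let ?f = "\<lambda>l. inverse (1 + l)"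
  have nn: "0 \<le> ?f \<bar>real_of_int k\<bar>" for k by simp
  have bd: "?f \<bar>real_of_int k\<bar> \<le> 1" for k by (simp add: inverse_le_1_iff)
  have "fun_calculus (eig.diag_op (\<lambda>k. complex_of_real \<bar>real_of_int k\<bar>)) ?f = eig.bdiag (\<lambda>k. complex_of_real (?f \<bar>real_of_int k\<bar>))"
    by (rule eig.fun_calculus_diag_op[where C = 1]) (use nn bd in simp)
  moreover have "\<not> trace_class (eig.bdiag (\<lambda>k. complex_of_real (?f \<bar>real_of_int k\<bar>)))"
  proof
    assume "trace_class (eig.bdiag (\<lambda>k. complex_of_real (?f \<bar>real_of_int k\<bar>)))"
    from eig.trace_class_bdiagD[of "\<lambda>k. ?f \<bar>real_of_int k\<bar>", OF bd nn this]
    have "summable (\<lambda>n. ?f (real n))" unfolding ab by (subst (asm) summable_on_int_iff) auto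
    then have "summable (\<lambda>n. inverse (real (Suc n)))" by (simp add: add.commute)
    then have "summable (\<lambda>n. inverse (real n))" by (subst (asm) summable_Suc_iff)
    then show False using not_summable_harmonic[where 'a = real] by (simp add: inverse_eq_divide)
  qed
  ultimately show "\<not> trace_class (fun_calculus (eig.diag_op (\<lambda>k. complex_of_real \<bar>real_of_int k\<bar>)) ?f)"
    by simp
qed

section \<open>The spectral triple of the noncommutative Toeplitz torus\<close>

theorem theorem3:
  shows "spectral_triple toeplitz_torus torus_smooth_algebra torus_rep torus_dirac \<and>
    Domain torus_dirac = dom_N \<times> dom_N \<and>
    even_grading torus_smooth_algebra torus_rep torus_dirac torus_grading \<and>
    regular_triple torus_smooth_algebra torus_rep torus_dirac \<and>
    one_plus_summable torus_dirac \<and>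
    discrete_spectrum torus_dirac \<and>
    op_spectrum torus_dirac = \<int> \<and>
    (\<forall>k::int. cvec.dim (eigenspace torus_dirac (of_int k)) = 1) \<and>
    (\<forall>k::int. torus_eigvec k \<noteq> 0 \<and> torus_eigvec k \<in> eigenspace torus_dirac (of_int k)) \<and>
    closure (cvec.span (range torus_eigvec)) = UNIV \<and>
    polar_part torus_dirac (fundamental_class torus_dirac) \<and>
    fundamental_class torus_dirac = offdiag_op (adj unilateral_shift) unilateral_shift \<and>
    fredholm_fundamental_class torus_grading torus_dirac \<and>
    nontrivial_fundamental_class torus_grading torus_dirac \<and>
    dirac_index torus_grading torus_dirac = 1"
proof (intro conjI allI)
  show "cvec.dim (eigenspace torus_dirac (of_int k)) = 1" for k
    unfolding eigenspace_torus_dirac by (rule dim_span_single[OF torus_eigvec_nz])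
  show "polar_part torus_dirac (fundamental_class torus_dirac)"
    unfolding fundamental_class_torus by (rule polar_part_torus_phase)
  show "fundamental_class torus_dirac = offdiag_op (adj unilateral_shift) unilateral_shift"
    by (simp add: fundamental_class_torus torus_phase_def)
  show "nontrivial_fundamental_class torus_grading torus_dirac"
    by (simp add: nontrivial_fundamental_class_def dirac_index_torus)
qed (rule spectral_triple_torus Domain_torus_dirac even_torus regular_torus one_plus_summable_torus
    discrete_spectrum_torus_dirac spectrum_torus_dirac torus_eigvec_nz torus_eigvec_in_eigenspace
    eig.dense fredholm_torus dirac_index_torus)+

end
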